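(* The following hold, where graphs are counted up to isomorphism. (1) The Petersen graph and the two Loupekine's snarks are the only rotation $T_i$-snarks with $i\le 3$. (2) There are precisely $15$ rotation $T_4$-snarks. In particular, with $\tilde T_4$ denoting the set of all rotation $T_4$-snarks, $$|\{24\}^*\cap\tilde T_4|=2,\quad |\{12,12\}^*\cap\tilde T_4|=1,\quad |\{18,6\}^*\cap\tilde T_4|=1,\quad |\{8,8,8\}^*\cap\tilde T_4|=8$$ and $$|\{6,6,6,6\}^*\cap\tilde T_4|=3.$$
   Context: All graphs are finite and loopless. A cycle is a $2$-regular connected graph. Edge colorings are proper. A snark is a cyclically $4$-edge connected cubic graph of girth at least $5$ admitting no $3$-edge coloring. A Hist in a cubic graph is a spanning tree all of whose vertices have degree $3$ or $1$ in the tree. Outer cycles. Let $G$ be a simple cubic graph with a Hist $T$. An outer cycle of $G$ (with respect to $T$) is a cycle of $G$ all of whose vertices are leaves of $T$. If $\{C_1,\dots,C_k\}$ is the set of all outer cycles of $G$ with respect to $T$, then $oc(G,T)=\{|V(C_1)|,\dots,|V(C_k)|\}$, regarded as a multiset. For a multiset $S$ of positive numbers, $S^*$ denotes the set of all snarks $G$ which have a Hist $T_G$ such that $oc(G,T_G)=S$. The trees $T_i$. For $i\ge 1$, $T_i$ is the unique tree with all vertex degrees in $\{1,3\}$ having a $3$-valent vertex (the central vertex) with distance $i$ to all leaves. It has $l_i=3\cdot 2^{i-1}$ leaves. A $T_i$-snark is a snark which has a spanning tree isomorphic to $T_i$. Rotation $T_i$-snarks. Let $i\ge 2$. A $T_i$-snark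 $G$ is a rotation $T_i$-snark if there is a drawing of $G$ in the plane (edges are simple curves, crossings allowed, and no edge-curve passes through a vertex other than its endpoints) and a labeling of the leaves of a Hist such that: (1) the drawing of $G$ contains a planar drawing of a (spanning) tree $T$ isomorphic to $T_i$; (1a) all leaves of $T$ lie on an imaginary circle $C$, all edges of $T$ are within the finite region of $C$, and the leaves are labeled $0,1,\dots,l_i-1$ in cyclic clockwise order along $C$; (1b) if $H$ is the plane graph consisting of the drawing of $T$ together with the $l_i$ arcs of $C$ joining consecutive leaves (regarded as edges), then the leaves $l_i-1$ and $0$ and the central vertex of $T$ are all contained in one facial cycle of $H$; (2) for every edge $ab\in E(G)$ joining two leaves $a,b\in\{0,\dots,l_i-1\}$ of $T$, the leaves $a+l_i/3$ and $b+l_i/3$ are also joined by an edge of $G$, with addition modulo $l_i$. Combinatorially, the leaf labelings satisfying (1), (1a), (1b) are exactly the following "standard labelings": $T$ has a central vertex $x$ and vertices $v_{k,j}$ for $1\le k\le i$, $0\le j<3\cdot 2^{k-1}$, where $x$ is adjacent to $v_{1,0},v_{1,1},v_{1,2}$, each $v_{k,j}$ with $k\ge2$ is adjacent to $v_{k-1,\lfloor j/2\rfloor}$, and leaf $j$ is $v_{i,j}$. The set of all rotation $T_i$-snarks is denoted $\tilde T_i$. The two Loupekine's snarks. Each is the cubic graph on $22$ vertices obtained from $T_3$, with its $12$ leaves given a standard labeling $0,\dots,11$, by adding the edges of the outer cycles listed below (each bracket lists the vertices of one outer cycle in cyclic order). First Loupekine's snark: $[0,3,4,7,8,11]$, $[1,2,9,10,5,6]$.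 Second Loupekine's snark: $[0,9,10,7,4,1,2,11,8,5,6,3]$.
   Formalization: In the five counts of S^* ∩ T̃_4, outer cycles are taken with respect to a Hist witnessing the rotation property, not an arbitrary Hist; with arbitrary Hists the counts fail, e.g. the {12,12} rotation T_4-snark also has a Hist with a single outer cycle of length 24. *)

theory Defs
  imports Main "HOL-Library.Multiset"
begin

section \<open>Finite simple graphs\<close>

text \<open>A graph is a pair of a vertex set and a set of edges, an edge being the two-element set of
  its endpoints. Parallel edges are not representable, which is harmless here: all graphs of
  interest have girth at least 5.\<close>

type_synonym 'v ugraph = "'v set \<times> 'v set set"

abbreviation verts :: "'v ugraph \<Rightarrow> 'v set" where "verts \<equiv> fst"
abbreviation edges :: "'v ugraph \<Rightarrow> 'v set set" where "edges \<equiv> snd"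

definition graph :: "'v ugraph \<Rightarrow> bool" where
  "graph G \<longleftrightarrow> finite (verts G) \<and> (\<forall>e\<in>edges G. e \<subseteq> verts G \<and> card e = 2)"

definition adj :: "'v ugraph \<Rightarrow> 'v \<Rightarrow> 'v \<Rightarrow> bool" where
  "adj G u v \<longleftrightarrow> {u, v} \<in> edges G"

definition degree :: "'v ugraph \<Rightarrow> 'v \<Rightarrow> nat" where
  "degree G v = card {e \<in> edges G. v \<in> e}"

definition regular :: "nat \<Rightarrow> 'v ugraph \<Rightarrow> bool" where
  "regular k G \<longleftrightarrow> (\<forall>v\<in>verts G. degree G v = k)"

definition subgraph :: "'v ugraph \<Rightarrow> 'v ugraph \<Rightarrow> bool" where
  "subgraph H G \<longleftrightarrow> graph H \<and> verts H \<subseteq> verts G \<and> edges H \<subseteq> edges G"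

definition connected_graph :: "'v ugraph \<Rightarrow> bool" where
  "connected_graph G \<longleftrightarrow> verts G \<noteq> {} \<and> (\<forall>u\<in>verts G. \<forall>v\<in>verts G. (adj G)\<^sup>*\<^sup>* u v)"

definition cycle :: "'v ugraph \<Rightarrow> bool" where
  "cycle C \<longleftrightarrow> graph C \<and> connected_graph C \<and> regular 2 C"

definition tree :: "'v ugraph \<Rightarrow> bool" where
  "tree T \<longleftrightarrow> graph T \<and> connected_graph T \<and> \<not> (\<exists>C. cycle C \<and> subgraph C T)"

text \<open>Length of a shortest walk; only meaningful for vertices of the same component.\<close>

definition distance :: "'v ugraph \<Rightarrow> 'v \<Rightarrow> 'v \<Rightarrow> nat" where
  "distance G u v = (LEAST n. (adj G ^^ n) u v)"

definition graph_iso :: "('v \<Rightarrow> 'w) \<Rightarrow> 'v ugraph \<Rightarrow> 'w ugraph \<Rightarrow> bool" where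
  "graph_iso f G H \<longleftrightarrow> graph G \<and> graph H \<and> bij_betw f (verts G) (verts H) \<and> edges H = (`) f ` edges G"

definition isomorphic :: "'v ugraph \<Rightarrow> 'w ugraph \<Rightarrow> bool" where
  "isomorphic G H \<longleftrightarrow> (\<exists>f. graph_iso f G H)"

definition iso_classes :: "'v ugraph set \<Rightarrow> 'v ugraph set set" where
  "iso_classes A = A // {(G, H). G \<in> A \<and> H \<in> A \<and> isomorphic G H}"

section \<open>Snarks\<close>

definition girth_at_least :: "nat \<Rightarrow> 'v ugraph \<Rightarrow> bool" where
  "girth_at_least k G \<longleftrightarrow> (\<forall>C. cycle C \<and> subgraph C G \<longrightarrow> k \<le> card (verts C))"

definition delete_edges :: "'v ugraph \<Rightarrow> 'v set set \<Rightarrow> 'v ugraph" where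
  "delete_edges G F = (verts G, edges G - F)"

text \<open>Deleting fewer than \<open>k\<close> edges never leaves two components that both contain a cycle.
  Applied to the empty set of edges this makes every cubic graph with the property connected.\<close>

definition cyclically_edge_connected :: "nat \<Rightarrow> 'v ugraph \<Rightarrow> bool" where
  "cyclically_edge_connected k G \<longleftrightarrow>
     (\<forall>F C D. F \<subseteq> edges G \<and> card F < k \<and>
        cycle C \<and> subgraph C (delete_edges G F) \<and>
        cycle D \<and> subgraph D (delete_edges G F) \<longrightarrow>
        (\<forall>u\<in>verts C. \<forall>v\<in>verts D. (adj (delete_edges G F))\<^sup>*\<^sup>* u v))"

definition edge_colorable :: "nat \<Rightarrow> 'v ugraph \<Rightarrow> bool" where
  "edge_colorable k G \<longleftrightarrow>
     (\<exists>c :: 'v set \<Rightarrow> nat. (\<forall>e\<in>edges G. c e < k) \<and>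
        (\<forall>e\<in>edges G. \<forall>f\<in>edges G. e \<noteq> f \<and> e \<inter> f \<noteq> {} \<longrightarrow> c e \<noteq> c f))"

definition snark :: "'v ugraph \<Rightarrow> bool" where
  "snark G \<longleftrightarrow> graph G \<and> regular 3 G \<and> cyclically_edge_connected 4 G \<and>
     girth_at_least 5 G \<and> \<not> edge_colorable 3 G"

section \<open>Hists and outer cycles\<close>

definition spanning_tree :: "'v ugraph \<Rightarrow> 'v ugraph \<Rightarrow> bool" where
  "spanning_tree T G \<longleftrightarrow> subgraph T G \<and> verts T = verts G \<and> tree T"

definition leaves :: "'v ugraph \<Rightarrow> 'v set" where
  "leaves T = {v \<in> verts T. degree T v = 1}"

definition hist :: "'v ugraph \<Rightarrow> 'v ugraph \<Rightarrow> bool" where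
  "hist T G \<longleftrightarrow> spanning_tree T G \<and> (\<forall>v\<in>verts T. degree T v \<in> {1, 3})"

definition outer_cycle :: "'v ugraph \<Rightarrow> 'v ugraph \<Rightarrow> 'v ugraph \<Rightarrow> bool" where
  "outer_cycle G T C \<longleftrightarrow> cycle C \<and> subgraph C G \<and> verts C \<subseteq> leaves T"

definition oc :: "'v ugraph \<Rightarrow> 'v ugraph \<Rightarrow> nat multiset" where
  "oc G T = {# card (verts C). C \<in># mset_set {C. outer_cycle G T C} #}"

section \<open>Rotation snarks\<close>

text \<open>Being the tree \<open>T\<^sub>i\<close>, up to isomorphism.\<close>

definition is_T :: "nat \<Rightarrow> 'v ugraph \<Rightarrow> bool" where
  "is_T i T \<longleftrightarrow> tree T \<and> (\<forall>v\<in>verts T. degree T v \<in> {1, 3}) \<and>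
     (\<exists>x\<in>verts T. degree T x = 3 \<and> (\<forall>v\<in>leaves T. distance T x v = i))"

definition T_snark :: "nat \<Rightarrow> 'v ugraph \<Rightarrow> bool" where
  "T_snark i G \<longleftrightarrow> snark G \<and> (\<exists>T. spanning_tree T G \<and> is_T i T)"

definition leaf_count :: "nat \<Rightarrow> nat" where
  "leaf_count i = 3 * 2 ^ (i - 1)"

text \<open>The tree \<open>T\<^sub>i\<close> in standard position: the centre is \<open>(0, 0)\<close>, level \<open>k\<close> consists of the vertices
  \<open>(k, j)\<close> for \<open>j < 3 * 2 ^ (k - 1)\<close> in clockwise order, and leaf \<open>j\<close> is \<open>(i, j)\<close>.\<close>

fun parent :: "nat \<times> nat \<Rightarrow> nat \<times> nat" where
  "parent (k, j) = (if k = 1 then (0, 0) else (k - 1, j div 2))"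

definition std_T :: "nat \<Rightarrow> (nat \<times> nat) ugraph" where
  "std_T i = (let B = {(k, j). 1 \<le> k \<and> k \<le> i \<and> j < 3 * 2 ^ (k - 1)}
     in (insert (0, 0) B, (\<lambda>v. {v, parent v}) ` B))"

text \<open>A drawing as in the definition of rotation snarks constrains only the spanning tree and the
  cyclic order of its leaves, since the remaining edges may be drawn with crossings. The leaf
  labelings obtained from such drawings are exactly those given by the isomorphisms \<open>f\<close> from the
  tree in standard position, the leaf labelled \<open>a\<close> being \<open>f (i, a)\<close>.\<close>

definition rotation_hist :: "nat \<Rightarrow> 'v ugraph \<Rightarrow> 'v ugraph \<Rightarrow> bool" where
  "rotation_hist i T G \<longleftrightarrow> hist T G \<and> is_T i T \<and>
     (\<exists>f. graph_iso f (std_T i) T \<and>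
        (\<forall>a < leaf_count i. \<forall>b < leaf_count i. {f (i, a), f (i, b)} \<in> edges G \<longrightarrow>
           {f (i, (a + leaf_count i div 3) mod leaf_count i),
            f (i, (b + leaf_count i div 3) mod leaf_count i)} \<in> edges G))"

definition rotation_snark :: "nat \<Rightarrow> 'v ugraph \<Rightarrow> bool" where
  "rotation_snark i G \<longleftrightarrow> 2 \<le> i \<and> T_snark i G \<and> (\<exists>T. rotation_hist i T G)"

definition rotation_snarks :: "nat \<Rightarrow> 'v ugraph set" where
  "rotation_snarks i = {G. rotation_snark i G}"

text \<open>The rotation \<open>T\<^sub>i\<close>-snarks in \<open>S\<^sup>*\<close>, where the outer cycles are taken with respect to a Hist that
  exhibits the rotation symmetry. An arbitrary Hist would not do: the same snark can have further
  Hists with different outer cycle lengths, and every rotation \<open>T\<^sub>4\<close>-snark has one with a single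
  outer cycle of length 24.\<close>

definition rotation_snarks_with_oc :: "nat \<Rightarrow> nat multiset \<Rightarrow> 'v ugraph set" where
  "rotation_snarks_with_oc i S =
     {G \<in> rotation_snarks i. \<exists>T. rotation_hist i T G \<and> oc G T = S}"

section \<open>The Petersen graph and Loupekine's snarks\<close>

definition petersen :: "nat ugraph" where
  "petersen = ({..<10},
     (\<Union>i<5. {{i, (i + 1) mod 5}, {i, i + 5}, {i + 5, (i + 2) mod 5 + 5}}))"

definition cycle_edges :: "'v list \<Rightarrow> 'v set set" where
  "cycle_edges vs = {{vs ! k, vs ! (Suc k mod length vs)} | k. k < length vs}"

definition add_outer_cycles :: "nat \<Rightarrow> nat list list \<Rightarrow> (nat \<times> nat) ugraph" where
  "add_outer_cycles i cs =
     (verts (std_T i), edges (std_T i) \<union> (\<Union>c\<in>set cs. cycle_edges (map (Pair i) c)))"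

definition loupekine1 :: "(nat \<times> nat) ugraph" where
  "loupekine1 = add_outer_cycles 3 [[0, 3, 4, 7, 8, 11], [1, 2, 9, 10, 5, 6]]"

definition loupekine2 :: "(nat \<times> nat) ugraph" where
  "loupekine2 = add_outer_cycles 3 [[0, 9, 10, 7, 4, 1, 2, 11, 8, 5, 6, 3]]"

end

theory Submission
  imports Defs
begin

text \<open>The rotation acts freely on the leaves of the tree, so a rotation snark is a threefold cover: its outer
  cycles are lifts of cycles through the leaves of one branch whose edges carry voltages in the cyclic group
  of order three. This leaves finitely many configurations. We choose a configuration that is lexicographically
  minimal under the automorphisms of the tree. A search with backtracking over the voltages then discards
  those with short cycles and those with a 3-edge-colouring that is invariant under the rotation up to
  a permutation of the colours; most of the remaining configurations have another explicit colouring or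
  an explicit cut with at most three edges. The survivors are verified to be snarks and
  are told apart by the numbers of vertices reached by walks of length 4. All computations are carried
  out by rewriting in the kernel.\<close>

section \<open>Invariance under isomorphism\<close>

text \<open>Outer cycle lengths depend on the Hist, so the normalisation transports the pair of
  graph and Hist, never the graph alone. Feasibility comes from separating scales. The shape of a
  configuration (its cyclic orders of leaf paths) precedes the voltages in the lexicographic key, so
  shapes are enumerated and pruned on their own before any of the up to \<open>3 ^ 8\<close> voltage
  assignments is looked at. A 3-edge-colouring of one branch of \<open>T\<^sub>4\<close> is given by
  seven switches. If the rotation shifts the colours this is all the data: 128 candidates, few
  enough to be carried through the search as a list. With independent branches there are
  \<open>2 ^ 21\<close>, so such colourings enter only as stored hints. One group of order three
  supplies branches, voltages and colours: the three colours add up to 0, so the missing colour is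
  \<open>- (x + y)\<close>, which commutes with shifts. Girth 5 in turn keeps the connectivity
  search small, because a side of a cut with at most four vertices contains no cycle.\<close>

definition img :: "('v \<Rightarrow> 'w) \<Rightarrow> 'v ugraph \<Rightarrow> 'w ugraph" where
  "img f G = (f ` verts G, (`) f ` edges G)"

lemma img_simps [simp]: "verts (img f G) = f ` verts G" "edges (img f G) = (`) f ` edges G"
  by (simp_all add: img_def)

lemma graph_edgeD: "graph G \<Longrightarrow> e \<in> edges G \<Longrightarrow> e \<subseteq> verts G \<and> card e = 2"
  by (auto simp: graph_def)

lemma graph_adjD: "graph G \<Longrightarrow> adj G u v \<Longrightarrow> u \<in> verts G \<and> v \<in> verts G \<and> u \<noteq> v"
  by (auto simp: graph_def adj_def dest!: bspec)

lemma adj_sym: "adj G u v \<longleftrightarrow> adj G v u"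
  by (simp add: adj_def insert_commute)

lemma graph_finite_edges: "graph G \<Longrightarrow> finite (edges G)"
  by (rule finite_subset[of _ "Pow (verts G)"]) (auto simp: graph_def)

lemma edges_inj: "graph G \<Longrightarrow> inj_on f (verts G) \<Longrightarrow> inj_on ((`) f) (edges G)"
  by (rule inj_on_subset[OF inj_on_image_Pow]) (auto simp: graph_def)

lemma graph_iso_img: "graph G \<Longrightarrow> inj_on f (verts G) \<Longrightarrow> graph_iso f G (img f G)"
  by (auto simp: graph_iso_def graph_def bij_betw_def dest!: bspec intro!: card_image inj_on_subset)
     (metis card_image inj_on_subset)

lemma graph_isoD:
  assumes "graph_iso f G H"
  shows "graph G" "graph H" "inj_on f (verts G)" "H = img f G"
  using assms by (auto simp: graph_iso_def bij_betw_def img_def prod_eq_iff)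

text \<open>Determining the target by an equation turns composition, inversion and restriction to
  subgraphs into rewriting of images.\<close>

lemma graph_iso_iff_img: "graph_iso f G H \<longleftrightarrow> graph G \<and> inj_on f (verts G) \<and> H = img f G"
  using graph_isoD graph_iso_img by metis

lemma img_comp: "img g (img f G) = img (g \<circ> f) G"
  by (auto simp: img_def image_comp image_image)

lemma img_cong: "graph G \<Longrightarrow> (\<And>v. v \<in> verts G \<Longrightarrow> f v = g v) \<Longrightarrow> img f G = img g G"
  by (auto simp: img_def graph_def intro!: image_cong)

lemma img_id: "img id G = G"
  by (simp add: img_def)

lemma graph_iso_trans: "graph_iso f G H \<Longrightarrow> graph_iso g H K \<Longrightarrow> graph_iso (g \<circ> f) G K"
  by (clarsimp simp: graph_iso_iff_img img_comp comp_inj_on)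

lemma graph_iso_inv:
  assumes "graph_iso f G H"
  shows "graph_iso (inv_into (verts G) f) H G"
proof -
  have "img (inv_into (verts G) f) H = img id G"
    unfolding graph_isoD(4)[OF assms] img_comp
    by (rule img_cong) (use graph_isoD[OF assms] in auto)
  then show ?thesis
    using graph_isoD[OF assms] by (auto simp: graph_iso_iff_img img_id intro: inj_on_inv_into)
qed

lemma graph_iso_refl: "graph G \<Longrightarrow> graph_iso id G G"
  by (simp add: graph_iso_iff_img img_id)

lemma isomorphic_refl: "graph G \<Longrightarrow> isomorphic G G"
  using graph_iso_refl isomorphic_def by blast

lemma isomorphic_sym: "isomorphic G H \<Longrightarrow> isomorphic H G"
  using graph_iso_inv isomorphic_def by metis

lemma isomorphic_trans: "isomorphic G H \<Longrightarrow> isomorphic H K \<Longrightarrow> isomorphic G K"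
  using graph_iso_trans isomorphic_def by metis

lemma graph_iso_edge_iff:
  assumes "graph_iso f G H" "e \<subseteq> verts G"
  shows "f ` e \<in> edges H \<longleftrightarrow> e \<in> edges G"
proof -
  note I = graph_isoD[OF assms(1)]
  have "f ` e = f ` e' \<Longrightarrow> e' \<in> edges G \<Longrightarrow> e \<in> edges G" for e'
    using assms(2) I(1,3) by (metis graph_edgeD inj_on_image_eq_iff)
  then show ?thesis using I by auto
qed

lemma graph_iso_adj_iff:
  "graph_iso f G H \<Longrightarrow> u \<in> verts G \<Longrightarrow> v \<in> verts G \<Longrightarrow> adj H (f u) (f v) \<longleftrightarrow> adj G u v"
  using graph_iso_edge_iff[of f G H "{u, v}"] by (simp add: adj_def)

lemma graph_iso_degree:
  assumes "graph_iso f G H" "v \<in> verts G"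
  shows "degree H (f v) = degree G v"
proof -
  note I = graph_isoD[OF assms(1)]
  have "f v \<in> f ` e \<longleftrightarrow> v \<in> e" if "e \<in> edges G" for e
    using I(1,3) assms(2) that by (meson graph_edgeD inj_on_image_mem_iff)
  then have "{e \<in> edges H. f v \<in> e} = (`) f ` {e \<in> edges G. v \<in> e}"
    using I(4) by auto
  then show ?thesis
    unfolding degree_def
    using edges_inj[OF I(1,3)] by (simp add: card_image inj_on_subset)
qed

lemma graph_iso_subgraph:
  assumes "graph_iso f G H" "subgraph C G"
  shows "graph_iso f C (img f C)" "subgraph (img f C) H"
proof -
  note I = graph_isoD[OF assms(1)]
  show 1: "graph_iso f C (img f C)"
    by (rule graph_iso_img) (use I assms(2) in \<open>auto simp: subgraph_def intro: inj_on_subset\<close>)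
  show "subgraph (img f C) H"
    using graph_isoD(2)[OF 1] I(4) assms(2) by (auto simp: subgraph_def)
qed

lemma graph_iso_rtranclp_imp:
  assumes "graph_iso f G H" "(adj G)\<^sup>*\<^sup>* u v"
  shows "(adj H)\<^sup>*\<^sup>* (f u) (f v)"
  using assms(2)
proof (induction rule: rtranclp_induct)
  case (step y z)
  then have "adj H (f y) (f z)"
    using graph_iso_adj_iff[OF assms(1)] graph_adjD[OF graph_isoD(1)[OF assms(1)]] by blast
  with step show ?case by simp
qed simp

lemma graph_iso_connected:
  assumes "graph_iso f G H" "connected_graph G" shows "connected_graph H"
  using graph_iso_rtranclp_imp[OF assms(1)] graph_isoD(4)[OF assms(1)] assms(2)
  by (auto simp: connected_graph_def)

lemma graph_iso_regular:
  assumes "graph_iso f G H" "regular k G" shows "regular k H"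
  using assms graph_iso_degree[OF assms(1)] graph_isoD(4)[OF assms(1)] by (auto simp: regular_def)

lemma graph_iso_cycle:
  assumes "graph_iso f G H" "cycle G" shows "cycle H"
  using assms(2) graph_iso_connected[OF assms(1)] graph_iso_regular[OF assms(1)] graph_isoD(2)[OF assms(1)]
  unfolding cycle_def by blast

lemma cycle_subgraph_img:
  assumes "graph_iso f G H" "cycle C" "subgraph C G"
  shows "cycle (img f C)" "subgraph (img f C) H" "card (verts (img f C)) = card (verts C)"
  using graph_iso_subgraph[OF assms(1,3)] assms(2) graph_iso_cycle[of f C "img f C"]
    card_image[OF graph_isoD(3)[OF graph_iso_subgraph(1)[OF assms(1,3)]]]
  by simp_all

lemma graph_iso_tree:
  assumes "graph_iso f G H" "tree G" shows "tree H"
  using assms graph_iso_connected[OF assms(1)] cycle_subgraph_img(1,2)[OF graph_iso_inv[OF assms(1)]]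
    graph_isoD(2)[OF assms(1)]
  unfolding tree_def by blast

lemma graph_iso_relpowp_imp:
  assumes "graph_iso f G H" "(adj G ^^ n) u v"
  shows "(adj H ^^ n) (f u) (f v)"
  using assms(2)
proof (induction n arbitrary: v)
  case (Suc n)
  then obtain y where y: "(adj G ^^ n) u y" "adj G y v" by auto
  then have "adj H (f y) (f v)"
    using graph_iso_adj_iff[OF assms(1)] graph_adjD[OF graph_isoD(1)[OF assms(1)]] by blast
  with Suc y show ?case by auto
qed simp

lemma graph_iso_distance:
  assumes "graph_iso f G H" "u \<in> verts G" "v \<in> verts G"
  shows "distance H (f u) (f v) = distance G u v"
proof -
  note I = graph_isoD[OF assms(1)]
  have "(adj H ^^ n) (f u) (f v) \<longleftrightarrow> (adj G ^^ n) u v" for n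
    using graph_iso_relpowp_imp[OF assms(1)] graph_iso_relpowp_imp[OF graph_iso_inv[OF assms(1)]]
    by (metis I(3) assms(2,3) inv_into_f_f)
  then show ?thesis by (simp add: distance_def)
qed

lemma graph_iso_leaves:
  assumes "graph_iso f G H" shows "leaves H = f ` leaves G"
  using graph_iso_degree[OF assms] graph_isoD(4)[OF assms] by (auto simp: leaves_def)

lemma graph_iso_is_T:
  assumes "graph_iso f G H" "is_T i G" shows "is_T i H"
proof -
  note I = graph_isoD[OF assms(1)]
  from assms(2) obtain x where x: "x \<in> verts G" "degree G x = 3" "\<forall>v\<in>leaves G. distance G x v = i"
    by (auto simp: is_T_def)
  have "f x \<in> verts H \<and> degree H (f x) = 3 \<and> (\<forall>v\<in>leaves H. distance H (f x) v = i)"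
    using x I(4) graph_iso_degree[OF assms(1)] graph_iso_distance[OF assms(1)]
    by (auto simp: graph_iso_leaves[OF assms(1)] leaves_def)
  then show ?thesis
    using assms graph_iso_tree[OF assms(1)] graph_iso_degree[OF assms(1)] I(4) by (auto simp: is_T_def)
qed

lemma graph_iso_delete_edges:
  assumes "graph_iso f G H" "F \<subseteq> edges G"
  shows "graph_iso f (delete_edges G F) (delete_edges H ((`) f ` F))"
proof -
  note I = graph_isoD[OF assms(1)]
  have eq: "(`) f ` (edges G - F) = (`) f ` edges G - (`) f ` F"
    by (rule inj_on_image_set_diff[OF edges_inj[OF I(1,3)] Diff_subset assms(2)])
  have "graph (delete_edges G F)" using I(1) by (simp add: graph_def delete_edges_def)
  moreover have "inj_on f (verts (delete_edges G F))" using I(3) by (simp add: delete_edges_def)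
  moreover have "delete_edges H ((`) f ` F) = img f (delete_edges G F)"
    by (simp add: img_def delete_edges_def I(4) eq)
  ultimately show ?thesis by (simp add: graph_iso_iff_img)
qed

lemma graph_iso_cyclically_edge_connected:
  assumes "graph_iso f G H" "cyclically_edge_connected k G"
  shows "cyclically_edge_connected k H"
  unfolding cyclically_edge_connected_def
proof (intro allI impI ballI, elim conjE)
  fix F C D u v
  assume F: "F \<subseteq> edges H" "card F < k" and C: "cycle C" "subgraph C (delete_edges H F)"
    and D: "cycle D" "subgraph D (delete_edges H F)" and uv: "u \<in> verts C" "v \<in> verts D"
  define g where "g = inv_into (verts G) f"
  define F' where "F' = (`) g ` F"
  have g: "graph_iso g H G" using graph_iso_inv[OF assms(1)] g_def by simp
  note I = graph_isoD[OF g]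
  have i: "graph_iso g (delete_edges H F) (delete_edges G F')"
    using graph_iso_delete_edges[OF g F(1)] by (simp add: F'_def)
  have "F' \<subseteq> edges G" using F(1) I(4) by (auto simp: F'_def)
  moreover have "card F' < k"
    unfolding F'_def using F(2) card_image_le[OF finite_subset[OF F(1) graph_finite_edges[OF I(1)]], of "(`) g"]
    by linarith
  ultimately have "(adj (delete_edges G F'))\<^sup>*\<^sup>* (g u) (g v)"
    using assms(2) cycle_subgraph_img(1,2)[OF i C] cycle_subgraph_img(1,2)[OF i D] uv
    unfolding cyclically_edge_connected_def by (metis imageI img_simps(1))
  then have "(adj (delete_edges H F))\<^sup>*\<^sup>* (inv_into (verts (delete_edges H F)) g (g u))
      (inv_into (verts (delete_edges H F)) g (g v))"
    using graph_iso_rtranclp_imp[OF graph_iso_inv[OF i]] by blast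
  moreover have "u \<in> verts (delete_edges H F)" "v \<in> verts (delete_edges H F)"
    using C D uv by (auto simp: subgraph_def)
  ultimately show "(adj (delete_edges H F))\<^sup>*\<^sup>* u v"
    using graph_isoD(3)[OF i] by (simp add: inv_into_f_f)
qed

lemma graph_iso_edge_colorable:
  assumes "graph_iso f G H" "edge_colorable k H"
  shows "edge_colorable k G"
proof -
  note I = graph_isoD[OF assms(1)]
  from assms(2) obtain c :: "_ \<Rightarrow> nat" where c: "\<forall>e\<in>edges H. c e < k"
    "\<forall>e\<in>edges H. \<forall>f\<in>edges H. e \<noteq> f \<and> e \<inter> f \<noteq> {} \<longrightarrow> c e \<noteq> c f"
    unfolding edge_colorable_def by (elim exE conjE) (rule that)
  have EH: "f ` e \<in> edges H" if "e \<in> edges G" for e using that I(4) by simp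
  have "c (f ` e) \<noteq> c (f ` e')" if "e \<in> edges G" "e' \<in> edges G" "e \<noteq> e'" "e \<inter> e' \<noteq> {}" for e e'
  proof -
    have "f ` e \<noteq> f ` e'" using edges_inj[OF I(1,3)] that by (auto dest: inj_onD)
    moreover have "f ` e \<inter> f ` e' \<noteq> {}" using that by auto
    ultimately show ?thesis using c(2)[THEN bspec, OF EH[OF that(1)], THEN bspec, OF EH[OF that(2)]] by simp
  qed
  then show ?thesis
    unfolding edge_colorable_def
    by (intro exI[of _ "\<lambda>e. c (f ` e)"] conjI ballI) (use c(1) EH in simp_all)
qed

lemma graph_iso_snark:
  assumes "graph_iso f G H" "snark G" shows "snark H"
proof -
  note I = graph_isoD[OF assms(1)]
  have "girth_at_least 5 H"
    unfolding girth_at_least_def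
    using cycle_subgraph_img[OF graph_iso_inv[OF assms(1)]] assms(2)
    by (metis girth_at_least_def snark_def)
  then show ?thesis
    using assms I graph_iso_regular[OF assms(1)] graph_iso_cyclically_edge_connected[OF assms(1)]
      graph_iso_edge_colorable[OF assms(1)]
    by (auto simp: snark_def)
qed

lemma graph_iso_hist:
  assumes "graph_iso f G H" "hist T G" shows "hist (img f T) H"
proof -
  have s: "subgraph T G" and h: "verts T = verts G" "tree T" "\<forall>v\<in>verts T. degree T v \<in> {1, 3}"
    using assms(2) by (auto simp: hist_def spanning_tree_def)
  note i = graph_iso_subgraph[OF assms(1) s]
  have "verts (img f T) = verts H" using graph_isoD(4)[OF assms(1)] h(1) by simp
  moreover have "\<forall>v\<in>verts (img f T). degree (img f T) v \<in> {1, 3}"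
    using h(3) graph_iso_degree[OF i(1)] by simp
  ultimately show ?thesis
    unfolding hist_def spanning_tree_def using i(2) graph_iso_tree[OF i(1) h(2)] by blast
qed

text \<open>Taking images under \<open>f\<close> and under its inverse gives mutually inverse maps
  between the outer cycles for \<open>T\<close> and those for \<open>img f T\<close>, and both
  preserve the number of vertices.\<close>

lemma graph_iso_oc:
  assumes "graph_iso f G H" "subgraph T G" shows "oc H (img f T) = oc G T"
proof -
  note I = graph_isoD[OF assms(1)] and fT = graph_iso_subgraph(1)[OF assms]
  define g where "g = inv_into (verts G) f"
  have g: "graph_iso g H G" using graph_iso_inv[OF assms(1)] g_def by simp
  have gf: "img g (img f C) = C" if "subgraph C G" for C
  proof -
    have "img g (img f C) = img id C"
      unfolding img_comp by (rule img_cong) (use that I in \<open>auto simp: subgraph_def g_def inv_into_f_f\<close>)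
    then show ?thesis by (simp add: img_id)
  qed
  have fg: "img f (img g C) = C" if "subgraph C H" for C
  proof -
    have "img f (img g C) = img id C"
      unfolding img_comp by (rule img_cong) (use that I in \<open>auto simp: subgraph_def g_def f_inv_into_f\<close>)
    then show ?thesis by (simp add: img_id)
  qed
  have lT: "leaves (img f T) = f ` leaves T" using graph_iso_leaves[OF fT] .
  have sub: "leaves T \<subseteq> verts G" using assms(2) by (auto simp: leaves_def subgraph_def)
  have 1: "outer_cycle H (img f T) (img f C)" if "outer_cycle G T C" for C
    using that cycle_subgraph_img[OF assms(1)] lT by (auto simp: outer_cycle_def)
  have 2: "outer_cycle G T (img g C)" if "outer_cycle H (img f T) C" for C
  proof -
    have "verts (img g C) \<subseteq> g ` f ` leaves T" using that lT by (auto simp: outer_cycle_def)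
    also have "\<dots> = leaves T" using sub I(3) by (auto simp: g_def image_image inv_into_f_f subset_iff)
    finally show ?thesis using that cycle_subgraph_img[OF g] by (auto simp: outer_cycle_def)
  qed
  have set_eq: "{C. outer_cycle H (img f T) C} = img f ` {C. outer_cycle G T C}"
  proof (intro equalityI subsetI)
    fix C assume C: "C \<in> {C. outer_cycle H (img f T) C}"
    then have "C = img f (img g C)" using fg by (auto simp: outer_cycle_def)
    then show "C \<in> img f ` {C. outer_cycle G T C}" using 2 C by blast
  qed (use 1 in auto)
  have inj: "inj_on (img f) {C. outer_cycle G T C}"
    by (rule inj_on_inverseI[of _ "img g"]) (auto simp: gf outer_cycle_def)
  have "oc H (img f T) = image_mset (\<lambda>C. card (verts C)) (image_mset (img f) (mset_set {C. outer_cycle G T C}))"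
    by (simp add: oc_def set_eq image_mset_mset_set[OF inj])
  also have "\<dots> = image_mset (\<lambda>C. card (verts (img f C))) (mset_set {C. outer_cycle G T C})"
    by (simp add: image_mset.compositionality comp_def)
  also have "\<dots> = oc G T"
    unfolding oc_def
  proof (rule image_mset_cong)
    fix C assume "C \<in># mset_set {C. outer_cycle G T C}"
    \<comment> \<open>An infinite set has the empty multiset, so membership yields the property in
      either case.\<close>
    then have "outer_cycle G T C" by (metis elem_mset_set empty_iff infinite_set_mset_mset_set mem_Collect_eq)
    then show "card (verts (img f C)) = card (verts C)"
      using cycle_subgraph_img(3)[OF assms(1)] by (simp add: outer_cycle_def)
  qed
  finally show ?thesis .
qed

lemma graph_iso_rotation_hist:
  assumes "graph_iso f G H" "rotation_hist i T G" "0 < i" shows "rotation_hist i (img f T) H"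
proof -
  have h: "hist T G" "is_T i T" and s: "subgraph T G" and vT: "verts T = verts G"
    using assms by (auto simp: rotation_hist_def hist_def spanning_tree_def)
  from assms(2) obtain h where h': "graph_iso h (std_T i) T"
    "\<forall>a < leaf_count i. \<forall>b < leaf_count i. {h (i, a), h (i, b)} \<in> edges G \<longrightarrow>
           {h (i, (a + leaf_count i div 3) mod leaf_count i),
            h (i, (b + leaf_count i div 3) mod leaf_count i)} \<in> edges G"
    by (auto simp: rotation_hist_def)
  \<comment> \<open>Here \<open>0 < i\<close> matters: by truncated subtraction
    \<open>leaf_count 0 = 3\<close>, although \<open>std_T 0\<close> consists of its centre
    only.\<close>
  have v: "h (i, a) \<in> verts G" if "a < leaf_count i" for a
  proof -
    have "(i, a) \<in> verts (std_T i)" using that assms(3)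
      by (auto simp: std_T_def leaf_count_def Let_def)
    then show ?thesis using graph_isoD(4)[OF h'(1)] vT by auto
  qed
  have e: "{f (h (i, a)), f (h (i, b))} \<in> edges H \<longleftrightarrow> {h (i, a), h (i, b)} \<in> edges G"
    if "a < leaf_count i" "b < leaf_count i" for a b
    using graph_iso_edge_iff[OF assms(1), of "{h (i, a), h (i, b)}"] v that by auto
  have pos: "leaf_count i > 0" by (simp add: leaf_count_def)
  have "\<forall>a < leaf_count i. \<forall>b < leaf_count i. {(f \<circ> h) (i, a), (f \<circ> h) (i, b)} \<in> edges H \<longrightarrow>
           {(f \<circ> h) (i, (a + leaf_count i div 3) mod leaf_count i),
            (f \<circ> h) (i, (b + leaf_count i div 3) mod leaf_count i)} \<in> edges H"
    using h'(2) pos by (simp add: e)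
  moreover have "graph_iso (f \<circ> h) (std_T i) (img f T)"
    using graph_iso_trans[OF h'(1) graph_iso_subgraph(1)[OF assms(1) s]] .
  ultimately show ?thesis
    using graph_iso_hist[OF assms(1) h(1)] graph_iso_is_T[OF graph_iso_subgraph(1)[OF assms(1) s] h(2)]
    unfolding rotation_hist_def by blast
qed

lemma rotation_snark_iff:
  "rotation_snark i G \<longleftrightarrow> 2 \<le> i \<and> snark G \<and> (\<exists>T. rotation_hist i T G)"
  by (auto simp: rotation_snark_def T_snark_def rotation_hist_def hist_def)

lemma graph_iso_rotation_snark:
  assumes "graph_iso f G H" "rotation_snark i G" shows "rotation_snark i H"
  using assms graph_iso_rotation_hist[OF assms(1), of i] graph_iso_snark[OF assms(1)]
  unfolding rotation_snark_iff by (metis less_le_trans zero_less_numeral)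

section \<open>The tree in path notation\<close>

text \<open>A datatype instead of residues, so that rewriting evaluates sums by pattern matching.
  The same type is used for branches, voltages and edge colours.\<close>

datatype z3 = Z0 | Z1 | Z2

instantiation z3 :: ab_group_add
begin

fun plus_z3 :: "z3 \<Rightarrow> z3 \<Rightarrow> z3" where
  "plus_z3 Z0 y = y" | "plus_z3 Z1 Z0 = Z1" | "plus_z3 Z1 Z1 = Z2" | "plus_z3 Z1 Z2 = Z0"
| "plus_z3 Z2 Z0 = Z2" | "plus_z3 Z2 Z1 = Z0" | "plus_z3 Z2 Z2 = Z1"

fun uminus_z3 :: "z3 \<Rightarrow> z3" where
  "uminus_z3 Z0 = Z0" | "uminus_z3 Z1 = Z2" | "uminus_z3 Z2 = Z1"

definition zero_z3 :: z3 where "zero_z3 = Z0"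

definition minus_z3 :: "z3 \<Rightarrow> z3 \<Rightarrow> z3" where "minus_z3 x y = x + - y"

instance
proof
  fix a b c :: z3
  show "a + b + c = a + (b + c)" by (cases a; cases b; cases c) simp_all
  show "a + b = b + a" by (cases a; cases b) simp_all
  show "0 + a = a" by (simp add: zero_z3_def)
  show "- a + a = 0" by (cases a) (simp_all add: zero_z3_def)
  show "a - b = a + - b" by (simp add: minus_z3_def)
qed

end

lemma UNIV_z3: "UNIV = {Z0, Z1, Z2}" using z3.exhaust by auto

lemma all_z3: "(\<forall>k. P k) \<longleftrightarrow> P Z0 \<and> P Z1 \<and> P Z2" by (metis z3.exhaust)

lemma card_UNIV_z3: "card (UNIV :: z3 set) = 3" by (simp add: UNIV_z3)

lemma finite_z3 [simp]: "finite (A :: z3 set)"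
  by (rule finite_subset[OF subset_UNIV]) (simp add: UNIV_z3)

type_synonym vertex = "(z3 \<times> bool list) option"

definition PT_verts :: "nat \<Rightarrow> vertex set" where
  "PT_verts d = insert None {Some (k, bs) | k bs. length bs \<le> d}"

fun par :: "vertex \<Rightarrow> vertex" where
  "par None = None"
| "par (Some (k, bs)) = (if bs = [] then None else Some (k, butlast bs))"

text \<open>The tree \<open>T\<^sub>d\<^sub>+\<^sub>1\<close>: below the centre \<open>None\<close>, the vertices of the branch \<open>k\<close> are addressed by their
  left-right paths. The rotation by a third of the leaves is \<open>k \<mapsto> k + 1\<close> in this notation.\<close>

definition PT :: "nat \<Rightarrow> vertex ugraph" where
  "PT d = (PT_verts d, (\<lambda>v. {v, par v}) ` (PT_verts d - {None}))"

fun level :: "vertex \<Rightarrow> nat" where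
  "level None = 0"
| "level (Some (k, bs)) = Suc (length bs)"

lemma verts_PT [simp]: "verts (PT d) = PT_verts d" by (simp add: PT_def)

lemma PT_verts_simps [simp]: "None \<in> PT_verts d" "Some (k, bs) \<in> PT_verts d \<longleftrightarrow> length bs \<le> d"
  by (auto simp: PT_verts_def)

lemma PT_verts_level: "v \<in> PT_verts d \<longleftrightarrow> level v \<le> Suc d"
  by (cases v rule: level.cases) auto

lemma finite_PT_verts: "finite (PT_verts d)"
proof -
  have "PT_verts d = insert None (Some ` (UNIV \<times> {bs. set bs \<subseteq> UNIV \<and> length bs \<le> d}))"
    by (auto simp: PT_verts_def)
  moreover have "finite {bs. set bs \<subseteq> (UNIV :: bool set) \<and> length bs \<le> d}"
    by (rule finite_lists_length_le) simp
  ultimately show ?thesis by simp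
qed

lemma level_par: "v \<noteq> None \<Longrightarrow> level v = Suc (level (par v))"
  by (cases v rule: level.cases) (auto simp: Suc_diff_Suc)

lemma par_neq: "v \<noteq> None \<Longrightarrow> par v \<noteq> v"
  using level_par by (metis n_not_Suc_n)

lemma par_in_PT: "v \<in> PT_verts d \<Longrightarrow> par v \<in> PT_verts d"
  using level_par[of v] by (cases "v = None") (auto simp: PT_verts_level)

lemma graph_PT: "graph (PT d)"
  unfolding graph_def
proof (intro conjI ballI)
  fix e assume "e \<in> edges (PT d)"
  then obtain v where "e = {v, par v}" "v \<in> PT_verts d" "v \<noteq> None"
    unfolding PT_def by (auto simp del: par.simps not_None_eq)
  then show "e \<subseteq> verts (PT d)" "card e = 2"
    using par_in_PT[of v d] par_neq[of v] by (auto simp del: par.simps)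
qed (simp add: finite_PT_verts)

lemma adj_PT: "adj (PT d) u v \<longleftrightarrow> u \<in> PT_verts d \<and> v \<in> PT_verts d \<and>
    (u \<noteq> None \<and> v = par u \<or> v \<noteq> None \<and> u = par v)"
  by (auto simp: adj_def PT_def doubleton_eq_iff par_in_PT simp del: par.simps not_None_eq)

lemma degree_adj:
  assumes "graph G" shows "degree G v = card {u. adj G v u}"
proof -
  have "{e \<in> edges G. v \<in> e} = (\<lambda>u. {v, u}) ` {u. adj G v u}"
  proof (intro equalityI subsetI)
    fix e assume e: "e \<in> {e \<in> edges G. v \<in> e}"
    then obtain x y where "e = {x, y}" "x \<noteq> y"
      using graph_edgeD[OF assms, of e] by (auto simp: card_2_iff)
    with e show "e \<in> (\<lambda>u. {v, u}) ` {u. adj G v u}" by (auto simp: adj_def insert_commute)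
  qed (auto simp: adj_def)
  moreover have "inj_on (\<lambda>u. {v, u}) {u. adj G v u}"
    by (auto simp: inj_on_def doubleton_eq_iff)
  ultimately show ?thesis by (simp add: degree_def card_image)
qed

lemma par_eq_Some_iff:
  "par v = Some (k, bs) \<longleftrightarrow> v = Some (k, bs @ [False]) \<or> v = Some (k, bs @ [True])"
proof (cases v rule: level.cases)
  case (2 l cs)
  show ?thesis
  proof (cases cs rule: rev_cases)
    case (snoc ys y)
    then show ?thesis by (cases y) (auto simp: 2)
  qed (simp add: 2)
qed simp

lemma par_eq_None_iff: "v \<noteq> None \<and> par v = None \<longleftrightarrow> (\<exists>k. v = Some (k, []))"
  by (cases v rule: level.cases) auto

lemma nbrs_None: "{u. adj (PT d) None u} = {Some (Z0, []), Some (Z1, []), Some (Z2, [])}"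
proof -
  have "adj (PT d) None u \<longleftrightarrow> (\<exists>k. u = Some (k, []))" for u
    unfolding par_eq_None_iff[symmetric] adj_PT
    by (cases u rule: level.cases) (auto split: if_splits)
  then have "{u. adj (PT d) None u} = (\<lambda>k. Some (k, [])) ` UNIV" by auto
  then show ?thesis by (simp add: UNIV_z3)
qed

lemma nbrs_inner:
  "length bs < d \<Longrightarrow> {u. adj (PT d) (Some (k, bs)) u} =
     {par (Some (k, bs)), Some (k, bs @ [False]), Some (k, bs @ [True])}"
  using par_in_PT[of "Some (k, bs)" d] by (auto simp: adj_PT par_eq_Some_iff eq_commute[of "Some (k, bs)" "par _"] simp del: par.simps)

lemma nbrs_leaf: "length bs = d \<Longrightarrow> {u. adj (PT d) (Some (k, bs)) u} = {par (Some (k, bs))}"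
  using par_in_PT[of "Some (k, bs)" d] by (auto simp: adj_PT par_eq_Some_iff eq_commute[of "Some (k, bs)" "par _"] simp del: par.simps)

lemma degree_PT:
  assumes "v \<in> PT_verts d" shows "degree (PT d) v = (if level v = Suc d then 1 else 3)"
proof (cases v rule: level.cases)
  case 1
  then show ?thesis by (simp add: degree_adj[OF graph_PT] nbrs_None)
next
  case (2 k bs)
  show ?thesis
  proof (cases "length bs = d")
    case True
    then show ?thesis by (simp add: 2 degree_adj[OF graph_PT] nbrs_leaf)
  next
    case False
    have "par v \<noteq> Some (k, bs @ [b])" for b
      using level_par[of v] 2 by auto
    then show ?thesis
      using False assms by (simp add: 2 degree_adj[OF graph_PT] nbrs_inner card_insert_if)
  qed
qed

lemma leaves_PT: "leaves (PT d) = {Some (k, bs) | k bs. length bs = d}"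
proof -
  have "v \<in> leaves (PT d) \<longleftrightarrow> level v = Suc d" for v
  proof (cases "v \<in> PT_verts d")
    case True then show ?thesis by (simp add: leaves_def degree_PT)
  next
    case False then show ?thesis by (simp add: leaves_def PT_verts_level)
  qed
  moreover have "level v = Suc d \<longleftrightarrow> (\<exists>k bs. v = Some (k, bs) \<and> length bs = d)" for v
    by (cases v rule: level.cases) auto
  ultimately show ?thesis by blast
qed

lemma relpowp_sym:
  assumes "\<And>x y. R x y \<Longrightarrow> R y x" "(R ^^ n) x y" shows "(R ^^ n) y x"
  using assms(2)
proof (induction n arbitrary: y)
  case (Suc n)
  then obtain z where "(R ^^ n) x z" "R z y" by auto
  then show ?case using relpowp_Suc_I2[of R y z n x] assms(1)[of z y] Suc.IH[of z] by blast
qed simp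

lemma PT_walk: "v \<in> PT_verts d \<Longrightarrow> (adj (PT d) ^^ level v) None v"
proof (induction "level v" arbitrary: v)
  case 0
  then show ?case by (cases v rule: level.cases) auto
next
  case (Suc n)
  then have v: "v \<noteq> None" by (metis level.simps(1) nat.simps(3))
  with Suc level_par[OF v] have n: "(adj (PT d) ^^ n) None (par v)" by (simp add: par_in_PT)
  have "adj (PT d) (par v) v" using v Suc.prems by (auto simp: adj_PT par_in_PT)
  with n have "(adj (PT d) ^^ Suc n) None v" by auto
  then show ?case using Suc.hyps(2) by simp
qed

lemma PT_level_le: "(adj (PT d) ^^ n) None v \<Longrightarrow> level v \<le> n"
proof (induction n arbitrary: v)
  case (Suc n)
  then obtain u where u: "(adj (PT d) ^^ n) None u" "adj (PT d) u v" by auto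
  then have "level v \<le> Suc (level u)" using level_par[of u] level_par[of v] by (auto simp: adj_PT)
  then show ?case using Suc.IH[OF u(1)] by simp
qed simp

lemma distance_PT: "v \<in> PT_verts d \<Longrightarrow> distance (PT d) None v = level v"
  unfolding distance_def by (rule Least_equality) (use PT_walk PT_level_le in blast)+

lemma connected_PT: "connected_graph (PT d)"
  unfolding connected_graph_def
proof (intro conjI ballI)
  fix u v assume "u \<in> verts (PT d)" "v \<in> verts (PT d)"
  then have "(adj (PT d) ^^ level u) u None" "(adj (PT d) ^^ level v) None v"
    using PT_walk[of u d] PT_walk[of v d] relpowp_sym[of "adj (PT d)" "level u" None u] adj_sym[of "PT d"]
    by simp_all
  then show "(adj (PT d))\<^sup>*\<^sup>* u v" by (rule rtranclp_trans[OF relpowp_imp_rtranclp relpowp_imp_rtranclp])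
qed (use PT_verts_simps(1) in \<open>auto simp del: PT_verts_simps\<close>)

text \<open>A vertex of maximal level on a cycle has only its parent as a neighbour.\<close>

lemma acyclic_PT: assumes "cycle C" "subgraph C (PT d)" shows False
proof -
  have g: "graph C" and ne: "verts C \<noteq> {}" using assms(1) by (auto simp: cycle_def connected_graph_def)
  have fin: "finite (verts C)" using g by (simp add: graph_def)
  obtain v where v: "v \<in> verts C" "\<And>u. u \<in> verts C \<Longrightarrow> level u \<le> level v"
    using obtains_MAX[OF fin ne, of level] Max_ge[of "level ` verts C"] fin by (metis finite_imageI imageI)
  have "{u. adj C v u} \<subseteq> {par v}"
  proof
    fix u assume "u \<in> {u. adj C v u}"
    then have u: "adj C v u" by simp
    have "adj (PT d) v u" using u assms(2) by (auto simp: adj_def subgraph_def)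
    moreover have "level u \<le> level v" using graph_adjD[OF g u] v(2) by blast
    ultimately show "u \<in> {par v}" using level_par[of u] by (auto simp: adj_PT)
  qed
  then have "degree C v \<le> 1"
    using card_mono[of "{par v}" "{u. adj C v u}"] by (simp add: degree_adj[OF g])
  moreover have "degree C v = 2" using assms(1) v(1) unfolding cycle_def regular_def by blast
  ultimately show False by simp
qed

lemma tree_PT: "tree (PT d)"
  using graph_PT connected_PT acyclic_PT unfolding tree_def by blast

lemma is_T_PT: "is_T (Suc d) (PT d)"
  unfolding is_T_def
proof (intro conjI bexI[of _ None] ballI)
  fix v assume "v \<in> leaves (PT d)"
  then show "distance (PT d) None v = Suc d" using distance_PT[of v d] by (auto simp: leaves_PT)
qed (auto simp: tree_PT degree_PT)

section \<open>Numbering the vertices of a level\<close>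

fun nz :: "z3 \<Rightarrow> nat" where "nz Z0 = 0" | "nz Z1 = 1" | "nz Z2 = 2"

text \<open>A number in mixed radix: the leading digit \<open>nz k\<close> is ternary, the following
  ones are binary. Dropping the last digit is \<open>j div 2\<close>, the parent in the standard
  tree.\<close>

definition idx :: "z3 \<Rightarrow> bool list \<Rightarrow> nat" where
  "idx k bs = foldl (\<lambda>a b. 2 * a + of_bool b) (nz k) bs"

fun enc :: "vertex \<Rightarrow> nat \<times> nat" where
  "enc None = (0, 0)"
| "enc (Some (k, bs)) = (Suc (length bs), idx k bs)"

lemma idx_simps [simp]: "idx k [] = nz k" "idx k (bs @ [b]) = 2 * idx k bs + of_bool b"
  by (simp_all add: idx_def)

lemma idx_less: "idx k bs < 3 * 2 ^ length bs"
proof (induction bs rule: rev_induct)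
  case Nil show ?case by (cases k) auto
qed auto

lemma idx_inj: "length bs = length cs \<Longrightarrow> idx k bs = idx l cs \<Longrightarrow> k = l \<and> bs = cs"
proof (induction bs arbitrary: cs rule: rev_induct)
  case Nil
  then show ?case by (cases k; cases l) auto
next
  case (snoc b bs)
  then obtain c cs' where cs: "cs = cs' @ [c]" by (cases cs rule: rev_cases) auto
  have e: "2 * idx k bs + of_bool b = 2 * idx l cs' + of_bool c"
    using snoc(3) by (simp add: cs)
  then have "b = c" "idx k bs = idx l cs'"
    by (cases b; cases c; simp; presburger)+
  then show ?case using snoc cs by auto
qed

lemma idx_surj: "j < 3 * 2 ^ l \<Longrightarrow> \<exists>k bs. length bs = l \<and> idx k bs = j"
proof (induction l arbitrary: j)
  case 0
  then have "j = nz Z0 \<or> j = nz Z1 \<or> j = nz Z2" by auto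
  then obtain k where "nz k = j" by blast
  then show ?case by (intro exI[of _ k] exI[of _ "[]"]) simp
next
  case (Suc l)
  then have "j div 2 < 3 * 2 ^ l" by auto
  then obtain k bs where "length bs = l" "idx k bs = j div 2" using Suc.IH by blast
  moreover have "2 * (j div 2) + of_bool (odd j) = j" by simp
  ultimately show ?case by (intro exI[of _ k] exI[of _ "bs @ [odd j]"]) simp
qed

text \<open>A third of a level is \<open>2 ^ length bs\<close>, the weight of the ternary leading
  digit. Adding it changes only the branch, and the reduction modulo the size of the level is the
  reduction of that digit modulo 3.\<close>

lemma idx_shift: "idx (k + Z1) bs = (idx k bs + 2 ^ length bs) mod (3 * 2 ^ length bs)"
proof -
  have e: "idx k bs = nz k * 2 ^ length bs + idx Z0 bs" for k
    by (induction bs rule: rev_induct) auto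
  have "idx Z0 bs < 2 ^ length bs"
    by (induction bs rule: rev_induct) auto
  then show ?thesis
    unfolding e[of k] e[of "k + Z1"] by (cases k) auto
qed

lemma enc_par: "v \<noteq> None \<Longrightarrow> enc (par v) = parent (enc v)"
proof (cases v rule: level.cases)
  case (2 k bs)
  then show ?thesis by (cases bs rule: rev_cases) auto
qed simp

lemma graph_iso_enc: "graph_iso enc (PT d) (std_T (Suc d))"
proof -
  have inj: "inj_on enc (PT_verts d)"
  proof (rule inj_onI)
    fix u v assume "enc u = enc v"
    then show "u = v" using idx_inj by (cases u rule: level.cases; cases v rule: level.cases) auto
  qed
  let ?B = "{(k, j). 1 \<le> k \<and> k \<le> Suc d \<and> j < (3 :: nat) * 2 ^ (k - 1)}"
  have B: "enc ` (PT_verts d - {None}) = ?B"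
  proof (intro equalityI subsetI)
    fix x assume "x \<in> ?B"
    then obtain k j where x: "x = (Suc k, j)" "k \<le> d" "j < 3 * 2 ^ k" by (cases x) (auto simp: Suc_le_eq gr0_conv_Suc)
    then obtain c bs where "length bs = k" "idx c bs = j" using idx_surj by blast
    then have "x = enc (Some (c, bs))" "Some (c, bs) \<in> PT_verts d - {None}" using x by auto
    then show "x \<in> enc ` (PT_verts d - {None})" by blast
  next
    fix x assume "x \<in> enc ` (PT_verts d - {None})"
    then obtain k bs where "x = (Suc (length bs), idx k bs)" "length bs \<le> d"
      by (auto simp: PT_verts_def)
    then show "x \<in> ?B" using idx_less[of k bs] by auto
  qed
  have "enc ` PT_verts d = insert (0, 0) ?B"
    unfolding B[symmetric] using PT_verts_simps(1) by (metis enc.simps(1) image_insert insert_Diff)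
  moreover have "(\<lambda>v. {v, parent v}) ` ?B = (`) enc ` edges (PT d)"
    unfolding B[symmetric] PT_def
    by (simp add: image_image) (rule image_cong, auto simp: enc_par simp del: parent.simps par.simps)
  ultimately have "std_T (Suc d) = img enc (PT d)"
    by (simp add: std_T_def img_def Let_def del: parent.simps)
  then show ?thesis using graph_PT inj by (simp add: graph_iso_iff_img)
qed

section \<open>Rotation-invariant outer edges as voltage graphs\<close>

text \<open>A rotation-invariant 2-regular graph on the leaves is described by its quotient under the
  rotation: a list of cycles whose entries \<open>(a, v)\<close> consist of a leaf path \<open>a\<close> and the amount \<open>v\<close> by
  which the branch changes along the edge to the next entry.\<close>

type_synonym config = "(bool list \<times> z3) list list"

definition arcs :: "('a \<times> z3) list list \<Rightarrow> ('a \<times> z3 \<times> 'a) set" where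
  "arcs cs = {(fst (c ! s), snd (c ! s), fst (c ! (Suc s mod length c))) | c s. c \<in> set cs \<and> s < length c}"

definition outer :: "config \<Rightarrow> vertex set set" where
  "outer cs = {{Some (k, a), Some (k + v, b)} | k a v b. (a, v, b) \<in> arcs cs}"

definition CG :: "nat \<Rightarrow> config \<Rightarrow> vertex ugraph" where
  "CG d cs = (PT_verts d, edges (PT d) \<union> outer cs)"

text \<open>A cycle of length 1 would lift to a triangle on the three copies of one leaf path (or to
  no edge at all). In a cycle of length 2 with total voltage 0 the second arc would run back along
  the lift of the first, giving the same edge twice.\<close>

definition valid :: "nat \<Rightarrow> config \<Rightarrow> bool" where
  "valid d cs \<longleftrightarrow> distinct (map fst (concat cs)) \<and> set (map fst (concat cs)) = {bs. length bs = d} \<and>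
     (\<forall>c\<in>set cs. 2 \<le> length c \<and> (length c = 2 \<longrightarrow> snd (c ! 0) + snd (c ! 1) \<noteq> Z0))"

lemma arcs_Nil [simp]: "arcs [] = {}" by (simp add: arcs_def)

lemma arcs_Cons: "arcs (c # cs) = arcs [c] \<union> arcs cs" by (auto simp: arcs_def)

lemma arcs_ends:
  assumes "(a, v, b) \<in> arcs cs" shows "a \<in> fst ` set (concat cs)" "b \<in> fst ` set (concat cs)"
proof -
  obtain c s where c: "c \<in> set cs" "s < length c" "a = fst (c ! s)" "b = fst (c ! (Suc s mod length c))"
    using assms by (auto simp: arcs_def)
  have "Suc s mod length c < length c" using c(2) by (intro mod_less_divisor) auto
  then have "c ! s \<in> set (concat cs)" "c ! (Suc s mod length c) \<in> set (concat cs)"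
    using c(1,2) by (auto intro!: bexI[of _ c])
  then show "a \<in> fst ` set (concat cs)" "b \<in> fst ` set (concat cs)" using c by auto
qed

lemma card2_eq: "card S = 2 \<Longrightarrow> x \<in> S \<Longrightarrow> y \<in> S \<Longrightarrow> x \<noteq> y \<Longrightarrow> S = {x, y}"
  by (auto simp: card_2_iff)

text \<open>The quotient may have parallel edges that differ only in their voltages, so
  \<open>N a\<close> collects darts, that is pairs of a voltage and an end, instead of
  neighbours.\<close>

locale two_regular =
  fixes V :: "'a set" and N :: "'a \<Rightarrow> (z3 \<times> 'a) set"
  assumes fin: "finite V"
    and two: "\<And>a. a \<in> V \<Longrightarrow> card (N a) = 2"
    and closed: "\<And>a v b. a \<in> V \<Longrightarrow> (v, b) \<in> N a \<Longrightarrow> b \<in> V"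
    and sym: "\<And>a v b. a \<in> V \<Longrightarrow> (v, b) \<in> N a \<Longrightarrow> (- v, a) \<in> N b"
    and noloop: "\<And>a v. a \<in> V \<Longrightarrow> (v, a) \<notin> N a"
begin

text \<open>All vertices but the last are distinct, and no dart is followed by its own reverse.
  Going straight back to the previous vertex along a parallel dart is permitted, since this closes a
  quotient cycle of length 2.\<close>

definition walk :: "nat \<Rightarrow> (nat \<Rightarrow> 'a) \<Rightarrow> (nat \<Rightarrow> z3) \<Rightarrow> bool" where
  "walk m a v \<longleftrightarrow> 0 < m \<and> inj_on a {..<m} \<and> (\<forall>s\<le>m. a s \<in> V) \<and> (\<forall>s<m. (v s, a (Suc s)) \<in> N (a s)) \<and>
     (\<forall>s. Suc s < m \<longrightarrow> (v (Suc s), a (Suc (Suc s))) \<noteq> (- v s, a s))"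

lemma longest_walk:
  assumes "V \<noteq> {}"
  obtains m a v where "walk m a v" "\<And>a v. \<not> walk (Suc m) a v"
proof -
  obtain x where x: "x \<in> V" using assms by blast
  then have "N x \<noteq> {}" using two by fastforce
  then obtain w y where w: "(w, y) \<in> N x" by (metis ex_in_conv surj_pair)
  have "walk 1 (\<lambda>s. if s = 0 then x else y) (\<lambda>_. w)"
    using x w closed by (auto simp: walk_def inj_on_def)
  then have 1: "\<exists>a v. walk 1 a v" by blast
  have b: "m \<le> card V" if "\<exists>a v. walk m a v" for m
  proof -
    from that obtain a v where "walk m a v" by blast
    then have "inj_on a {..<m}" "a ` {..<m} \<subseteq> V" by (auto simp: walk_def)
    then show ?thesis using card_inj_on_le[of a "{..<m}" V] fin by simp
  qed
  obtain m where m: "\<exists>a v. walk m a v" "\<forall>k. (\<exists>a v. walk k a v) \<longrightarrow> k \<le> m"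
    using Nat.ex_has_greatest_nat[of "\<lambda>m. \<exists>a v. walk m a v" 1 "card V"] 1 b by auto
  from m(1) obtain a v where "walk m a v" by blast
  moreover have "\<not> walk (Suc m) a v" for a v using m(2) by (metis Suc_n_not_le_n)
  ultimately show ?thesis by (rule that)
qed

text \<open>At the last vertex there is a second dart besides the one pointing back, so a new vertex
  there would allow an extension. If instead the walk met itself at an inner vertex
  \<open>a j\<close>, both darts of \<open>a j\<close> would already lie on the walk, and the dart
  back along the last step would have to be one of them; every such coincidence contradicts
  distinctness, the ban on reversal, or the absence of loops.\<close>

lemma longest_walk_closed:
  assumes w: "walk m a v" and max: "\<And>a v. \<not> walk (Suc m) a v"
  shows "a m = a 0"
proof -
  obtain n where n: "m = Suc n" using w by (auto simp: walk_def gr0_conv_Suc)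
  have inj: "\<And>i j. i < m \<Longrightarrow> j < m \<Longrightarrow> a i = a j \<Longrightarrow> i = j"
    and aV: "\<And>s. s \<le> m \<Longrightarrow> a s \<in> V" and N: "\<And>s. s < m \<Longrightarrow> (v s, a (Suc s)) \<in> N (a s)"
    and nb: "\<And>s. Suc s < m \<Longrightarrow> (v (Suc s), a (Suc (Suc s))) \<noteq> (- v s, a s)"
    using w by (auto simp: walk_def inj_on_def)
  have rev: "(- v s, a s) \<in> N (a (Suc s))" if "s < m" for s using sym[OF aV N] that by simp
  have "a m \<in> a ` {..<m}"
  proof (rule ccontr)
    assume new: "a m \<notin> a ` {..<m}"
    have "\<not> N (a m) \<subseteq> {(- v n, a n)}"
    proof
      assume "N (a m) \<subseteq> {(- v n, a n)}"
      then have "card (N (a m)) \<le> card {(- v n, a n)}" by (intro card_mono) auto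
      then show False using two[OF aV[of m]] by simp
    qed
    then obtain p where p: "p \<in> N (a m)" "p \<noteq> (- v n, a n)" by blast
    obtain x b where p': "p = (x, b)" by (cases p)
    have b: "b \<in> V" using closed[of "a m" x b] aV[of m] p p' by simp
    define a' where "a' = a(Suc m := b)"
    define v' where "v' = v(m := x)"
    have "inj_on a {..<Suc m}" using new w by (simp add: lessThan_Suc walk_def)
    then have "inj_on a' {..<Suc m}" by (simp add: a'_def inj_on_def)
    moreover have "\<forall>s\<le>Suc m. a' s \<in> V" using aV b by (auto simp: a'_def le_Suc_eq)
    moreover have "\<forall>s<Suc m. (v' s, a' (Suc s)) \<in> N (a' s)"
      using N p p' by (auto simp: a'_def v'_def less_Suc_eq)
    moreover have "\<forall>s. Suc s < Suc m \<longrightarrow> (v' (Suc s), a' (Suc (Suc s))) \<noteq> (- v' s, a' s)"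
    proof (intro allI impI)
      fix s assume s: "Suc s < Suc m"
      show "(v' (Suc s), a' (Suc (Suc s))) \<noteq> (- v' s, a' s)"
      proof (cases "Suc s = m")
        case True
        then show ?thesis using p p' n by (auto simp: a'_def v'_def)
      next
        case False
        then show ?thesis using nb[of s] s by (auto simp: a'_def v'_def)
      qed
    qed
    ultimately have "walk (Suc m) a' v'" unfolding walk_def by blast
    then show False using max by blast
  qed
  then obtain j where j: "j < m" "a m = a j" by auto
  have "j = 0"
  proof (cases j)
    case (Suc i)
    have i: "i < m" "Suc i < m" using j Suc by auto
    have "(- v i, a i) \<noteq> (v j, a (Suc j))" using nb[OF i(2)] Suc by auto
    then have "N (a j) = {(- v i, a i), (v j, a (Suc j))}"
      using card2_eq[OF two[OF aV[of j]]] rev[OF i(1)] N[OF j(1)] j(1) Suc by auto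
    moreover have "(- v n, a n) \<in> N (a j)" using rev[of n] n j by simp
    ultimately consider "a n = a i" | "- v n = v j" "a n = a (Suc j)" by auto
    then show ?thesis
    proof cases
      case 1
      then have "n = i" using inj[of n i] n i by simp
      then show ?thesis using j(1) n Suc by simp
    next
      case 2
      show ?thesis
      proof (cases "Suc j < m")
        case True
        then have "n = Suc j" using inj[of n "Suc j"] 2(2) n by simp
        moreover have "v n = - v j" using 2(1) by (metis minus_minus)
        ultimately show ?thesis using nb[OF True] j(2) n by auto
      next
        case False
        then have "Suc j = m" using j(1) by simp
        then have "(v j, a j) \<in> N (a j)" using N[OF j(1)] j(2) by simp
        then show ?thesis using noloop[OF aV[of j]] j(1) by simp
      qed
    qed
  qed
  then show ?thesis using j by simp
qed

lemma closed_walk: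
  assumes "V \<noteq> {}"
  obtains c where "2 \<le> length c" "distinct (map fst c)" "fst ` set c \<subseteq> V"
    "length c = 2 \<longrightarrow> snd (c ! 0) + snd (c ! 1) \<noteq> Z0"
    "\<forall>a\<in>fst ` set c. N a = {(v, b). (a, v, b) \<in> arcs [c] \<or> (b, - v, a) \<in> arcs [c]}"
proof -
  obtain m a v where w: "walk m a v" and max: "\<And>a v. \<not> walk (Suc m) a v"
    using longest_walk[OF assms] by metis
  have am: "a m = a 0" by (rule longest_walk_closed[OF w max])
  obtain n where n: "m = Suc n" using w by (auto simp: walk_def gr0_conv_Suc)
  have inj: "\<And>i j. i < m \<Longrightarrow> j < m \<Longrightarrow> a i = a j \<Longrightarrow> i = j"
    and aV: "\<And>s. s \<le> m \<Longrightarrow> a s \<in> V" and N: "\<And>s. s < m \<Longrightarrow> (v s, a (Suc s)) \<in> N (a s)"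
    and nb: "\<And>s. Suc s < m \<Longrightarrow> (v (Suc s), a (Suc (Suc s))) \<noteq> (- v s, a s)"
    using w by (auto simp: walk_def inj_on_def)
  have rev: "(- v s, a s) \<in> N (a (Suc s))" if "s < m" for s using sym[OF aV N] that by simp
  have "m \<noteq> 1" using N[of 0] noloop[OF aV[of 0]] am by auto
  then have m2: "2 \<le> m" using n by simp
  define c where "c = map (\<lambda>s. (a s, v s)) [0..<m]"
  have len: "length c = m" by (simp add: c_def)
  have cs: "c ! s = (a s, v s)" if "s < m" for s using that by (simp add: c_def)
  have am': "a (Suc s mod m) = a (Suc s)" if "s < m" for s
    using that am by (cases "Suc s = m") auto
  then have nx: "fst (c ! (Suc s mod m)) = a (Suc s)" if "s < m" for s
    using cs[of "Suc s mod m"] that m2 by simp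
  have "arcs [c] = (\<lambda>s. (fst (c ! s), snd (c ! s), fst (c ! (Suc s mod m)))) ` {..<m}"
    by (auto simp: arcs_def len)
  also have "\<dots> = (\<lambda>s. (a s, v s, a (Suc s))) ` {..<m}"
    by (rule image_cong) (simp_all add: cs nx am')
  finally have arcs: "arcs [c] = {(a s, v s, a (Suc s)) | s. s < m}" by auto
  \<comment> \<open>The cyclic predecessor: the two darts at \<open>a s\<close> follow the arc
    leaving it and reverse the arc arriving from \<open>a (pr s)\<close>.\<close>
  define pr where "pr s = (if s = 0 then n else s - 1)" for s
  have pr: "pr s < m \<and> a (Suc (pr s)) = a s" if "s < m" for s
    using that n am by (auto simp: pr_def)
  have pr_uniq: "t = pr s" if "t < m" "s < m" "a (Suc t) = a s" for s t
  proof (cases "Suc t = m")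
    case True
    then have "s = 0" using that am inj[of 0 s] by simp
    then show ?thesis using True n by (simp add: pr_def)
  next
    case False
    then show ?thesis using that inj[of "Suc t" s] by (auto simp: pr_def)
  qed
  \<comment> \<open>The ban on reversal also holds across the closing point: there a violation would
    force length 2, where it is the ban at position 0.\<close>
  have nb2: "(v s, a (Suc s)) \<noteq> (- v (pr s), a (pr s))" if s: "s < m" for s
  proof (cases s)
    case (Suc t)
    then show ?thesis using nb[of t] s by (simp add: pr_def)
  next
    case 0
    show ?thesis
    proof
      assume e: "(v s, a (Suc s)) = (- v (pr s), a (pr s))"
      then have "a 1 = a n" using 0 by (simp add: pr_def)
      then have "n = 1" using inj[of 1 n] n m2 by simp
      then have "(v 1, a 2) = (- v 0, a 0)" using e 0 am n by (simp add: pr_def numeral_2_eq_2)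
      then show False using nb[of 0] n \<open>n = 1\<close> by (simp add: numeral_2_eq_2)
    qed
  qed
  show ?thesis
  proof (rule that[of c])
    show "distinct (map fst c)" using inj by (auto simp: c_def distinct_map inj_on_def)
    show "fst ` set c \<subseteq> V" using aV by (auto simp: c_def)
    show "2 \<le> length c" using m2 len by simp
    show "length c = 2 \<longrightarrow> snd (c ! 0) + snd (c ! 1) \<noteq> Z0"
    proof (intro impI notI)
      assume that: "length c = 2"
      assume "snd (c ! 0) + snd (c ! 1) = Z0"
      moreover have m: "m = 2" using that len by simp
      ultimately have "v 0 + v 1 = 0" by (simp add: c_def zero_z3_def numeral_2_eq_2 upt_rec)
      then have "v 1 = - v 0" by (simp add: eq_neg_iff_add_eq_0 add.commute)
      then show False using nb[of 0] am m by (simp add: numeral_2_eq_2)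
    qed
    show "\<forall>x\<in>fst ` set c. N x = {(w, b). (x, w, b) \<in> arcs [c] \<or> (b, - w, x) \<in> arcs [c]}"
  proof
    fix x assume "x \<in> fst ` set c"
    then obtain s where s: "s < m" "x = a s" by (auto simp: c_def)
    have "N x = {(v s, a (Suc s)), (- v (pr s), a (pr s))}"
      using card2_eq[OF two[OF aV[of s]] N[OF s(1)] _ nb2[OF s(1)]] rev[of "pr s"] pr[OF s(1)] s by simp
    also have "\<dots> = {(w, b). (x, w, b) \<in> arcs [c] \<or> (b, - w, x) \<in> arcs [c]}"
    proof (intro equalityI subsetI)
      fix p assume "p \<in> {(v s, a (Suc s)), (- v (pr s), a (pr s))}"
      then show "p \<in> {(w, b). (x, w, b) \<in> arcs [c] \<or> (b, - w, x) \<in> arcs [c]}"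
        using pr[OF s(1)] s unfolding arcs by fastforce
    next
      fix p assume "p \<in> {(w, b). (x, w, b) \<in> arcs [c] \<or> (b, - w, x) \<in> arcs [c]}"
      then obtain w b where p: "p = (w, b)" "(x, w, b) \<in> arcs [c] \<or> (b, - w, x) \<in> arcs [c]" by blast
      from p(2) show "p \<in> {(v s, a (Suc s)), (- v (pr s), a (pr s))}"
      proof
        assume "(x, w, b) \<in> arcs [c]"
        then obtain t where t: "t < m" "x = a t" "w = v t" "b = a (Suc t)" unfolding arcs by blast
        then have "t = s" using inj s by simp
        then show ?thesis using t p by simp
      next
        assume "(b, - w, x) \<in> arcs [c]"
        then obtain t where t: "t < m" "b = a t" "- w = v t" "x = a (Suc t)" unfolding arcs by blast
        then have "t = pr s" using pr_uniq s by simp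
        moreover have "w = - v t" using t(3) by (metis minus_minus)
        ultimately show ?thesis using t p by simp
      qed
    qed
    finally show "N x = {(w, b). (x, w, b) \<in> arcs [c] \<or> (b, - w, x) \<in> arcs [c]}" .
  qed
  qed
qed

end

text \<open>The support of a closed walk contains both darts of each of its vertices, so no dart
  connects it with the rest. The complement is again two-regular, and induction on its size
  applies.\<close>

lemma two_regular_decompose:
  assumes "two_regular V N"
  shows "\<exists>cs. distinct (map fst (concat cs)) \<and> set (map fst (concat cs)) = V \<and>
    (\<forall>c\<in>set cs. 2 \<le> length c \<and> (length c = 2 \<longrightarrow> snd (c ! 0) + snd (c ! 1) \<noteq> Z0)) \<and>
    (\<forall>a\<in>V. N a = {(v, b). (a, v, b) \<in> arcs cs \<or> (b, - v, a) \<in> arcs cs})"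
  using assms
proof (induction "card V" arbitrary: V rule: less_induct)
  case less
  interpret two_regular V N by (rule less.prems)
  show ?case
  proof (cases "V = {}")
    case True
    then show ?thesis by (intro exI[of _ "[]"]) simp
  next
    case False
    obtain c where c: "2 \<le> length c" "distinct (map fst c)" "fst ` set c \<subseteq> V"
      "length c = 2 \<longrightarrow> snd (c ! 0) + snd (c ! 1) \<noteq> Z0"
      "\<forall>a\<in>fst ` set c. N a = {(v, b). (a, v, b) \<in> arcs [c] \<or> (b, - v, a) \<in> arcs [c]}"
      by (rule closed_walk[OF False])
    let ?C = "fst ` set c"
    have ends: "a \<in> ?C \<and> b \<in> ?C" if "(a, v, b) \<in> arcs [c]" for a v b using arcs_ends[OF that] by simp
    have sub: "b \<in> ?C" if "a \<in> ?C" "(v, b) \<in> N a" for a v b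
      using c(5) that ends by blast
    have tr: "two_regular (V - ?C) N"
    proof
      show "b \<in> V - ?C" if "a \<in> V - ?C" "(v, b) \<in> N a" for a v b
        using closed[of a v b] sym[of a v b] sub[of b "- v" a] that by blast
    qed (use fin two sym noloop in auto)
    have less: "card (V - ?C) < card V"
    proof -
      have "?C \<noteq> {}" using c(1) by auto
      then have "0 < card ?C" by (simp add: card_gt_0_iff)
      moreover have "card ?C \<le> card V" by (rule card_mono[OF fin c(3)])
      moreover have "card (V - ?C) = card V - card ?C" by (rule card_Diff_subset[OF _ c(3)]) simp
      ultimately show ?thesis by linarith
    qed
    obtain cs where cs: "distinct (map fst (concat cs))" "set (map fst (concat cs)) = V - ?C"
      "\<forall>c\<in>set cs. 2 \<le> length c \<and> (length c = 2 \<longrightarrow> snd (c ! 0) + snd (c ! 1) \<noteq> Z0)"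
      "\<forall>a\<in>V - ?C. N a = {(v, b). (a, v, b) \<in> arcs cs \<or> (b, - v, a) \<in> arcs cs}"
      using less.hyps[OF less tr] by (elim exE conjE) (rule that)
    have ends': "a \<in> V - ?C \<and> b \<in> V - ?C" if "(a, v, b) \<in> arcs cs" for a v b
      using arcs_ends[OF that] cs(2) unfolding set_map by blast
    have "N a = {(v, b). (a, v, b) \<in> arcs (c # cs) \<or> (b, - v, a) \<in> arcs (c # cs)}" if a: "a \<in> V" for a
    proof (cases "a \<in> ?C")
      case True
      then have "(a, v, b) \<notin> arcs cs \<and> (b, - v, a) \<notin> arcs cs" for v b using ends' by blast
      then show ?thesis unfolding arcs_Cons[of c cs] using c(5)[THEN bspec, OF True] by simp
    next
      case False
      then have "(a, v, b) \<notin> arcs [c] \<and> (b, - v, a) \<notin> arcs [c]" for v b using ends by blast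
      moreover have "N a = {(v, b). (a, v, b) \<in> arcs cs \<or> (b, - v, a) \<in> arcs cs}"
        using cs(4) False a by blast
      ultimately show ?thesis unfolding arcs_Cons[of c cs] by simp
    qed
    moreover have "distinct (map fst (concat (c # cs)))" "set (map fst (concat (c # cs))) = V"
      using cs(1,2) c(2,3) by auto
    moreover have "\<forall>c\<in>set (c # cs). 2 \<le> length c \<and> (length c = 2 \<longrightarrow> snd (c ! 0) + snd (c ! 1) \<noteq> Z0)"
      using cs(3) c(1,4) by simp
    ultimately show ?thesis by (intro exI[of _ "c # cs"]) blast
  qed
qed

text \<open>By rotation invariance an edge between leaves is determined by its two leaf paths and
  the difference of the branches, so it suffices to look at the copy \<open>Z0\<close> of every leaf
  path. These data form a two-regular voltage graph, whose cycles are the configuration.\<close>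

lemma config_exists:
  assumes G: "graph G" "verts G = PT_verts d" "regular 3 G" "edges (PT d) \<subseteq> edges G"
    and noloop: "\<And>k l a. length a = d \<Longrightarrow> {Some (k, a), Some (l, a)} \<notin> edges G"
    and rot: "\<And>k l a b. length a = d \<Longrightarrow> length b = d \<Longrightarrow> {Some (k, a), Some (l, b)} \<in> edges G \<Longrightarrow>
      {Some (k + Z1, a), Some (l + Z1, b)} \<in> edges G"
  shows "\<exists>cs. valid d cs \<and> G = CG d cs"
proof -
  have rotk: "{Some (k + c, a), Some (l + c, b)} \<in> edges G"
    if "length a = d" "length b = d" "{Some (k, a), Some (l, b)} \<in> edges G" for k l a b c
  proof -
    have e: "k + Z0 = k" "l + Z0 = l" "k + Z2 = k + Z1 + Z1" "l + Z2 = l + Z1 + Z1"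
      by (cases k; cases l; simp)+
    show ?thesis
      using that rot[OF that] rot[OF that(1,2) rot[OF that]] by (cases c) (simp_all only: e)
  qed
  \<comment> \<open>At an inner vertex the three tree edges already exhaust the degree, so every
    further edge of \<open>G\<close> joins two leaves.\<close>
  have inner: "adj (PT d) w u" if "adj G w u" "w \<in> PT_verts d" "level w \<noteq> Suc d" for w u
  proof -
    have 3: "card {u. adj G w u} = 3" "card {u. adj (PT d) w u} = 3"
      using G(1-3) that degree_PT[of w d] degree_adj[OF G(1), of w] degree_adj[OF graph_PT, of d w]
      by (auto simp: regular_def)
    have "finite {u. adj G w u}" using 3(1) card.infinite by fastforce
    moreover have "{u. adj (PT d) w u} \<subseteq> {u. adj G w u}" using G(4) by (auto simp: adj_def)
    ultimately have "{u. adj (PT d) w u} = {u. adj G w u}" using 3 by (intro card_subset_eq) auto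
    then show ?thesis using that(1) by blast
  qed
  have leaf: "\<exists>k a. w = Some (k, a) \<and> length a = d" if "level w = Suc d" for w
    using that by (cases w rule: level.cases) auto
  define N where "N a = {(v, b). length b = d \<and> {Some (Z0, a), Some (v, b)} \<in> edges G}" for a
  have rel: "(l - k, b) \<in> N a \<longleftrightarrow> {Some (k, a), Some (l, b)} \<in> edges G"
    if "length a = d" "length b = d" for a b k l
  proof -
    have e: "k + - k = Z0" "l + - k = l - k" "Z0 + k = k" "l - k + k = l"
      by (simp_all add: zero_z3_def[symmetric])
    show ?thesis
      using rotk[OF that, of k l "- k"] rotk[OF that, of Z0 "l - k" k] that(2) unfolding e N_def by auto
  qed
  have "two_regular {bs. length bs = d} N"
  proof
    show "finite {bs :: bool list. length bs = d}"
      using finite_lists_length_eq[of "UNIV :: bool set" d] by simp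
  next
    fix a v b assume a: "a \<in> {bs. length bs = d}" and b: "(v, b) \<in> N a"
    then show "b \<in> {bs. length bs = d}" by (simp add: N_def)
    then have "{Some (v, b), Some (Z0, a)} \<in> edges G" using b by (simp add: N_def insert_commute)
    then have "(Z0 - v, a) \<in> N b" using rel[of b a Z0 v] a b by (simp add: N_def)
    then show "(- v, a) \<in> N b" by (simp add: zero_z3_def[symmetric])
  next
    fix a :: "bool list" and v assume "a \<in> {bs. length bs = d}"
    then show "(v, a) \<notin> N a" using noloop by (simp add: N_def)
  next
    fix a :: "bool list" assume "a \<in> {bs. length bs = d}"
    then have a: "length a = d" by simp
    let ?u = "Some (Z0, a)"
    have lu: "level ?u = Suc d" using a by simp
    have pu: "adj (PT d) ?u (par ?u)" using a par_in_PT[of ?u d] by (simp add: adj_PT del: par.simps)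
    have lpu: "level (par ?u) \<noteq> Suc d" using level_par[of ?u] lu by simp
    \<comment> \<open>One of the three edges at a leaf leads to its parent, which leaves exactly two
      darts.\<close>
    have "{w. adj G ?u w} = insert (par ?u) (Some ` N a)"
    proof (intro equalityI subsetI)
      fix w assume "w \<in> {w. adj G ?u w}"
      then have w: "adj G ?u w" "adj G w ?u" "w \<in> PT_verts d"
        using graph_adjD[OF G(1), of ?u w] G(2) adj_sym[of G ?u w] by auto
      show "w \<in> insert (par ?u) (Some ` N a)"
      proof (cases "level w = Suc d")
        case True
        then obtain v b where "w = Some (v, b)" "length b = d" using leaf by blast
        then show ?thesis using w(1) by (auto simp: N_def adj_def)
      next
        case False
        then have "adj (PT d) w ?u" using inner w by blast
        then have "w \<noteq> None \<and> ?u = par w \<or> w = par ?u" by (simp add: adj_PT del: par.simps)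
        moreover have "level (par w) \<noteq> Suc d" if "w \<noteq> None"
          using level_par[OF that] w(3) by (simp add: PT_verts_level)
        ultimately show ?thesis using lu by fastforce
      qed
    next
      fix w assume "w \<in> insert (par ?u) (Some ` N a)"
      then show "w \<in> {w. adj G ?u w}" using pu G(4) by (auto simp: N_def adj_def simp del: par.simps)
    qed
    moreover have "par ?u \<notin> Some ` N a" using lpu by (auto simp: N_def simp del: par.simps)
    moreover have c3: "card {w. adj G ?u w} = 3"
      using G(1-3) a degree_adj[OF G(1), of ?u] by (simp add: regular_def)
    ultimately have "card (insert (par ?u) (Some ` N a)) = 3" "par ?u \<notin> Some ` N a" by simp_all
    moreover from this have "finite (Some ` N a)" using card.infinite[of "insert (par ?u) (Some ` N a)"] by fastforce
    ultimately have "card (Some ` N a) = 2" by simp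
    then show "card (N a) = 2" by (simp add: card_image)
  qed
  then obtain cs where cs: "distinct (map fst (concat cs))" "set (map fst (concat cs)) = {bs. length bs = d}"
      "\<forall>c\<in>set cs. 2 \<le> length c \<and> (length c = 2 \<longrightarrow> snd (c ! 0) + snd (c ! 1) \<noteq> Z0)"
      "\<forall>a\<in>{bs. length bs = d}. N a = {(v, b). (a, v, b) \<in> arcs cs \<or> (b, - v, a) \<in> arcs cs}"
    by (elim two_regular_decompose[THEN exE] conjE) (rule that)
  have ends: "length a = d \<and> length b = d" if "(a, v, b) \<in> arcs cs" for a v b
    using arcs_ends[OF that] cs(2) unfolding set_map by blast
  have "edges G = edges (PT d) \<union> outer cs"
  proof (intro equalityI subsetI)
    fix e assume e: "e \<in> edges G"
    then obtain x y where xy: "e = {x, y}" "x \<in> PT_verts d" "y \<in> PT_verts d"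
      using graph_edgeD[OF G(1) e] G(2) by (auto simp: card_2_iff)
    have A: "adj G x y" "adj G y x" using e xy by (auto simp: adj_def insert_commute)
    show "e \<in> edges (PT d) \<union> outer cs"
    proof (cases "level x = Suc d \<and> level y = Suc d")
      case True
      then obtain k a l b where ab: "x = Some (k, a)" "y = Some (l, b)" "length a = d" "length b = d"
        using leaf[of x] leaf[of y] by blast
      then have "(l - k, b) \<in> N a" using rel e xy by simp
      then have "(a, l - k, b) \<in> arcs cs \<or> (b, - (l - k), a) \<in> arcs cs" using cs(4) ab by simp
      then have "e \<in> outer cs"
      proof
        assume "(a, l - k, b) \<in> arcs cs"
        then have "{Some (k, a), Some (k + (l - k), b)} \<in> outer cs" unfolding outer_def by blast
        then show ?thesis using xy ab by simp
      next
        assume "(b, - (l - k), a) \<in> arcs cs"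
        then have "{Some (l, b), Some (l + - (l - k), a)} \<in> outer cs" unfolding outer_def by blast
        then show ?thesis using xy ab by (simp add: insert_commute)
      qed
      then show ?thesis by simp
    next
      case False
      then have "adj (PT d) x y \<or> adj (PT d) y x" using inner A xy by blast
      then show ?thesis using xy by (auto simp: adj_def insert_commute)
    qed
  next
    fix e assume "e \<in> edges (PT d) \<union> outer cs"
    then show "e \<in> edges G"
    proof
      assume "e \<in> outer cs"
      then obtain k a v b where e: "e = {Some (k, a), Some (k + v, b)}" "(a, v, b) \<in> arcs cs"
        unfolding outer_def by blast
      then have "(k + v - k, b) \<in> N a" using cs(4) ends[OF e(2)] by simp
      then show ?thesis using rel[of a b "k + v" k] ends[OF e(2)] e by simp
    qed (use G(4) in blast)
  qed
  then have "G = CG d cs" using G(2) by (simp add: CG_def prod_eq_iff)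
  moreover have "valid d cs" using cs by (simp add: valid_def)
  ultimately show ?thesis by blast
qed

section \<open>Cycles given by vertex lists\<close>

definition cyc :: "'v list \<Rightarrow> 'v ugraph" where "cyc p = (set p, cycle_edges p)"

lemma cycle_edges_iff:
  "cycle_edges p = (\<lambda>k. {p ! k, p ! (Suc k mod length p)}) ` {..<length p}"
  by (auto simp: cycle_edges_def)

lemma adj_cyc:
  assumes "distinct p" "3 \<le> length p" "k < length p"
  shows "{u. adj (cyc p) (p ! k) u} =
    {p ! (Suc k mod length p), p ! (if k = 0 then length p - 1 else k - 1)}"
    (is "?A = {?x, ?y}")
proof (intro equalityI subsetI)
  let ?m = "length p"
  have mod: "Suc j mod ?m < ?m" for j using assms(2) by (intro mod_less_divisor) auto
  fix u assume "u \<in> ?A"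
  then obtain j where j: "j < ?m" "{p ! k, u} = {p ! j, p ! (Suc j mod ?m)}"
    by (auto simp: adj_def cyc_def cycle_edges_iff)
  then consider "p ! k = p ! j" "u = p ! (Suc j mod ?m)" | "p ! k = p ! (Suc j mod ?m)" "u = p ! j"
    by (auto simp: doubleton_eq_iff)
  then show "u \<in> {?x, ?y}"
  proof cases
    case 1
    then have "j = k" using nth_eq_iff_index_eq[OF assms(1,3) j(1)] by simp
    then show ?thesis using 1 by simp
  next
    case 2
    then have k: "k = Suc j mod ?m" using nth_eq_iff_index_eq[OF assms(1,3) mod[of j]] by simp
    have "j = (if k = 0 then ?m - 1 else k - 1)"
    proof (cases "Suc j = ?m")
      case True then show ?thesis using k by auto
    next
      case False then show ?thesis using k j(1) by auto
    qed
    then show ?thesis using 2 by simp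
  qed
next
  let ?m = "length p"
  fix u assume u: "u \<in> {?x, ?y}"
  let ?j = "if k = 0 then ?m - 1 else k - 1"
  have "?j < ?m" "Suc ?j mod ?m = k" using assms by auto
  then have "{p ! k, ?y} \<in> cycle_edges p" unfolding cycle_edges_iff
    by (intro image_eqI[of _ _ ?j]) auto
  moreover have "{p ! k, ?x} \<in> cycle_edges p" using assms(3) unfolding cycle_edges_iff by blast
  ultimately show "u \<in> ?A" using u by (auto simp: adj_def cyc_def)
qed

lemma cycle_cyc:
  assumes "distinct p" "3 \<le> length p" shows "cycle (cyc p)"
proof -
  let ?m = "length p"
  have mod: "Suc j mod ?m < ?m" for j using assms(2) by (intro mod_less_divisor) auto
  have ne: "p ! k \<noteq> p ! (Suc k mod ?m)" if "k < ?m" for k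
  proof -
    have "Suc k mod ?m \<noteq> k" using that assms(2) by (cases "Suc k = ?m") auto
    then show ?thesis using that mod[of k] assms(1) by (simp add: nth_eq_iff_index_eq)
  qed
  have g: "graph (cyc p)"
    using ne mod by (auto simp: graph_def cyc_def cycle_edges_iff)
  have "degree (cyc p) v = 2" if v: "v \<in> verts (cyc p)" for v
  proof -
    from v obtain k where k: "k < ?m" "v = p ! k" by (auto simp: cyc_def in_set_conv_nth)
    let ?j = "if k = 0 then ?m - 1 else k - 1"
    have "Suc k mod ?m \<noteq> ?j" using k(1) assms(2) by (cases "Suc k = ?m") auto
    moreover have j: "?j < ?m" using k(1) by auto
    ultimately have "p ! (Suc k mod ?m) \<noteq> p ! ?j"
      using nth_eq_iff_index_eq[OF assms(1) mod[of k] j] by blast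
    then show ?thesis
      unfolding degree_adj[OF g] k(2) adj_cyc[OF assms k(1)] by simp
  qed
  moreover have "connected_graph (cyc p)"
    unfolding connected_graph_def
  proof (intro conjI ballI)
    show "verts (cyc p) \<noteq> {}" using assms(2) by (auto simp: cyc_def)
    have 0: "(adj (cyc p))\<^sup>*\<^sup>* (p ! 0) (p ! k)" if "k < ?m" for k
      using that
    proof (induction k)
      case (Suc k)
      have "adj (cyc p) (p ! k) (p ! Suc k)"
        unfolding adj_def cyc_def cycle_edges_iff snd_conv
        by (intro image_eqI[of _ _ k]) (use Suc.prems in auto)
      then show ?case using Suc by (meson Suc_lessD rtranclp.rtrancl_into_rtrancl)
    qed simp
    have sy: "symp (adj (cyc p))\<^sup>*\<^sup>*" by (intro symp_rtranclp sympI) (simp add: adj_sym)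
    fix u v assume "u \<in> verts (cyc p)" "v \<in> verts (cyc p)"
    then obtain i j where "i < ?m" "u = p ! i" "j < ?m" "v = p ! j"
      by (auto simp: cyc_def in_set_conv_nth)
    then show "(adj (cyc p))\<^sup>*\<^sup>* u v"
      using 0[of i] 0[of j] sympD[OF sy] by (metis rtranclp_trans)
  qed
  ultimately show ?thesis using g by (simp add: cycle_def regular_def)
qed

lemma subgraph_cyc:
  assumes "graph G" "distinct p" "3 \<le> length p" "cycle_edges p \<subseteq> edges G"
  shows "subgraph (cyc p) G"
proof -
  have "p ! k \<in> verts G" if "k < length p" for k
  proof -
    have "{p ! k, p ! (Suc k mod length p)} \<in> edges G"
      using assms(4) that unfolding cycle_edges_iff by blast
    then show ?thesis using graph_edgeD[OF assms(1)] by blast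
  qed
  then have "set p \<subseteq> verts G" by (auto simp: in_set_conv_nth)
  then show ?thesis
    using cycle_cyc[OF assms(2,3)] assms(4) by (simp add: subgraph_def cycle_def cyc_def)
qed

section \<open>Girth five in terms of triangles and squares\<close>

lemma girth_triangle:
  assumes "girth_at_least 5 G" "graph G" "adj G x y" "adj G y z" "adj G z x" shows False
proof -
  have d: "distinct [x, y, z]" using graph_adjD[OF assms(2)] assms(3-) by auto
  have e: "cycle_edges [x, y, z] \<subseteq> edges G"
    using assms(3-5) by (auto simp: cycle_edges_def adj_def less_Suc_eq)
  have "cycle (cyc [x, y, z])" using cycle_cyc[OF d] by simp
  moreover have "subgraph (cyc [x, y, z]) G" using subgraph_cyc[OF assms(2) d _ e] by simp
  ultimately have "5 \<le> card (verts (cyc [x, y, z]))" using assms(1) unfolding girth_at_least_def by blast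
  then show False using card_length[of "[x, y, z]"] by (simp add: cyc_def)
qed

lemma girth_square:
  assumes "girth_at_least 5 G" "graph G" "adj G x y" "adj G y z" "adj G z w" "adj G w x" "x \<noteq> z" "y \<noteq> w"
  shows False
proof -
  have d: "distinct [x, y, z, w]" using graph_adjD[OF assms(2)] assms(3-) by auto
  have e: "cycle_edges [x, y, z, w] \<subseteq> edges G"
    using assms(3-6) by (auto simp: cycle_edges_def adj_def less_Suc_eq)
  have "cycle (cyc [x, y, z, w])" using cycle_cyc[OF d] by simp
  moreover have "subgraph (cyc [x, y, z, w]) G" using subgraph_cyc[OF assms(2) d _ e] by simp
  ultimately have "5 \<le> card (verts (cyc [x, y, z, w]))" using assms(1) unfolding girth_at_least_def by blast
  then show False using card_length[of "[x, y, z, w]"] by (simp add: cyc_def)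
qed

text \<open>Let \<open>a\<close> and \<open>b\<close> be the neighbours of \<open>v\<close> on a
  cycle, and \<open>c\<close> and \<open>e\<close> the vertices following them. Without triangles
  \<open>c\<close> differs from \<open>b\<close> and \<open>e\<close> from \<open>a\<close>; then
  either \<open>c = e\<close> gives a square or the cycle has the five vertices \<open>v\<close>,
  \<open>a\<close>, \<open>b\<close>, \<open>c\<close>, \<open>e\<close>.\<close>

lemma girth_at_least_5I:
  assumes G: "graph G"
    and tri: "\<And>x y z. adj G x y \<Longrightarrow> adj G y z \<Longrightarrow> adj G z x \<Longrightarrow> False"
    and sq: "\<And>x y z w. adj G x y \<Longrightarrow> adj G y z \<Longrightarrow> adj G z w \<Longrightarrow> adj G w x \<Longrightarrow> x \<noteq> z \<Longrightarrow> y \<noteq> w \<Longrightarrow> False"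
  shows "girth_at_least 5 G"
  unfolding girth_at_least_def
proof (intro allI impI, elim conjE, rule ccontr)
  fix C assume C: "cycle C" "subgraph C G" "\<not> 5 \<le> card (verts C)"
  have g: "graph C" and ne: "verts C \<noteq> {}" and deg: "\<And>v. v \<in> verts C \<Longrightarrow> card {u. adj C v u} = 2"
    using C(1) degree_adj[of C] unfolding cycle_def connected_graph_def regular_def by auto
  have sub: "adj C u v \<Longrightarrow> adj G u v" for u v using C(2) by (auto simp: adj_def subgraph_def)
  obtain v where v: "v \<in> verts C" using ne by blast
  obtain a b where ab: "{u. adj C v u} = {a, b}" "a \<noteq> b"
    using deg[OF v] unfolding card_2_iff by blast
  have av: "adj C v a" "adj C v b" using ab(1) by blast+
  have other: "\<exists>z. adj C u z \<and> z \<noteq> x" if u: "u \<in> verts C" for u x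
  proof -
    obtain p q where "{w. adj C u w} = {p, q}" "p \<noteq> q"
      using deg[OF u] unfolding card_2_iff by blast
    then show ?thesis by blast
  qed
  have V: "u \<in> verts C \<and> w \<in> verts C \<and> u \<noteq> w" if "adj C u w" for u w using graph_adjD[OF g that] .
  obtain c where c: "adj C a c" "c \<noteq> v" using other V[OF av(1)] by blast
  obtain e where e: "adj C b e" "e \<noteq> v" using other V[OF av(2)] by blast
  have s: "adj C x y \<Longrightarrow> adj C y x" for x y using adj_sym[of C] by blast
  have "c \<noteq> b" using tri[of v a b] sub s av c by blast
  have "e \<noteq> a" using tri[of v a b] sub s av e by blast
  have "c = e"
  proof (rule ccontr)
    assume "c \<noteq> e"
    then have d: "distinct [v, a, b, c, e]"
      using V av c e \<open>c \<noteq> b\<close> \<open>e \<noteq> a\<close> ab(2) by auto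
    have "set [v, a, b, c, e] \<subseteq> verts C" using V av c e v by auto
    then have "card (set [v, a, b, c, e]) \<le> card (verts C)"
      using g by (intro card_mono) (auto simp: graph_def)
    then show False using C(3) distinct_card[OF d] by simp
  qed
  then show False using sq[of v a c b] sub s av c e ab(2) by blast
qed

text \<open>The edges leaving \<open>X\<close> are a set of deleted edges that violates the
  definition: afterwards no walk leaves \<open>X\<close>, while \<open>p\<close> inside and
  \<open>q\<close> outside keep all their edges.\<close>

lemma cut_not_cyclically_connected:
  assumes G: "graph G" and F: "card {e \<in> edges G. e \<inter> X \<noteq> {} \<and> \<not> e \<subseteq> X} < 4"
    and p: "distinct p" "3 \<le> length p" "cycle_edges p \<subseteq> edges G" "set p \<subseteq> X"
    and q: "distinct q" "3 \<le> length q" "cycle_edges q \<subseteq> edges G" "set q \<inter> X = {}"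
  shows "\<not> cyclically_edge_connected 4 G"
proof
  assume cec: "cyclically_edge_connected 4 G"
  let ?F = "{e \<in> edges G. e \<inter> X \<noteq> {} \<and> \<not> e \<subseteq> X}"
  let ?D = "delete_edges G ?F"
  have gD: "graph ?D" using G by (auto simp: graph_def delete_edges_def)
  have sub: "e \<subseteq> set r" if er: "e \<in> cycle_edges r" for e and r :: "'a list"
  proof -
    obtain k where k: "k < length r" and e: "e = {r ! k, r ! (Suc k mod length r)}"
      using er by (auto simp: cycle_edges_iff)
    have "Suc k mod length r < length r" using k by (intro mod_less_divisor) auto
    then show ?thesis unfolding e using k by simp
  qed
  have "cycle_edges p \<subseteq> edges ?D" using p(3,4) sub[of _ p] by (auto simp: delete_edges_def)
  moreover have "cycle_edges q \<subseteq> edges ?D" using q(3,4) sub[of _ q] by (fastforce simp: delete_edges_def)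
  ultimately have s: "subgraph (cyc p) ?D" "subgraph (cyc q) ?D"
    using subgraph_cyc[OF gD] p q by blast+
  have "0 < length p" "0 < length q" using p(2) q(2) by auto
  then have "p ! 0 \<in> set p" "q ! 0 \<in> set q" by (simp_all add: nth_mem)
  moreover have "?F \<subseteq> edges G" by blast
  ultimately have r: "(adj ?D)\<^sup>*\<^sup>* (p ! 0) (q ! 0)"
    using cec[unfolded cyclically_edge_connected_def, rule_format, of ?F "cyc p" "cyc q" "p ! 0" "q ! 0"]
      F s cycle_cyc[OF p(1,2)] cycle_cyc[OF q(1,2)] by (simp add: cyc_def)
  have "v \<in> X" if "(adj ?D)\<^sup>*\<^sup>* u v" "u \<in> X" for u v
    using that by (induction rule: rtranclp_induct) (auto simp: adj_def delete_edges_def)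
  then show False using r \<open>p ! 0 \<in> set p\<close> \<open>q ! 0 \<in> set q\<close> p(4) q(4) by blast
qed

section \<open>Config graphs\<close>

lemma verts_CG [simp]: "verts (CG d cs) = PT_verts d" by (simp add: CG_def)

lemma edges_CG: "edges (CG d cs) = edges (PT d) \<union> outer cs" by (simp add: CG_def)

lemma valid_ends:
  assumes "valid d cs" "(a, v, b) \<in> arcs cs" shows "length a = d" "length b = d"
  using arcs_ends[OF assms(2)] assms(1) unfolding valid_def set_map by blast+

lemma distinct_concat_index:
  assumes "distinct (map fst (concat cs))" "c \<in> set cs" "c' \<in> set cs" "s < length c" "t < length c'"
    "fst (c ! s) = fst (c' ! t)"
  shows "c = c' \<and> s = t"
  using assms
proof (induction cs)
  case (Cons e cs)
  have *: False if "f \<in> set cs" "s < length e" "t < length f" "fst (e ! s) = fst (f ! t)" for f s t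
  proof -
    have "e ! s \<in> set e" "f ! t \<in> set f" using that by auto
    then have "e ! s \<in> set e" "f ! t \<in> set (concat cs)" using that(1) by auto
    then have "fst (e ! s) \<in> fst ` set e" "fst (f ! t) \<in> fst ` set (concat cs)" by blast+
    then show False using Cons.prems(1) that(4) by auto
  qed
  consider "c = e" "c' = e" | "c = e" "c' \<in> set cs" | "c \<in> set cs" "c' = e" | "c \<in> set cs" "c' \<in> set cs"
    using Cons.prems(2,3) by auto
  then show ?case
  proof cases
    case 1
    have "distinct (map fst e)" using Cons.prems(1) by simp
    then have "s = t" using 1 Cons.prems(4-6) nth_eq_iff_index_eq[of "map fst e" s t] by simp
    then show ?thesis using 1 by simp
  next
    case 2 then show ?thesis using *[of c' s t] Cons.prems(4-6) by simp
  next
    case 3 then show ?thesis using *[of c t s] Cons.prems(4-6) by simp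
  next
    case 4 then show ?thesis using Cons.IH Cons.prems by simp
  qed
qed simp

text \<open>A leaf path occurs only once in all the cycles, so an arc is determined by the position
  of its start and equally by that of its end.\<close>

lemma arcs_unique:
  assumes "distinct (map fst (concat cs))" "(a, v, b) \<in> arcs cs"
  shows "(a, v', b') \<in> arcs cs \<Longrightarrow> v' = v \<and> b' = b"
    and "(a', v', b) \<in> arcs cs \<Longrightarrow> v' = v \<and> a' = a"
proof -
  obtain c s where c: "c \<in> set cs" "s < length c" "a = fst (c ! s)" "v = snd (c ! s)"
    "b = fst (c ! (Suc s mod length c))" using assms(2) unfolding arcs_def by blast
  {
    assume "(a, v', b') \<in> arcs cs"
    then obtain c' s' where c': "c' \<in> set cs" "s' < length c'" "a = fst (c' ! s')" "v' = snd (c' ! s')"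
      "b' = fst (c' ! (Suc s' mod length c'))" unfolding arcs_def by blast
    have "c = c' \<and> s = s'" by (rule distinct_concat_index[OF assms(1)]) (use c c' in auto)
    then show "v' = v \<and> b' = b" using c c' by simp
  }
  {
    assume "(a', v', b) \<in> arcs cs"
    then obtain c' s' where c': "c' \<in> set cs" "s' < length c'" "a' = fst (c' ! s')" "v' = snd (c' ! s')"
      "b = fst (c' ! (Suc s' mod length c'))" unfolding arcs_def by blast
    have "c = c' \<and> Suc s mod length c = Suc s' mod length c'"
    proof (rule distinct_concat_index[OF assms(1) c(1) c'(1)])
      show "Suc s mod length c < length c" "Suc s' mod length c' < length c'"
        using c(2) c'(2) by (auto intro!: mod_less_divisor)
    qed (use c c' in simp)
    then have e: "c' = c" "Suc s mod length c = Suc s' mod length c" by auto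
    have "s < length c" "s' < length c" using c c' e by auto
    then have "s = s'" using e(2) by (cases "Suc s = length c"; cases "Suc s' = length c") auto
    then show "v' = v \<and> a' = a" using c c' e by simp
  }
qed

lemma arcs_no_loop:
  assumes "valid d cs" "(a, v, b) \<in> arcs cs" shows "a \<noteq> b"
proof
  assume ab: "a = b"
  obtain c s where c: "c \<in> set cs" "s < length c" "a = fst (c ! s)"
    "b = fst (c ! (Suc s mod length c))" using assms(2) unfolding arcs_def by blast
  have "Suc s mod length c < length c" using c(2) by (intro mod_less_divisor) auto
  then have "s = Suc s mod length c"
    using distinct_concat_index[of cs c c s "Suc s mod length c"] c ab assms(1)
    by (simp add: valid_def)
  moreover have "2 \<le> length c" using c(1) assms(1) by (simp add: valid_def)
  ultimately show False using c(2) by (cases "Suc s = length c") auto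
qed

lemma arcs_out_exists:
  assumes "valid d cs" "length a = d" shows "\<exists>v b. (a, v, b) \<in> arcs cs"
proof -
  have "a \<in> fst ` set (concat cs)" using assms unfolding valid_def set_map by blast
  then obtain c p where "c \<in> set cs" "p \<in> set c" "a = fst p" by auto
  then obtain s where "c \<in> set cs" "s < length c" "a = fst (c ! s)"
    by (auto simp: in_set_conv_nth[of p])
  then show ?thesis unfolding arcs_def by blast
qed

lemma leaf_not_adj:
  assumes "length a = d" "length b = d" shows "\<not> adj (PT d) (Some (k, a)) (Some (l, b))"
proof
  assume "adj (PT d) (Some (k, a)) (Some (l, b))"
  then consider "Some (l, b) = par (Some (k, a))" | "Some (k, a) = par (Some (l, b))"
    unfolding adj_PT by blast
  then show False
  proof cases
    case 1
    then have "level (Some (k, a)) = Suc (level (Some (l, b)))" using level_par[of "Some (k, a)"] by simp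
    then show False using assms by simp
  next
    case 2
    then have "level (Some (l, b)) = Suc (level (Some (k, a)))" using level_par[of "Some (l, b)"] by simp
    then show False using assms by simp
  qed
qed

lemma outer_leaves:
  assumes "valid d cs" "e \<in> outer cs"
  shows "\<exists>k a l b. e = {Some (k, a), Some (l, b)} \<and> length a = d \<and> length b = d \<and> a \<noteq> b"
proof -
  obtain k a v b where e: "e = {Some (k, a), Some (k + v, b)}" "(a, v, b) \<in> arcs cs"
    using assms(2) unfolding outer_def by blast
  then show ?thesis
    using valid_ends[OF assms(1) e(2)] arcs_no_loop[OF assms(1) e(2)] by blast
qed

lemma graph_CG: assumes "valid d cs" shows "graph (CG d cs)"
proof -
  have "e \<subseteq> PT_verts d \<and> card e = 2" if "e \<in> outer cs" for e
    using outer_leaves[OF assms that] by auto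
  then show ?thesis using graph_PT[of d] by (auto simp: graph_def CG_def)
qed

lemma subgraph_PT_CG: "subgraph (PT d) (CG d cs)"
  by (simp add: subgraph_def graph_PT CG_def)

lemma hist_PT_CG: "hist (PT d) (CG d cs)"
  by (auto simp: hist_def spanning_tree_def subgraph_PT_CG tree_PT degree_PT)

lemma outer_rot: "e \<in> outer cs \<Longrightarrow> map_option (map_prod ((+) c) id) ` e \<in> outer cs"
proof -
  assume "e \<in> outer cs"
  then obtain k a v b where e: "e = {Some (k, a), Some (k + v, b)}" "(a, v, b) \<in> arcs cs"
    unfolding outer_def by blast
  then have "map_option (map_prod ((+) c) id) ` e = {Some (c + k, a), Some ((c + k) + v, b)}"
    by (simp add: add.assoc)
  then show ?thesis using e(2) unfolding outer_def by blast
qed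

text \<open>The leaf \<open>a\<close> of the standard labelling is the image of the path vertex with code \<open>(d + 1, a)\<close>.\<close>

lemma rotation_hist_PT:
  assumes "valid d cs" shows "rotation_hist (Suc d) (PT d) (CG d cs)"
proof -
  let ?f = "inv_into (PT_verts d) enc"
  let ?n = "leaf_count (Suc d)"
  have n: "?n = 3 * 2 ^ d" by (simp add: leaf_count_def)
  have f: "graph_iso ?f (std_T (Suc d)) (PT d)" using graph_iso_inv[OF graph_iso_enc[of d]] by simp
  have fe: "?f (enc v) = v" if "v \<in> PT_verts d" for v
    using inv_into_f_f[OF graph_isoD(3)[OF graph_iso_enc[of d]]] that by simp
  have leaf: "\<exists>k bs. length bs = d \<and> idx k bs = a \<and> ?f (Suc d, a) = Some (k, bs) \<and>
      ?f (Suc d, (a + ?n div 3) mod ?n) = Some (Z1 + k, bs)" if an: "a < ?n" for a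
  proof -
    obtain k bs where k: "length bs = d" "idx k bs = a" using idx_surj an n by metis
    have "?f (enc (Some (k, bs))) = Some (k, bs)" by (rule fe) (simp add: k)
    moreover have "?f (enc (Some (k + Z1, bs))) = Some (k + Z1, bs)" by (rule fe) (simp add: k)
    moreover have "idx (k + Z1) bs = (a + ?n div 3) mod ?n" using idx_shift[of k bs] k n by simp
    ultimately show ?thesis using k by (auto simp: add.commute)
  qed
  have "{?f (Suc d, (a + ?n div 3) mod ?n), ?f (Suc d, (b + ?n div 3) mod ?n)} \<in> edges (CG d cs)"
    if ab: "a < ?n" "b < ?n" "{?f (Suc d, a), ?f (Suc d, b)} \<in> edges (CG d cs)" for a b
  proof -
    obtain k as where a: "length as = d" "?f (Suc d, a) = Some (k, as)"
      "?f (Suc d, (a + ?n div 3) mod ?n) = Some (Z1 + k, as)" using leaf[OF ab(1)] by blast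
    obtain l bs where b: "length bs = d" "?f (Suc d, b) = Some (l, bs)"
      "?f (Suc d, (b + ?n div 3) mod ?n) = Some (Z1 + l, bs)" using leaf[OF ab(2)] by blast
    have "\<not> adj (PT d) (Some (k, as)) (Some (l, bs))"
      using leaf_not_adj[OF a(1) b(1)] .
    then have "{Some (k, as), Some (l, bs)} \<in> outer cs"
      using ab(3) a b by (simp add: CG_def adj_def)
    from outer_rot[OF this, of Z1] show ?thesis using a b by (simp add: CG_def)
  qed
  then show ?thesis
    using f hist_PT_CG is_T_PT unfolding rotation_hist_def by blast
qed

text \<open>The chosen Hist is moved to standard position; the graph then is a config graph.\<close>

lemma rotation_snark_config:
  assumes "snark G" "rotation_hist (Suc d) T G"
  shows "\<exists>cs h. valid d cs \<and> graph_iso h (CG d cs) G \<and> img h (PT d) = T"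
proof -
  obtain f where f: "graph_iso f (std_T (Suc d)) T"
    "\<forall>a < leaf_count (Suc d). \<forall>b < leaf_count (Suc d). {f (Suc d, a), f (Suc d, b)} \<in> edges G \<longrightarrow>
       {f (Suc d, (a + leaf_count (Suc d) div 3) mod leaf_count (Suc d)),
        f (Suc d, (b + leaf_count (Suc d) div 3) mod leaf_count (Suc d))} \<in> edges G"
    using assms(2) unfolding rotation_hist_def by blast
  have G: "graph G" "regular 3 G" "girth_at_least 5 G" using assms(1) by (auto simp: snark_def)
  have T: "subgraph T G" "verts T = verts G"
    using assms(2) by (auto simp: rotation_hist_def hist_def spanning_tree_def)
  define h where "h = f \<circ> enc"
  have hT: "graph_iso h (PT d) T" unfolding h_def by (rule graph_iso_trans[OF graph_iso_enc f(1)])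
  have bij: "inj_on h (PT_verts d)" "h ` PT_verts d = verts G"
    using graph_isoD(3,4)[OF hT] T(2) by auto
  \<comment> \<open>The graph is pulled back along the labelling, so that its Hist becomes
    \<open>PT d\<close> itself.\<close>
  define g where "g = inv_into (PT_verts d) h"
  have "inj_on g (verts G)" unfolding g_def by (rule inj_on_inv_into) (simp add: bij)
  then have gG: "graph_iso g G (img g G)" using G(1) by (rule graph_iso_img[rotated])
  define H where "H = img g G"
  have hg: "h (g v) = v" if "v \<in> verts G" for v using that bij(2) by (simp add: g_def f_inv_into_f)
  have gh: "g (h v) = v" if "v \<in> PT_verts d" for v using that bij(1) by (simp add: g_def)
  have vH: "verts H = PT_verts d"
    unfolding H_def img_simps bij(2)[symmetric] image_image using gh by (simp cong: image_cong)
  have hH: "graph_iso h H G"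
  proof -
    have "img h H = img id G"
      unfolding H_def img_comp by (rule img_cong[OF G(1)]) (simp add: hg)
    then show ?thesis
      using graph_isoD(2)[OF gG] bij(1) vH by (simp add: graph_iso_iff_img img_id H_def)
  qed
  have eH: "{h x, h y} \<in> edges G \<longleftrightarrow> {x, y} \<in> edges H" if "x \<in> PT_verts d" "y \<in> PT_verts d" for x y
    using graph_iso_edge_iff[OF hH, of "{x, y}"] that vH by simp
  have PTH: "edges (PT d) \<subseteq> edges H"
  proof
    fix e assume e: "e \<in> edges (PT d)"
    then have "e \<subseteq> PT_verts d" using graph_edgeD[OF graph_PT] by fastforce
    moreover have "h ` e \<in> edges G" using e graph_isoD(4)[OF hT] T(1) by (auto simp: subgraph_def)
    ultimately show "e \<in> edges H" using graph_iso_edge_iff[OF hH, of e] vH by simp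
  qed
  have rot: "{Some (k + Z1, a), Some (l + Z1, b)} \<in> edges H"
    if ab: "length a = d" "length b = d" "{Some (k, a), Some (l, b)} \<in> edges H" for k l a b
  proof -
    have n: "leaf_count (Suc d) = 3 * 2 ^ d" by (simp add: leaf_count_def)
    have lt: "idx k a < leaf_count (Suc d)" "idx l b < leaf_count (Suc d)"
      using idx_less[of k a] idx_less[of l b] ab n by simp_all
    have h: "h (Some (j, bs)) = f (Suc d, idx j bs)" if "length bs = d" for j bs
      using that by (simp add: h_def)
    have sh: "h (Some (j + Z1, bs)) = f (Suc d, (idx j bs + leaf_count (Suc d) div 3) mod leaf_count (Suc d))"
      if "length bs = d" for j bs
      using that idx_shift[of j bs] n by (simp add: h_def)
    have "{h (Some (k, a)), h (Some (l, b))} \<in> edges G" using eH ab by simp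
    then have "{h (Some (k + Z1, a)), h (Some (l + Z1, b))} \<in> edges G"
      using f(2)[rule_format, OF lt] unfolding sh[OF ab(1)] sh[OF ab(2)]
      unfolding h[OF ab(1)] h[OF ab(2)] by (simp only:)
    then show ?thesis using eH ab by simp
  qed
  have snH: "snark H" using graph_iso_snark[OF gG assms(1)] by (simp add: H_def)
  then have gH: "graph H" "regular 3 H" "girth_at_least 5 H" by (auto simp: snark_def)
  \<comment> \<open>An edge between two copies of the same leaf path would be rotated into a
    triangle on all three copies.\<close>
  have noloop: "{Some (k, a), Some (l, a)} \<notin> edges H" if a: "length a = d" for k l a
  proof
    assume e: "{Some (k, a), Some (l, a)} \<in> edges H"
    then have "k \<noteq> l" using graph_edgeD[OF gH(1)] by fastforce
    have e1: "{Some (k + Z1, a), Some (l + Z1, a)} \<in> edges H" using rot[OF a a e] .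
    have e2: "{Some (k + Z1 + Z1, a), Some (l + Z1 + Z1, a)} \<in> edges H" using rot[OF a a e1] .
    have "adj H (Some (Z0, a)) (Some (Z1, a)) \<and> adj H (Some (Z1, a)) (Some (Z2, a)) \<and> adj H (Some (Z2, a)) (Some (Z0, a))"
      using e e1 e2 \<open>k \<noteq> l\<close> unfolding adj_def by (cases k; cases l) (simp_all add: insert_commute)
    then show False using girth_triangle[OF gH(3,1)] by blast
  qed
  obtain cs where "valid d cs" "H = CG d cs"
    using config_exists[OF gH(1) vH gH(2) PTH noloop rot] by blast
  moreover have "img h (PT d) = T" using graph_isoD(4)[OF hT] by simp
  ultimately show ?thesis using hH by blast
qed

section \<open>Lifts of quotient cycles\<close>

fun net :: "('a \<times> z3) list \<Rightarrow> z3" where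
  "net [] = Z0"
| "net ((a, v) # c) = v + net c"

fun lift :: "z3 \<Rightarrow> (bool list \<times> z3) list \<Rightarrow> vertex list" where
  "lift k [] = []"
| "lift k ((a, v) # c) = Some (k, a) # lift (k + v) c"

text \<open>A quotient cycle of length \<open>m\<close> lifts to three cycles of length \<open>m\<close> if its voltages add up to 0
  and to one cycle of length \<open>3m\<close> otherwise.\<close>

definition lifts :: "(bool list \<times> z3) list \<Rightarrow> vertex list list" where
  "lifts c = (if net c = Z0 then [lift Z0 c, lift Z1 c, lift Z2 c] else [lift Z0 (c @ c @ c)])"

lemma z3_add_Z0 [simp]: "k + Z0 = k" "Z0 + k = k"
  using add_0_right[of k] by (simp_all add: zero_z3_def)

lemma length_lift [simp]: "length (lift k c) = length c"
  by (induction k c rule: lift.induct) auto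

lemma net_append: "net (c @ e) = net c + net e"
  by (induction c rule: net.induct) (auto simp: add.assoc)

lemma lift_append: "lift k (c @ e) = lift k c @ lift (k + net c) e"
  by (induction k c rule: lift.induct) (auto simp: add.assoc)

lemma lift_nth: "s < length c \<Longrightarrow> lift k c ! s = Some (k + net (take s c), fst (c ! s))"
proof (induction k c arbitrary: s rule: lift.induct)
  case (2 k a v c)
  then show ?case by (cases s) (auto simp: add.assoc)
qed simp

lemma net_take_Suc: "s < length c \<Longrightarrow> net (take (Suc s) c) = net (take s c) + snd (c ! s)"
  by (simp add: take_Suc_conv_app_nth net_append prod.case_eq_if) (cases "c ! s", simp)

definition arc_step :: "config \<Rightarrow> vertex \<Rightarrow> vertex \<Rightarrow> bool" where
  "arc_step cs x y \<longleftrightarrow> (\<exists>k a v b. x = Some (k, a) \<and> y = Some (k + v, b) \<and> (a, v, b) \<in> arcs cs)"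

text \<open>Total voltage 0 makes the closing arc end in the copy where the lift began. A cycle with
  another total voltage is handled by applying this to its threefold repetition, whose total voltage
  is a multiple of 3.\<close>

lemma lift_closed:
  assumes "net e = Z0" "i < length e"
    and "(fst (e ! i), snd (e ! i), fst (e ! (Suc i mod length e))) \<in> arcs cs"
  shows "arc_step cs (lift k e ! i) (lift k e ! (Suc i mod length e))"
proof -
  have "Suc i mod length e < length e" using assms(2) by (intro mod_less_divisor) auto
  then have n: "lift k e ! (Suc i mod length e) =
      Some (k + net (take (Suc i mod length e) e), fst (e ! (Suc i mod length e)))" by (rule lift_nth)
  have "net (take (Suc i mod length e) e) = net (take i e) + snd (e ! i)"
  proof (cases "Suc i = length e")
    case True
    then have "net e = net (take i e) + snd (e ! i)" using net_take_Suc[OF assms(2)] by simp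
    then show ?thesis using True assms(1) by simp
  next
    case False
    then show ?thesis using assms(2) net_take_Suc by simp
  qed
  then show ?thesis
    unfolding n lift_nth[OF assms(2)] arc_step_def using assms(3) by (auto simp: add.assoc)
qed

lemma lift_set:
  "set (lift k c) = {Some (k + net (take s c), fst (c ! s)) | s. s < length c}"
proof -
  have "set (lift k c) = (\<lambda>s. lift k c ! s) ` {..<length c}" by (auto simp: set_conv_nth)
  also have "\<dots> = (\<lambda>s. Some (k + net (take s c), fst (c ! s))) ` {..<length c}"
    by (rule image_cong) (simp_all add: lift_nth)
  finally show ?thesis by auto
qed

text \<open>A common vertex would occur at the same position of both lifts, because leaf paths are
  not repeated; but at each position the copies differ by the constant \<open>k - l\<close>.\<close>

lemma lift_disjoint:
  assumes "distinct (map fst c)" "k \<noteq> l" shows "set (lift k c) \<inter> set (lift l c) = {}"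
proof (rule ccontr)
  assume "set (lift k c) \<inter> set (lift l c) \<noteq> {}"
  then obtain s t where st: "s < length c" "t < length c" "k + net (take s c) = l + net (take t c)"
    "fst (c ! s) = fst (c ! t)" by (auto simp: lift_set)
  then have "s = t" using nth_eq_iff_index_eq[OF assms(1), of s t] by simp
  then show False using st(3) assms(2) by simp
qed

lemma distinct_lift: "distinct (map fst c) \<Longrightarrow> distinct (lift k c)"
  by (induction k c rule: lift.induct) (force simp: lift_set)+

lemma lift_cover: "(\<Union>k. set (lift k c)) = {Some (j, a) | j a. a \<in> fst ` set c}"
proof (intro equalityI subsetI)
  fix x :: vertex assume "x \<in> {Some (j, a) | j a. a \<in> fst ` set c}"
  then obtain j p where p: "x = Some (j, fst p)" "p \<in> set c" by auto
  then obtain s where s: "x = Some (j, fst (c ! s))" "s < length c" by (auto simp: in_set_conv_nth[of p])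
  have "x \<in> set (lift (j - net (take s c)) c)" using s by (auto simp: lift_set intro!: exI[of _ s])
  then show "x \<in> (\<Union>k. set (lift k c))" by blast
qed (auto simp: lift_set)

lemma z3_multiples: "n \<noteq> Z0 \<Longrightarrow> {Z0, n, n + n} = UNIV" "n \<noteq> Z0 \<Longrightarrow> n + n \<noteq> n" "n + n + n = Z0"
    "n \<noteq> Z0 \<Longrightarrow> n + n \<noteq> Z0"
  by (cases n; auto simp: UNIV_z3)+

lemma lifts_concat:
  assumes "distinct (map fst c)"
  shows "distinct (concat (lifts c))" "set (concat (lifts c)) = {Some (j, a) | j a. a \<in> fst ` set c}"
proof -
  have "distinct (concat (lifts c)) \<and> set (concat (lifts c)) = (\<Union>k. set (lift k c))"
  proof (cases "net c = Z0")
    case True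
    then show ?thesis
      using distinct_lift[OF assms] lift_disjoint[OF assms] by (auto simp: lifts_def UNIV_z3)
  next
    case False
    note n = z3_multiples(1,2,4)[OF False]
    have "(\<Union>k. set (lift k c)) = (\<Union>k\<in>{Z0, net c, net c + net c}. set (lift k c))"
      using n(1) by simp
    then show ?thesis
      using distinct_lift[OF assms] lift_disjoint[OF assms] n(2,3) False
      by (simp add: lifts_def lift_append Int_Un_distrib Int_Un_distrib2 Un_assoc)
  qed
  then show "distinct (concat (lifts c))" "set (concat (lifts c)) = {Some (j, a) | j a. a \<in> fst ` set c}"
    by (simp_all add: lift_cover)
qed

lemma lifts_step:
  assumes "c \<in> set cs" "p \<in> set (lifts c)" "i < length p"
  shows "arc_step cs (p ! i) (p ! (Suc i mod length p))"
proof -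
  have arc: "(fst (c ! i), snd (c ! i), fst (c ! (Suc i mod length c))) \<in> arcs cs" if "i < length c" for i
    using that assms(1) unfolding arcs_def by blast
  show ?thesis
  proof (cases "net c = Z0")
    case True
    then obtain k where p: "p = lift k c" using assms(2) by (auto simp: lifts_def)
    then show ?thesis using lift_closed[OF True _ arc] assms(3) by simp
  next
    case False
    let ?e = "c @ c @ c" and ?m = "length c"
    have p: "p = lift Z0 ?e" using False assms(2) by (simp add: lifts_def)
    have m: "0 < ?m" using p assms(3) by auto
    have nth: "?e ! j = c ! (j mod ?m)" if "j < 3 * ?m" for j
    proof -
      consider "j < ?m" | "?m \<le> j" "j < 2 * ?m" | "2 * ?m \<le> j" by linarith
      then show ?thesis
      proof cases
        case 2
        then have "j mod ?m = j - ?m" using le_mod_geq[of ?m j] by simp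
        then show ?thesis using 2 by (simp add: nth_append)
      next
        case 3
        then have "j mod ?m = j - 2 * ?m"
          using le_mod_geq[of ?m j] le_mod_geq[of ?m "j - ?m"] that by (simp add: mult_2)
        then show ?thesis using 3 that by (simp add: nth_append mult_2)
      qed (simp add: nth_append)
    qed
    have i: "i < 3 * ?m" using p assms(3) by simp
    have len: "length ?e = 3 * ?m" by simp
    have "Suc i mod (3 * ?m) < 3 * ?m" using m by simp
    then have "?e ! (Suc i mod length ?e) = c ! (Suc (i mod ?m) mod ?m)"
      unfolding len using nth by (simp add: mod_mod_cancel mod_Suc_eq)
    then have "(fst (?e ! i), snd (?e ! i), fst (?e ! (Suc i mod length ?e))) \<in> arcs cs"
      using arc[of "i mod ?m"] nth[OF i] m by simp
    moreover have "net ?e = Z0" using z3_multiples(3)[of "net c"] by (simp add: net_append add.assoc)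
    ultimately show ?thesis using lift_closed[of ?e i cs Z0] i unfolding p by simp
  qed
qed

lemma lifts_cycle_edges:
  assumes "c \<in> set cs" "p \<in> set (lifts c)" shows "cycle_edges p \<subseteq> outer cs"
proof
  fix e assume "e \<in> cycle_edges p"
  then obtain i where i: "i < length p" "e = {p ! i, p ! (Suc i mod length p)}" by (auto simp: cycle_edges_iff)
  obtain k a v b where "p ! i = Some (k, a)" "p ! (Suc i mod length p) = Some (k + v, b)" "(a, v, b) \<in> arcs cs"
    using lifts_step[OF assms i(1)] unfolding arc_step_def by blast
  then show "e \<in> outer cs" unfolding i(2) outer_def by auto
qed

lemma valid_cycle:
  assumes "valid d cs" "c \<in> set cs"
  shows "distinct (map fst c)" "fst ` set c \<subseteq> {bs. length bs = d}" "2 \<le> length c"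
    "net c = Z0 \<Longrightarrow> 3 \<le> length c"
proof -
  show "distinct (map fst c)"
    using assms by (auto simp: valid_def map_concat dest!: distinct_concat_iff[THEN iffD1])
  show "fst ` set c \<subseteq> {bs. length bs = d}" using assms by (auto simp: valid_def)
  show 2: "2 \<le> length c" using assms by (simp add: valid_def)
  assume n: "net c = Z0"
  have "length c \<noteq> 2"
  proof
    assume l: "length c = 2"
    then obtain a v b w where "c = [(a, v), (b, w)]"
      by (auto simp: numeral_2_eq_2 length_Suc_conv)
    then show False using assms l n by (auto simp: valid_def)
  qed
  then show "3 \<le> length c" using 2 by linarith
qed

lemma lifts_cycle:
  assumes "valid d cs" "c \<in> set cs" "p \<in> set (lifts c)"
  shows "distinct p" "3 \<le> length p" "cycle_edges p \<subseteq> edges (CG d cs)"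
proof -
  note v = valid_cycle[OF assms(1,2)]
  show "distinct p"
    using lifts_concat(1)[OF v(1)] assms(3) by (auto dest: distinct_concat_iff[THEN iffD1])
  show "3 \<le> length p"
    using v(3,4) assms(3) by (auto simp: lifts_def split: if_splits)
  show "cycle_edges p \<subseteq> edges (CG d cs)"
    using lifts_cycle_edges[OF assms(2,3)] by (auto simp: edges_CG)
qed

definition all_lifts :: "config \<Rightarrow> vertex list list" where
  "all_lifts cs = concat (map lifts cs)"

lemma all_lifts_concat:
  assumes "distinct (map fst (concat cs))"
  shows "distinct (concat (all_lifts cs)) \<and>
    set (concat (all_lifts cs)) = {Some (j, a) | j a. a \<in> fst ` set (concat cs)}"
  using assms
proof (induction cs)
  case (Cons c cs)
  have c: "distinct (map fst c)" and IH: "distinct (concat (all_lifts cs))"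
    "set (concat (all_lifts cs)) = {Some (j, a) | j a. a \<in> fst ` set (concat cs)}"
    using Cons by auto
  have "set (map fst c) \<inter> set (map fst (concat cs)) = {}"
    using Cons.prems by (simp only: concat.simps map_append distinct_append)
  then have "fst ` set c \<inter> fst ` set (concat cs) = {}" by (simp only: set_map)
  then have "set (concat (lifts c)) \<inter> set (concat (all_lifts cs)) = {}"
    unfolding IH(2) lifts_concat(2)[OF c] by blast
  then have dd: "distinct (concat (lifts c) @ concat (all_lifts cs))"
    using IH(1) lifts_concat(1)[OF c] unfolding distinct_append by blast
  have u: "fst ` set (concat (c # cs)) = fst ` set c \<union> fst ` set (concat cs)"
    by (simp only: concat.simps set_append image_Un)
  moreover have "set (concat (lifts c) @ concat (all_lifts cs)) =
      {Some (j, a) | j a. a \<in> fst ` set (concat (c # cs))}"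
    unfolding u set_append IH(2) lifts_concat(2)[OF c] by blast
  ultimately show ?case using dd by (simp add: all_lifts_def)
qed (simp add: all_lifts_def)

text \<open>At a vertex of \<open>cyc p\<close>, any edge to another leaf lies on a listed cycle,
  and by disjointness on \<open>p\<close>. An outer cycle meeting \<open>p\<close> therefore has
  there the same two edges as \<open>cyc p\<close>, and by connectedness the two cycles
  coincide.\<close>

lemma outer_cycles_unique:
  assumes G: "graph G" and L: "distinct (concat L)" "set (concat L) = leaves T"
    and cyc: "\<And>p. p \<in> set L \<Longrightarrow> 3 \<le> length p \<and> cycle_edges p \<subseteq> edges G"
    and cover: "\<And>e. e \<in> edges G \<Longrightarrow> e \<subseteq> leaves T \<Longrightarrow> \<exists>p\<in>set L. e \<in> cycle_edges p"
  shows "{C. outer_cycle G T C} = cyc ` set L" "oc G T = mset (map length L)"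
proof -
  have dp: "distinct p" if "p \<in> set L" for p using L(1) that by (auto dest: distinct_concat_iff[THEN iffD1])
  have disj: "p = q" if "p \<in> set L" "q \<in> set L" "x \<in> set p" "x \<in> set q" for p q x
    using L(1) that unfolding distinct_concat_iff by blast
  have cc: "cycle (cyc p)" "subgraph (cyc p) G" if "p \<in> set L" for p
    using cycle_cyc[OF dp[OF that]] subgraph_cyc[OF G dp[OF that]] cyc[OF that] by auto
  have csub: "e \<subseteq> set p" if "p \<in> set L" "e \<in> cycle_edges p" for e p
    using graph_edgeD[of "cyc p" e] cc(1)[OF that(1)] that(2) by (simp add: cycle_def cyc_def)
  show set_eq: "{C. outer_cycle G T C} = cyc ` set L"
  proof (intro equalityI subsetI)
    fix C assume "C \<in> cyc ` set L"
    then obtain p where p: "p \<in> set L" "C = cyc p" by blast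
    have "set p \<subseteq> leaves T" using L(2) p(1) by auto
    then show "C \<in> {C. outer_cycle G T C}" using p cc[OF p(1)] by (simp add: outer_cycle_def cyc_def)
  next
    fix C assume "C \<in> {C. outer_cycle G T C}"
    then have C: "cycle C" "subgraph C G" "verts C \<subseteq> leaves T" by (auto simp: outer_cycle_def)
    have gC: "graph C" using C(1) by (simp add: cycle_def)
    obtain v where v: "v \<in> verts C" using C(1) by (auto simp: cycle_def connected_graph_def)
    then obtain p where p: "p \<in> set L" "v \<in> set p" using C(3) L(2) by auto
    let ?P = "cyc p"
    have gP: "graph ?P" using cc(1)[OF p(1)] by (simp add: cycle_def)
    have nb: "{u. adj C x u} = {u. adj ?P x u}" if x: "x \<in> verts C" "x \<in> set p" for x
    proof (rule card_subset_eq)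
      have two: "card {u. adj C x u} = 2" "card {u. adj ?P x u} = 2"
        using C(1) cc(1)[OF p(1)] x degree_adj[OF gC, of x] degree_adj[OF gP, of x]
        by (simp_all add: cycle_def regular_def cyc_def)
      then show "card {u. adj C x u} = card {u. adj ?P x u}" by simp
      show "finite {u. adj ?P x u}" using two(2) card.infinite by fastforce
      show "{u. adj C x u} \<subseteq> {u. adj ?P x u}"
      proof
        fix u assume "u \<in> {u. adj C x u}"
        then have u: "adj C x u" by simp
        then have "{x, u} \<in> edges G" "{x, u} \<subseteq> leaves T"
          using C(2,3) graph_adjD[OF gC u] by (auto simp: adj_def subgraph_def)
        then obtain q where q: "q \<in> set L" "{x, u} \<in> cycle_edges q" using cover by blast
        then have "q = p" using csub[OF q] disj[OF q(1) p(1)] x(2) by blast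
        then show "u \<in> {u. adj ?P x u}" using q(2) by (simp add: adj_def cyc_def)
      qed
    qed
    have 1: "y \<in> set p" if "(adj C)\<^sup>*\<^sup>* v y" for y
      using that
    proof (induction rule: rtranclp_induct)
      case (step y z)
      then have "adj ?P y z" using nb[of y] graph_adjD[OF gC step(2)] by blast
      then show ?case using graph_adjD[OF gP] by (auto simp: cyc_def)
    qed (rule p)
    have 2: "y \<in> verts C" if "(adj ?P)\<^sup>*\<^sup>* v y" for y
      using that
    proof (induction rule: rtranclp_induct)
      case (step y z)
      have "y \<in> set p" using graph_adjD[OF gP step(2)] by (simp add: cyc_def)
      then have "adj C y z" using nb[of y] step by blast
      then show ?case using graph_adjD[OF gC] by blast
    qed (rule v)
    have "verts C \<subseteq> set p" using 1 C(1) v by (auto simp: cycle_def connected_graph_def)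
    moreover have "set p \<subseteq> verts C" using 2 cc(1)[OF p(1)] p(2) by (auto simp: cycle_def connected_graph_def cyc_def)
    ultimately have V: "verts C = set p" by blast
    have A: "adj C x u \<longleftrightarrow> adj ?P x u" for x u
      using nb[of x] V graph_adjD[OF gC, of x u] graph_adjD[OF gP, of x u] by (auto simp: cyc_def)
    have E: "e \<in> edges C \<longleftrightarrow> e \<in> edges ?P" for e
    proof
      assume e: "e \<in> edges C"
      then obtain x y where "e = {x, y}" using graph_edgeD[OF gC e] by (auto simp: card_2_iff)
      then show "e \<in> edges ?P" using A[of x y] e by (simp add: adj_def)
    next
      assume e: "e \<in> edges ?P"
      then obtain x y where "e = {x, y}" using graph_edgeD[OF gP e] by (auto simp: card_2_iff)
      then show "e \<in> edges C" using A[of x y] e by (simp add: adj_def)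
    qed
    have "C = ?P" using V E by (intro prod_eqI) (auto simp: cyc_def)
    then show "C \<in> cyc ` set L" using p(1) by blast
  qed
  have ne: "p \<noteq> []" if "p \<in> set L" for p using cyc[OF that] by auto
  have inj: "inj_on cyc (set L)"
  proof (rule inj_onI)
    fix p q assume pq: "p \<in> set L" "q \<in> set L" "cyc p = cyc q"
    then have "set p = set q" by (simp add: cyc_def)
    moreover have "hd p \<in> set p" using ne[OF pq(1)] by simp
    ultimately show "p = q" using disj[OF pq(1,2)] by blast
  qed
  \<comment> \<open>Distinctness of a concatenation does not exclude repeated empty lists, so these
    have to be ruled out separately.\<close>
  have "removeAll [] L = L" using ne by (intro removeAll_id) auto
  then have dL: "distinct L" using L(1) distinct_concat_iff[of L] by simp
  have "oc G T = image_mset (\<lambda>C. card (verts C)) (image_mset cyc (mset_set (set L)))"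
    by (simp add: oc_def set_eq image_mset_mset_set[OF inj])
  also have "\<dots> = image_mset (\<lambda>p. card (set p)) (mset L)"
    by (simp add: image_mset.compositionality comp_def cyc_def mset_set_set[OF dL])
  also have "\<dots> = image_mset length (mset L)"
    by (rule image_mset_cong) (use dp distinct_card in auto)
  finally show "oc G T = mset (map length L)" by simp
qed

lemma oc_CG:
  assumes v: "valid d cs"
  shows "oc (CG d cs) (PT d) = mset (map length (all_lifts cs))"
proof (rule outer_cycles_unique(2)[OF graph_CG[OF v]])
  have dc: "distinct (map fst (concat cs))" "fst ` set (concat cs) = {bs. length bs = d}"
    using v unfolding valid_def set_map by auto
  show "distinct (concat (all_lifts cs))" using all_lifts_concat[OF dc(1)] by simp
  show lv: "set (concat (all_lifts cs)) = leaves (PT d)"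
    using all_lifts_concat[OF dc(1)] unfolding dc(2) leaves_PT by auto
  show "3 \<le> length p \<and> cycle_edges p \<subseteq> edges (CG d cs)" if p: "p \<in> set (all_lifts cs)" for p
  proof -
    obtain c where "c \<in> set cs" "p \<in> set (lifts c)" using p by (auto simp: all_lifts_def)
    then show ?thesis using lifts_cycle(2,3)[OF v] by blast
  qed
  fix e assume e: "e \<in> edges (CG d cs)" "e \<subseteq> leaves (PT d)"
  have "e \<notin> edges (PT d)"
  proof
    assume eT: "e \<in> edges (PT d)"
    obtain x y where xy: "e = {x, y}" using graph_edgeD[OF graph_PT eT] by (auto simp: card_2_iff)
    then have "x \<in> leaves (PT d)" "y \<in> leaves (PT d)" using e(2) by simp_all
    then obtain k a l b where "x = Some (k, a)" "length a = d" "y = Some (l, b)" "length b = d"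
      by (auto simp: leaves_PT)
    then show False using leaf_not_adj[of a d b k l] eT xy by (simp add: adj_def)
  qed
  then have "e \<in> outer cs" using e(1) by (simp add: edges_CG)
  then obtain k a w b where w: "e = {Some (k, a), Some (k + w, b)}" "(a, w, b) \<in> arcs cs"
    unfolding outer_def by blast
  have "Some (k, a) \<in> leaves (PT d)" using e(2) w(1) by simp
  then obtain p where p: "p \<in> set (all_lifts cs)" "Some (k, a) \<in> set p"
    unfolding lv[symmetric] set_concat by blast
  then obtain c where cp: "c \<in> set cs" "p \<in> set (lifts c)" by (auto simp: all_lifts_def)
  obtain i where i: "i < length p" "p ! i = Some (k, a)" using p(2) by (auto simp: in_set_conv_nth)
  \<comment> \<open>Only one arc leaves \<open>a\<close>, so the successor of this leaf on the lift
    is the other end of \<open>e\<close>.\<close>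
  obtain w' b' where "p ! (Suc i mod length p) = Some (k + w', b')" "(a, w', b') \<in> arcs cs"
    using lifts_step[OF cp(1,2) i(1)] i(2) by (auto simp: arc_step_def)
  then have "e = {p ! i, p ! (Suc i mod length p)}"
    using arcs_unique(1)[OF dc(1) w(2)] w(1) i(2) by auto
  then have "e \<in> cycle_edges p" using i(1) by (auto simp: cycle_edges_iff)
  then show "\<exists>p\<in>set (all_lifts cs). e \<in> cycle_edges p" using p(1) by blast
qed

section \<open>Obstructions\<close>

lemma adj_CG_arc: "(a, v, b) \<in> arcs cs \<Longrightarrow> adj (CG d cs) (Some (k, a)) (Some (k + v, b))"
  unfolding adj_def edges_CG outer_def by blast

lemma adj_CG_par: "length a = d \<Longrightarrow> adj (CG d cs) (Some (k, a)) (par (Some (k, a)))"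
  using par_in_PT[of "Some (k, a)" d] by (auto simp: adj_def edges_CG PT_def simp del: par.simps)

text \<open>An edge of voltage 0 stays within its copy of the branch, so two siblings joined by it
  form a triangle with their parent.\<close>

lemma sibling_edge_not_snark:
  assumes "valid d cs" "0 < d" "(a, Z0, b) \<in> arcs cs" "butlast a = butlast b"
  shows "\<not> snark (CG d cs)"
proof
  assume "snark (CG d cs)"
  then have g: "girth_at_least 5 (CG d cs)" by (simp add: snark_def)
  note l = valid_ends[OF assms(1,3)]
  have "a \<noteq> []" "b \<noteq> []" using l assms(2) by auto
  then have p: "par (Some (Z0, a)) = par (Some (Z0, b))" using assms(4) by simp
  show False
    using girth_triangle[OF g graph_CG[OF assms(1)], of "Some (Z0, a)" "Some (Z0, b)" "par (Some (Z0, a))"]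
      adj_CG_arc[OF assms(3), of d Z0] adj_CG_par[OF l(1), of cs Z0] adj_CG_par[OF l(2), of cs Z0]
      p adj_sym[of "CG d cs"] by simp
qed

text \<open>The two voltages cancel, so the path returns to the copy it started from; its ends, its
  middle vertex and the common parent of the ends form a square.\<close>

lemma sibling_path_not_snark:
  assumes "valid d cs" "0 < d" "(a, u, b) \<in> arcs cs" "(b, v, c) \<in> arcs cs" "u + v = Z0" "a \<noteq> c"
    "butlast a = butlast c"
  shows "\<not> snark (CG d cs)"
proof
  assume "snark (CG d cs)"
  then have g: "girth_at_least 5 (CG d cs)" by (simp add: snark_def)
  note l = valid_ends[OF assms(1,3)] valid_ends[OF assms(1,4)]
  have "a \<noteq> []" "c \<noteq> []" using l assms(2) by auto
  then have p: "par (Some (Z0, a)) = par (Some (Z0, c))" using assms(7) by simp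
  have "level (par (Some (Z0, a))) \<noteq> level (Some (u, b))" using level_par[of "Some (Z0, a)"] l by simp
  then have ne: "Some (u, b) \<noteq> par (Some (Z0, a))" by metis
  show False
    using girth_square[OF g graph_CG[OF assms(1)], of "Some (Z0, a)" "Some (u, b)" "Some (Z0, c)" "par (Some (Z0, a))"]
      adj_CG_arc[OF assms(3), of d Z0] adj_CG_arc[OF assms(4), of d u]
      adj_CG_par[OF l(1), of cs Z0] adj_CG_par[OF l(4), of cs Z0]
      p assms(5,6) ne adj_sym[of "CG d cs"] by simp
qed

lemma short_lift_not_snark:
  assumes "valid d cs" "c \<in> set cs" "net c = Z0" "length c < 5"
  shows "\<not> snark (CG d cs)"
proof
  assume "snark (CG d cs)"
  then have g: "girth_at_least 5 (CG d cs)" by (simp add: snark_def)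
  have p: "lift Z0 c \<in> set (lifts c)" using assms(3) by (simp add: lifts_def)
  note l = lifts_cycle[OF assms(1,2) p]
  have "5 \<le> card (verts (cyc (lift Z0 c)))"
    using g cycle_cyc[OF l(1,2)] subgraph_cyc[OF graph_CG[OF assms(1)] l]
    unfolding girth_at_least_def by blast
  then show False using card_length[of "lift Z0 c"] assms(4) by (simp add: cyc_def)
qed

text \<open>The three edges above the copies of an inner vertex \<open>u\<close> form a cut.\<close>

lemma closed_subtree_not_snark:
  assumes v: "valid d cs" and u: "u \<noteq> []"
    and cl: "\<And>c. c \<in> set cs \<Longrightarrow> (\<forall>a\<in>fst ` set c. take (length u) a = u) \<or> (\<forall>a\<in>fst ` set c. take (length u) a \<noteq> u)"
    and c1: "c1 \<in> set cs" "\<forall>a\<in>fst ` set c1. take (length u) a = u"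
    and c2: "c2 \<in> set cs" "\<forall>a\<in>fst ` set c2. take (length u) a \<noteq> u"
  shows "\<not> snark (CG d cs)"
proof
  assume sn: "snark (CG d cs)"
  define X :: "vertex set" where "X = {Some (k, bs) | k bs. take (length u) bs = u}"
  have X: "Some (k, bs) \<in> X \<longleftrightarrow> take (length u) bs = u" for k bs by (simp add: X_def)
  have N: "None \<notin> X" by (simp add: X_def)
  obtain p where p: "p \<in> set (lifts c1)" by (cases "net c1 = Z0") (auto simp: lifts_def)
  obtain q where q: "q \<in> set (lifts c2)" by (cases "net c2 = Z0") (auto simp: lifts_def)
  have in_lift: "set r \<subseteq> {Some (j, a) | j a. a \<in> fst ` set c}" if "c \<in> set cs" "r \<in> set (lifts c)" for r c
    unfolding lifts_concat(2)[OF valid_cycle(1)[OF v that(1)], symmetric] set_concat using that(2) by blast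
  have "set p \<subseteq> X"
  proof
    fix x assume "x \<in> set p"
    then obtain j a where x: "x = Some (j, a)" "a \<in> fst ` set c1" using in_lift[OF c1(1) p] by blast
    then show "x \<in> X" using c1(2)[THEN bspec, OF x(2)] X by simp
  qed
  moreover have "set q \<inter> X = {}"
  proof -
  have "x \<notin> X" if "x \<in> set q" for x
  proof -
    obtain j a where x: "x = Some (j, a)" "a \<in> fst ` set c2" using in_lift[OF c2(1) q] \<open>x \<in> set q\<close> by blast
    then show ?thesis using c2(2)[THEN bspec, OF x(2)] X by simp
  qed
  then show ?thesis by blast
  qed
  moreover have "card {e \<in> edges (CG d cs). e \<inter> X \<noteq> {} \<and> \<not> e \<subseteq> X} < 4"
  proof -
    have "{e \<in> edges (CG d cs). e \<inter> X \<noteq> {} \<and> \<not> e \<subseteq> X} \<subseteq> (\<lambda>k. {Some (k, u), par (Some (k, u))}) ` UNIV"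
    proof
      fix e assume "e \<in> {e \<in> edges (CG d cs). e \<inter> X \<noteq> {} \<and> \<not> e \<subseteq> X}"
      then have e: "e \<in> edges (PT d) \<union> outer cs" "e \<inter> X \<noteq> {}" "\<not> e \<subseteq> X" by (auto simp: edges_CG)
      \<comment> \<open>A tree edge leaves \<open>X\<close> only above a copy of \<open>u\<close>.
        An outer edge never does, because each quotient cycle lies on one side.\<close>
      from e(1) show "e \<in> (\<lambda>k. {Some (k, u), par (Some (k, u))}) ` UNIV"
      proof
        assume "e \<in> edges (PT d)"
        then obtain w where w: "e = {w, par w}" "w \<noteq> None" unfolding PT_def by (auto simp del: par.simps not_None_eq)
        then obtain k bs where kb: "w = Some (k, bs)" by (metis not_None_eq surj_pair)
        show ?thesis
        proof (cases bs rule: rev_cases)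
          case Nil
          then have "e \<inter> X = {}" using w kb X N u by simp
          then show ?thesis using e(2) by simp
        next
          case (snoc cs b)
          then have "par w = Some (k, cs)" using kb by simp
          then have e': "e = {Some (k, cs @ [b]), Some (k, cs)}" using w kb snoc by simp
          have imp: "take (length u) (cs @ [b]) = u" if "take (length u) cs = u"
          proof -
            have "min (length cs) (length u) = length u" using that by (metis length_take)
            then have "length u \<le> length cs" by simp
            then show ?thesis using that by simp
          qed
          have t2: "take (length u) cs \<noteq> u"
          proof
            assume t: "take (length u) cs = u"
            then have "e \<subseteq> X" unfolding e' using imp X by simp
            then show False using e(3) by simp
          qed
          obtain x where "x \<in> e" "x \<in> X" using e(2) by blast
          then have "take (length u) (cs @ [b]) = u" using t2 X unfolding e' by auto
          note t = this t2
          have "length (take (length u) (cs @ [b])) = length u" using t(1) by simp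
          moreover have "\<not> length u \<le> length cs" using t by auto
          ultimately have "length u = Suc (length cs)" by simp
          then have "bs = u" using t(1) snoc by simp
          then show ?thesis using w kb by blast
        qed
      next
        assume "e \<in> outer cs"
        then obtain k a w b where w: "e = {Some (k, a), Some (k + w, b)}" "(a, w, b) \<in> arcs cs"
          unfolding outer_def by blast
        then obtain c s where c: "c \<in> set cs" "s < length c"
          "(a, w, b) = (fst (c ! s), snd (c ! s), fst (c ! (Suc s mod length c)))"
          unfolding arcs_def by blast
        then have "(a, w, b) \<in> arcs [c]" unfolding arcs_def by auto
        then have "a \<in> fst ` set c" "b \<in> fst ` set c" using arcs_ends[of a w b "[c]"] by simp_all
        then show ?thesis using cl[OF c(1)] e(2,3) w(1) X by auto
      qed
    qed
    then have "card {e \<in> edges (CG d cs). e \<inter> X \<noteq> {} \<and> \<not> e \<subseteq> X} \<le> card (UNIV :: z3 set)"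
      by (meson card_image_le card_mono finite_imageI finite_z3 le_trans)
    then show ?thesis by (simp add: card_UNIV_z3)
  qed
  ultimately have "\<not> cyclically_edge_connected 4 (CG d cs)"
    using cut_not_cyclically_connected[OF graph_CG[OF v]] lifts_cycle[OF v c1(1) p] lifts_cycle[OF v c2(1) q]
    by blast
  then show False using sn by (simp add: snark_def)
qed

section \<open>Edge colourings from colourings of the tree\<close>

text \<open>The three colours add up to 0, so for different \<open>x\<close> and \<open>y\<close>
  this is the remaining one.\<close>

definition third :: "z3 \<Rightarrow> z3 \<Rightarrow> z3" where "third x y = - (x + y)"

lemma third_neq: "x \<noteq> y \<Longrightarrow> third x y \<noteq> x" "x \<noteq> y \<Longrightarrow> third x y \<noteq> y"
  by (cases x; cases y; simp add: third_def)+

text \<open>A 3-edge-colouring of a binary tree is determined by the colour \<open>c\<close> of its root edge and a switch at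
  every inner vertex, which tells the child edge with colour \<open>c + 1\<close> from the one with colour \<open>c + 2\<close>.\<close>

datatype sw = Lf | Nd bool sw sw

text \<open>The colour of the edge above the vertex \<open>bs\<close> of a branch whose root edge
  has colour \<open>c\<close>. A bare \<open>Lf\<close> acts as a tree with all switches
  \<open>True\<close>.\<close>

fun scol :: "sw \<Rightarrow> z3 \<Rightarrow> bool list \<Rightarrow> z3" where
  "scol s c [] = c"
| "scol Lf c (x # xs) = scol Lf (if x then c + Z1 else c + Z2) xs"
| "scol (Nd b l r) c (x # xs) = scol (if x then r else l) (if x = b then c + Z1 else c + Z2) xs"

text \<open>Switches only fix differences of colours. This is why one switch tree describes a
  colouring of all three branches that is invariant up to a shift.\<close>

lemma scol_shift: "scol s (c + k) bs = scol s c bs + k"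
proof -
  have e: "(if P then c + k + Z1 else c + k + Z2) = (if P then c + Z1 else c + Z2) + k" for P c
    by (simp add: ac_simps)
  show ?thesis by (induction s c bs rule: scol.induct) (simp_all only: scol.simps e)
qed

lemma z3_shift_neq [simp]: "c + Z1 \<noteq> c" "c + Z2 \<noteq> c" "c + Z1 \<noteq> c + Z2" "c + Z2 \<noteq> c + Z1"
  by (cases c; simp)+

lemma scol_single: "scol s c [x] = (if x = (case s of Lf \<Rightarrow> True | Nd b _ _ \<Rightarrow> b) then c + Z1 else c + Z2)"
  by (cases s) auto

lemma scol_child: "scol s c (bs @ [x]) \<noteq> scol s c bs"
  by (induction s c bs rule: scol.induct) (simp_all add: scol_single zero_z3_def)

lemma scol_siblings: "scol s c (bs @ [False]) \<noteq> scol s c (bs @ [True])"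
  by (induction s c bs rule: scol.induct) (auto simp: scol_single zero_z3_def split: sw.splits)

text \<open>An edge of the tree is represented by its lower end. The root edge of branch
  \<open>k\<close> has colour \<open>k\<close>, which is the general case up to a permutation of the
  colours.\<close>

fun vcol :: "(z3 \<Rightarrow> sw) \<Rightarrow> vertex \<Rightarrow> z3" where
  "vcol S None = Z0"
| "vcol S (Some (k, bs)) = scol (S k) k bs"

lemma vcol_child: "w \<noteq> None \<Longrightarrow> par w \<noteq> None \<Longrightarrow> vcol S w \<noteq> vcol S (par w)"
proof (cases w rule: level.cases)
  case (2 k bs)
  assume "par w \<noteq> None"
  then show ?thesis using 2 scol_child by (cases bs rule: rev_cases) auto
qed simp

lemma vcol_siblings: "w \<noteq> None \<Longrightarrow> w' \<noteq> None \<Longrightarrow> w \<noteq> w' \<Longrightarrow> par w = par w' \<Longrightarrow> vcol S w \<noteq> vcol S w'"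
proof (cases w rule: level.cases; cases w' rule: level.cases)
  fix k bs l cs assume w: "w = Some (k, bs)" "w' = Some (l, cs)" "w \<noteq> w'" "par w = par w'"
  show ?thesis
  proof (cases "bs = [] \<or> cs = []")
    case True
    then show ?thesis using w by (auto split: if_splits)
  next
    case False
    then obtain bs' b cs' c where bc: "bs = bs' @ [b]" "cs = cs' @ [c]" by (metis rev_exhaust)
    then show ?thesis using w scol_siblings[of "S k" k bs'] by (cases b; cases c) auto
  qed
qed simp_all

text \<open>\<open>X k a\<close> is the colour with which the outer cycle enters the leaf. It has to
  avoid the colour of the tree edge, and the cycle then leaves the leaf with the third colour, which
  is the colour entering the next leaf.\<close>

lemma edge_colorable_CG:
  assumes v: "valid d cs"
    and X: "\<And>k a. length a = d \<Longrightarrow> X k a \<noteq> scol (S k) k a"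
    and step: "\<And>k a v b. (a, v, b) \<in> arcs cs \<Longrightarrow> X (k + v) b = third (scol (S k) k a) (X k a)"
  shows "edge_colorable 3 (CG d cs)"
proof -
  \<comment> \<open>Indices for the edges: a tree edge is named by its lower end, an outer edge by
    the leaf from which its arc starts. Colours can so be defined without orienting a set of two
    vertices.\<close>
  define I :: "(vertex + z3 \<times> bool list) set"
    where "I = Inl ` (PT_verts d - {None}) \<union> Inr ` {(k, a). length a = d}"
  have "\<exists>out. \<forall>a. length a = d \<longrightarrow> (a, fst (out a), snd (out a)) \<in> arcs cs"
    using arcs_out_exists[OF v] by (intro choice allI) (metis fst_conv snd_conv)
  then obtain out where out: "\<And>a. length a = d \<Longrightarrow> (a, fst (out a), snd (out a)) \<in> arcs cs" by blast
  define nx where "nx k a = Some (k + fst (out a), snd (out a))" for k :: z3 and a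
  define ed where "ed i = (case i of Inl w \<Rightarrow> {w, par w} | Inr (k, a) \<Rightarrow> {Some (k, a), nx k a})" for i
  define col where "col i = (case i of Inl w \<Rightarrow> vcol S w | Inr (k, a) \<Rightarrow> third (scol (S k) k a) (X k a))" for i
  have edges: "edges (CG d cs) = ed ` I"
  proof (intro equalityI subsetI)
    fix e assume "e \<in> edges (CG d cs)"
    then have "e \<in> edges (PT d) \<or> e \<in> outer cs" by (simp add: edges_CG)
    then show "e \<in> ed ` I"
    proof
      assume "e \<in> edges (PT d)"
      then obtain w where w: "e = {w, par w}" "w \<in> PT_verts d" "w \<noteq> None"
        unfolding PT_def by (auto simp del: par.simps not_None_eq)
      then have "Inl w \<in> I" "e = ed (Inl w)" by (simp_all add: I_def ed_def del: par.simps)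
      then show ?thesis by blast
    next
      assume "e \<in> outer cs"
      then obtain k a v' b where e: "e = {Some (k, a), Some (k + v', b)}" "(a, v', b) \<in> arcs cs"
        unfolding outer_def by blast
      have a: "length a = d" using valid_ends[OF v e(2)] by simp
      have "v' = fst (out a) \<and> b = snd (out a)"
        using arcs_unique(1)[OF _ out[OF a] e(2)] v by (simp add: valid_def)
      then have "e = ed (Inr (k, a))" using e(1) by (simp add: ed_def nx_def)
      moreover have "Inr (k, a) \<in> I" using a by (simp add: I_def)
      ultimately show ?thesis by blast
    qed
  next
    fix e assume "e \<in> ed ` I"
    then obtain i where i: "i \<in> I" "e = ed i" by blast
    show "e \<in> edges (CG d cs)"
    proof (cases i)
      case (Inl w)
      then show ?thesis using i by (auto simp: I_def ed_def edges_CG PT_def simp del: par.simps)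
    next
      case (Inr q)
      then obtain k a where q: "i = Inr (k, a)" "length a = d" using i(1) by (auto simp: I_def)
      have "{Some (k, a), Some (k + fst (out a), snd (out a))} \<in> outer cs"
        using out[OF q(2)] unfolding outer_def by blast
      then have "e \<in> outer cs" using i(2) q(1) by (simp add: ed_def nx_def)
      then show ?thesis by (simp add: edges_CG)
    qed
  qed
  have colnx: "col (Inr (k, a)) = X (k + fst (out a)) (snd (out a))" if "length a = d" for k a
    using step[OF out[OF that], of k] by (simp add: col_def)
  have lnx: "length (snd (out a)) = d" if "length a = d" for a using valid_ends[OF v out[OF that]] by simp
  have LL: "col (Inl w) \<noteq> col (Inl w')" if "w \<noteq> None" "w' \<noteq> None" "w \<noteq> w'" "ed (Inl w) \<inter> ed (Inl w') \<noteq> {}" for w w'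
  proof -
    from that(3,4) consider "par w = w'" | "w = par w'" | "par w = par w'" by (auto simp: ed_def simp del: par.simps)
    then show ?thesis
    proof cases
      case 1 then show ?thesis using vcol_child[of w S] that by (simp add: col_def)
    next
      case 2 then show ?thesis using vcol_child[of w' S] that by (simp add: col_def)
    next
      case 3 then show ?thesis using vcol_siblings[of w w' S] that by (simp add: col_def)
    qed
  qed
  have LR: "col (Inl w) \<noteq> col (Inr (k, a))"
    if w: "w \<in> PT_verts d" "w \<noteq> None" and a: "length a = d" and i: "ed (Inl w) \<inter> ed (Inr (k, a)) \<noteq> {}" for w k a
  proof -
    have "level (par w) \<noteq> Suc d" using level_par[OF w(2)] w(1) by (simp add: PT_verts_level)
    moreover have "level (Some (k, a)) = Suc d" "level (nx k a) = Suc d" using a lnx[OF a] by (simp_all add: nx_def)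
    ultimately have "par w \<noteq> Some (k, a)" "par w \<noteq> nx k a" by metis+
    then consider "w = Some (k, a)" | "w = nx k a" using i by (auto simp: ed_def simp del: par.simps)
    then show ?thesis
    proof cases
      case 1
      then show ?thesis using third_neq(1)[of "scol (S k) k a" "X k a"] X[OF a, of k] by (simp add: col_def)
    next
      case 2
      then have "col (Inl w) = scol (S (k + fst (out a))) (k + fst (out a)) (snd (out a))" by (simp add: col_def nx_def)
      then show ?thesis using X[OF lnx[OF a], of "k + fst (out a)"] colnx[OF a, of k] by simp
    qed
  qed
  have RR1: "col (Inr (k, a)) \<noteq> col (Inr (l, b))" if ab: "length a = d" "length b = d" "Some (k, a) = nx l b" for k a l b
  proof -
    have ka: "k = l + fst (out b)" "a = snd (out b)" using ab(3) by (simp_all add: nx_def)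
    have "col (Inr (l, b)) = X k a" using colnx[OF ab(2), of l] ka by simp
    moreover have "col (Inr (k, a)) \<noteq> X k a"
      using third_neq(2)[of "scol (S k) k a" "X k a"] X[OF ab(1), of k] by (simp add: col_def)
    ultimately show ?thesis by simp
  qed
  have RR: "col (Inr (k, a)) \<noteq> col (Inr (l, b))"
    if ab: "length a = d" "length b = d" "(k, a) \<noteq> (l, b)" "ed (Inr (k, a)) \<inter> ed (Inr (l, b)) \<noteq> {}" for k a l b
  proof -
    from ab(3,4) consider "Some (k, a) = nx l b" | "nx k a = Some (l, b)" | "nx k a = nx l b" by (auto simp: ed_def)
    then show ?thesis
    proof cases
      case 1 then show ?thesis using RR1 ab by blast
    next
      case 2 then show ?thesis using RR1[of b a l k] ab by simp
    next
      case 3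
      then have e: "k + fst (out a) = l + fst (out b)" "snd (out a) = snd (out b)" by (simp_all add: nx_def)
      have dist: "distinct (map fst (concat cs))" using v unfolding valid_def by blast
      have "fst (out b) = fst (out a) \<and> b = a"
        by (rule arcs_unique(2)[OF dist out[OF ab(1)]]) (use out[OF ab(2)] in \<open>simp only: e(2)\<close>)
      then have "b = a" "k = l" using e(1) by (auto simp only: add_right_cancel)
      then show ?thesis using ab(3) by blast
    qed
  qed
  have IL: "Inl w \<in> I \<longleftrightarrow> w \<in> PT_verts d \<and> w \<noteq> None" for w
    unfolding I_def by (simp add: image_iff del: not_None_eq)
  have key: "col i \<noteq> col j" if ij: "i \<in> I" "j \<in> I" "i \<noteq> j" "ed i \<inter> ed j \<noteq> {}" for i j
  proof (cases i)
    case (Inl w)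
    then have w: "w \<in> PT_verts d" "w \<noteq> None" using ij(1) IL[of w] by simp_all
    show ?thesis
    proof (cases j)
      case (Inl w')
      then have "w' \<noteq> None" using ij(2) Inl IL[of w'] by simp
      then show ?thesis using LL[of w w'] w ij Inl \<open>i = Inl w\<close> by simp
    next
      case (Inr q)
      then obtain k a where q: "j = Inr (k, a)" "length a = d" using ij(2) by (auto simp: I_def)
      then show ?thesis using LR[OF w q(2), of k] ij(4) Inl by simp
    qed
  next
    case (Inr q)
    then obtain k a where q: "i = Inr (k, a)" "length a = d" using ij(1) by (auto simp: I_def)
    show ?thesis
    proof (cases j)
      case (Inl w)
      then have w: "w \<in> PT_verts d" "w \<noteq> None" using ij(2) IL[of w] by simp_all
      have "ed (Inl w) \<inter> ed (Inr (k, a)) \<noteq> {}" using ij(4) q(1) Inl by (simp add: Int_commute)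
      then show ?thesis using LR[OF w q(2), of k] q(1) Inl by simp
    next
      case (Inr q')
      then obtain l b where q': "j = Inr (l, b)" "length b = d" using ij(2) by (auto simp: I_def)
      then show ?thesis using RR[OF q(2) q'(2), of k l] ij(3,4) q(1) by simp
    qed
  qed
  \<comment> \<open>Any index of an edge will do, because \<open>ed\<close> recovers the edge and
    different edges thus have different indices.\<close>
  define ind where "ind e = (SOME i. i \<in> I \<and> ed i = e)" for e
  have ind: "ind e \<in> I \<and> ed (ind e) = e" if e: "e \<in> edges (CG d cs)" for e
  proof -
    have "\<exists>i. i \<in> I \<and> ed i = e" using e unfolding edges by blast
    then show ?thesis unfolding ind_def by (rule someI_ex)
  qed
  have nzinj: "nz x \<noteq> nz y" if "x \<noteq> y" for x y using that by (cases x; cases y) simp_all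
  show ?thesis
    unfolding edge_colorable_def
  proof (intro exI[of _ "\<lambda>e. nz (col (ind e))"] conjI ballI impI)
    fix e show "nz (col (ind e)) < 3" by (cases "col (ind e)") simp_all
  next
    fix e f assume ef: "e \<in> edges (CG d cs)" "f \<in> edges (CG d cs)" "e \<noteq> f \<and> e \<inter> f \<noteq> {}"
    have "ind e \<noteq> ind f" using ind[OF ef(1)] ind[OF ef(2)] ef(3) by metis
    then show "nz (col (ind e)) \<noteq> nz (col (ind f))"
      using key[of "ind e" "ind f"] ind[OF ef(1)] ind[OF ef(2)] ef(3) nzinj by simp
  qed
qed

text \<open>\<open>st t c f s k\<close> is the colour entering copy \<open>k\<close> of the leaf
  path at position \<open>s\<close> if \<open>f\<close> gives the colours entering the copies of the
  first one. Unlike \<open>chain\<close> it can be evaluated at any position, as the definition of a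
  global colouring requires.\<close>

fun st :: "(z3 \<Rightarrow> 'a \<Rightarrow> z3) \<Rightarrow> ('a \<times> z3) list \<Rightarrow> (z3 \<Rightarrow> z3) \<Rightarrow> nat \<Rightarrow> z3 \<Rightarrow> z3" where
  "st t c f 0 = f"
| "st t c f (Suc s) = (\<lambda>j. third (t (j - snd (c ! s)) (fst (c ! s))) (st t c f s (j - snd (c ! s))))"

text \<open>The walk along a quotient cycle transports the colours \<open>f k\<close> with which the edges enter the
  three copies of a leaf.\<close>

fun chain :: "(z3 \<Rightarrow> 'a \<Rightarrow> z3) \<Rightarrow> ('a \<times> z3) list \<Rightarrow> (z3 \<Rightarrow> z3) \<Rightarrow> (z3 \<Rightarrow> z3) \<Rightarrow> bool" where
  "chain t [] f g = (f = g)"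
| "chain t ((a, v) # c) f g = ((\<forall>k. f k \<noteq> t k a) \<and> chain t c (\<lambda>j. third (t (j - v) a) (f (j - v))) g)"

lemma st_Cons: "st t ((a, v) # c) f (Suc s) = st t c (\<lambda>j. third (t (j - v) a) (f (j - v))) s"
  by (induction s) (simp_all del: st.simps(2), simp_all)

lemma chain_st:
  "chain t c f g \<Longrightarrow> (\<forall>s<length c. \<forall>k. st t c f s k \<noteq> t k (fst (c ! s))) \<and> st t c f (length c) = g"
proof (induction t c f g rule: chain.induct)
  case (2 t a v c f g)
  then have IH: "\<forall>s<length c. \<forall>k. st t c (\<lambda>j. third (t (j - v) a) (f (j - v))) s k \<noteq> t k (fst (c ! s))"
    "st t c (\<lambda>j. third (t (j - v) a) (f (j - v))) (length c) = g" and f: "\<forall>k. f k \<noteq> t k a" by auto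
  have "st t ((a, v) # c) f s k \<noteq> t k (fst (((a, v) # c) ! s))" if "s < Suc (length c)" for s k
    using that IH(1) f by (cases s) (simp_all add: st_Cons del: st.simps(2))
  then show ?case using IH(2) by (simp add: st_Cons del: st.simps(2))
qed simp

text \<open>A fixed point of the transport around each quotient cycle gives consistent colours of
  all its lifts at once, whatever the total voltage is.\<close>

lemma chains_not_snark:
  assumes v: "valid d cs" and ch: "\<And>c. c \<in> set cs \<Longrightarrow> \<exists>f. chain (\<lambda>k. scol (S k) k) c f f"
  shows "\<not> snark (CG d cs)"
proof -
  let ?t = "\<lambda>k. scol (S k) k"
  have dist: "distinct (map fst (concat cs))" using v by (simp add: valid_def)
  obtain F where F: "\<And>c. c \<in> set cs \<Longrightarrow> chain ?t c (F c) (F c)" using ch by metis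
  define pos where "pos a = (SOME (c, s). c \<in> set cs \<and> s < length c \<and> fst (c ! s) = a)" for a
  have pos: "pos (fst (c ! s)) = (c, s)" if "c \<in> set cs" "s < length c" for c s
    unfolding pos_def
  proof (rule some_equality)
    fix q assume q: "case q of (c', s') \<Rightarrow> c' \<in> set cs \<and> s' < length c' \<and> fst (c' ! s') = fst (c ! s)"
    obtain c' s' where q': "q = (c', s')" by (cases q)
    then show "q = (c, s)" using distinct_concat_index[OF dist, of c' c s' s] q that by simp
  qed (use that in simp)
  define X where "X k a = (case pos a of (c, s) \<Rightarrow> st ?t c (F c) s k)" for k a
  have Xs: "X k (fst (c ! s)) = st ?t c (F c) s k" if "c \<in> set cs" "s < length c" for c s k
    using pos[OF that] by (simp add: X_def)
  have "edge_colorable 3 (CG d cs)"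
  proof (rule edge_colorable_CG[OF v, where X = X and S = S])
    fix k a assume "length (a :: bool list) = d"
    then obtain w b where "(a, w, b) \<in> arcs cs" using arcs_out_exists[OF v] by blast
    then obtain c s where "c \<in> set cs" "s < length c" "a = fst (c ! s)" unfolding arcs_def by blast
    then show "X k a \<noteq> scol (S k) k a" using chain_st[OF F] by (simp add: Xs)
  next
    fix k a w b assume "(a, w, b) \<in> arcs cs"
    then obtain c s where c: "c \<in> set cs" "s < length c" "a = fst (c ! s)" "w = snd (c ! s)"
      "b = fst (c ! (Suc s mod length c))" unfolding arcs_def by blast
    have "Suc s mod length c < length c" using c(2) by (intro mod_less_divisor) auto
    then have "X (k + w) b = st ?t c (F c) (Suc s mod length c) (k + w)" using c by (simp add: Xs)
    also have "\<dots> = st ?t c (F c) (Suc s) (k + w)"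
    proof (cases "Suc s = length c")
      case True
      have "st ?t c (F c) (length c) = F c" using chain_st[OF F[OF c(1)]] by blast
      then show ?thesis using True by (simp del: st.simps(2))
    next
      case False
      then show ?thesis using c(2) by (simp del: st.simps(2))
    qed
    also have "\<dots> = third (scol (S k) k a) (st ?t c (F c) s k)" using c by simp
    also have "st ?t c (F c) s k = X k a" using c by (simp add: Xs)
    finally show "X (k + w) b = third (scol (S k) k a) (X k a)" .
  qed
  then show ?thesis by (simp add: snark_def)
qed

text \<open>Colourings for which the rotation shifts all colours by 1.\<close>

fun eqrun :: "z3 list \<Rightarrow> ('a \<times> z3) list \<Rightarrow> z3 \<Rightarrow> (z3 list \<times> z3) option" where
  "eqrun ts [] x = Some (ts, x)"
| "eqrun [] (p # c) x = None"
| "eqrun (t # ts) ((a, v) # c) x = (if x = t then None else eqrun ts c (third t x - v))"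

text \<open>Since \<open>- 2 = 1\<close> modulo 3, \<open>third\<close> commutes with shifts of both
  arguments. Functions of the form \<open>x + k\<close> are therefore preserved by the transport, so
  the single colour \<open>x\<close> replaces the function, and passing an arc of voltage
  \<open>v\<close> subtracts \<open>v\<close>. The leftover \<open>r\<close> is the list of tree
  colours for the following cycles.\<close>

lemma eqrun_chain:
  "eqrun (map t (map fst c) @ r) c x = Some (r', y) \<Longrightarrow>
    r' = r \<and> chain (\<lambda>k a. t a + k) c (\<lambda>k. x + k) (\<lambda>k. y + k)"
proof (induction c arbitrary: x)
  case (Cons p c)
  obtain a v where p: "p = (a, v)" by (cases p)
  have x: "x \<noteq> t a" and e: "eqrun (map t (map fst c) @ r) c (third (t a) x - v) = Some (r', y)"
    using Cons.prems by (auto simp: p split: if_splits)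
  have sh: "third (t a + (j - v)) (x + (j - v)) = third (t a) x - v + j" for j
    by (cases "t a"; cases x; cases j; cases v; simp add: third_def minus_z3_def zero_z3_def)
  show ?case using Cons.IH[OF e] x by (simp add: p sh)
qed simp

fun accs :: "z3 list \<Rightarrow> ('a \<times> z3) list list \<Rightarrow> bool" where
  "accs ts [] = True"
| "accs ts (c # cs) = (\<exists>x ts'. eqrun ts c x = Some (ts', x) \<and> accs ts' cs)"

lemma accs_not_snark:
  assumes v: "valid d cs" and a: "accs (map (scol s Z0) (map fst (concat cs))) cs"
  shows "\<not> snark (CG d cs)"
proof (rule chains_not_snark[OF v, where S = "\<lambda>_. s"])
  have "scol s k a = scol s Z0 a + k" for k a
    using scol_shift[of s Z0 k a] by (simp only: z3_add_Z0)
  then have t: "(\<lambda>k. scol s k) = (\<lambda>k a. scol s Z0 a + k)" by (intro ext)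
  have "\<forall>c\<in>set cs. \<exists>f. chain (\<lambda>k a. scol s Z0 a + k) c f f"
    using a
  proof (induction cs)
    case (Cons c cs)
    let ?r = "map (scol s Z0) (map fst (concat cs))"
    have "\<exists>x ts'. eqrun (map (scol s Z0) (map fst c) @ ?r) c x = Some (ts', x) \<and> accs ts' cs"
      using Cons.prems by (simp del: map_map eqrun.simps)
    then obtain x ts' where x: "eqrun (map (scol s Z0) (map fst c) @ ?r) c x = Some (ts', x)" "accs ts' cs"
      by (elim exE conjE)
    have c: "ts' = ?r \<and> chain (\<lambda>k a. scol s Z0 a + k) c (\<lambda>k. x + k) (\<lambda>k. x + k)"
      by (rule eqrun_chain[OF x(1)])
    then have "\<forall>c\<in>set cs. \<exists>f. chain (\<lambda>k a. scol s Z0 a + k) c f f" using Cons.IH x(2) by simp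
    then show ?case using c unfolding list.set ball_simps by blast
  qed simp
  then have "\<forall>c\<in>set cs. \<exists>f. chain (\<lambda>k. scol s k) c f f" by (simp only: t[symmetric])
  then show "\<exists>f. chain (\<lambda>k. scol s k) c f f" if "c \<in> set cs" for c using that by (rule bspec)
qed

section \<open>Colourings with independent branches\<close>

fun sel :: "z3 \<times> z3 \<times> z3 \<Rightarrow> z3 \<Rightarrow> z3" where
  "sel (a, b, c) Z0 = a" | "sel (a, b, c) Z1 = b" | "sel (a, b, c) Z2 = c"

fun turn :: "(z3 \<times> z3 \<times> z3) list \<Rightarrow> ('a \<times> z3) list \<Rightarrow> z3 \<Rightarrow> z3 \<Rightarrow> z3 option" where
  "turn ts [] k x = Some x"
| "turn [] (p # c) k x = None"
| "turn (t # ts) ((a, v) # c) k x =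
    (let y = sel t k in if x = y then None else turn ts c (k + v) (third y x))"

text \<open>\<open>turn\<close> follows one lift for one turn, from copy \<open>k\<close> to copy
  \<open>k + net c\<close>. Its results for the three values of \<open>k\<close> together are the
  transport of a function.\<close>

lemma turn_chain:
  assumes "\<And>k a. sel (T a) k = t k a"
  shows "(\<And>k. turn (map T (map fst c)) c k (f k) = Some (g (k + net c))) \<Longrightarrow> chain t c f g"
proof (induction c arbitrary: f)
  case Nil
  then show ?case by auto
next
  case (Cons p c)
  obtain a v where p: "p = (a, v)" by (cases p)
  have 1: "f k \<noteq> t k a" "turn (map T (map fst c)) c (k + v) (third (t k a) (f k)) = Some (g (k + (v + net c)))" for k
    using Cons.prems[of k] by (auto simp: p assms Let_def split: if_splits)
  have "turn (map T (map fst c)) c j (third (t (j - v) a) (f (j - v))) = Some (g (j + net c))" for j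
    using 1(2)[of "j - v"] by (simp add: add.assoc[symmetric])
  from Cons.IH[OF this] 1(1) show ?case by (simp add: p)
qed

text \<open>If the total voltage is 0, each of the three lifts closes after one turn and has its own
  starting colour. Otherwise a single lift has to return to its colour after three turns.\<close>

definition cycle3 :: "(z3 \<times> z3 \<times> z3) list \<Rightarrow> ('a \<times> z3) list \<Rightarrow> bool" where
  "cycle3 ts c = (let n = net c; r = turn ts c;
     loop = (\<lambda>k x. r k x = Some x);
     long = (\<lambda>x. case r Z0 x of None \<Rightarrow> False | Some y \<Rightarrow> (case r n y of None \<Rightarrow> False | Some z \<Rightarrow> r (n + n) z = Some x));
     ex = (\<lambda>P. if P Z0 then True else if P Z1 then True else P Z2)
   in if n = Z0 then (if ex (loop Z0) then if ex (loop Z1) then ex (loop Z2) else False else False) else ex long)"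

lemma cycle3_chain:
  assumes T: "\<And>k a. sel (T a) k = t k a" and c: "cycle3 (map T (map fst c)) c"
  shows "\<exists>f. chain t c f f"
proof -
  define r where "r = turn (map T (map fst c)) c"
  have ex: "(if P Z0 then True else if P Z1 then True else P Z2) \<longleftrightarrow> (\<exists>x. P x)" for P
    by (metis z3.exhaust)
  have "\<exists>f. \<forall>k. r k (f k) = Some (f (k + net c))"
  proof (cases "net c = Z0")
    case True
    then have "(\<exists>x. r Z0 x = Some x) \<and> (\<exists>x. r Z1 x = Some x) \<and> (\<exists>x. r Z2 x = Some x)"
      using c True unfolding cycle3_def Let_def r_def[symmetric] ex by (auto split: if_splits)
    then have "\<forall>k. \<exists>x. r k x = Some x" by (simp only: all_z3)
    then obtain f where "\<forall>k. r k (f k) = Some (f k)" by metis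
    then show ?thesis using True by auto
  next
    case False
    then have "\<exists>x. case r Z0 x of None \<Rightarrow> False | Some y \<Rightarrow> (case r (net c) y of None \<Rightarrow> False | Some z \<Rightarrow> r (net c + net c) z = Some x)"
      using c False unfolding cycle3_def Let_def r_def[symmetric] ex by (auto split: if_splits)
    then obtain x y z where xyz: "r Z0 x = Some y" "r (net c) y = Some z" "r (net c + net c) z = Some x"
      by (auto split: option.splits)
    let ?n = "net c"
    \<comment> \<open>The single lift passes through the copies \<open>Z0\<close>, \<open>n\<close>,
      \<open>n + n\<close> of the first leaf path in this order, entering them with the colours
      \<open>x\<close>, \<open>y\<close>, \<open>z\<close>.\<close>
    define f where "f k = (if k = Z0 then x else if k = ?n then y else z)" for k
    have "r k (f k) = Some (f (k + ?n))" for k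
    proof -
      note m = z3_multiples[of ?n]
      have "k \<in> {Z0, ?n, ?n + ?n}" using m(1)[OF False] by simp
      then consider "k = Z0" | "k = ?n" | "k = ?n + ?n" by auto
      then show ?thesis
        using xyz m(2-4) False by cases (simp_all add: f_def)
    qed
    then show ?thesis by blast
  qed
  then show ?thesis unfolding r_def using turn_chain[of T t c, OF T] by metis
qed

fun all2 :: "('a \<Rightarrow> 'b \<Rightarrow> bool) \<Rightarrow> 'a list \<Rightarrow> 'b list \<Rightarrow> bool" where
  "all2 P [] [] = True"
| "all2 P (x # xs) (y # ys) = (if P x y then all2 P xs ys else False)"
| "all2 P _ _ = False"

definition tri :: "sw \<times> sw \<times> sw \<Rightarrow> bool list \<Rightarrow> z3 \<times> z3 \<times> z3" where
  "tri h a = (case h of (s0, s1, s2) \<Rightarrow> (scol s0 Z0 a, scol s1 Z1 a, scol s2 Z2 a))"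

lemma all2_cycle3_not_snark:
  assumes v: "valid d cs" and a: "all2 cycle3 (map (map (tri h)) (map (map fst) cs)) cs"
  shows "\<not> snark (CG d cs)"
proof -
  obtain s0 s1 s2 where h: "h = (s0, s1, s2)" by (cases h)
  define S where "S k = (case k of Z0 \<Rightarrow> s0 | Z1 \<Rightarrow> s1 | Z2 \<Rightarrow> s2)" for k
  have T: "sel (tri h a) k = scol (S k) k a" for k a by (cases k) (simp_all add: h tri_def S_def)
  have "\<forall>c\<in>set cs. \<exists>f. chain (\<lambda>k. scol (S k) k) c f f"
    using a
  proof (induction cs)
    case (Cons c cs)
    then have "cycle3 (map (tri h) (map fst c)) c" "all2 cycle3 (map (map (tri h)) (map (map fst) cs)) cs"
      by (simp_all split: if_splits)
    then show ?case using Cons.IH cycle3_chain[of "tri h" "\<lambda>k. scol (S k) k" c, OF T] by simp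
  qed simp
  then show ?thesis using chains_not_snark[OF v, of S] by blast
qed

section \<open>Search for equivariant colourings over all voltages of a shape\<close>

lemma third_code [code]:
  "third Z0 Z0 = Z0" "third Z0 Z1 = Z2" "third Z0 Z2 = Z1"
  "third Z1 Z0 = Z2" "third Z1 Z1 = Z1" "third Z1 Z2 = Z0"
  "third Z2 Z0 = Z1" "third Z2 Z1 = Z0" "third Z2 Z2 = Z2"
  by (simp_all add: third_def)

lemma minus_z3_code [code]:
  "Z0 - Z0 = Z0" "Z0 - Z1 = Z2" "Z0 - Z2 = Z1"
  "Z1 - Z0 = Z1" "Z1 - Z1 = Z0" "Z1 - Z2 = Z2"
  "Z2 - Z0 = Z2" "Z2 - Z1 = Z1" "Z2 - Z2 = Z0"
  by (simp_all add: minus_z3_def zero_z3_def)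

section \<open>Short cycles recognised while a quotient cycle is traced\<close>

definition sib :: "bool list \<Rightarrow> bool list \<Rightarrow> bool" where
  "sib a b \<longleftrightarrow> (if butlast a = butlast b then a \<noteq> b else False)"

definition shortc :: "(bool list \<times> z3) list \<Rightarrow> bool" where
  "shortc c \<longleftrightarrow> (\<exists>a b. (a, Z0, b) \<in> arcs [c] \<and> sib a b) \<or>
     (\<exists>a u b v e. (a, u, b) \<in> arcs [c] \<and> (b, v, e) \<in> arcs [c] \<and> u + v = Z0 \<and> sib a e) \<or>
     (net c = Z0 \<and> length c < 5)"

lemma arcs_single_sub: "c \<in> set cs \<Longrightarrow> x \<in> arcs [c] \<Longrightarrow> x \<in> arcs cs"
  unfolding arcs_def by auto

lemma shortc_not_snark:
  assumes "valid d cs" "0 < d" "c \<in> set cs" "shortc c"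
  shows "\<not> snark (CG d cs)"
  using assms(4) unfolding shortc_def
proof (elim disjE exE conjE)
  fix a b assume "(a, Z0, b) \<in> arcs [c]" "sib a b"
  then show ?thesis
    using sibling_edge_not_snark[OF assms(1,2) arcs_single_sub[OF assms(3)]] by (simp add: sib_def split: if_splits)
next
  fix a u b v e assume "(a, u, b) \<in> arcs [c]" "(b, v, e) \<in> arcs [c]" "u + v = Z0" "sib a e"
  then show ?thesis
    using sibling_path_not_snark[OF assms(1,2) arcs_single_sub[OF assms(3)] arcs_single_sub[OF assms(3)]]
    by (simp add: sib_def split: if_splits)
next
  assume "net c = Z0" "length c < 5"
  then show ?thesis by (rule short_lift_not_snark[OF assms(1,3)])
qed

lemma arcs_mid: "(a, v, b) \<in> arcs [xs @ (a, v) # (b, w) # ys]"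
  unfolding arcs_def by (intro CollectI exI[of _ "xs @ (a, v) # (b, w) # ys"] exI[of _ "length xs"])
    (simp add: nth_append)

lemma arcs_last: "(a, v, fst (hd (xs @ [(a, v)]))) \<in> arcs [xs @ [(a, v)]]"
  unfolding arcs_def by (intro CollectI exI[of _ "xs @ [(a, v)]"] exI[of _ "length xs"])
    (simp add: nth_append hd_conv_nth)

text \<open>The traced part \<open>cur\<close> is stored in reverse, so that its head carries the
  preceding arc. Only triangles and squares that use the new arc from \<open>a\<close> to
  \<open>b\<close> have to be looked for.\<close>

fun stepbad :: "(bool list \<times> z3) list \<Rightarrow> bool list \<Rightarrow> z3 \<Rightarrow> bool list \<Rightarrow> bool" where
  "stepbad [] a v b = (if v = Z0 then sib a b else False)"
| "stepbad ((e, u) # cur) a v b =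
    (if (if v = Z0 then sib a b else False) then True else if u + v = Z0 then sib e b else False)"

lemma stepbad: "stepbad cur a v b \<Longrightarrow> shortc (rev cur @ (a, v) # (b, w) # r)"
proof -
  assume *: "stepbad cur a v b"
  have 1: "(a, v, b) \<in> arcs [rev cur @ (a, v) # (b, w) # r]" by (rule arcs_mid)
  show ?thesis
  proof (cases "v = Z0 \<and> sib a b")
    case True
    then show ?thesis using 1 unfolding shortc_def by blast
  next
    case False
    then obtain e u cur' where c: "cur = (e, u) # cur'" "u + v = Z0" "sib e b"
      using * by (cases cur) (auto split: if_splits)
    have "(e, u, a) \<in> arcs [rev cur' @ (e, u) # (a, v) # ((b, w) # r)]" by (rule arcs_mid)
    then have "(e, u, a) \<in> arcs [rev cur @ (a, v) # (b, w) # r]" by (simp add: c(1))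
    then show ?thesis using 1 c(2,3) unfolding shortc_def by blast
  qed
qed

text \<open>What is left at the closing point: the arc from the last leaf \<open>l\<close> to the
  first leaf \<open>h\<close>, the two paths of length 2 containing it, and the length of the lift.
  The four applications of \<open>tl\<close> test for length at most 4 without arithmetic on
  numerals.\<close>

fun closebad :: "(bool list \<times> z3) list \<Rightarrow> bool" where
  "closebad [] = False"
| "closebad ((l, v) # cur) = (case rev ((l, v) # cur) of [] \<Rightarrow> False | (h, w) # c \<Rightarrow>
    if (if v = Z0 then sib l h else False) then True
    else if (case cur of [] \<Rightarrow> False | (q, u) # _ \<Rightarrow> if u + v = Z0 then sib q h else False) then True
    else if (case c of [] \<Rightarrow> False | (e, _) # _ \<Rightarrow> if v + w = Z0 then sib l e else False) then True
    else if net ((h, w) # c) = Z0 then tl (tl (tl (tl ((h, w) # c)))) = [] else False)"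

lemma closebad: "closebad c \<Longrightarrow> shortc (rev c)"
proof (cases c)
  case (Cons p cur)
  obtain l v where p: "p = (l, v)" by (cases p)
  obtain h w c' where r: "rev cur @ [(l, v)] = (h, w) # c'" by (cases "rev cur @ [(l, v)]") auto
  assume "closebad c"
  then have *: "closebad ((l, v) # cur)" using Cons p by simp
  have rc: "rev c = rev cur @ [(l, v)]" using Cons p by simp
  have la: "(l, v, h) \<in> arcs [rev c]"
    unfolding rc using arcs_last[of l v "rev cur"] r by simp
  consider "v = Z0" "sib l h" | q u cur' where "cur = (q, u) # cur'" "u + v = Z0" "sib q h"
    | e x c'' where "c' = (e, x) # c''" "v + w = Z0" "sib l e"
    | "net ((h, w) # c') = Z0" "tl (tl (tl (tl ((h, w) # c')))) = []"
    using * r by (auto split: if_splits list.splits)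
  then show ?thesis
  proof cases
    case 1 then show ?thesis using la unfolding shortc_def by blast
  next
    case 2
    have "(q, u, l) \<in> arcs [rev cur' @ (q, u) # (l, v) # []]" by (rule arcs_mid)
    then have "(q, u, l) \<in> arcs [rev c]" by (simp add: rc 2)
    then show ?thesis using la 2 unfolding shortc_def by blast
  next
    case 3
    have "(h, w, e) \<in> arcs [[] @ (h, w) # (e, x) # c'']" by (rule arcs_mid)
    then have "(h, w, e) \<in> arcs [rev c]" using r by (simp add: rc 3)
    then show ?thesis using la 3 unfolding shortc_def by blast
  next
    case 4
    have "length c' < 4" using 4(2) by (auto simp: neq_Nil_conv tl_def split: list.splits)
    then show ?thesis using 4(1) unfolding shortc_def rc r by simp
  qed
qed simp

section \<open>Partial colourings carried through the search\<close>

fun tpr :: "z3 \<Rightarrow> (z3 \<times> z3) list \<Rightarrow> (z3 \<times> z3) list" where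
  "tpr t [] = []"
| "tpr t ((x0, x) # p) = (if x = t then tpr t p else (x0, third t x) # tpr t p)"

text \<open>The colour leaving a leaf does not depend on the voltage of the next arc. This half of a
  step is hence computed once and shared by the voltages to be tried; \<open>adv\<close> does the
  other half.\<close>

fun turnL :: "(z3 list \<times> (z3 \<times> z3) list) list \<Rightarrow> (z3 list \<times> (z3 \<times> z3) list) list" where
  "turnL [] = []"
| "turnL (([], p) # L) = turnL L"
| "turnL ((t # ts, p) # L) = (case tpr t p of [] \<Rightarrow> turnL L | y # ys \<Rightarrow> (ts, y # ys) # turnL L)"

fun advp :: "z3 \<Rightarrow> (z3 \<times> z3) list \<Rightarrow> (z3 \<times> z3) list" where
  "advp v [] = []"
| "advp v ((x0, y) # p) = (x0, y - v) # advp v p"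

fun adv :: "z3 \<Rightarrow> (z3 list \<times> (z3 \<times> z3) list) list \<Rightarrow> (z3 list \<times> (z3 \<times> z3) list) list" where
  "adv v [] = []"
| "adv v ((ts, p) # L) = (ts, advp v p) # adv v L"

fun loops :: "z3 \<Rightarrow> (z3 \<times> z3) list \<Rightarrow> bool" where
  "loops v [] = False"
| "loops v ((x0, y) # p) = (if y - v = x0 then True else loops v p)"

definition diag :: "(z3 \<times> z3) list" where "diag = [(Z0, Z0), (Z1, Z1), (Z2, Z2)]"

text \<open>For a closed cycle it only matters that some starting colour returned. The next cycle is
  independent of it apart from the tree colouring, so all three starting colours are
  reinstated.\<close>

fun closeL :: "z3 \<Rightarrow> (z3 list \<times> (z3 \<times> z3) list) list \<Rightarrow> (z3 list \<times> (z3 \<times> z3) list) list" where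
  "closeL v [] = []"
| "closeL v ((ts, p) # L) = (if loops v p then (ts, diag) # closeL v L else closeL v L)"

text \<open>The last two leaves at once: from colour \<open>x\<close> through tree colour
  \<open>t\<close>, along voltage \<open>v\<close>, through tree colour \<open>u\<close>, along
  voltage \<open>w\<close>, and back to the starting colour \<open>x0\<close>.\<close>

fun hitp :: "z3 \<Rightarrow> z3 \<Rightarrow> (z3 \<times> z3) list \<Rightarrow> z3 \<Rightarrow> z3 \<Rightarrow> bool" where
  "hitp t u [] v w = False"
| "hitp t u ((x0, x) # p) v w = (if x = t then hitp t u p v w else
     if third t x - v = u then hitp t u p v w else
     if third u (third t x - v) - w = x0 then True else hitp t u p v w)"

fun hite :: "z3 list \<Rightarrow> (z3 \<times> z3) list \<Rightarrow> z3 \<Rightarrow> z3 \<Rightarrow> bool" where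
  "hite (t # u # ts) p v w = hitp t u p v w"
| "hite _ p v w = False"

fun hitL :: "(z3 list \<times> (z3 \<times> z3) list) list \<Rightarrow> z3 \<Rightarrow> z3 \<Rightarrow> bool" where
  "hitL [] v w = False"
| "hitL ((ts, p) # L) v w = (if hite ts p v w then True else hitL L v w)"

fun last3 :: "bool \<Rightarrow> (bool list \<times> z3) list \<Rightarrow> config \<Rightarrow> config list" where
  "last3 True c acc = []"
| "last3 False c acc = [rev (rev c # acc)]"

fun last2 :: "bool \<Rightarrow> (z3 list \<times> (z3 \<times> z3) list) list \<Rightarrow> (bool list \<times> z3) list \<Rightarrow> config \<Rightarrow> z3 \<Rightarrow> z3 \<Rightarrow> config list" where
  "last2 True L c acc v w = []"
| "last2 False L c acc v w = last3 (hitL L v w) c acc"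

fun last1 :: "bool \<Rightarrow> bool \<Rightarrow> (z3 list \<times> (z3 \<times> z3) list) list \<Rightarrow> (bool list \<times> z3) list \<Rightarrow> bool list \<Rightarrow> config \<Rightarrow> z3 \<Rightarrow> config list" where
  "last1 True fl L cur b acc v = []"
| "last1 False True L cur b acc v = last2 (closebad ((b, Z0) # cur)) L ((b, Z0) # cur) acc v Z0 @
     last2 (closebad ((b, Z1) # cur)) L ((b, Z1) # cur) acc v Z1 @ last2 (closebad ((b, Z2) # cur)) L ((b, Z2) # cur) acc v Z2"
| "last1 False False L cur b acc v = last2 (closebad ((b, Z0) # cur)) L ((b, Z0) # cur) acc v Z0 @
     last2 (closebad ((b, Z1) # cur)) L ((b, Z1) # cur) acc v Z1"

fun last0 :: "bool \<Rightarrow> (z3 list \<times> (z3 \<times> z3) list) list \<Rightarrow> (bool list \<times> z3) list \<Rightarrow> bool list \<Rightarrow> bool list \<Rightarrow> config \<Rightarrow> config list" where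
  "last0 True L cur a b acc = last1 (stepbad cur a Z0 b) True L ((a, Z0) # cur) b acc Z0 @
     last1 (stepbad cur a Z1 b) True L ((a, Z1) # cur) b acc Z1 @ last1 (stepbad cur a Z2 b) True L ((a, Z2) # cur) b acc Z2"
| "last0 False L cur a b acc = last1 (stepbad cur a Z0 b) False L ((a, Z0) # cur) b acc Z0 @
     last1 (stepbad cur a Z1 b) True L ((a, Z1) # cur) b acc Z1"

text \<open>The search lists the configurations of a given shape that it cannot exclude.
  It maintains the list \<open>L\<close> of all tree colourings for which the closed quotient cycles admit a
  colour and for which the current walk can still be coloured; each comes with the pairs of start and current
  colour of the walk. The flag \<open>fl\<close> records whether a nonzero voltage has occurred: by the symmetry
  \<open>v \<mapsto> - v\<close> the first one may be taken to be 1. The last two voltages are treated separately, since it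
  then is faster to look for one colouring per pair of voltages than to maintain the list.\<close>

fun srch :: "(z3 list \<times> (z3 \<times> z3) list) list \<Rightarrow> bool \<Rightarrow> (bool list \<times> z3) list \<Rightarrow>
      bool list list \<Rightarrow> bool list list list \<Rightarrow> config \<Rightarrow> config list"
  and sstep :: "(z3 list \<times> (z3 \<times> z3) list) list \<Rightarrow> bool \<Rightarrow> (bool list \<times> z3) list \<Rightarrow>
      bool list list \<Rightarrow> bool list list list \<Rightarrow> config \<Rightarrow> bool list \<Rightarrow> z3 \<Rightarrow> config list" where
  "srch L fl cur [] [] acc = (if L = [] then [rev acc] else [])"
| "srch L fl cur [] (c # cs) acc = srch L fl [] c cs acc"
| "srch L fl cur (a # as) cs acc = (if length as = 1 \<and> cs = [] then last0 fl L cur a (hd as) acc else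
     sstep (turnL L) fl cur as cs acc a Z0 @ sstep (turnL L) True cur as cs acc a Z1 @
     (if fl then sstep (turnL L) True cur as cs acc a Z2 else []))"
| "sstep M fl cur [] cs acc a v = (if closebad ((a, v) # cur) then [] else
     srch (closeL v M) fl [] [] cs (rev ((a, v) # cur) # acc))"
| "sstep M fl cur (b # as) cs acc a v =
     (if stepbad cur a v b then [] else srch (adv v M) fl ((a, v) # cur) (b # as) cs acc)"

fun nzok :: "bool \<Rightarrow> z3 list \<Rightarrow> bool" where
  "nzok True vs = True"
| "nzok False [] = True"
| "nzok False (v # vs) = (case v of Z0 \<Rightarrow> nzok False vs | Z1 \<Rightarrow> True | Z2 \<Rightarrow> False)"

lemma nzok_Z0: "nzok fl (Z0 # vs) = nzok fl vs"
  by (cases fl) simp_all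

text \<open>The entry \<open>e\<close> of the search list extends to a colouring of the remainder
  \<open>r\<close> of the current cycle and of all later cycles. \<open>ac2\<close> is the same
  condition in the middle of a step, when the colour has been turned but the voltage
  \<open>v\<close> is still to be applied.\<close>

definition ac :: "z3 list \<times> (z3 \<times> z3) list \<Rightarrow> (bool list \<times> z3) list \<Rightarrow> config \<Rightarrow> bool" where
  "ac e r rest \<longleftrightarrow> (\<exists>x0 x ts'. (x0, x) \<in> set (snd e) \<and> eqrun (fst e) r x = Some (ts', x0) \<and> accs ts' rest)"

definition ac2 :: "z3 list \<times> (z3 \<times> z3) list \<Rightarrow> z3 \<Rightarrow> (bool list \<times> z3) list \<Rightarrow> config \<Rightarrow> bool" where
  "ac2 e v r rest \<longleftrightarrow> (\<exists>x0 y ts'. (x0, y) \<in> set (snd e) \<and> eqrun (fst e) r (y - v) = Some (ts', x0) \<and> accs ts' rest)"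

lemma tpr_set: "(x0, y) \<in> set (tpr t p) \<longleftrightarrow> (\<exists>x. (x0, x) \<in> set p \<and> x \<noteq> t \<and> y = third t x)"
  by (induction t p rule: tpr.induct) auto

lemma turnL_set: "(ts, q) \<in> set (turnL L) \<Longrightarrow> \<exists>t p. (t # ts, p) \<in> set L \<and> q = tpr t p"
proof (induction L rule: turnL.induct)
  case (3 t ts' p L)
  show ?case
  proof (cases "(ts, q) \<in> set (turnL L)")
    case True
    then obtain t' p' where "(t' # ts, p') \<in> set L" "q = tpr t' p'" using 3 by (cases "tpr t p") auto
    then show ?thesis by auto
  next
    case False
    then have "ts = ts'" "q = tpr t p" using 3(3) by (cases "tpr t p"; auto)+
    then show ?thesis by auto
  qed
qed auto

lemma turnL_ac: "e \<in> set (turnL L) \<Longrightarrow> ac2 e v r rest \<Longrightarrow> \<exists>e\<in>set L. ac e ((a, v) # r) rest"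
proof -
  assume e: "e \<in> set (turnL L)" "ac2 e v r rest"
  obtain ts q where tq: "e = (ts, q)" by (cases e)
  obtain x0 y ts' where y: "(x0, y) \<in> set q" "eqrun ts r (y - v) = Some (ts', x0)" "accs ts' rest"
    using e(2) by (auto simp: ac2_def tq)
  obtain t p where p: "(t # ts, p) \<in> set L" "q = tpr t p" using turnL_set e(1) tq by blast
  obtain x where x: "(x0, x) \<in> set p" "x \<noteq> t" "y = third t x" using y(1) p(2) tpr_set by blast
  have "eqrun (t # ts) ((a, v) # r) x = Some (ts', x0)" using x y(2) by simp
  then have "ac (t # ts, p) ((a, v) # r) rest" using x(1) y(3) unfolding ac_def fst_conv snd_conv by blast
  then show ?thesis using p(1) by blast
qed

lemma advp_set: "(x0, x) \<in> set (advp v p) \<longleftrightarrow> (\<exists>y. (x0, y) \<in> set p \<and> x = y - v)"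
  by (induction v p rule: advp.induct) auto

lemma adv_set: "(ts, q) \<in> set (adv v M) \<longleftrightarrow> (\<exists>p. (ts, p) \<in> set M \<and> q = advp v p)"
  by (induction v M rule: adv.induct) auto

lemma adv_ac: "e \<in> set (adv v M) \<Longrightarrow> ac e r rest \<Longrightarrow> \<exists>e\<in>set M. ac2 e v r rest"
proof -
  assume e: "e \<in> set (adv v M)" "ac e r rest"
  obtain ts q where tq: "e = (ts, q)" by (cases e)
  obtain p where p: "(ts, p) \<in> set M" "q = advp v p" using e(1) tq adv_set by blast
  have "ac2 (ts, p) v r rest" using e(2) unfolding ac_def ac2_def tq p(2) fst_conv snd_conv advp_set by blast
  then show ?thesis using p(1) by blast
qed

lemma loops_set: "loops v p \<Longrightarrow> \<exists>x0 y. (x0, y) \<in> set p \<and> y - v = x0"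
  by (induction v p rule: loops.induct) (auto split: if_splits)

lemma closeL_set: "(ts, q) \<in> set (closeL v M) \<Longrightarrow> q = diag \<and> (\<exists>p. (ts, p) \<in> set M \<and> loops v p)"
  by (induction v M rule: closeL.induct) (auto split: if_splits)

lemma closeL_ac: "e \<in> set (closeL v M) \<Longrightarrow> accs (fst e) rest \<Longrightarrow> \<exists>e\<in>set M. ac2 e v [] rest"
proof -
  assume e: "e \<in> set (closeL v M)" "accs (fst e) rest"
  obtain ts q where tq: "e = (ts, q)" by (cases e)
  obtain p where p: "(ts, p) \<in> set M" "loops v p" using e(1) tq closeL_set by blast
  obtain x0 y where "(x0, y) \<in> set p" "y - v = x0" using loops_set[OF p(2)] by blast
  then have "ac2 (ts, p) v [] rest" using e(2) unfolding ac2_def tq fst_conv snd_conv eqrun.simps by blast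
  then show ?thesis using p(1) by blast
qed

lemma diag_ac: "ac (ts, diag) c rest \<Longrightarrow> accs ts (c # rest)"
  unfolding ac_def diag_def by auto

text \<open>The configuration which a state of the search stands for once \<open>r\<close> completes
  the current cycle and \<open>rest\<close> supplies the later ones; finished cycles and the current
  one are stored in reverse.\<close>

definition full :: "bool list list \<Rightarrow> config \<Rightarrow> (bool list \<times> z3) list \<Rightarrow> (bool list \<times> z3) list \<Rightarrow> config \<Rightarrow> config" where
  "full as acc cur r rest = rev acc @ (if as = [] then rest else (rev cur @ r) # rest)"

lemma hitp: "hitp t u p v w \<Longrightarrow> \<exists>x0 x. (x0, x) \<in> set p \<and> eqrun (t # u # ts) [(a, v), (b, w)] x = Some (ts, x0)"
proof (induction t u p v w rule: hitp.induct)
  case (2 t u x0 x p v w)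
  show ?case
  proof (cases "x \<noteq> t \<and> third t x - v \<noteq> u \<and> third u (third t x - v) - w = x0")
    case True
    then show ?thesis by (intro exI[of _ x0] exI[of _ x]) simp
  next
    case False
    then have "hitp t u p v w" using 2(4) by (simp split: if_splits)
    then have "\<exists>x0 x. (x0, x) \<in> set p \<and> eqrun (t # u # ts) [(a, v), (b, w)] x = Some (ts, x0)"
      using 2(1-3) False by blast
    then show ?thesis by (meson list.set_intros(2))
  qed
qed simp

lemma hitL: "hitL L v w \<Longrightarrow> \<exists>e\<in>set L. ac e [(a, v), (b, w)] []"
proof (induction L)
  case (Cons e L)
  obtain ts p where e: "e = (ts, p)" by (cases e)
  show ?case
  proof (cases "hite ts p v w")
    case True
    obtain t u ts' where ts: "ts = t # u # ts'" "hitp t u p v w" using True by (cases "(ts, p, v, w)" rule: hite.cases) auto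
    then have "ac e [(a, v), (b, w)] []" using hitp[OF ts(2), of ts' a b] unfolding ac_def e fst_conv snd_conv accs.simps by blast
    then show ?thesis by simp
  next
    case False
    then have "\<exists>e\<in>set L. ac e [(a, v), (b, w)] []" using Cons e by simp
    then show ?thesis by simp
  qed
qed simp

lemma last0:
  assumes "nzok fl [v, w]" "\<not> stepbad cur a v b" "\<not> closebad ((b, w) # (a, v) # cur)" "\<not> hitL L v w"
  shows "rev acc @ [rev cur @ [(a, v), (b, w)]] \<in> set (last0 fl L cur a b acc)"
  using assms by (cases fl; cases v; cases w) simp_all

text \<open>Each completion of a search state is either excluded for one of three reasons (a short
  cycle, a first nonzero voltage other than 1, a colouring extending an entry of the list) or
  appears in the output. The premise about \<open>diag\<close> describes the list between two
  cycles.\<close>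

lemma srch_sound:
  "(as = [] \<Longrightarrow> snd ` set L \<subseteq> {diag}) \<Longrightarrow> [] \<notin> set cs \<Longrightarrow> map fst r = as \<Longrightarrow> map (map fst) rest = cs \<Longrightarrow>
    (\<exists>c\<in>set (full as acc cur r rest). shortc c) \<or> \<not> nzok fl (map snd (r @ concat rest)) \<or>
    (\<exists>e\<in>set L. if as = [] then accs (fst e) rest else ac e r rest) \<or> full as acc cur r rest \<in> set (srch L fl cur as cs acc)"
  "[] \<notin> set cs \<Longrightarrow> map fst r = as \<Longrightarrow> map (map fst) rest = cs \<Longrightarrow>
    (\<exists>c\<in>set (full [a] acc cur ((a, v) # r) rest). shortc c) \<or> \<not> nzok fl (map snd (r @ concat rest)) \<or>
    (\<exists>e\<in>set M. ac2 e v r rest) \<or> full [a] acc cur ((a, v) # r) rest \<in> set (sstep M fl cur as cs acc a v)"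
proof (induction L fl cur as cs acc and M fl cur as cs acc a v arbitrary: r rest and r rest rule: srch_sstep.induct)
  case (1 L fl cur acc)
  then show ?case by (cases L) (auto simp: full_def)
next
  case (2 L fl cur c cs acc)
  obtain c' rest' where rest: "rest = c' # rest'" "map fst c' = c" "map (map fst) rest' = cs" using 2(5) by auto
  have ne: "c \<noteq> []" "[] \<notin> set cs" using 2(3) by auto
  have f: "full c acc [] c' rest' = full [] acc cur r rest" using ne rest by (simp add: full_def)
  have r: "r = []" using 2(4) by simp
  have "(\<exists>c\<in>set (full c acc [] c' rest'). shortc c) \<or> \<not> nzok fl (map snd (c' @ concat rest')) \<or>
    (\<exists>e\<in>set L. if c = [] then accs (fst e) rest' else ac e c' rest') \<or>
    full c acc [] c' rest' \<in> set (srch L fl [] c cs acc)"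
    by (rule 2(1)[OF _ ne(2) rest(2,3)]) (use ne in simp)
  \<comment> \<open>As the entries carry \<open>diag\<close>, recorded start and current colours
    agree, so a run reaching the recorded start is a closed one.\<close>
  moreover have "\<exists>e\<in>set L. accs (fst e) rest" if ex: "\<exists>e\<in>set L. ac e c' rest'"
  proof -
    obtain e where e: "e \<in> set L" "ac e c' rest'" using ex by blast
    have "snd e = diag" using 2(2) e(1) by blast
    then have "accs (fst e) rest" using diag_ac[of "fst e" c' rest'] e(2) rest(1) by (cases e) simp
    then show ?thesis using e(1) by blast
  qed
  ultimately show ?case using f ne rest(1) r by auto
next
  case (3 L fl cur a as cs acc)
  note prems = 3(5,6,7)
  obtain v r' where r: "r = (a, v) # r'" "map fst r' = as" using 3(6) by (auto simp: Cons_eq_map_conv)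
  show ?case
  proof (cases "length as = 1 \<and> cs = []")
    case True
    then obtain b w where rb: "r' = [(b, w)]" "as = [b]" "rest = []"
      using r(2) 3(7) by (auto simp: length_Suc_conv)
    have s: "srch L fl cur (a # as) cs acc = last0 fl L cur a b acc" using True rb by simp
    have f: "full (a # as) acc cur r rest = rev acc @ [rev cur @ [(a, v), (b, w)]]" by (simp add: full_def r rb)
    have "shortc (rev cur @ [(a, v), (b, w)])" if "stepbad cur a v b" using stepbad[OF that, of w "[]"] by simp
    moreover have "shortc (rev cur @ [(a, v), (b, w)])" if "closebad ((b, w) # (a, v) # cur)"
      using closebad[OF that] by simp
    moreover have "\<exists>e\<in>set L. ac e r rest" if "hitL L v w" using hitL[OF that] r rb by simp
    ultimately show ?thesis using last0[of fl v w cur a b L acc] unfolding s f by (auto simp: r rb)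
  next
    case general: False
    have f: "full (a # as) acc cur r rest = full [a] acc cur ((a, v) # r') rest" by (simp add: full_def r)
    have main: ?thesis
      if IH: "\<And>r' rest. [] \<notin> set cs \<Longrightarrow> map fst r' = as \<Longrightarrow> map (map fst) rest = cs \<Longrightarrow>
    (\<exists>c\<in>set (full [a] acc cur ((a, v) # r') rest). shortc c) \<or> \<not> nzok fl' (map snd (r' @ concat rest)) \<or>
    (\<exists>e\<in>set (turnL L). ac2 e v r' rest) \<or> full [a] acc cur ((a, v) # r') rest \<in> set (sstep (turnL L) fl' cur as cs acc a v)"
      and nz': "nzok fl (map snd (r @ concat rest)) \<Longrightarrow> nzok fl' (map snd (r' @ concat rest)) \<and>
        set (sstep (turnL L) fl' cur as cs acc a v) \<subseteq> set (srch L fl cur (a # as) cs acc)" for fl'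
    proof -
      have "(\<exists>e\<in>set (turnL L). ac2 e v r' rest) \<Longrightarrow> \<exists>e\<in>set L. ac e r rest"
        unfolding r(1) using turnL_ac by blast
      then show ?thesis using IH[OF 3(5) r(2) 3(7)] nz' unfolding f by auto
    qed
    show ?thesis
    proof (cases v)
      case Z0
      show ?thesis
        by (rule main[of fl]) (use 3(1)[OF general] Z0 general in \<open>auto simp: r nzok_Z0\<close>)
    next
      case Z1
      show ?thesis
        by (rule main[of True]) (use 3(2)[OF general] Z1 general in \<open>auto simp: r\<close>)
    next
      case Z2
      show ?thesis
      proof (cases fl)
        case True
        show ?thesis
          by (rule main[of True]) (use 3(3)[OF general True] Z2 general True in \<open>auto simp: r\<close>)
      next
        case False
        then show ?thesis using Z2 by (simp add: r)
      qed
    qed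
  qed
next
  case (4 M fl cur cs acc a v)
  have r: "r = []" using 4(3) by simp
  let ?c = "(a, v) # cur"
  show ?case
  proof (cases "closebad ?c")
    case True
    then have "shortc (rev cur @ [(a, v)])" using closebad[of ?c] by simp
    then show ?thesis by (simp add: full_def r)
  next
    case False
    have sn: "snd ` set (closeL v M) \<subseteq> {diag}" using closeL_set by fastforce
    have "(\<exists>c\<in>set (full [] (rev ?c # acc) [] [] rest). shortc c) \<or> \<not> nzok fl (map snd ([] @ concat rest)) \<or>
      (\<exists>e\<in>set (closeL v M). if ([] :: bool list list) = [] then accs (fst e) rest else ac e [] rest) \<or>
      full [] (rev ?c # acc) [] [] rest \<in> set (srch (closeL v M) fl [] [] cs (rev ?c # acc))"
      by (rule 4(1)[OF False sn 4(2) _ 4(4)]) simp_all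
    moreover have "full [a] acc cur [(a, v)] rest = full [] (rev ?c # acc) [] [] rest" by (simp add: full_def)
    moreover have "\<exists>e\<in>set M. ac2 e v [] rest" if "\<exists>e\<in>set (closeL v M). accs (fst e) rest"
      using that closeL_ac by blast
    ultimately show ?thesis unfolding r using False by auto
  qed
next
  case (5 M fl cur b as cs acc a v)
  have f: "full [a] acc cur ((a, v) # r) rest = full (b # as) acc ((a, v) # cur) r rest" by (simp add: full_def)
  show ?case
  proof (cases "stepbad cur a v b")
    case True
    obtain w r' where "r = (b, w) # r'" using 5(3) by (auto simp: Cons_eq_map_conv)
    then have "shortc (rev cur @ (a, v) # r)" using stepbad[OF True] by simp
    then show ?thesis by (simp add: full_def)
  next
    case False
    have "(\<exists>c\<in>set (full (b # as) acc ((a, v) # cur) r rest). shortc c) \<or> \<not> nzok fl (map snd (r @ concat rest)) \<or>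
      (\<exists>e\<in>set (adv v M). if b # as = [] then accs (fst e) rest else ac e r rest) \<or>
      full (b # as) acc ((a, v) # cur) r rest \<in> set (srch (adv v M) fl ((a, v) # cur) (b # as) cs acc)"
      by (rule 5(1)[OF False _ 5(2,3,4)]) simp
    then show ?thesis unfolding f using adv_ac False by auto
  qed
qed

text \<open>One switch for each of the \<open>2 ^ d - 1\<close> inner vertices of a branch: 2, 8 and
  128 trees for \<open>d\<close> = 1, 2, 3.\<close>

fun allsw :: "nat \<Rightarrow> sw list" where
  "allsw 0 = [Lf]"
| "allsw (Suc d) = (let S = allsw d in
    concat (map (\<lambda>l. concat (map (\<lambda>r. [Nd False l r, Nd True l r]) S)) S))"

definition survivors :: "sw list \<Rightarrow> bool list list list \<Rightarrow> config list" where
  "survivors S sh = srch (map (\<lambda>s. (map (scol s Z0) (concat sh), diag)) S) False [] [] sh []"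

text \<open>A snark has neither a short cycle nor an invariant colouring, and the voltage condition
  is assumed, so of the alternatives of the search only membership in its output remains.\<close>

theorem survivors:
  assumes "valid d cs" "0 < d" "snark (CG d cs)" "nzok False (map snd (concat cs))"
  shows "cs \<in> set (survivors S (map (map fst) cs))"
proof -
  let ?L = "map (\<lambda>s. (map (scol s Z0) (concat (map (map fst) cs)), diag)) S"
  have "[] \<notin> set (map (map fst) cs)" using valid_cycle(3)[OF assms(1)] by fastforce
  then have "(\<exists>c\<in>set (full [] [] [] [] cs). shortc c) \<or> \<not> nzok False (map snd ([] @ concat cs)) \<or>
    (\<exists>e\<in>set ?L. if ([] :: bool list list) = [] then accs (fst e) cs else ac e [] cs) \<or>
    full [] [] [] [] cs \<in> set (srch ?L False [] [] (map (map fst) cs) [])"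
    by (intro srch_sound(1)) auto
  moreover have "full [] [] [] [] cs = cs" by (simp add: full_def)
  moreover have "\<not> accs (fst e) cs" if "e \<in> set ?L" for e
    using that accs_not_snark[OF assms(1)] assms(3) by (auto simp: map_concat[symmetric])
  ultimately show ?thesis using shortc_not_snark[OF assms(1,2)] assms(3,4) by (auto simp: survivors_def)
qed

section \<open>Canonical representatives\<close>

text \<open>The Hist \<open>T\<close> is part of the relation, so that every normalisation step
  preserves the outer cycle lengths with respect to it.\<close>

definition reaches :: "nat \<Rightarrow> config \<Rightarrow> 'v ugraph \<Rightarrow> 'v ugraph \<Rightarrow> bool" where
  "reaches d cs G T \<longleftrightarrow> valid d cs \<and> (\<exists>h. graph_iso h (CG d cs) G \<and> img h (PT d) = T)"

text \<open>Switch trees are reused for automorphisms of a branch. Here \<open>True\<close>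
  exchanges the two children and \<open>Lf\<close> is the identity, in contrast to
  \<open>scol\<close>, where \<open>Lf\<close> stands for switches \<open>True\<close>.\<close>

fun act :: "sw \<Rightarrow> bool list \<Rightarrow> bool list" where
  "act s [] = []"
| "act Lf (x # xs) = x # xs"
| "act (Nd b l r) (x # xs) = (x \<noteq> b) # act (if x then r else l) xs"

lemma length_act [simp]: "length (act s bs) = length bs"
  by (induction s bs rule: act.induct) auto

lemma act_inj: "act s bs = act s cs \<Longrightarrow> bs = cs"
proof (induction s bs arbitrary: cs rule: act.induct)
  case (1 s)
  then have "length cs = 0" using length_act[of s cs] by simp
  then show ?case by simp
next
  case (2 x xs)
  then show ?case by (cases cs) auto
next
  case (3 b l r x xs)
  obtain y ys where cs: "cs = y # ys" using 3(2) by (cases cs) auto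
  have xy: "x = y" using 3(2) cs by auto
  then have "act (if x then r else l) xs = act (if x then r else l) ys" using 3(2) cs by simp
  then show ?case using 3(1) xy cs by simp
qed

lemma act_butlast: "act s (butlast bs) = butlast (act s bs)"
proof (induction s bs rule: act.induct)
  case (3 b l r x xs)
  show ?case
  proof (cases xs)
    case (Cons y ys)
    have "act s (y # ys) \<noteq> []" for s using length_act[of s "y # ys"] by (metis length_0_conv list.distinct(1))
    then show ?thesis using 3 Cons by simp
  qed simp
qed auto

definition neg :: "bool \<Rightarrow> z3 \<Rightarrow> z3" where "neg e v = (if e then - v else v)"

lemma neg_neg: "neg e (neg e v) = v"
  by (cases e; cases v) (simp_all add: neg_def)

lemma neg_add: "neg e (u + v) = neg e u + neg e v"
  by (cases e; cases u; cases v) (simp_all add: neg_def)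

lemma neg_Z0: "neg e v = Z0 \<longleftrightarrow> v = Z0"
  by (cases e; cases v) (simp_all add: neg_def)

lemmas neg_simps = neg_neg neg_add neg_Z0

lemma neg_inj: "neg e u = neg e v \<longleftrightarrow> u = v" by (metis neg_simps(1))

text \<open>The same switch tree acts in all three branches, which commutes with the rotation; the
  optional reflection \<open>k \<mapsto> - k\<close> inverts the rotation. So the image of a
  rotation-invariant graph is rotation-invariant and again comes from a configuration.\<close>

fun vact :: "sw \<Rightarrow> bool \<Rightarrow> vertex \<Rightarrow> vertex" where
  "vact s e None = None"
| "vact s e (Some (k, bs)) = Some (neg e k, act s bs)"

lemma level_vact: "level (vact s e v) = level v" by (cases v rule: level.cases) auto

lemma vact_par: "vact s e (par v) = par (vact s e v)"
proof (cases v rule: level.cases)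
  case (2 k bs)
  have "act s bs = [] \<longleftrightarrow> bs = []" using length_act[of s bs] by (metis length_0_conv)
  then show ?thesis by (simp add: 2 act_butlast)
qed simp

lemma vact_inj: "inj_on (vact s e) A"
proof (rule inj_onI)
  fix u v assume "vact s e u = vact s e v"
  then show "u = v"
    by (cases u rule: level.cases; cases v rule: level.cases) (auto simp: neg_inj dest: act_inj)
qed

lemma vact_PT_verts: "vact s e ` PT_verts d = PT_verts d"
  by (rule endo_inj_surj[OF finite_PT_verts _ vact_inj]) (auto simp: PT_verts_level level_vact)

lemma img_vact_PT: "img (vact s e) (PT d) = PT d"
proof -
  have "vact s e ` (PT_verts d - {None}) = PT_verts d - {None}"
    using inj_on_image_set_diff[OF vact_inj[of s e UNIV], of "PT_verts d" "{None}"] vact_PT_verts by simp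
  then have "(\<lambda>v. {v, par v}) ` (vact s e ` (PT_verts d - {None})) = (\<lambda>v. {v, par v}) ` (PT_verts d - {None})"
    by simp
  then show ?thesis by (simp add: img_def PT_def image_image vact_par vact_PT_verts del: par.simps)
qed

definition cact :: "sw \<Rightarrow> bool \<Rightarrow> config \<Rightarrow> config" where
  "cact s e cs = map (map (map_prod (act s) (neg e))) cs"

lemma map_fst_cact: "map fst (concat (cact s e cs)) = map (act s) (map fst (concat cs))"
  by (simp add: cact_def map_concat comp_def)

lemma arcs_cact: "arcs (cact s e cs) = (\<lambda>(a, v, b). (act s a, neg e v, act s b)) ` arcs cs"
proof (intro equalityI subsetI)
  fix x assume "x \<in> arcs (cact s e cs)"
  then obtain c i where c: "c \<in> set (cact s e cs)" "i < length c"
    "x = (fst (c ! i), snd (c ! i), fst (c ! (Suc i mod length c)))" unfolding arcs_def by blast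
  then obtain c' where c': "c' \<in> set cs" "c = map (map_prod (act s) (neg e)) c'" by (auto simp: cact_def)
  have i: "i < length c'" "Suc i mod length c' < length c'"
    using c(2) c'(2) by (auto intro!: mod_less_divisor)
  have "(fst (c' ! i), snd (c' ! i), fst (c' ! (Suc i mod length c'))) \<in> arcs cs"
    using c'(1) i(1) unfolding arcs_def by blast
  moreover have "x = (act s (fst (c' ! i)), neg e (snd (c' ! i)), act s (fst (c' ! (Suc i mod length c'))))"
    using c(3) c'(2) i by simp
  ultimately show "x \<in> (\<lambda>(a, v, b). (act s a, neg e v, act s b)) ` arcs cs" by force
next
  fix x assume "x \<in> (\<lambda>(a, v, b). (act s a, neg e v, act s b)) ` arcs cs"
  then obtain a v b where x: "x = (act s a, neg e v, act s b)" "(a, v, b) \<in> arcs cs" by auto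
  then obtain c i where c: "c \<in> set cs" "i < length c" "a = fst (c ! i)" "v = snd (c ! i)"
    "b = fst (c ! (Suc i mod length c))" unfolding arcs_def by blast
  let ?c = "map (map_prod (act s) (neg e)) c"
  have i: "Suc i mod length c < length c" using c(2) by (intro mod_less_divisor) auto
  have "?c \<in> set (cact s e cs)" using c(1) by (simp add: cact_def)
  moreover have "x = (fst (?c ! i), snd (?c ! i), fst (?c ! (Suc i mod length ?c)))" "i < length ?c"
    using x c i by simp_all
  ultimately show "x \<in> arcs (cact s e cs)" unfolding arcs_def by blast
qed

lemma outer_cact: "outer (cact s e cs) = (`) (vact s e) ` outer cs"
proof (intro equalityI subsetI)
  fix x assume "x \<in> outer (cact s e cs)"
  then obtain k a v b where x: "x = {Some (k, a), Some (k + v, b)}" "(a, v, b) \<in> arcs (cact s e cs)"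
    unfolding outer_def by blast
  then obtain a' v' b' where a: "a = act s a'" "v = neg e v'" "b = act s b'" "(a', v', b') \<in> arcs cs"
    by (auto simp: arcs_cact)
  have "x = vact s e ` {Some (neg e k, a'), Some (neg e k + v', b')}"
    using x(1) a by (simp add: neg_simps)
  moreover have "{Some (neg e k, a'), Some (neg e k + v', b')} \<in> outer cs" using a(4) unfolding outer_def by blast
  ultimately show "x \<in> (`) (vact s e) ` outer cs" by blast
next
  fix x assume "x \<in> (`) (vact s e) ` outer cs"
  then obtain y where y: "y \<in> outer cs" "x = vact s e ` y" by blast
  then obtain k a v b where k: "y = {Some (k, a), Some (k + v, b)}" "(a, v, b) \<in> arcs cs"
    unfolding outer_def by blast
  have "(act s a, neg e v, act s b) \<in> arcs (cact s e cs)" unfolding arcs_cact using k(2) by force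
  then have "{Some (neg e k, act s a), Some (neg e k + neg e v, act s b)} \<in> outer (cact s e cs)"
    unfolding outer_def by blast
  then show "x \<in> outer (cact s e cs)" using y(2) k(1) by (simp add: neg_simps)
qed

lemma valid_cact: assumes "valid d cs" shows "valid d (cact s e cs)"
proof -
  have "inj_on (act s) A" for A by (rule inj_onI) (rule act_inj)
  then have 1: "distinct (map fst (concat (cact s e cs)))"
    using assms unfolding map_fst_cact distinct_map valid_def by blast
  have "finite {bs :: bool list. length bs = d}"
    using finite_lists_length_eq[of "UNIV :: bool set" d] by simp
  then have "act s ` {bs. length bs = d} = {bs. length bs = d}"
    by (rule endo_inj_surj) (auto intro: inj_onI act_inj)
  then have 2: "set (map fst (concat (cact s e cs))) = {bs. length bs = d}"
    using assms unfolding map_fst_cact valid_def by (simp only: set_map)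
  have "2 \<le> length c \<and> (length c = 2 \<longrightarrow> snd (c ! 0) + snd (c ! 1) \<noteq> Z0)" if cc: "c \<in> set (cact s e cs)" for c
  proof -
    obtain c' where c': "c' \<in> set cs" "c = map (map_prod (act s) (neg e)) c'" using cc by (auto simp: cact_def)
    have v: "2 \<le> length c'" "length c' = 2 \<Longrightarrow> snd (c' ! 0) + snd (c' ! 1) \<noteq> Z0"
      using assms c'(1) by (simp_all add: valid_def)
    then show ?thesis using c'(2) by (auto simp: neg_simps(2)[symmetric] neg_simps(3))
  qed
  then show ?thesis using 1 2 by (simp add: valid_def)
qed

lemma reaches_cact: assumes "reaches d cs G T" shows "reaches d (cact s e cs) G T"
proof -
  obtain h where v: "valid d cs" and h: "graph_iso h (CG d cs) G" "img h (PT d) = T"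
    using assms by (auto simp: reaches_def)
  have "img (vact s e) (CG d cs) = CG d (cact s e cs)"
    using arg_cong[OF img_vact_PT[of s e d], of snd]
    by (simp add: img_def CG_def image_Un outer_cact vact_PT_verts)
  then have i: "graph_iso (vact s e) (CG d cs) (CG d (cact s e cs))"
    using graph_CG[OF v] vact_inj by (simp add: graph_iso_iff_img)
  let ?g = "inv_into (PT_verts d) (vact s e)"
  have "graph_iso ?g (CG d (cact s e cs)) (CG d cs)" using graph_iso_inv[OF i] by simp
  then have "graph_iso (h \<circ> ?g) (CG d (cact s e cs)) G" by (rule graph_iso_trans[OF _ h(1)])
  moreover have "img (h \<circ> ?g) (PT d) = T"
  proof -
    have "img ?g (PT d) = img ?g (img (vact s e) (PT d))" by (simp only: img_vact_PT)
    also have "\<dots> = img id (PT d)"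
      unfolding img_comp by (rule img_cong[OF graph_PT]) (simp add: inv_into_f_f[OF vact_inj])
    finally show ?thesis using h(2) by (simp add: img_id flip: img_comp)
  qed
  ultimately show ?thesis using valid_cact[OF v] unfolding reaches_def by blast
qed

lemma reaches_outer: "reaches d cs G T \<Longrightarrow> valid d cs' \<Longrightarrow> outer cs' = outer cs \<Longrightarrow> reaches d cs' G T"
  by (auto simp: reaches_def CG_def)

lemma arcs_Union: "arcs cs = (\<Union>c\<in>set cs. arcs [c])"
  unfolding arcs_def by auto

lemma outer_Union: "outer cs = (\<Union>c\<in>set cs. outer [c])"
  unfolding outer_def arcs_Union[of cs] by blast

definition cyc_ok :: "(bool list \<times> z3) list \<Rightarrow> bool" where
  "cyc_ok c \<longleftrightarrow> 2 \<le> length c \<and> (length c = 2 \<longrightarrow> snd (c ! 0) + snd (c ! 1) \<noteq> Z0)"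

text \<open>Replacing one cycle by a traversal of the same cycle, and permuting the cycles.\<close>

definition same_cycle :: "(bool list \<times> z3) list \<Rightarrow> (bool list \<times> z3) list \<Rightarrow> bool" where
  "same_cycle c c' \<longleftrightarrow> outer [c'] = outer [c] \<and> mset (map fst c') = mset (map fst c) \<and> (cyc_ok c \<longrightarrow> cyc_ok c')"

lemma same_cycle_refl: "same_cycle c c" by (simp add: same_cycle_def)

lemma same_cycle_trans: "same_cycle c c' \<Longrightarrow> same_cycle c' c'' \<Longrightarrow> same_cycle c c''"
  by (simp add: same_cycle_def)

lemma same_cycles:
  "list_all2 same_cycle cs cs' \<Longrightarrow> outer cs' = outer cs \<and> mset (map fst (concat cs')) = mset (map fst (concat cs)) \<and>
    ((\<forall>c\<in>set cs. cyc_ok c) \<longrightarrow> (\<forall>c\<in>set cs'. cyc_ok c))"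
proof (induction rule: list_all2_induct)
  case (Cons c cs c' cs')
  have o: "outer (x # xs) = outer [x] \<union> outer xs" for x xs
    unfolding outer_def arcs_Cons[of x xs] by blast
  have "same_cycle c c'" and IH: "outer cs' = outer cs" "mset (map fst (concat cs')) = mset (map fst (concat cs))"
    "(\<forall>c\<in>set cs. cyc_ok c) \<longrightarrow> (\<forall>c\<in>set cs'. cyc_ok c)" using Cons by blast+
  then have s: "outer [c'] = outer [c]" "mset (map fst c') = mset (map fst c)" "cyc_ok c \<longrightarrow> cyc_ok c'"
    unfolding same_cycle_def by blast+
  have "outer (c' # cs') = outer (c # cs)" unfolding o[of c cs] o[of c' cs'] s(1) IH(1) ..
  moreover have "mset (map fst (concat (c' # cs'))) = mset (map fst (concat (c # cs)))"
    using s(2) IH(2) by (simp only: concat.simps map_append mset_append)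
  ultimately show ?case using s(3) IH(3) by simp
qed simp

lemma valid_mset:
  assumes "valid d cs" "mset (map fst (concat cs')) = mset (map fst (concat cs))" "\<forall>c\<in>set cs'. cyc_ok c"
  shows "valid d cs'"
  using assms mset_eq_imp_distinct_iff[OF assms(2)] mset_eq_setD[OF assms(2)]
  unfolding valid_def cyc_ok_def by (simp only: )

lemma valid_cyc_ok: "valid d cs \<Longrightarrow> c \<in> set cs \<Longrightarrow> cyc_ok c" by (simp add: valid_def cyc_ok_def)

lemma reaches_same_cycles: "reaches d cs G T \<Longrightarrow> list_all2 same_cycle cs cs' \<Longrightarrow> reaches d cs' G T"
proof -
  assume r: "reaches d cs G T" and s: "list_all2 same_cycle cs cs'"
  have v: "valid d cs" using r by (simp add: reaches_def)
  have "valid d cs'" using same_cycles[OF s] valid_cyc_ok[OF v] valid_mset[OF v] by blast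
  then show ?thesis using reaches_outer[OF r] same_cycles[OF s] by blast
qed

lemma reaches_perm: assumes "reaches d cs G T" "mset cs' = mset cs" shows "reaches d cs' G T"
proof -
  have v: "valid d cs" using assms(1) by (simp add: reaches_def)
  have s: "set cs' = set cs" using assms(2) by (rule mset_eq_setD)
  have "mset (map fst (concat cs')) = mset (map fst (concat cs))"
  proof -
    have "mset (concat cs') = mset (concat cs)"
      using assms(2) by (simp add: mset_concat) (metis mset_map sum_mset_sum_list)
    then show ?thesis by (simp only: mset_map)
  qed
  then have "valid d cs'" using valid_mset[OF v] valid_cyc_ok[OF v] s by blast
  then show ?thesis using reaches_outer[OF assms(1)] outer_Union[of cs] outer_Union[of cs'] s by simp
qed

section \<open>Rotating and reversing a quotient cycle\<close>

lemma arcs_rotate1: "arcs [rotate1 c] = arcs [c]"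
proof -
  have nth: "rotate1 c ! s = c ! (Suc s mod length c)" if "s < length c" for s
    using that nth_rotate1 by metis
  let ?m = "length c"
  let ?f = "\<lambda>s. (fst (c ! (s mod ?m)), snd (c ! (s mod ?m)), fst (c ! (Suc s mod ?m)))"
  have A: "arcs [c] = ?f ` {..<?m}" by (auto simp: arcs_def)
  have "arcs [rotate1 c] = (\<lambda>s. (fst (rotate1 c ! s), snd (rotate1 c ! s), fst (rotate1 c ! (Suc s mod ?m)))) ` {..<?m}"
    by (auto simp: arcs_def)
  also have "\<dots> = (\<lambda>s. ?f (Suc s)) ` {..<?m}"
  proof (rule image_cong)
    fix s assume s: "s \<in> {..<?m}"
    then have "Suc s mod ?m < ?m" by (intro mod_less_divisor) auto
    then show "(fst (rotate1 c ! s), snd (rotate1 c ! s), fst (rotate1 c ! (Suc s mod ?m))) = ?f (Suc s)"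
      using nth[of s] nth[of "Suc s mod ?m"] s by (simp add: mod_Suc_eq)
  qed simp
  also have "\<dots> = ?f ` {..<?m}"
  proof (intro equalityI subsetI)
    fix x assume "x \<in> (\<lambda>s. ?f (Suc s)) ` {..<?m}"
    then obtain s where s: "s < ?m" "x = ?f (Suc s)" by blast
    then have "Suc s mod ?m < ?m" "x = ?f (Suc s mod ?m)" by (auto intro!: mod_less_divisor simp: mod_Suc_eq)
    then show "x \<in> ?f ` {..<?m}" by blast
  next
    fix x assume "x \<in> ?f ` {..<?m}"
    then obtain s where s: "s < ?m" "x = ?f s" by blast
    show "x \<in> (\<lambda>s. ?f (Suc s)) ` {..<?m}"
    proof (cases s)
      case 0
      have 1: "Suc (?m - 1) = ?m" "?m - 1 \<in> {..<?m}" using s by auto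
      have "Suc ?m mod ?m = Suc 0 mod ?m" using mod_add_self2[of "Suc 0" ?m] by simp
      then have "x = ?f (Suc (?m - 1))" unfolding s(2) 0 1(1) by (simp only: mod_self mod_0)
      then show ?thesis using 1(2) by (rule image_eqI)
    next
      case (Suc t)
      then have "x = ?f (Suc t)" "t \<in> {..<?m}" using s by auto
      then show ?thesis by (rule image_eqI)
    qed
  qed
  finally show ?thesis using A by simp
qed

lemma same_cycle_rotate1: "same_cycle c (rotate1 c)"
proof -
  have "outer [rotate1 c] = outer [c]" unfolding outer_def arcs_rotate1 ..
  moreover have "mset (map fst (rotate1 c)) = mset (map fst c)" by (cases c) auto
  moreover have "cyc_ok (rotate1 c)" if "cyc_ok c"
  proof -
    have "snd (rotate1 c ! 0) + snd (rotate1 c ! 1) = snd (c ! 0) + snd (c ! 1)" if l: "length c = 2"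
    proof -
      obtain p q where "c = [p, q]" using l by (auto simp: numeral_2_eq_2 length_Suc_conv)
      then show ?thesis by (simp add: add.commute)
    qed
    then show ?thesis using that by (simp add: cyc_ok_def)
  qed
  ultimately show ?thesis by (simp add: same_cycle_def)
qed

lemma same_cycle_rotate: "same_cycle (xs @ ys) (ys @ xs)"
proof -
  have "same_cycle c (rotate n c)" for n c
    by (induction n) (auto intro: same_cycle_refl same_cycle_trans same_cycle_rotate1)
  then show ?thesis using rotate_append[of xs ys] by metis
qed

text \<open>The reversed traversal keeps its first leaf. The voltages are reversed as a whole and
  not shifted along with the leaves, since a voltage belongs to the arc that leaves its
  entry.\<close>

definition rv :: "(bool list \<times> z3) list \<Rightarrow> (bool list \<times> z3) list" where
  "rv c = (case map fst c of [] \<Rightarrow> [] | a # as \<Rightarrow> zip (a # rev as) (map uminus (rev (map snd c))))"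

lemma map_fst_rv: "map fst (rv c) = (case map fst c of [] \<Rightarrow> [] | a # as \<Rightarrow> a # rev as)"
  by (cases c) (simp_all add: rv_def)

lemma rv_Nil [simp]: "rv [] = []" by (simp add: rv_def)

lemma length_rv [simp]: "length (rv c) = length c"
  by (cases c) (simp_all add: rv_def)

lemma rv_nth:
  assumes "s < length c"
  shows "rv c ! s = (fst (c ! ((length c - s) mod length c)), - snd (c ! (length c - 1 - s)))"
proof (cases c)
  case (Cons p c')
  have "map uminus (rev (map snd c)) ! s = - snd (c ! (length c - 1 - s))"
    using assms by (simp add: rev_nth)
  moreover have "(fst p # rev (map fst c')) ! s = fst (c ! ((length c - s) mod length c))"
  proof (cases s)
    case (Suc t)
    then have "t < length c'" using assms Cons by simp
    then show ?thesis using Suc Cons by (simp add: rev_nth nth_Cons' Suc_diff_Suc)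
  qed (simp add: Cons)
  ultimately show ?thesis using assms Cons by (simp add: rv_def)
qed (use assms in simp)

lemma arcs_rv_sub: "(a, v, b) \<in> arcs [rv c] \<Longrightarrow> (b, - v, a) \<in> arcs [c]"
proof -
  let ?m = "length c"
  assume "(a, v, b) \<in> arcs [rv c]"
  then obtain s where s: "s < ?m" "a = fst (rv c ! s)" "v = snd (rv c ! s)" "b = fst (rv c ! (Suc s mod ?m))"
    by (auto simp: arcs_def)
  define t where "t = ?m - 1 - s"
  have t: "t < ?m" "Suc t = ?m - s" using s(1) by (auto simp: t_def)
  have a: "a = fst (c ! (Suc t mod ?m))" "v = - snd (c ! t)" using rv_nth[OF s(1)] s(2,3) t by (simp_all add: t_def)
  have m: "Suc s mod ?m < ?m" using s(1) by (intro mod_less_divisor) auto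
  have "b = fst (c ! ((?m - Suc s mod ?m) mod ?m))" using rv_nth[OF m] s(4) by simp
  moreover have "(?m - Suc s mod ?m) mod ?m = t"
    using s(1) by (cases "Suc s = ?m") (auto simp: t_def)
  ultimately have "b = fst (c ! t)" by simp
  then show ?thesis using a t(1) unfolding arcs_def by auto
qed

lemma outer_rv_sub: "outer [rv c] \<subseteq> outer [c]"
proof
  fix e assume "e \<in> outer [rv c]"
  then obtain k a v b where e: "e = {Some (k, a), Some (k + v, b)}" "(a, v, b) \<in> arcs [rv c]"
    unfolding outer_def by blast
  then have "{Some (k + v, b), Some (k + v + - v, a)} \<in> outer [c]" using arcs_rv_sub unfolding outer_def by blast
  then show "e \<in> outer [c]" using e(1) by (simp add: insert_commute)
qed

lemma rv_rv: "rv (rv c) = c"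
proof (rule nth_equalityI)
  show "length (rv (rv c)) = length c" by simp
  fix s assume "s < length (rv (rv c))"
  then have s: "s < length c" by simp
  let ?m = "length c"
  have 1: "(?m - s) mod ?m < ?m" "?m - 1 - s < ?m" using s by (auto intro!: mod_less_divisor)
  have "fst (rv (rv c) ! s) = fst (c ! ((?m - (?m - s) mod ?m) mod ?m))"
    using rv_nth[of s "rv c"] rv_nth[OF 1(1)] s by simp
  moreover have "(?m - (?m - s) mod ?m) mod ?m = s" using s by (cases s) auto
  moreover have "snd (rv (rv c) ! s) = snd (c ! (?m - 1 - (?m - 1 - s)))"
    using rv_nth[of s "rv c"] rv_nth[OF 1(2)] s by simp
  moreover have "?m - 1 - (?m - 1 - s) = s" using s by simp
  ultimately show "rv (rv c) ! s = c ! s" by (simp add: prod_eq_iff)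
qed

lemma same_cycle_rv: "same_cycle c (rv c)"
proof -
  have "outer [rv c] = outer [c]" using outer_rv_sub[of c] outer_rv_sub[of "rv c"] rv_rv[of c] by simp
  moreover have "mset (map fst (rv c)) = mset (map fst c)"
    unfolding map_fst_rv by (cases c) simp_all
  moreover have "cyc_ok (rv c)" if "cyc_ok c"
  proof -
    have e: "snd (rv c ! 0) + snd (rv c ! 1) = - (snd (c ! 0) + snd (c ! 1))" if l: "length c = 2"
    proof -
      obtain p q where "c = [p, q]" using l by (auto simp: numeral_2_eq_2 length_Suc_conv)
      then show ?thesis by (simp add: rv_def add.commute)
    qed
    have n: "- z = Z0 \<longleftrightarrow> z = Z0" for z by (cases z) simp_all
    have "snd (rv c ! 0) + snd (rv c ! 1) \<noteq> Z0" if l: "length c = 2"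
      unfolding e[OF l] n using \<open>cyc_ok c\<close> l unfolding cyc_ok_def by blast
    then show ?thesis using \<open>cyc_ok c\<close> unfolding cyc_ok_def length_rv by blast
  qed
  ultimately show ?thesis by (simp add: same_cycle_def)
qed

section \<open>Lexicographic order and minimal configurations\<close>

fun lexb :: "bool list \<Rightarrow> bool list \<Rightarrow> bool" where
  "lexb (x # xs) (y # ys) = (if x = y then lexb xs ys else y)"
| "lexb _ _ = False"

fun valb :: "bool list \<Rightarrow> nat" where
  "valb [] = 0"
| "valb (x # xs) = (if x then 2 ^ length xs else 0) + valb xs"

lemma valb_less: "valb xs < 2 ^ length xs" by (induction xs) auto

text \<open>On lists of equal length the lexicographic order is the order of binary numbers, which
  provides minimal elements.\<close>

lemma lexb_valb: "lexb xs ys \<Longrightarrow> length xs = length ys \<Longrightarrow> valb xs < valb ys"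
proof (induction xs ys rule: lexb.induct)
  case (1 x xs y ys)
  then show ?case using valb_less[of xs] by (cases x; cases y) auto
qed simp_all

lemma lexb_append: "length xs = length ys \<Longrightarrow> lexb xs ys \<Longrightarrow> lexb (xs @ us) (ys @ vs)"
  by (induction xs ys rule: lexb.induct) (auto split: if_splits)

lemma lexb_prefix [simp]: "lexb (xs @ us) (xs @ vs) = lexb us vs"
  by (induction xs) auto

text \<open>The codes 00, 10, 11 have equal length and are ordered like 0, 1, 2.\<close>

fun vbits :: "z3 list \<Rightarrow> bool list" where
  "vbits [] = []"
| "vbits (v # vs) = (case v of Z0 \<Rightarrow> False # False # vbits vs | Z1 \<Rightarrow> True # False # vbits vs | Z2 \<Rightarrow> True # True # vbits vs)"

lemma length_vbits [simp]: "length (vbits vs) = 2 * length vs"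
  by (induction vs) (auto split: z3.splits)

definition flat :: "bool list list list \<Rightarrow> bool list" where "flat sh = concat (concat sh)"

text \<open>Shape before voltages: a smaller shape decides the comparison, so shapes can be rejected
  before voltages are assigned. The division into cycles is not recorded, hence different shapes may
  have the same first part.\<close>

definition key :: "config \<Rightarrow> bool list" where
  "key cs = flat (map (map fst) cs) @ vbits (map snd (concat cs))"

lemma length_concat_const: "(\<And>x. x \<in> set xs \<Longrightarrow> length x = n) \<Longrightarrow> length (concat xs) = n * length xs"
  by (induction xs) auto

lemma flat_alt: "flat (map (map fst) cs) = concat (map fst (concat cs))"
  by (simp add: flat_def map_concat)

lemma length_flat_valid:
  assumes "valid d cs"
  shows "length (flat (map (map fst) cs)) = d * card {bs :: bool list. length bs = d}"
    "length (concat cs) = card {bs :: bool list. length bs = d}"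
proof -
  have "length (map fst (concat cs)) = card (set (map fst (concat cs)))"
    using assms unfolding valid_def by (metis distinct_card)
  then show l: "length (concat cs) = card {bs :: bool list. length bs = d}"
    using assms unfolding valid_def by (simp only: length_map)
  have "length (concat (map fst (concat cs))) = d * length (map fst (concat cs))"
    by (rule length_concat_const) (use assms in \<open>auto simp: valid_def simp del: set_map set_concat\<close>)
  then show "length (flat (map (map fst) cs)) = d * card {bs :: bool list. length bs = d}"
    unfolding flat_alt using l by simp
qed

definition minimal :: "nat \<Rightarrow> config \<Rightarrow> 'v ugraph \<Rightarrow> 'v ugraph \<Rightarrow> bool" where
  "minimal d cs G T \<longleftrightarrow> reaches d cs G T \<and> (\<forall>cs'. reaches d cs' G T \<longrightarrow> \<not> lexb (key cs') (key cs))"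

lemma minimal_exists: assumes "reaches d cs G T" shows "\<exists>cs. minimal d cs G T"
proof -
  obtain cs0 where 0: "reaches d cs0 G T" "\<And>cs'. reaches d cs' G T \<Longrightarrow> valb (key cs0) \<le> valb (key cs')"
    using ex_has_least_nat[of "\<lambda>cs. reaches d cs G T" cs "\<lambda>cs. valb (key cs)"] assms by blast
  have "\<not> lexb (key cs') (key cs0)" if r: "reaches d cs' G T" for cs'
  proof
    assume l: "lexb (key cs') (key cs0)"
    have "length (key cs') = length (key cs0)"
      using length_flat_valid[of d cs'] length_flat_valid[of d cs0] r 0(1) by (simp add: key_def reaches_def)
    then show False using lexb_valb[OF l] 0(2)[OF r] by simp
  qed
  then show ?thesis using 0(1) unfolding minimal_def by blast
qed

lemma minimal_flat:
  assumes "minimal d cs G T" "reaches d cs' G T"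
  shows "\<not> lexb (flat (map (map fst) cs')) (flat (map (map fst) cs))"
proof
  assume l: "lexb (flat (map (map fst) cs')) (flat (map (map fst) cs))"
  have "length (flat (map (map fst) cs')) = length (flat (map (map fst) cs))"
    using assms length_flat_valid(1)[of d cs'] length_flat_valid(1)[of d cs] by (simp add: minimal_def reaches_def)
  then show False using lexb_append[OF _ l] assms unfolding minimal_def key_def by blast
qed

lemma act_Lf [simp]: "act Lf bs = bs" by (cases bs) auto

text \<open>Negating all voltages keeps the shape. If the first nonzero voltage were 2, the negated
  list would be smaller at this place.\<close>

lemma minimal_nzok: assumes "minimal d cs G T" shows "nzok False (map snd (concat cs))"
proof (rule ccontr)
  have l: "\<not> nzok False vs \<Longrightarrow> lexb (vbits (map uminus vs)) (vbits vs)" for vs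
    by (induction vs) (auto split: z3.splits)
  assume "\<not> nzok False (map snd (concat cs))"
  from l[OF this] have "lexb (key (cact Lf True cs)) (key cs)"
    by (simp add: key_def cact_def map_concat neg_def comp_def flat_def)
  moreover have "reaches d (cact Lf True cs) G T"
    by (rule reaches_cact) (use assms in \<open>simp add: minimal_def\<close>)
  ultimately show False using assms unfolding minimal_def by blast
qed

fun exl :: "('a \<Rightarrow> bool) \<Rightarrow> 'a list \<Rightarrow> bool" where
  "exl P [] = False"
| "exl P (x # xs) = (if P x then True else exl P xs)"

fun alll :: "('a \<Rightarrow> bool) \<Rightarrow> 'a list \<Rightarrow> bool" where
  "alll P [] = True"
| "alll P (x # xs) = (if P x then alll P xs else False)"

lemma exl_iff: "exl P xs \<longleftrightarrow> (\<exists>x\<in>set xs. P x)" by (induction xs) auto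

lemma alll_iff: "alll P xs \<longleftrightarrow> (\<forall>x\<in>set xs. P x)" by (induction xs) auto

section \<open>Normal form after applying a tree automorphism\<close>

fun minleaf :: "bool list list \<Rightarrow> bool list" where
  "minleaf [] = []"
| "minleaf (x # xs) = (case xs of [] \<Rightarrow> x | _ # _ \<Rightarrow> let m = minleaf xs in if lexb m x then m else x)"

text \<open>Everything is written over a projection \<open>g\<close>, so that the same functions
  normalise bare shapes (\<open>id\<close>) and configurations (\<open>fst\<close>), and the two
  results can be compared by mapping.\<close>

definition rotm :: "('a \<Rightarrow> bool list) \<Rightarrow> 'a list \<Rightarrow> 'a list" where
  "rotm g c = (let m = minleaf (map g c) in dropWhile (\<lambda>p. g p \<noteq> m) c @ takeWhile (\<lambda>p. g p \<noteq> m) c)"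

text \<open>The direction is chosen by comparing the second leaf with the last one. In a cycle of
  length 2 these coincide, so its two directions, which differ in the voltages only, are not
  identified; some representatives are listed twice for this reason.\<close>

definition canonc :: "('a \<Rightarrow> bool list) \<Rightarrow> ('a list \<Rightarrow> 'a list) \<Rightarrow> 'a list \<Rightarrow> 'a list" where
  "canonc g R c = (let c' = rotm g c in case c' of [] \<Rightarrow> c' | _ # r \<Rightarrow> (case r of [] \<Rightarrow> c' | x # _ \<Rightarrow>
     if lexb (g (last r)) (g x) then R c' else c'))"

definition hg :: "('a \<Rightarrow> bool list) \<Rightarrow> 'a list \<Rightarrow> bool list" where
  "hg g e = (case e of [] \<Rightarrow> [] | x # _ \<Rightarrow> g x)"

fun insc :: "('a \<Rightarrow> bool list) \<Rightarrow> 'a list \<Rightarrow> 'a list list \<Rightarrow> 'a list list" where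
  "insc g c [] = [c]"
| "insc g c (e # es) = (if lexb (hg g e) (hg g c) then e # insc g c es else c # e # es)"

fun sortc :: "('a \<Rightarrow> bool list) \<Rightarrow> 'a list list \<Rightarrow> 'a list list" where
  "sortc g [] = []"
| "sortc g (c # cs) = insc g c (sortc g cs)"

definition rvs :: "'a list \<Rightarrow> 'a list" where "rvs c = (case c of [] \<Rightarrow> [] | a # as \<Rightarrow> a # rev as)"

definition tnorm :: "sw \<Rightarrow> bool \<Rightarrow> config \<Rightarrow> config" where
  "tnorm s e cs = sortc fst (map (canonc fst rv) (cact s e cs))"

definition snorm :: "sw \<Rightarrow> bool list list list \<Rightarrow> bool list list list" where
  "snorm s sh = sortc id (map (canonc id rvs) (map (map (act s)) sh))"

lemma map_rotm: "map g (rotm g c) = rotm id (map g c)"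
  by (simp add: rotm_def Let_def dropWhile_map takeWhile_map comp_def)

lemma map_canonc: "map fst (canonc fst rv c) = canonc id rvs (map fst c)"
proof -
  have *: "map fst c' = rotm id (map fst c)" if "c' = rotm fst c" for c'
    unfolding that by (rule map_rotm)
  obtain c' where c': "c' = rotm fst c" by blast
  show ?thesis
    unfolding canonc_def Let_def c'[symmetric] *[OF c', symmetric]
    by (auto simp: map_fst_rv rvs_def last_map split: list.splits)
qed

lemma map_insc: "map (map g) (insc g c es) = insc id (map g c) (map (map g) es)"
  by (induction es) (auto simp: hg_def split: list.splits)

lemma map_sortc: "map (map g) (sortc g cs) = sortc id (map (map g) cs)"
  by (induction cs) (simp_all add: map_insc id_def)

lemma map_tnorm: "map (map fst) (tnorm s e cs) = snorm s (map (map fst) cs)"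
  by (simp add: tnorm_def snorm_def map_sortc map_canonc comp_def cact_def)

lemma mset_insc: "mset (insc g c es) = add_mset c (mset es)"
  by (induction es) auto

lemma mset_sortc: "mset (sortc g cs) = mset cs"
  by (induction cs) (simp_all add: mset_insc)

lemma same_cycle_rotm: "same_cycle c (rotm fst c)"
proof -
  let ?P = "\<lambda>p. fst p \<noteq> minleaf (map fst c)"
  have "same_cycle (takeWhile ?P c @ dropWhile ?P c) (dropWhile ?P c @ takeWhile ?P c)"
    by (rule same_cycle_rotate)
  then show ?thesis by (simp add: rotm_def Let_def)
qed

lemma same_cycle_canonc: "same_cycle c (canonc fst rv c)"
proof -
  have "canonc fst rv c = rotm fst c \<or> canonc fst rv c = rv (rotm fst c)"
    unfolding canonc_def Let_def by (auto split: list.splits)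
  then show ?thesis using same_cycle_rotm same_cycle_trans[OF same_cycle_rotm same_cycle_rv] by metis
qed

lemma reaches_tnorm: assumes "reaches d cs G T" shows "reaches d (tnorm s e cs) G T"
proof -
  have "list_all2 same_cycle cs' (map (canonc fst rv) cs')" for cs'
    by (simp add: list_all2_map2 list_all2_same same_cycle_canonc)
  then have "reaches d (map (canonc fst rv) (cact s e cs)) G T"
    by (rule reaches_same_cycles[OF reaches_cact[OF assms]])
  then show ?thesis unfolding tnorm_def by (rule reaches_perm) (rule mset_sortc)
qed

definition nonminS :: "sw list \<Rightarrow> bool list list list \<Rightarrow> bool" where
  "nonminS S sh = (let f = flat sh in exl (\<lambda>s. lexb (flat (snorm s sh)) f) S)"

definition nonmin :: "sw list \<Rightarrow> config \<Rightarrow> bool" where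
  "nonmin S cs = (let k = key cs in
     exl (\<lambda>s. if lexb (key (tnorm s False cs)) k then True else lexb (key (tnorm s True cs)) k) S)"

text \<open>Sound for any list \<open>S\<close>: each member yields a configuration of the same
  graph and Hist, and a smaller one refutes minimality. The choice of \<open>S\<close> only decides
  how much is rejected.\<close>

lemma minimal_not_nonminS: "minimal d cs G T \<Longrightarrow> \<not> nonminS S (map (map fst) cs)"
proof -
  assume m: "minimal d cs G T"
  then have "reaches d cs G T" by (simp add: minimal_def)
  from minimal_flat[OF m reaches_tnorm[OF this, of _ False]] show ?thesis
    by (simp add: nonminS_def exl_iff map_tnorm Let_def)
qed

lemma minimal_not_nonmin: "minimal d cs G T \<Longrightarrow> \<not> nonmin S cs"
proof -
  assume m: "minimal d cs G T"
  then have "reaches d cs G T" by (simp add: minimal_def)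
  then have r: "reaches d (tnorm s e cs) G T" for s e by (rule reaches_tnorm)
  have "\<not> lexb (key (tnorm s e cs)) (key cs)" for s e using m r[of s e] unfolding minimal_def by blast
  then show ?thesis by (simp add: nonmin_def exl_iff Let_def)
qed

fun pre :: "bool list \<Rightarrow> bool list \<Rightarrow> bool" where
  "pre [] a = True"
| "pre (x # u) [] = False"
| "pre (x # u) (y # a) = (if x = y then pre u a else False)"

lemma pre_iff: "pre u a \<longleftrightarrow> take (length u) a = u"
  by (induction u a rule: pre.induct) auto

definition closedS :: "bool list list \<Rightarrow> bool list list list \<Rightarrow> bool" where
  "closedS us sh = exl (\<lambda>u. if alll (\<lambda>c. if alll (pre u) c then True else alll (\<lambda>a. \<not> pre u a) c) sh then
     if exl (alll (pre u)) sh then exl (alll (\<lambda>a. \<not> pre u a)) sh else False else False) us"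

lemma closedS_not_snark:
  assumes "valid d cs" "closedS us (map (map fst) cs)" "[] \<notin> set us"
  shows "\<not> snark (CG d cs)"
proof -
  obtain u where u: "u \<in> set us"
    "\<forall>c\<in>set cs. (\<forall>a\<in>fst ` set c. take (length u) a = u) \<or> (\<forall>a\<in>fst ` set c. take (length u) a \<noteq> u)"
    "\<exists>c\<in>set cs. \<forall>a\<in>fst ` set c. take (length u) a = u"
    "\<exists>c\<in>set cs. \<forall>a\<in>fst ` set c. take (length u) a \<noteq> u"
    using assms(2) by (auto simp: closedS_def exl_iff alll_iff pre_iff split: if_splits)
  then have "u \<noteq> []" using assms(3) by blast
  from u(3) obtain c1 where c1: "c1 \<in> set cs" "\<forall>a\<in>fst ` set c1. take (length u) a = u" by (elim bexE)
  from u(4) obtain c2 where c2: "c2 \<in> set cs" "\<forall>a\<in>fst ` set c2. take (length u) a \<noteq> u" by (elim bexE)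
  show ?thesis
    by (rule closed_subtree_not_snark[OF assms(1) \<open>u \<noteq> []\<close> _ c1 c2]) (rule bspec[OF u(2)])
qed

section \<open>Enumeration of the shapes\<close>

fun sub :: "bool \<Rightarrow> bool list list \<Rightarrow> bool list list" where
  "sub b [] = []"
| "sub b (x # r) = (case x of [] \<Rightarrow> sub b r | y # xs \<Rightarrow> if y = b then xs # sub b r else sub b r)"

text \<open>In a canonical configuration the first leaf below any vertex is the leftmost one below it.\<close>

fun okW :: "bool list list \<Rightarrow> bool list \<Rightarrow> bool" where
  "okW vis [] = True"
| "okW vis (b # w) = (case vis of [] \<Rightarrow> if b then False else okW [] w | _ # _ \<Rightarrow> okW (sub b vis) w)"

lemma sub_set: "x \<in> set (sub b vis) \<longleftrightarrow> b # x \<in> set vis"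
  by (induction vis) (auto split: list.splits)

lemma okWI:
  assumes "\<And>i. i < length w \<Longrightarrow> (\<forall>x\<in>set vis. take i x \<noteq> take i w) \<Longrightarrow> \<not> w ! i"
  shows "okW vis w"
  using assms
proof (induction w arbitrary: vis)
  case (Cons b w)
  have 0: "vis = [] \<Longrightarrow> \<not> b" using Cons.prems[of 0] by auto
  have "okW (sub b vis) w"
  proof (rule Cons.IH)
    fix i assume i: "i < length w" "\<forall>x\<in>set (sub b vis). take i x \<noteq> take i w"
    have "take (Suc i) x \<noteq> take (Suc i) (b # w)" if "x \<in> set vis" for x
    proof (cases x)
      case (Cons a l)
      show ?thesis
      proof
        assume "take (Suc i) x = take (Suc i) (b # w)"
        then have "a = b" "take i l = take i w" using Cons by simp_all
        then show False using i(2) sub_set[of l b vis] that Cons by blast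
      qed
    qed simp
    then show "\<not> w ! i" using Cons.prems[of "Suc i"] i(1) by simp
  qed
  then show ?case using 0 by (cases vis) auto
qed simp

text \<open>The automorphism exchanging the two children of the single vertex
  \<open>u\<close>.\<close>

fun swt :: "bool list \<Rightarrow> sw" where
  "swt [] = Nd True Lf Lf"
| "swt (x # u) = Nd False (if x then Lf else swt u) (if x then swt u else Lf)"

lemma act_swt_other: "take (length u) bs \<noteq> u \<Longrightarrow> act (swt u) bs = bs"
proof (induction u arbitrary: bs)
  case (Cons x u)
  then show ?case by (cases bs; cases x) auto
qed simp

lemma act_swt_hit: "act (swt u) (u @ x # r) = u @ (\<not> x) # r"
  by (induction u) auto

text \<open>Suppose \<open>w\<close> turns right at a vertex below which no earlier leaf lies.
  Exchanging the children of this vertex fixes all earlier leaves and makes \<open>w\<close>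
  smaller.\<close>

lemma minimal_okW:
  assumes m: "minimal d cs G T" and L: "map fst (concat cs) = p @ w # q" and vis: "set vis = set p"
  shows "okW vis w"
proof (rule okWI)
  fix i assume i: "i < length w" "\<forall>x\<in>set vis. take i x \<noteq> take i w"
  show "\<not> w ! i"
  proof
    assume wi: "w ! i"
    define u where "u = take i w"
    have w: "w = u @ True # drop (Suc i) w" using id_take_nth_drop[OF i(1)] wi by (simp add: u_def)
    have lu: "length u = i" using i(1) by (simp add: u_def)
    let ?s = "swt u"
    have p: "map (act ?s) p = p"
      by (rule map_idI) (use i(2) vis lu in \<open>auto simp: u_def[symmetric] intro!: act_swt_other\<close>)
    have w': "act ?s w = u @ False # drop (Suc i) w" by (subst w) (simp add: act_swt_hit)
    have "flat (map (map fst) (cact ?s False cs)) = concat p @ (u @ False # drop (Suc i) w) @ concat (map (act ?s) q)"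
      unfolding flat_alt map_fst_cact L by (simp add: p w')
    moreover have "flat (map (map fst) cs) = concat p @ (u @ True # drop (Suc i) w) @ concat q"
      unfolding flat_alt L using w by simp
    ultimately have "lexb (flat (map (map fst) (cact ?s False cs))) (flat (map (map fst) cs))"
      by simp
    moreover have "reaches d (cact ?s False cs) G T" by (rule reaches_cact) (use m in \<open>simp add: minimal_def\<close>)
    ultimately show False using minimal_flat[OF m] by blast
  qed
qed

lemma reaches_replace:
  assumes "reaches d (p @ c # q) G T" "same_cycle c c'" shows "reaches d (p @ c' # q) G T"
  by (rule reaches_same_cycles[OF assms(1)])
    (simp add: list_all2_append list_all2_same same_cycle_refl assms(2))

text \<open>A smaller leaf in this or a later cycle could be brought to this place, by moving its
  cycle forward and rotating it to begin with that leaf.\<close>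

lemma minimal_head:
  assumes m: "minimal d (p @ c # q) G T" and c: "c \<noteq> []" and x: "x \<in> fst ` set (concat (c # q))"
  shows "\<not> lexb x (fst (hd c))"
proof
  assume l: "lexb x (fst (hd c))"
  have r: "reaches d (p @ c # q) G T" using m by (simp add: minimal_def)
  obtain e z where e: "e \<in> set (c # q)" "z \<in> set e" "x = fst z" using x by auto
  obtain q1 q2 where q: "c # q = q1 @ e # q2" using split_list[OF e(1)] by blast
  obtain xs ys where s: "e = xs @ z # ys" using split_list[OF e(2)] by blast
  have "reaches d (p @ e # (q1 @ q2)) G T" by (rule reaches_perm[OF r]) (simp add: q)
  then have r': "reaches d (p @ ((z # ys) @ xs) # (q1 @ q2)) G T"
    by (rule reaches_replace) (unfold s, rule same_cycle_rotate)
  obtain z0 c' where c': "c = z0 # c'" using c by (cases c) auto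
  have len: "length (fst y) = d" if "y \<in> set (concat (p @ c # q))" for y
    using r that unfolding reaches_def valid_def by (metis (mono_tags, lifting) imageI mem_Collect_eq set_map)
  have "z \<in> set (concat (c # q))" using e(1,2) by auto
  then have "length x = d" "length (fst z0) = d" using len[of z] len[of z0] e(3) c' by auto
  then have "lexb (x @ u) (fst z0 @ v)" for u v using l c' lexb_append by simp
  then have "lexb (flat (map (map fst) (p @ ((z # ys) @ xs) # (q1 @ q2)))) (flat (map (map fst) (p @ c # q)))"
    unfolding flat_alt using e(3) c' by simp
  then show False using minimal_flat[OF m r'] by blast
qed

text \<open>The cycle is given in reverse, as \<open>gen\<close> accumulates it:
  \<open>hd rc\<close> is its last leaf, compared with its second one.\<close>

definition dirok :: "bool list list \<Rightarrow> bool" where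
  "dirok rc = (case rev rc of [] \<Rightarrow> True | _ # r \<Rightarrow> (case r of [] \<Rightarrow> True | y # _ \<Rightarrow> \<not> lexb (hd rc) y))"

lemma dirok_rev: "dirok (rev (x # y # zs)) \<longleftrightarrow> \<not> lexb (last (x # y # zs)) y"
  by (simp only: dirok_def rev_rev_ident list.case hd_rev)

text \<open>Reversal by \<open>rv\<close> keeps the first leaf and puts the last one in second
  place, so a last leaf below the second would yield a smaller key.\<close>

lemma minimal_dirok:
  assumes m: "minimal d cs G T" and c: "c \<in> set cs"
  shows "dirok (rev (map fst c))"
proof (rule ccontr)
  assume nd: "\<not> dirok (rev (map fst c))"
  obtain p q where cs: "cs = p @ c # q" using split_list[OF c] by blast
  have r: "reaches d cs G T" using m by (simp add: minimal_def)
  have "\<exists>a b r'. c = a # b # r' \<and> lexb (fst (last c)) (fst b)"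
  proof (cases c)
    case (Cons a c')
    show ?thesis
    proof (cases c')
      case (Cons b r')
      have "map fst c = fst a # fst b # map fst r'" using Cons \<open>c = a # c'\<close> by simp
      moreover from this have "last (fst a # fst b # map fst r') = fst (last c)"
        using last_map[of c fst] \<open>c = a # c'\<close> by simp
      ultimately show ?thesis
        using nd dirok_rev[of "fst a" "fst b" "map fst r'"] Cons \<open>c = a # c'\<close> by metis
    qed (use nd Cons in \<open>simp add: dirok_def\<close>)
  qed (use nd in \<open>simp add: dirok_def\<close>)
  then obtain a b r' where ab: "c = a # b # r'" "lexb (fst (last c)) (fst b)" by (elim exE conjE)
  have len: "length (fst y) = d" if "y \<in> set c" for y
    using r that c unfolding reaches_def valid_def by (metis (mono_tags, lifting) UN_I imageI mem_Collect_eq set_concat set_map)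
  have "last c \<in> set c" "b \<in> set c" using ab(1) by auto
  then have "length (fst (last c)) = length (fst b)" using len by metis
  then have l: "lexb (fst (last c) @ u) (fst b @ v)" for u v using ab(2) lexb_append by blast
  have "last c = last (b # r')" using ab(1) by simp
  then have "b # r' = butlast (b # r') @ [last c]" using append_butlast_last_id[of "b # r'"] by simp
  then have "rev (map fst (b # r')) = rev (map fst (butlast (b # r') @ [last c]))" by (rule arg_cong)
  then have mf: "map fst (rv c) = fst a # fst (last c) # rev (map fst (butlast (b # r')))"
    unfolding map_fst_rv ab(1) list.map list.case by simp
  have "lexb (flat (map (map fst) (p @ rv c # q))) (flat (map (map fst) cs))"
  proof -
    have mc: "map fst c = fst a # fst b # map fst r'" using ab(1) by simp
    show ?thesis unfolding flat_def cs map_append list.map mf mc by (simp add: l)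
  qed
  moreover have "reaches d (p @ rv c # q) G T"
    by (rule reaches_replace[OF _ same_cycle_rv]) (use r cs in simp)
  ultimately show False using minimal_flat[OF m] by blast
qed

text \<open>The first argument only bounds the depth of the recursion by its length.\<close>

fun gen :: "'b list \<Rightarrow> bool list list \<Rightarrow> bool list list \<Rightarrow> bool list list list \<Rightarrow> bool list list list list" where
  "gen [] rem cur acc = []"
| "gen (_ # f) rem [] acc = (case rem of [] \<Rightarrow> [rev acc] | _ # _ \<Rightarrow>
     concat (map (\<lambda>h. if exl (\<lambda>x. lexb x h) rem then [] else
       if okW (concat acc) h then gen f (removeAll h rem) [h] acc else []) rem))"
| "gen (_ # f) rem (x # cur) acc =
     (case cur of [] \<Rightarrow> [] | _ # _ \<Rightarrow> if dirok (x # cur) then gen f rem [] (rev (x # cur) # acc) else []) @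
     concat (map (\<lambda>w. if okW (x # cur @ concat acc) w then gen f (removeAll w rem) (w # x # cur) acc else []) rem)"

text \<open>These are the consequences of minimality that can be tested while a shape grows. The
  list \<open>vis\<close> is only required to have the elements of the prefix \<open>p\<close>,
  because the enumeration stores visited leaves in another order.\<close>

definition okshape :: "bool list list list \<Rightarrow> bool" where
  "okshape sh \<longleftrightarrow> (\<forall>p w q vis. concat sh = p @ w # q \<longrightarrow> set vis = set p \<longrightarrow> okW vis w) \<and>
     (\<forall>p c q. sh = p @ c # q \<longrightarrow> (\<forall>x\<in>set (concat (c # q)). \<not> lexb x (hd c))) \<and>
     (\<forall>c\<in>set sh. 2 \<le> length c \<and> dirok (rev c)) \<and> distinct (concat sh)"

text \<open>One claim for states between two cycles and one for states inside a cycle, each relying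
  on the other. Every leaf still to be placed and every cycle still to be closed costs one element
  of \<open>f\<close>, and the final output one more.\<close>

lemma gen_complete:
  "(okshape (rev acc @ rest) \<longrightarrow> set rem = set (concat rest) \<longrightarrow> length (concat rest) + length rest < length f \<longrightarrow>
     rev acc @ rest \<in> set (gen f rem [] acc)) \<and>
   (okshape (rev acc @ (rev (x # cur) @ r) # rest) \<longrightarrow> set rem = set (r @ concat rest) \<longrightarrow>
     Suc (length (r @ concat rest) + length rest) < length f \<longrightarrow>
     rev acc @ (rev (x # cur) @ r) # rest \<in> set (gen f rem (x # cur) acc))"
proof (induction f arbitrary: rem x cur r rest acc)
  case (Cons y f)
  have "rev acc @ rest \<in> set (gen (y # f) rem [] acc)"
    if ok: "okshape (rev acc @ rest)" and rem: "set rem = set (concat rest)"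
      and len: "length (concat rest) + length rest < length (y # f)"
  proof (cases rest)
    case Nil
    then show ?thesis using rem by simp
  next
    case (Cons c rest')
    have "2 \<le> length c" using ok Cons by (simp add: okshape_def)
    then obtain h r where c: "c = h # r" by (cases c) auto
    have h: "h \<in> set rem" using rem Cons c by simp
    have "\<forall>x\<in>set (concat (c # rest')). \<not> lexb x (hd c)" using ok Cons unfolding okshape_def by blast
    then have ex: "\<not> exl (\<lambda>x. lexb x h) rem" using rem Cons c by (simp add: exl_iff)
    have "concat (rev acc @ rest) = concat (rev acc) @ h # (r @ concat rest')" using Cons c by simp
    moreover have "set (concat acc) = set (concat (rev acc))" by simp
    ultimately have W: "okW (concat acc) h" using ok unfolding okshape_def by blast
    have "distinct (concat rest)" using ok by (simp add: okshape_def)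
    then have "set (removeAll h rem) = set (r @ concat rest')" using rem Cons c by auto
    moreover have "Suc (length (r @ concat rest') + length rest') < length f" using len Cons c by simp
    ultimately have "rev acc @ (rev [h] @ r) # rest' \<in> set (gen f (removeAll h rem) [h] acc)"
      using Cons.IH[where acc = acc and x = h and cur = "[]" and r = r and rest = rest' and rem = "removeAll h rem"] ok Cons c by simp
    then have "rev acc @ rest \<in> set (gen f (removeAll h rem) [h] acc)" using Cons c by simp
    moreover obtain z zs where z: "rem = z # zs" using h by (cases rem) auto
    ultimately show ?thesis using ex W h unfolding gen.simps z list.case by (auto simp del: exl.simps removeAll.simps intro!: bexI[of _ h])
  qed
  moreover have "rev acc @ (rev (x # cur) @ r) # rest \<in> set (gen (y # f) rem (x # cur) acc)"
    if ok: "okshape (rev acc @ (rev (x # cur) @ r) # rest)" and rem: "set rem = set (r @ concat rest)"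
      and len: "Suc (length (r @ concat rest) + length rest) < length (y # f)"
  proof (cases r)
    case Nil
    have d: "2 \<le> length (rev (x # cur))" "dirok (rev (rev (x # cur)))"
      using ok Nil unfolding okshape_def by auto
    then obtain z zs where z: "cur = z # zs" by (cases cur) auto
    have "rev (rev (x # cur) # acc) @ rest \<in> set (gen f rem [] (rev (x # cur) # acc))"
      using Cons.IH[where acc = "rev (x # cur) # acc" and rest = rest and rem = rem] ok rem len Nil by simp
    then show ?thesis using d(2) Nil unfolding gen.simps z list.case by simp
  next
    case (Cons w r')
    have w: "w \<in> set rem" using rem Cons by simp
    have "concat (rev acc @ (rev (x # cur) @ r) # rest) = (concat (rev acc) @ rev (x # cur)) @ w # (r' @ concat rest)"
      using Cons by simp
    moreover have "set (x # cur @ concat acc) = set (concat (rev acc) @ rev (x # cur))" by auto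
    ultimately have W: "okW (x # cur @ concat acc) w" using ok unfolding okshape_def by blast
    have "distinct (r @ concat rest)" using ok by (simp add: okshape_def)
    then have "set (removeAll w rem) = set (r' @ concat rest)" using rem Cons by auto
    moreover have "Suc (length (r' @ concat rest) + length rest) < length f" using len Cons by simp
    ultimately have "rev acc @ (rev (w # x # cur) @ r') # rest \<in> set (gen f (removeAll w rem) (w # x # cur) acc)"
      using Cons.IH[where acc = acc and x = w and cur = "x # cur" and r = r' and rest = rest and rem = "removeAll w rem"] ok Cons by simp
    then have "rev acc @ (rev (x # cur) @ r) # rest \<in> set (gen f (removeAll w rem) (w # x # cur) acc)"
      using Cons by simp
    then show ?thesis using W w unfolding gen.simps by (auto simp del: removeAll.simps intro!: bexI[of _ w])
  qed
  ultimately show ?case by blast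
qed simp

lemma minimal_okshape: assumes m: "minimal d cs G T" shows "okshape (map (map fst) cs)"
proof -
  have v: "valid d cs" using m by (simp add: minimal_def reaches_def)
  have 1: "okW vis w" if "concat (map (map fst) cs) = p @ w # q" "set vis = set p" for p w q vis
    using minimal_okW[OF m _ that(2), of w q] that(1) by (simp add: map_concat)
  have 2: "\<not> lexb x (hd c)" if c: "map (map fst) cs = p @ c # q" and x: "x \<in> set (concat (c # q))" for p c q x
  proof -
    obtain p' c' q' where cs: "cs = p' @ c' # q'" "c = map fst c'" "q = map (map fst) q'"
      using c by (auto simp: map_eq_append_conv map_eq_Cons_conv)
    have "c' \<noteq> []" using valid_cycle(3)[OF v, of c'] cs(1) by auto
    moreover have "x \<in> fst ` set (concat (c' # q'))" using x cs(2,3) by (auto simp: image_Un)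
    ultimately show ?thesis using minimal_head[of d p' c' q' G T x] m cs by (simp add: hd_map)
  qed
  have 3: "2 \<le> length c \<and> dirok (rev c)" if c: "c \<in> set (map (map fst) cs)" for c
  proof -
    obtain c' where "c' \<in> set cs" "c = map fst c'" using c by auto
    then show ?thesis using minimal_dirok[OF m, of c'] valid_cycle(3)[OF v, of c'] by simp
  qed
  have 4: "distinct (concat (map (map fst) cs))" using v by (simp add: valid_def map_concat)
  show ?thesis unfolding okshape_def using 1 2 3 4 by blast
qed

text \<open>There are at most as many cycles as leaves, since no cycle is empty. So twice the number
  of leaves bounds the steps.\<close>

lemma minimal_gen:
  assumes m: "minimal d cs G T" and L: "set L = {bs. length bs = d}" and f: "2 * card {bs :: bool list. length bs = d} < length f"
  shows "map (map fst) cs \<in> set (gen f L [] [])"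
proof -
  have v: "valid d cs" using m by (simp add: minimal_def reaches_def)
  have l: "length (concat cs) = card {bs :: bool list. length bs = d}" by (rule length_flat_valid(2)[OF v])
  have "length cs \<le> length (concat cs)" if "\<forall>c\<in>set cs. c \<noteq> []" for cs :: config
    using that by (induction cs) (auto simp: Suc_le_eq neq_Nil_conv)
  then have "length cs \<le> length (concat cs)" using valid_cycle(3)[OF v] by fastforce
  moreover have "length (concat (map (map fst) cs)) = length (concat cs)" by (metis length_map map_concat)
  moreover have "set L = set (concat (map (map fst) cs))"
    using v L unfolding valid_def map_concat by simp
  ultimately show ?thesis
    using gen_complete[of "[]" "map (map fst) cs" L f] minimal_okshape[OF m] f l by simp
qed

section \<open>Tests for the survivors of a shape\<close>

definition fallback :: "(z3 \<times> z3 \<times> z3) list list list \<Rightarrow> config list \<Rightarrow> sw list \<Rightarrow> config \<Rightarrow> bool" where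
  "fallback tss R S cs = (if exl (\<lambda>ts. all2 cycle3 ts cs) tss then True else
     if exl (\<lambda>c. c = cs) R then True else nonmin S cs)"

text \<open>The leaf colours of a hint depend on the shape only, so they are tabulated once and used
  for every surviving voltage assignment.\<close>

definition test_shape :: "config list \<Rightarrow> sw list \<Rightarrow> (sw \<times> sw \<times> sw) list \<Rightarrow> bool list list list \<Rightarrow> bool" where
  "test_shape R S hs sh = alll (fallback (map (\<lambda>h. map (map (tri h)) sh) hs) R S) (survivors S sh)"

lemma test_shape:
  assumes "test_shape R S hs (map (map fst) cs)" "minimal d cs G T" "snark (CG d cs)" "0 < d"
  shows "cs \<in> set R"
proof -
  have v: "valid d cs" using assms(2) by (simp add: minimal_def reaches_def)
  have "fallback (map (\<lambda>h. map (map (tri h)) (map (map fst) cs)) hs) R S cs"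
    using assms(1) survivors[OF v assms(4,3) minimal_nzok[OF assms(2)], of S] by (simp add: test_shape_def alll_iff)
  moreover have "\<not> all2 cycle3 (map (map (tri h)) (map (map fst) cs)) cs" for h
    using all2_cycle3_not_snark[OF v] assms(3) by blast
  moreover have "\<not> nonmin S cs" by (rule minimal_not_nonmin[OF assms(2)])
  ultimately show ?thesis by (auto simp: fallback_def exl_iff split: if_splits)
qed

definition check_shapes :: "bool list list \<Rightarrow> sw list \<Rightarrow> bool list list list list \<Rightarrow> bool list list list list \<Rightarrow> bool" where
  "check_shapes us S shs gs = alll (\<lambda>sh. if nonminS S sh then True else if closedS us sh then True else
     exl (\<lambda>s. s = sh) shs) gs"

lemma check_shapes:
  assumes "check_shapes us S shs (gen f L [] [])" "set L = {bs. length bs = d}" "[] \<notin> set us"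
    "2 * card {bs :: bool list. length bs = d} < length f" "minimal d cs G T" "snark (CG d cs)"
  shows "map (map fst) cs \<in> set shs"
proof -
  have v: "valid d cs" using assms(5) by (simp add: minimal_def reaches_def)
  show ?thesis
    using assms(1) minimal_gen[OF assms(5,2,4)] minimal_not_nonminS[OF assms(5), of S]
      closedS_not_snark[OF v _ assms(3)] assms(6)
    by (auto simp: check_shapes_def alll_iff exl_iff split: if_splits)
qed

section \<open>Code equations\<close>

text \<open>The simplifier normalises the branches of a conditional again, including the values they contain.
  The following equations therefore branch by pattern matching on an evaluated argument instead.\<close>

fun consne :: "z3 list \<Rightarrow> (z3 \<times> z3) list \<Rightarrow> (z3 list \<times> (z3 \<times> z3) list) list \<Rightarrow> (z3 list \<times> (z3 \<times> z3) list) list" where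
  "consne ts [] L = L"
| "consne ts (y # ys) L = (ts, y # ys) # L"

fun consif :: "bool \<Rightarrow> z3 list \<Rightarrow> (z3 list \<times> (z3 \<times> z3) list) list \<Rightarrow> (z3 list \<times> (z3 \<times> z3) list) list" where
  "consif True ts L = (ts, diag) # L"
| "consif False ts L = L"

lemma turnL_code [code]:
  "turnL [] = []" "turnL (([], p) # L) = turnL L" "turnL ((t # ts, p) # L) = consne ts (tpr t p) (turnL L)"
  by (simp_all split: list.split)

lemma closeL_code [code]: "closeL v [] = []" "closeL v ((ts, p) # L) = consif (loops v p) ts (closeL v L)"
  by simp_all

definition "snode M fl cur as cs acc a = sstep M fl cur as cs acc a Z0 @ sstep M True cur as cs acc a Z1 @
  (if fl then sstep M True cur as cs acc a Z2 else [])"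

definition "sgo b M fl cur as cs acc a v = (if b then [] else srch (adv v M) fl ((a, v) # cur) as cs acc)"

definition "sclose b M fl c cs acc v = (if b then [] else srch (closeL v M) fl [] [] cs (rev c # acc))"

lemma srch_code [code]:
  "srch [] fl cur [] [] acc = [rev acc]"
  "srch (x # L) fl cur [] [] acc = []"
  "srch L fl cur [] (c # cs) acc = srch L fl [] c cs acc"
  "srch L fl cur [a] cs acc = snode (turnL L) fl cur [] cs acc a"
  "srch L fl cur [a, b] [] acc = last0 fl L cur a b acc"
  "srch L fl cur [a, b] (c # cs) acc = snode (turnL L) fl cur [b] (c # cs) acc a"
  "srch L fl cur (a # b # a2 # as) cs acc = snode (turnL L) fl cur (b # a2 # as) cs acc a"
  by (simp_all add: snode_def)

lemma snode_code [code]: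
  "snode M True cur as cs acc a = sstep M True cur as cs acc a Z0 @ sstep M True cur as cs acc a Z1 @
    sstep M True cur as cs acc a Z2"
  "snode M False cur as cs acc a = sstep M False cur as cs acc a Z0 @ sstep M True cur as cs acc a Z1"
  by (simp_all add: snode_def)

lemma sstep_code [code]:
  "sstep M fl cur [] cs acc a v = sclose (closebad ((a, v) # cur)) M fl ((a, v) # cur) cs acc v"
  "sstep M fl cur (b # as) cs acc a v = sgo (stepbad cur a v b) M fl cur (b # as) cs acc a v"
  by (simp_all add: sclose_def sgo_def)

lemma sgo_code [code]:
  "sgo True M fl cur as cs acc a v = []"
  "sgo False M fl cur as cs acc a v = srch (adv v M) fl ((a, v) # cur) as cs acc"
  by (simp_all add: sgo_def)

lemma sclose_code [code]:
  "sclose True M fl c cs acc v = []"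
  "sclose False M fl c cs acc v = srch (closeL v M) fl [] [] cs (rev c # acc)"
  by (simp_all add: sclose_def)

definition "hit_go b L v w \<longleftrightarrow> b \<or> hitL L v w"

lemma hitL_code [code]: "hitL [] v w = False" "hitL ((ts, p) # L) v w = hit_go (hite ts p v w) L v w"
  by (simp_all add: hit_go_def)

lemma hit_go_code [code]: "hit_go True L v w = True" "hit_go False L v w = hitL L v w"
  by (simp_all add: hit_go_def)

definition "exl_go b P xs \<longleftrightarrow> b \<or> exl P xs"
definition "alll_go b P xs \<longleftrightarrow> b \<and> alll P xs"

lemma exl_code [code]: "exl P [] = False" "exl P (x # xs) = exl_go (P x) P xs"
  by (simp_all add: exl_go_def)

lemma alll_code [code]: "alll P [] = True" "alll P (x # xs) = alll_go (P x) P xs"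
  by (simp_all add: alll_go_def)

lemma exl_go_code [code]: "exl_go True P xs = True" "exl_go False P xs = exl P xs"
  by (simp_all add: exl_go_def)

lemma alll_go_code [code]: "alll_go True P xs = alll P xs" "alll_go False P xs = False"
  by (simp_all add: alll_go_def)

definition "all2_go b P xs ys \<longleftrightarrow> b \<and> all2 P xs ys"

lemma all2_code [code]:
  "all2 P [] [] = True" "all2 P (x # xs) (y # ys) = all2_go (P x y) P xs ys"
  "all2 P [] (y # ys) = False" "all2 P (x # xs) [] = False"
  by (simp_all add: all2_go_def)

lemma all2_go_code [code]: "all2_go True P xs ys = all2 P xs ys" "all2_go False P xs ys = False"
  by (simp_all add: all2_go_def)

definition "turn_go b y ts c k x = (if b then None else turn ts c k (third y x))"
definition "turn_sel y ts c k x = turn_go (x = y) y ts c k x"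

lemma turn_code [code]:
  "turn ts [] k x = Some x" "turn [] (p # c) k x = None"
  "turn (t # ts) ((a, v) # c) k x = turn_sel (sel t k) ts c (k + v) x"
  by (simp_all add: turn_sel_def turn_go_def Let_def)

lemma turn_go_code [code]:
  "turn_go True y ts c k x = None" "turn_go False y ts c k x = turn ts c k (third y x)"
  by (simp_all add: turn_go_def)

fun hit :: "z3 \<Rightarrow> z3 option \<Rightarrow> bool" where
  "hit x None = False"
| "hit x (Some y) = (x = y)"

fun turn2 :: "z3 option \<Rightarrow> z3 \<Rightarrow> (z3 \<times> z3 \<times> z3) list \<Rightarrow> ('a \<times> z3) list \<Rightarrow> z3 option" where
  "turn2 None k ts c = None"
| "turn2 (Some x) k ts c = turn ts c k x"

definition "long_hit n ts c x = hit x (turn2 (turn2 (turn ts c Z0 x) n ts c) (n + n) ts c)"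
definition "loop_hit k ts c x = hit x (turn ts c k x)"

fun ex3 :: "bool \<Rightarrow> (z3 \<Rightarrow> bool) \<Rightarrow> z3 list \<Rightarrow> bool" where
  "ex3 True P xs = True"
| "ex3 False P [] = False"
| "ex3 False P (x # xs) = ex3 (P x) P xs"

fun all3 :: "bool \<Rightarrow> (z3 \<Rightarrow> bool) \<Rightarrow> z3 list \<Rightarrow> bool" where
  "all3 False P xs = False"
| "all3 True P [] = True"
| "all3 True P (x # xs) = all3 (P x) P xs"

fun cycle3_net :: "z3 \<Rightarrow> (z3 \<times> z3 \<times> z3) list \<Rightarrow> ('a \<times> z3) list \<Rightarrow> bool" where
  "cycle3_net Z0 ts c = all3 True (\<lambda>k. ex3 False (loop_hit k ts c) [Z0, Z1, Z2]) [Z0, Z1, Z2]"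
| "cycle3_net Z1 ts c = ex3 False (long_hit Z1 ts c) [Z0, Z1, Z2]"
| "cycle3_net Z2 ts c = ex3 False (long_hit Z2 ts c) [Z0, Z1, Z2]"

lemma cycle3_code [code]: "cycle3 ts c = cycle3_net (net c) ts c"
proof -
  have hit: "hit x o' = (o' = Some x)" for x o' by (cases o') auto
  have ex: "ex3 False P [Z0, Z1, Z2] = (if P Z0 then True else if P Z1 then True else P Z2)" for P
    by (cases "P Z0"; cases "P Z1"; cases "P Z2") simp_all
  have all: "all3 True P [Z0, Z1, Z2] = (if P Z0 then if P Z1 then P Z2 else False else False)" for P
    by (cases "P Z0"; cases "P Z1"; cases "P Z2") simp_all
  have long: "long_hit n ts c x = (case turn ts c Z0 x of None \<Rightarrow> False | Some y \<Rightarrow>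
      (case turn ts c n y of None \<Rightarrow> False | Some z \<Rightarrow> turn ts c (n + n) z = Some x))" for n x
    by (auto simp: long_hit_def hit split: option.splits)
  show ?thesis
    by (cases "net c") (simp_all only: cycle3_def cycle3_net.simps ex all long loop_hit_def hit Let_def z3.distinct if_True if_False simp_thms)
qed

definition "fallback2 b R S cs \<longleftrightarrow> b \<or> (if exl (\<lambda>c. c = cs) R then True else nonmin S cs)"
definition "fallback3 b S cs \<longleftrightarrow> b \<or> nonmin S cs"

lemma fallback_code [code]:
  "fallback tss R S cs = fallback2 (exl (\<lambda>ts. all2 cycle3 ts cs) tss) R S cs"
  by (simp add: fallback_def fallback2_def)

lemma fallback2_code [code]:
  "fallback2 True R S cs = True" "fallback2 False R S cs = fallback3 (exl (\<lambda>c. c = cs) R) S cs"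
  by (simp_all add: fallback2_def fallback3_def)

lemma fallback3_code [code]: "fallback3 True S cs = True" "fallback3 False S cs = nonmin S cs"
  by (simp_all add: fallback3_def)

definition "shape_go1 b us S sh \<longleftrightarrow> b \<or> closedS us sh \<or> nonminS S sh"
definition "shape_go2 b S sh \<longleftrightarrow> b \<or> nonminS S sh"

lemma check_shapes_code [code]:
  "check_shapes us S shs gs = alll (\<lambda>sh. shape_go1 (exl (\<lambda>s. s = sh) shs) us S sh) gs"
  unfolding check_shapes_def alll_iff shape_go1_def by (intro ball_cong refl) simp

lemma shape_go_code [code]:
  "shape_go1 True us S sh = True" "shape_go1 False us S sh = shape_go2 (closedS us sh) S sh"
  "shape_go2 True S sh = True" "shape_go2 False S sh = nonminS S sh"
  by (simp_all add: shape_go1_def shape_go2_def)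

section \<open>Executable checks for cubic graphs\<close>

definition nbfun :: "'v ugraph \<Rightarrow> ('v \<Rightarrow> 'v list) \<Rightarrow> bool" where
  "nbfun G N \<longleftrightarrow> (\<forall>v\<in>verts G. set (N v) = {u. adj G v u})"

lemma nbfunD: "nbfun G N \<Longrightarrow> v \<in> verts G \<Longrightarrow> u \<in> set (N v) \<longleftrightarrow> adj G v u"
  by (auto simp: nbfun_def)

definition mem_go :: "bool \<Rightarrow> 'a \<Rightarrow> 'a list \<Rightarrow> bool" where "mem_go b x ys \<longleftrightarrow> b \<or> x \<in> set ys"
definition mem :: "'a \<Rightarrow> 'a list \<Rightarrow> bool" where "mem x ys \<longleftrightarrow> x \<in> set ys"

lemma mem_code [code]: "mem x [] = False" "mem x (y # ys) = mem_go (x = y) x ys"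
  "mem_go True x ys = True" "mem_go False x ys = mem x ys"
  by (auto simp: mem_def mem_go_def)

fun dist :: "'a list \<Rightarrow> bool" where "dist [] = True" | "dist (x # xs) = (\<not> mem x xs \<and> dist xs)"

lemma dist_iff: "dist xs = distinct xs" by (induction xs) (auto simp: mem_def)

definition local_check :: "('v \<Rightarrow> 'v list) \<Rightarrow> 'v list \<Rightarrow> bool" where
  "local_check N vs \<longleftrightarrow> alll (\<lambda>v. length (N v) = 3 \<and> dist (N v @ concat (map (\<lambda>y. filter (\<lambda>z. z \<noteq> v) (N y)) (N v)))) vs"

text \<open>If the neighbours of \<open>v\<close> and their further neighbours are pairwise
  different, no triangle and no square passes through \<open>v\<close>.\<close>

lemma local_check:
  assumes G: "graph G" and N: "nbfun G N" and vs: "set vs = verts G" and c: "local_check N vs"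
  shows "regular 3 G" "girth_at_least 5 G"
proof -
  have 1: "length (N v) = 3" "distinct (N v)" "distinct (concat (map (\<lambda>y. filter (\<lambda>z. z \<noteq> v) (N y)) (N v)))"
    "\<And>y z. y \<in> set (N v) \<Longrightarrow> z \<in> set (N v) \<Longrightarrow> z \<in> set (N y) \<Longrightarrow> z = v" if "v \<in> verts G" for v
  proof -
    have *: "length (N v) = 3 \<and> distinct (N v @ concat (map (\<lambda>y. filter (\<lambda>z. z \<noteq> v) (N y)) (N v)))"
      using c vs that by (simp add: local_check_def alll_iff dist_iff)
    then show "length (N v) = 3" "distinct (N v)" "distinct (concat (map (\<lambda>y. filter (\<lambda>z. z \<noteq> v) (N y)) (N v)))"
      by simp_all
    fix y z assume "y \<in> set (N v)" "z \<in> set (N v)" "z \<in> set (N y)"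
    then show "z = v" using * by auto
  qed
  show "regular 3 G" unfolding regular_def
  proof
    fix v assume v: "v \<in> verts G"
    have "degree G v = card (set (N v))" using N v by (simp add: degree_adj[OF G] nbfun_def)
    then show "degree G v = 3" using 1(1,2)[OF v] by (simp add: distinct_card)
  qed
  show "girth_at_least 5 G"
  proof (rule girth_at_least_5I[OF G])
    fix x y z assume a: "adj G x y" "adj G y z" "adj G z x"
    have v: "x \<in> verts G" "y \<in> verts G" "z \<noteq> x" using graph_adjD[OF G] a by blast+
    have "adj G x z" using a(3) by (simp add: adj_sym[of G x z])
    then show False using 1(4)[OF v(1), of y z] a v by (simp add: nbfunD[OF N])
  next
    fix x y z w assume a: "adj G x y" "adj G y z" "adj G z w" "adj G w x" "x \<noteq> z" "y \<noteq> w"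
    have v: "x \<in> verts G" "y \<in> verts G" "w \<in> verts G" using graph_adjD[OF G] a by blast+
    have s: "adj G x w" "adj G w z" using a(3,4) adj_sym[of G] by blast+
    let ?f = "\<lambda>y. filter (\<lambda>z. z \<noteq> x) (N y)"
    have z: "z \<in> set (?f y)" "z \<in> set (?f w)" using a s v by (simp_all add: nbfunD[OF N])
    have yw: "y \<in> set (N x)" "w \<in> set (N x)" using a s v by (simp_all add: nbfunD[OF N])
    \<comment> \<open>Distinctness of the concatenation makes the lists of \<open>y\<close> and
      \<open>w\<close> disjoint only once they are known to be different lists; this in turn holds
      because both are nonempty, containing \<open>z\<close>.\<close>
    have "?f y \<noteq> ?f w"
    proof
      assume e: "?f y = ?f w"
      have d: "distinct (removeAll [] (map ?f (N x)))" using 1(3)[OF v(1)] by (simp add: distinct_concat_iff)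
      have "?f y \<noteq> []" using z(1) by fastforce
      moreover have "distinct (filter (\<lambda>l. l \<noteq> []) (map ?f (N x)))"
        using d by (simp add: removeAll_filter_not_eq eq_commute[of "[]"] )
      ultimately show False
      proof -
        have "inj_on ?f {y \<in> set (N x). ?f y \<noteq> []}"
        proof -
          have "distinct (map ?f (filter (\<lambda>y. ?f y \<noteq> []) (N x)))"
            using \<open>distinct (filter (\<lambda>l. l \<noteq> []) (map ?f (N x)))\<close> by (simp add: filter_map o_def)
          then have "inj_on ?f (set (filter (\<lambda>y. ?f y \<noteq> []) (N x)))" by (simp only: distinct_map)
          then show ?thesis by simp
        qed
        then have "y = w"
        proof (rule inj_onD[where f = ?f and x = y and y = w, OF _ e])
          show "y \<in> {y \<in> set (N x). ?f y \<noteq> []}" using yw(1) \<open>?f y \<noteq> []\<close> by blast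
          show "w \<in> {y \<in> set (N x). ?f y \<noteq> []}" using yw(2) \<open>?f y \<noteq> []\<close> e by simp
        qed
        then show False using a(6) by blast
      qed
    qed
    moreover have "?f y \<in> set (map ?f (N x))" "?f w \<in> set (map ?f (N x))" using yw by auto
    ultimately have "set (?f y) \<inter> set (?f w) = {}" using 1(3)[OF v(1)] unfolding distinct_concat_iff by blast
    then show False using z by blast
  qed
qed

section \<open>Cyclic edge connectivity by a search through bipartitions\<close>

fun trim1 :: "bool \<Rightarrow> bool list \<Rightarrow> bool list" where
  "trim1 False [] = []"
| "trim1 b bs = b # bs"

fun trim :: "bool list \<Rightarrow> bool list" where
  "trim [] = []"
| "trim (b # bs) = trim1 b (trim bs)"

text \<open>For each vertex, the bits telling which earlier vertices are related to it, the latest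
  first. Adjacency is thereby computed once, outside the exponential search. Trimming the trailing
  \<open>False\<close> entries lets a scan stop at the oldest relevant vertex.\<close>

fun masks :: "('v \<Rightarrow> 'v \<Rightarrow> bool) \<Rightarrow> 'v list \<Rightarrow> 'v list \<Rightarrow> bool list list" where
  "masks R [] ps = []"
| "masks R (v # vs) ps = trim (map (R v) ps) # masks R vs (v # ps)"

fun pay :: "bool \<Rightarrow> nat \<Rightarrow> nat" where
  "pay True n = n" | "pay False (Suc n) = n" | "pay False 0 = 0"

text \<open>The budget left after placing a vertex on side \<open>x\<close>: each earlier neighbour
  on the other side contributes a crossing edge and costs 1.\<close>

fun cm :: "bool list \<Rightarrow> bool list \<Rightarrow> bool \<Rightarrow> nat \<Rightarrow> nat" where
  "cm [] ms x n = n"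
| "cm (b # k) [] x n = n"
| "cm (False # k) (m # ms) x n = cm k ms x n"
| "cm (True # k) (m # ms) x n = cm k ms x (pay (m = x) n)"

lemma cm_trim1: "cm (trim1 b bs) ms x n = cm (b # bs) ms x n"
  by (cases b; cases bs; cases ms) simp_all

lemma cm_Cons_cong: "(\<And>n. cm k ms x n = cm k' ms x n) \<Longrightarrow> cm (b # k) (m # ms) x n = cm (b # k') (m # ms) x n"
  by (cases b) simp_all

lemma cm_trim: "cm (trim k) ms x n = cm k ms x n"
proof (induction k arbitrary: ms n)
  case (Cons b k)
  show ?case
  proof (cases ms)
    case (Cons m ms')
    then show ?thesis by (simp only: trim.simps cm_trim1 Cons cm_Cons_cong[OF Cons.IH])
  qed (simp add: cm_trim1)
qed simp

lemma cm_filter: "cm (map P ps) (map f ps) x n = n - length (filter (\<lambda>u. P u \<and> f u \<noteq> x) ps)"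
proof (induction ps arbitrary: n)
  case (Cons p ps)
  have "pay b n = n - (if b then 0 else 1)" for b n by (cases b; cases n) simp_all
  then show ?case using Cons by (cases "P p") simp_all
qed simp

fun few :: "nat \<Rightarrow> bool \<Rightarrow> bool list \<Rightarrow> bool" where
  "few n b [] = True"
| "few 0 True (True # m) = False"
| "few (Suc n) True (True # m) = few n True m"
| "few 0 False (False # m) = False"
| "few (Suc n) False (False # m) = few n False m"
| "few n True (False # m) = few n True m"
| "few n False (True # m) = few n False m"

lemma few: "few n b m \<Longrightarrow> length (filter (\<lambda>x. x = b) m) \<le> n"
  by (induction n b m rule: few.induct) simp_all

text \<open>A branch ends successfully once four crossing edges have been met. A bipartition with
  fewer must have a side of at most four vertices, which in a graph of girth 5 contains no
  cycle.\<close>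

fun cutsearch :: "bool list list \<Rightarrow> bool list \<Rightarrow> nat \<Rightarrow> bool" where
  "cutsearch ks m 0 = True"
| "cutsearch [] m (Suc n) = (few 4 True m \<or> few 4 False m)"
| "cutsearch (k # ks) m (Suc n) = (cutsearch ks (True # m) (cm k m True (Suc n)) \<and>
     cutsearch ks (False # m) (cm k m False (Suc n)))"

definition crossing :: "'v ugraph \<Rightarrow> 'v set \<Rightarrow> 'v set set" where
  "crossing G X = {e \<in> edges G. e \<inter> X \<noteq> {} \<and> \<not> e \<subseteq> X}"

lemma crossing_Compl: "crossing G (- X) = crossing G X"
  by (auto simp: crossing_def)

text \<open>The budget is always 4 minus the number of crossing edges among the vertices placed so
  far; the recursion follows the branch that agrees with \<open>X\<close>.\<close>

lemma cutsearch:
  assumes G: "graph G" and N: "nbfun G N"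
  shows "cutsearch (masks (\<lambda>v u. mem u (N v)) vs ps) (map (\<lambda>v. v \<in> X) ps) (4 - card {e \<in> crossing G X. e \<subseteq> set ps}) \<Longrightarrow>
    distinct (vs @ ps) \<Longrightarrow> set vs \<union> set ps \<subseteq> verts G \<Longrightarrow> card (crossing G X) < 4 \<Longrightarrow>
    length (filter (\<lambda>v. v \<in> X) (vs @ ps)) \<le> 4 \<or> length (filter (\<lambda>v. v \<notin> X) (vs @ ps)) \<le> 4"
proof (induction vs arbitrary: ps)
  case Nil
  have fin: "finite (crossing G X)" using graph_finite_edges[OF G] by (simp add: crossing_def)
  have "card {e \<in> crossing G X. e \<subseteq> set ps} \<le> card (crossing G X)" by (rule card_mono[OF fin]) blast
  then have "0 < 4 - card {e \<in> crossing G X. e \<subseteq> set ps}" using Nil(4) by linarith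
  then obtain n where n: "4 - card {e \<in> crossing G X. e \<subseteq> set ps} = Suc n" using gr0_implies_Suc by blast
  have "few 4 True (map (\<lambda>v. v \<in> X) ps) \<or> few 4 False (map (\<lambda>v. v \<in> X) ps)"
    using Nil(1) by (simp only: n masks.simps cutsearch.simps)
  then show ?case
  proof
    assume "few 4 True (map (\<lambda>v. v \<in> X) ps)"
    from few[OF this] show ?thesis by (simp add: filter_map o_def)
  next
    assume "few 4 False (map (\<lambda>v. v \<in> X) ps)"
    from few[OF this] show ?thesis by (simp add: filter_map o_def)
  qed
next
  case (Cons v vs)
  let ?cr = "\<lambda>ps. {e \<in> crossing G X. e \<subseteq> set ps}"
  let ?K = "filter (\<lambda>u. mem u (N v) \<and> (u \<in> X) \<noteq> (v \<in> X)) ps"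
  have fin: "finite (crossing G X)" using graph_finite_edges[OF G] by (simp add: crossing_def)
  have v: "v \<in> verts G" "v \<notin> set ps" using Cons.prems by auto
  have "card (?cr ps) \<le> card (crossing G X)" by (rule card_mono[OF fin]) blast
  then have "0 < 4 - card (?cr ps)" using Cons.prems(4) by linarith
  then obtain n where n: "4 - card (?cr ps) = Suc n" using gr0_implies_Suc by blast
  have split: "?cr (v # ps) = ?cr ps \<union> (\<lambda>u. {v, u}) ` set ?K" (is "?L = ?A \<union> ?B")
  proof
    show "?L \<subseteq> ?A \<union> ?B"
    proof
      fix e assume e: "e \<in> ?L"
      show "e \<in> ?A \<union> ?B"
      proof (cases "v \<in> e")
        case False then show ?thesis using e by auto
      next
        case True
        have eG: "e \<in> edges G" "e \<inter> X \<noteq> {}" "\<not> e \<subseteq> X" "e \<subseteq> insert v (set ps)" using e by (auto simp: crossing_def)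
        have "card e = 2" using graph_edgeD[OF G eG(1)] by blast
        then obtain a b where "e = {a, b}" "a \<noteq> b" by (meson card_2_iff)
        then obtain u where u: "e = {v, u}" "u \<noteq> v" using True by blast
        have "adj G v u" using eG(1) u by (simp add: adj_def)
        then have "u \<in> set ?K" using eG u v by (auto simp: mem_def nbfunD[OF N])
        then show ?thesis using u by blast
      qed
    qed
    show "?A \<union> ?B \<subseteq> ?L"
      using v by (auto simp: crossing_def mem_def nbfunD[OF N] adj_def)
  qed
  have "?cr ps \<inter> (\<lambda>u. {v, u}) ` set ?K = {}" using v by auto
  moreover have "inj_on (\<lambda>u. {v, u}) (set ?K)" by (auto simp: inj_on_def doubleton_eq_iff)
  moreover have "distinct ?K" using Cons.prems by simp
  moreover have "finite (?cr ps)" using fin by simp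
  ultimately have card: "card (?cr (v # ps)) = card (?cr ps) + length ?K"
    by (simp only: split card_Un_disjoint[OF _ finite_imageI[OF finite_set]] card_image distinct_card)
  have f: "(\<lambda>u. mem u (N v) \<and> (u \<in> X) \<noteq> x) = (\<lambda>u. mem u (N v) \<and> (u \<in> X) \<noteq> (v \<in> X))" if "x = (v \<in> X)" for x
    using that by simp
  have cmv: "cm (trim (map (\<lambda>u. mem u (N v)) ps)) (map (\<lambda>v. v \<in> X) ps) (v \<in> X) (Suc n) = 4 - card (?cr (v # ps))"
    by (simp only: cm_trim cm_filter card n[symmetric] diff_diff_left)
  have "cutsearch (masks (\<lambda>v u. mem u (N v)) vs (v # ps)) ((v \<in> X) # map (\<lambda>v. v \<in> X) ps)
      (cm (trim (map (\<lambda>u. mem u (N v)) ps)) (map (\<lambda>v. v \<in> X) ps) (v \<in> X) (Suc n))"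
    using Cons.prems(1) unfolding n masks.simps cutsearch.simps by (cases "v \<in> X") (simp_all only: simp_thms)
  then have "cutsearch (masks (\<lambda>v u. mem u (N v)) vs (v # ps)) (map (\<lambda>v. v \<in> X) (v # ps)) (4 - card (?cr (v # ps)))"
    by (simp only: cmv list.map)
  from Cons.IH[OF this] Cons.prems
  have "length (filter (\<lambda>v. v \<in> X) (vs @ v # ps)) \<le> 4 \<or> length (filter (\<lambda>v. v \<notin> X) (vs @ v # ps)) \<le> 4" by auto
  then show ?case by (auto split: if_splits)
qed

lemma adj_rtranclp_mono:
  assumes "edges H \<subseteq> edges K" "(adj H)\<^sup>*\<^sup>* a b" shows "(adj K)\<^sup>*\<^sup>* a b"
proof -
  have "adj H \<le> adj K" using assms(1) by (auto simp: adj_def)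
  then show ?thesis using assms(2) rtranclp_mono by (metis predicate2D)
qed

text \<open>If deleting \<open>F\<close> separates two cycles, let \<open>X\<close> be the component
  containing the first. All edges leaving \<open>X\<close> belong to \<open>F\<close>, so there are
  at most three, yet both sides contain a cycle and thus at least five vertices.\<close>

lemma cyclically_edge_connected_4I:
  assumes G: "graph G" and N: "nbfun G N" and g: "girth_at_least 5 G"
    and vs: "set (v # vs) = verts G" "distinct (v # vs)"
    and c: "cutsearch (masks (\<lambda>v u. mem u (N v)) vs [v]) [True] 4"
  shows "cyclically_edge_connected 4 G"
  unfolding cyclically_edge_connected_def
proof (intro allI impI ballI, elim conjE, rule ccontr)
  fix F C D u w
  assume F: "F \<subseteq> edges G" "card F < 4" and C: "cycle C" "subgraph C (delete_edges G F)"
    and D: "cycle D" "subgraph D (delete_edges G F)" and uw: "u \<in> verts C" "w \<in> verts D"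
    and nr: "\<not> (adj (delete_edges G F))\<^sup>*\<^sup>* u w"
  define H where "H = delete_edges G F"
  define X where "X = {x. (adj H)\<^sup>*\<^sup>* u x}"
  have eH: "edges H = edges G - F" "verts H = verts G" by (simp_all add: H_def delete_edges_def)
  have cross: "crossing G X \<subseteq> F"
  proof
    fix e assume "e \<in> crossing G X"
    then have e: "e \<in> edges G" "e \<inter> X \<noteq> {}" "\<not> e \<subseteq> X" by (auto simp: crossing_def)
    have "card e = 2" using graph_edgeD[OF G e(1)] by blast
    then obtain p q where pq: "e = {p, q}" by (meson card_2_iff)
    obtain a b where ab: "e = {a, b}" "a \<in> X" "b \<notin> X"
    proof (cases "p \<in> X")
      case True then show thesis using that[of p q] e pq by blast
    next
      case False then show thesis using that[of q p] e pq by blast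
    qed
    show "e \<in> F"
    proof (rule ccontr)
      assume "e \<notin> F"
      then have "adj H a b" using ab e by (simp add: adj_def eH)
      then have "b \<in> X" using ab(2) unfolding X_def by (simp add: rtranclp.rtrancl_into_rtrancl)
      then show False using ab(3) by blast
    qed
  qed
  have finF: "finite F" using F(1) graph_finite_edges[OF G] finite_subset by blast
  have small: "card (crossing G X) < 4" using card_mono[OF finF cross] F(2) by linarith
  have CG: "subgraph C G" "subgraph D G" using C(2) D(2) by (auto simp: subgraph_def delete_edges_def)
  have eC: "edges C \<subseteq> edges H" "edges D \<subseteq> edges H" using C(2) D(2) by (auto simp: subgraph_def H_def)
  have CX: "verts C \<subseteq> X"
  proof
    fix x assume "x \<in> verts C"
    then have "(adj C)\<^sup>*\<^sup>* u x" using C(1) uw(1) by (simp add: cycle_def connected_graph_def)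
    from adj_rtranclp_mono[OF eC(1) this] show "x \<in> X" by (simp add: X_def)
  qed
  have DX: "verts D \<inter> X = {}"
  proof (rule ccontr)
    assume "verts D \<inter> X \<noteq> {}"
    then obtain x where x: "x \<in> verts D" "x \<in> X" by blast
    have "(adj D)\<^sup>*\<^sup>* x w" using D(1) uw(2) x(1) by (simp add: cycle_def connected_graph_def)
    from adj_rtranclp_mono[OF eC(2) this] have "(adj H)\<^sup>*\<^sup>* x w" .
    moreover have "(adj H)\<^sup>*\<^sup>* u x" using x(2) by (simp add: X_def)
    ultimately show False using nr rtranclp_trans unfolding H_def by metis
  qed
  have 5: "5 \<le> card (verts C)" "5 \<le> card (verts D)"
    using g C(1) D(1) CG unfolding girth_at_least_def by blast+
  have sub: "verts C \<subseteq> verts G" "verts D \<subseteq> verts G" using CG by (auto simp: subgraph_def)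
  have len: "card (verts K) \<le> length (filter P (vs @ [v]))" if "verts K \<subseteq> verts G" "\<And>x. x \<in> verts K \<Longrightarrow> P x" for K :: "'a ugraph" and P
  proof -
    have d: "distinct (filter P (vs @ [v]))" using vs(2) by auto
    have "verts K \<subseteq> set (filter P (vs @ [v]))"
    proof
      fix x assume x: "x \<in> verts K"
      then have "x \<in> set (v # vs)" using that(1) vs(1) by blast
      then show "x \<in> set (filter P (vs @ [v]))" using that(2)[OF x] by auto
    qed
    from card_mono[OF finite_set this] show ?thesis by (simp only: distinct_card[OF d])
  qed
  have main: False if "v \<in> Y" "card (crossing G Y) < 4"
    and "5 \<le> length (filter (\<lambda>v. v \<in> Y) (vs @ [v]))" "5 \<le> length (filter (\<lambda>v. v \<notin> Y) (vs @ [v]))" for Y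
  proof -
    have "e \<notin> crossing G Y" if "e \<subseteq> {v}" for e
      using that \<open>v \<in> Y\<close> by (auto simp: crossing_def)
    then have 0: "{e \<in> crossing G Y. e \<subseteq> set [v]} = {}" by auto
    have "cutsearch (masks (\<lambda>v u. mem u (N v)) vs [v]) (map (\<lambda>v. v \<in> Y) [v]) (4 - card {e \<in> crossing G Y. e \<subseteq> set [v]})"
      using c that(1) unfolding 0 by simp
    from cutsearch[OF G N this _ _ that(2)] show False using vs that(3,4) by auto
  qed
  have l: "5 \<le> length (filter (\<lambda>v. v \<in> X) (vs @ [v]))" "5 \<le> length (filter (\<lambda>v. v \<notin> X) (vs @ [v]))"
    using len[OF sub(1), of "\<lambda>v. v \<in> X"] len[OF sub(2), of "\<lambda>v. v \<notin> X"] CX DX 5 by force+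
  \<comment> \<open>The search places its first vertex on side \<open>True\<close>; if that vertex
    lies outside \<open>X\<close>, the complement has the same crossing edges.\<close>
  show False
  proof (cases "v \<in> X")
    case True show False by (rule main[OF True small l])
  next
    case False
    show False by (rule main[of "- X"]) (use False small l in \<open>simp_all only: crossing_Compl Compl_iff not_not\<close>, simp)
  qed
qed

section \<open>Non-colourability by exhaustive search\<close>

fun used_go :: "bool \<Rightarrow> z3 \<Rightarrow> bool list \<Rightarrow> z3 list \<Rightarrow> bool" and used :: "z3 \<Rightarrow> bool list \<Rightarrow> z3 list \<Rightarrow> bool" where
  "used_go True x k ms = True"
| "used_go False x k ms = used x k ms"
| "used x [] m = False"
| "used x (b # k) [] = False"
| "used x (False # k) (m # ms) = used x k ms"
| "used x (True # k) (m # ms) = used_go (x = m) x k ms"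

lemma used_trim1: "used x (trim1 b bs) ms = used x (b # bs) ms"
  by (cases b; cases bs; cases ms) simp_all

lemma used_go_iff: "used_go b x k ms \<longleftrightarrow> b \<or> used x k ms" by (cases b) simp_all

lemma used_trim: "used x (trim k) ms = used x k ms"
proof (induction k arbitrary: ms)
  case (Cons b k)
  show ?case using Cons.IH by (cases ms; cases b) (simp_all add: used_trim1 used_go_iff)
qed simp

lemma used_map: "used x (map P ps) (map f ps) \<longleftrightarrow> (\<exists>u\<in>set ps. P u \<and> f u = x)"
proof (induction ps)
  case (Cons p ps)
  then show ?case by (cases "P p") (auto simp: used_go_iff)
qed simp

text \<open>The masks now relate edges instead of vertices: a colour is blocked if an earlier edge
  meeting the new one has it. Reaching the end of the list would be a colouring, hence the value
  \<open>False\<close> there.\<close>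

fun nocol :: "bool list list \<Rightarrow> z3 list \<Rightarrow> bool" and nocol_go :: "bool \<Rightarrow> z3 \<Rightarrow> bool list list \<Rightarrow> z3 list \<Rightarrow> bool" where
  "nocol [] m = False"
| "nocol (k # ks) m = (nocol_go (used Z0 k m) Z0 ks m \<and> nocol_go (used Z1 k m) Z1 ks m \<and> nocol_go (used Z2 k m) Z2 ks m)"
| "nocol_go True x ks m = True"
| "nocol_go False x ks m = nocol ks (x # m)"

lemma nocol_go_iff: "nocol_go b x ks m \<longleftrightarrow> b \<or> nocol ks (x # m)" by (cases b) simp_all

fun meets :: "'v \<times> 'v \<Rightarrow> 'v \<times> 'v \<Rightarrow> bool" where
  "meets (a, b) (c, e) = (if a = c then b \<noteq> e else if b = c then a \<noteq> e else if a = e then True else b = e)"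

lemma meets: "meets (a, b) (c, e) \<Longrightarrow> a \<noteq> b \<Longrightarrow> c \<noteq> e \<Longrightarrow> {a, b} \<noteq> {c, e} \<and> {a, b} \<inter> {c, e} \<noteq> {}"
  by (auto simp: doubleton_eq_iff split: if_splits)

lemma nocol:
  "nocol (masks meets es ps) (map c ps) \<Longrightarrow> (\<And>e f. e \<in> set (es @ ps) \<Longrightarrow> f \<in> set (es @ ps) \<Longrightarrow> meets e f \<Longrightarrow> c e \<noteq> c f) \<Longrightarrow> False"
proof (induction es arbitrary: ps)
  case (Cons e es)
  have "\<not> used (c e) (trim (map (meets e) ps)) (map c ps)"
    unfolding used_trim used_map using Cons.prems(2)[of e] by fastforce
  then have "nocol (masks meets es (e # ps)) (map c (e # ps))"
    using Cons.prems(1) by (cases "c e") (simp_all add: nocol_go_iff)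
  from Cons.IH[OF this] Cons.prems(2) show False by auto
qed simp

text \<open>An edge within the list of vertices is listed at the end that comes first;
  \<open>ps\<close> holds the vertices already treated.\<close>

fun elist :: "('v \<Rightarrow> 'v list) \<Rightarrow> 'v list \<Rightarrow> 'v list \<Rightarrow> ('v \<times> 'v) list" where
  "elist N [] ps = []"
| "elist N (v # vs) ps = map (Pair v) (filter (\<lambda>u. \<not> mem u ps) (N v)) @ elist N vs (v # ps)"

lemma elist: "(a, b) \<in> set (elist N vs ps) \<Longrightarrow> a \<in> set vs \<and> b \<in> set (N a)"
  by (induction vs arbitrary: ps) auto

lemma elist_complete:
  "v \<in> set vs \<Longrightarrow> u \<in> set (N v) \<Longrightarrow> v \<in> set (N u) \<Longrightarrow> u \<notin> set ps \<Longrightarrow> v \<notin> set ps \<Longrightarrow> u \<in> set vs \<Longrightarrow>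
    (v, u) \<in> set (elist N vs ps) \<or> (u, v) \<in> set (elist N vs ps)"
proof (induction vs arbitrary: ps)
  case (Cons a vs)
  consider "a = v" | "a = u" | "a \<noteq> v" "a \<noteq> u" by blast
  then show ?case
  proof cases
    case 3
    then have "(v, u) \<in> set (elist N vs (a # ps)) \<or> (u, v) \<in> set (elist N vs (a # ps))"
      using Cons.IH[of "a # ps"] Cons.prems by simp
    then show ?thesis unfolding elist.simps set_append by blast
  qed (use Cons.prems in \<open>simp_all add: mem_def\<close>)
qed simp

text \<open>The first three edges pairwise meet, so their colours are different and may be fixed by
  a permutation of the colours. In \<open>elist\<close> they are the three edges at the first
  vertex.\<close>

fun colcheck :: "('v \<times> 'v) list \<Rightarrow> bool" where
  "colcheck (e1 # e2 # e3 # es) = (meets e1 e2 \<and> meets e1 e3 \<and> meets e2 e3 \<and>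
     nocol (masks meets es [e3, e2, e1]) [Z2, Z1, Z0])"
| "colcheck _ = False"

lemma three_colors:
  assumes "a \<noteq> b" "a \<noteq> c" "b \<noteq> c" "a < 3" "b < 3" "c < 3" "x < (3 :: nat)"
  shows "x = a \<or> x = b \<or> x = c"
proof -
  have "{a, b, c} = {..<3}"
  proof (rule card_subset_eq)
    show "{a, b, c} \<subseteq> {..<3}" using assms by simp
    show "card {a, b, c} = card {..<3 :: nat}" using assms by simp
  qed simp
  then have "x \<in> {a, b, c}" using assms(7) by simp
  then show ?thesis by blast
qed

lemma not_edge_colorable_3I:
  assumes G: "graph G" and N: "nbfun G N" and vs: "set vs \<subseteq> verts G" and c: "colcheck (elist N vs [])"
  shows "\<not> edge_colorable 3 G"
proof
  assume "edge_colorable 3 G"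
  then obtain f :: "'a set \<Rightarrow> nat" where f': "(\<forall>e\<in>edges G. f e < 3) \<and>
      (\<forall>e\<in>edges G. \<forall>e'\<in>edges G. e \<noteq> e' \<and> e \<inter> e' \<noteq> {} \<longrightarrow> f e \<noteq> f e')"
    unfolding edge_colorable_def by (rule exE)
  have f: "e \<in> edges G \<Longrightarrow> f e < 3"
    "e \<in> edges G \<Longrightarrow> e' \<in> edges G \<Longrightarrow> e \<noteq> e' \<Longrightarrow> e \<inter> e' \<noteq> {} \<Longrightarrow> f e \<noteq> f e'" for e e'
    using f' by simp_all
  obtain L where L: "L = elist N vs []" by simp
  obtain e1 e2 e3 es where es: "elist N vs [] = e1 # e2 # e3 # es"
    using c unfolding L[symmetric] by (cases L rule: colcheck.cases) simp_all
  have c': "meets e1 e2" "meets e1 e3" "meets e2 e3" "nocol (masks meets es [e3, e2, e1]) [Z2, Z1, Z0]"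
    using c unfolding es colcheck.simps by blast+
  define g where "g = (\<lambda>e. f {fst e, snd e})"
  have E: "{fst e, snd e} \<in> edges G" "fst e \<noteq> snd e" if "e \<in> set (elist N vs [])" for e
  proof -
    have "fst e \<in> set vs" "snd e \<in> set (N (fst e))" using elist[of "fst e" "snd e" N vs "[]"] that by auto
    then have a: "adj G (fst e) (snd e)" using vs N by (auto simp: nbfunD)
    then show "{fst e, snd e} \<in> edges G" by (simp add: adj_def)
    show "fst e \<noteq> snd e" using graph_adjD[OF G a] by blast
  qed
  have g: "g e \<noteq> g e'" if "e \<in> set (elist N vs [])" "e' \<in> set (elist N vs [])" "meets e e'" for e e'
  proof -
    have m: "meets (fst e, snd e) (fst e', snd e')" using that(3) by simp
    show ?thesis using meets[OF m E(2)[OF that(1)] E(2)[OF that(2)]] f(2)[OF E(1)[OF that(1)] E(1)[OF that(2)]]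
      by (simp add: g_def)
  qed
  have lt: "g e < 3" if "e \<in> set (elist N vs [])" for e using f(1)[OF E(1)[OF that]] by (simp add: g_def)
  define h where "h = (\<lambda>n. if n = g e1 then Z0 else if n = g e2 then Z1 else Z2)"
  have mem: "e1 \<in> set (elist N vs [])" "e2 \<in> set (elist N vs [])" "e3 \<in> set (elist N vs [])"
    unfolding es by simp_all
  have n: "g e1 \<noteq> g e2" "g e1 \<noteq> g e3" "g e2 \<noteq> g e3" using g[OF mem(1,2) c'(1)] g[OF mem(1,3) c'(2)] g[OF mem(2,3) c'(3)] .
  have l3: "g e1 < 3" "g e2 < 3" "g e3 < 3" using lt[OF mem(1)] lt[OF mem(2)] lt[OF mem(3)] .
  have inj: "h a \<noteq> h b" if "a < 3" "b < 3" "a \<noteq> b" for a b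
  proof -
    have "x = g e1 \<or> x = g e2 \<or> x = g e3" if "x < 3" for x by (rule three_colors[OF n l3 that])
    then have "a = g e1 \<or> a = g e2 \<or> a = g e3" "b = g e1 \<or> b = g e2 \<or> b = g e3" using that by blast+
    moreover have "h (g e1) = Z0" "h (g e2) = Z1" "h (g e3) = Z2" using n by (simp_all add: h_def)
    ultimately show ?thesis using that(3) by (elim disjE) simp_all
  qed
  have "map (\<lambda>e. h (g e)) [e3, e2, e1] = [Z2, Z1, Z0]" using n by (simp add: h_def)
  then have "nocol (masks meets es [e3, e2, e1]) (map (\<lambda>e. h (g e)) [e3, e2, e1])" using c'(4) by (simp only:)
  then show False
  proof (rule nocol)
    fix e e' assume "e \<in> set (es @ [e3, e2, e1])" "e' \<in> set (es @ [e3, e2, e1])" "meets e e'"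
    moreover have "set (es @ [e3, e2, e1]) = set (elist N vs [])" unfolding es by auto
    ultimately have e: "e \<in> set (elist N vs [])" "e' \<in> set (elist N vs [])" "meets e e'" by blast+
    show "h (g e) \<noteq> h (g e')" by (rule inj[OF lt[OF e(1)] lt[OF e(2)] g[OF e]])
  qed
qed

section \<open>Certificates for small cuts\<close>

definition crosspair :: "'v list \<Rightarrow> 'v \<times> 'v \<Rightarrow> bool" where
  "crosspair xs e \<longleftrightarrow> mem (fst e) xs \<noteq> mem (snd e) xs"

definition cyc_check :: "('v \<Rightarrow> 'v list) \<Rightarrow> 'v list \<Rightarrow> bool" where
  "cyc_check N p \<longleftrightarrow> 3 \<le> length p \<and> dist p \<and> alll (\<lambda>e. mem (snd e) (N (fst e))) (zip p (rotate1 p))"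

definition cut_check :: "('v \<Rightarrow> 'v list) \<Rightarrow> 'v list \<Rightarrow> 'v list \<Rightarrow> 'v list \<Rightarrow> 'v list \<Rightarrow> bool" where
  "cut_check N vs xs p q \<longleftrightarrow> length (filter (crosspair xs) (elist N vs [])) < 4 \<and>
     cyc_check N p \<and> cyc_check N q \<and> alll (\<lambda>v. mem v xs) p \<and> alll (\<lambda>v. mem v vs) p \<and>
     alll (\<lambda>v. \<not> mem v xs) q \<and> alll (\<lambda>v. mem v vs) q"

lemma set_zip_rotate1: "set (zip p (rotate1 p)) = {(p ! k, p ! (Suc k mod length p)) | k. k < length p}"
  by (auto simp: set_zip nth_rotate1)

lemma cyc_check:
  assumes "nbfun G N" "cyc_check N p" "set p \<subseteq> verts G"
  shows "distinct p" "3 \<le> length p" "cycle_edges p \<subseteq> edges G"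
proof -
  show "distinct p" "3 \<le> length p" using assms(2) by (simp_all add: cyc_check_def dist_iff)
  show "cycle_edges p \<subseteq> edges G"
  proof
    fix e assume "e \<in> cycle_edges p"
    then obtain k where k: "k < length p" "e = {p ! k, p ! (Suc k mod length p)}" by (auto simp: cycle_edges_def)
    have "(p ! k, p ! (Suc k mod length p)) \<in> set (zip p (rotate1 p))" unfolding set_zip_rotate1 using k by blast
    then have "p ! (Suc k mod length p) \<in> set (N (p ! k))" using assms(2) by (force simp: cyc_check_def alll_iff mem_def)
    moreover have "p ! k \<in> verts G" using assms(3) nth_mem[OF k(1)] by blast
    ultimately have "adj G (p ! k) (p ! (Suc k mod length p))" using nbfunD[OF assms(1)] by blast
    then show "e \<in> edges G" by (simp only: k(2) adj_def)
  qed
qed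

lemma cut_check:
  assumes G: "graph G" and N: "nbfun G N" and vs: "set vs = verts G" and c: "cut_check N vs xs p q"
  shows "\<not> snark G"
proof -
  have sub: "set p \<subseteq> verts G" "set q \<subseteq> verts G" "set p \<subseteq> set xs" "set q \<inter> set xs = {}"
    using c vs by (auto simp: cut_check_def alll_iff mem_def)
  have "{e \<in> edges G. e \<inter> set xs \<noteq> {} \<and> \<not> e \<subseteq> set xs} \<subseteq> (\<lambda>e. {fst e, snd e}) ` set (filter (crosspair xs) (elist N vs []))"
  proof
    fix e assume e: "e \<in> {e \<in> edges G. e \<inter> set xs \<noteq> {} \<and> \<not> e \<subseteq> set xs}"
    have "card e = 2" using graph_edgeD[OF G] e by blast
    then obtain a b where ab: "e = {a, b}" by (meson card_2_iff)
    have a: "adj G a b" "adj G b a" using e ab adj_sym[of G a b] by (auto simp: adj_def)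
    have v: "a \<in> verts G" "b \<in> verts G" using graph_adjD[OF G a(1)] by blast+
    have x: "(a \<in> set xs) \<noteq> (b \<in> set xs)" using e ab by blast
    have "(a, b) \<in> set (elist N vs []) \<or> (b, a) \<in> set (elist N vs [])"
      using elist_complete[of a vs b N "[]"] a v vs nbfunD[OF N] by simp
    then show "e \<in> (\<lambda>e. {fst e, snd e}) ` set (filter (crosspair xs) (elist N vs []))"
    proof
      assume "(a, b) \<in> set (elist N vs [])"
      then show ?thesis using x ab by (intro image_eqI[of _ _ "(a, b)"]) (auto simp: crosspair_def mem_def)
    next
      assume "(b, a) \<in> set (elist N vs [])"
      then show ?thesis using x ab by (intro image_eqI[of _ _ "(b, a)"]) (auto simp: crosspair_def mem_def)
    qed
  qed
  from card_mono[OF _ this] have "card {e \<in> edges G. e \<inter> set xs \<noteq> {} \<and> \<not> e \<subseteq> set xs} \<le>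
      card ((\<lambda>e. {fst e, snd e}) ` set (filter (crosspair xs) (elist N vs [])))" by simp
  also have "\<dots> \<le> card (set (filter (crosspair xs) (elist N vs [])))" by (rule card_image_le) simp
  also have "\<dots> \<le> length (filter (crosspair xs) (elist N vs []))" by (rule card_length)
  also have "\<dots> < 4" using c by (simp add: cut_check_def)
  finally have "card {e \<in> edges G. e \<inter> set xs \<noteq> {} \<and> \<not> e \<subseteq> set xs} < 4" .
  moreover have "cyc_check N p" "cyc_check N q" using c by (simp_all add: cut_check_def)
  ultimately have "\<not> cyclically_edge_connected 4 G"
    using cut_not_cyclically_connected[OF G, of "set xs" p q] cyc_check[OF N _ sub(1)] cyc_check[OF N _ sub(2)] sub by blast
  then show ?thesis by (simp add: snark_def)
qed

definition snark_check :: "('v \<Rightarrow> 'v list) \<Rightarrow> 'v list \<Rightarrow> 'v list \<Rightarrow> 'v list \<Rightarrow> bool" where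
  "snark_check N ls vs ws \<longleftrightarrow> alll (\<lambda>v. mem v vs) ls \<and> alll (\<lambda>v. mem v ls) vs \<and> alll (\<lambda>v. mem v ls) ws \<and> dist vs \<and>
     local_check N ls \<and> cutsearch (masks (\<lambda>v u. mem u (N v)) (tl vs) [hd vs]) [True] 4 \<and> colcheck (elist N ws [])"

lemma snark_check:
  assumes G: "graph G" and N: "nbfun G N" and ls: "set ls = verts G" "ls \<noteq> []" and c: "snark_check N ls vs ws"
  shows "snark G"
proof -
  have vs: "set vs = verts G" "distinct vs" and ws: "set ws \<subseteq> verts G"
    using c ls by (auto simp: snark_check_def alll_iff mem_def dist_iff)
  have ne: "vs = hd vs # tl vs" using vs(1) ls by (cases vs) auto
  have l: "regular 3 G" "girth_at_least 5 G" using local_check[OF G N ls(1)] c by (simp_all add: snark_check_def)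
  have "cyclically_edge_connected 4 G"
    by (rule cyclically_edge_connected_4I[OF G N l(2), of "hd vs" "tl vs"]) (use vs ne c in \<open>simp_all add: snark_check_def\<close>)
  moreover have "\<not> edge_colorable 3 G"
    by (rule not_edge_colorable_3I[OF G N ws]) (use c in \<open>simp add: snark_check_def\<close>)
  ultimately show ?thesis using G l by (simp add: snark_def)
qed

section \<open>Walk counts as isomorphism invariants\<close>

definition reach_count :: "nat \<Rightarrow> 'v ugraph \<Rightarrow> nat \<Rightarrow> nat" where
  "reach_count n G m = card {v \<in> verts G. card {u. (adj G ^^ n) v u} = m}"

lemma graph_iso_relpowp_iff:
  assumes f: "graph_iso f G H" and v: "v \<in> verts G"
  shows "{u. (adj H ^^ n) (f v) u} = f ` {u. (adj G ^^ n) v u}" and "{u. (adj G ^^ n) v u} \<subseteq> verts G"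
proof (induction n)
  case 0
  case 1 show ?case by auto
  case 2 show ?case using v by auto
next
  case (Suc n)
  note G = graph_isoD(1)[OF f] and H = graph_isoD(2)[OF f]
  have a: "adj H (f x) y \<longleftrightarrow> (\<exists>z. y = f z \<and> adj G x z)" if "x \<in> verts G" for x y
  proof
    assume y: "adj H (f x) y"
    then have "y \<in> verts H" using graph_adjD[OF H] by blast
    then obtain z where z: "z \<in> verts G" "y = f z" using graph_isoD(4)[OF f] by (auto simp: img_def)
    then show "\<exists>z. y = f z \<and> adj G x z" using y graph_iso_adj_iff[OF f that] by blast
  next
    assume "\<exists>z. y = f z \<and> adj G x z"
    then obtain z where z: "y = f z" "adj G x z" by blast
    then show "adj H (f x) y" using graph_iso_adj_iff[OF f that, of z] graph_adjD[OF G z(2)] by blast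
  qed
  case 1
  show ?case
  proof (intro set_eqI iffI)
    fix u assume "u \<in> {u. (adj H ^^ Suc n) (f v) u}"
    then obtain w where w: "(adj H ^^ n) (f v) w" "adj H w u" by auto
    then obtain x where x: "w = f x" "(adj G ^^ n) v x" using Suc(1) by blast
    then have "x \<in> verts G" using Suc(2) by blast
    then obtain z where "u = f z" "adj G x z" using a w(2) x(1) by blast
    then show "u \<in> f ` {u. (adj G ^^ Suc n) v u}" using x(2) by auto
  next
    fix u assume "u \<in> f ` {u. (adj G ^^ Suc n) v u}"
    then obtain z x where z: "u = f z" "(adj G ^^ n) v x" "adj G x z" by auto
    then have "x \<in> verts G" using Suc(2) by blast
    then have "adj H (f x) u" using a z by blast
    moreover have "(adj H ^^ n) (f v) (f x)" using Suc(1) z(2) by blast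
    ultimately show "u \<in> {u. (adj H ^^ Suc n) (f v) u}" by auto
  qed
  case 2
  show ?case using graph_adjD[OF G] by auto
qed

lemma isomorphic_reach_count:
  assumes "isomorphic G H" shows "reach_count n G m = reach_count n H m"
proof -
  obtain f where f: "graph_iso f G H" using assms by (auto simp: isomorphic_def)
  have inj: "inj_on f (verts G)" and V: "verts H = f ` verts G" using graph_isoD[OF f] by (auto simp: img_def)
  have c: "card {u. (adj H ^^ n) (f v) u} = card {u. (adj G ^^ n) v u}" if "v \<in> verts G" for v
    unfolding graph_iso_relpowp_iff(1)[OF f that]
    by (rule card_image) (rule inj_on_subset[OF inj graph_iso_relpowp_iff(2)[OF f that]])
  have "{v \<in> verts H. card {u. (adj H ^^ n) v u} = m} = f ` {v \<in> verts G. card {u. (adj G ^^ n) v u} = m}"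
    using c V by auto
  moreover have "inj_on f {v \<in> verts G. card {u. (adj G ^^ n) v u} = m}" by (rule inj_on_subset[OF inj]) blast
  ultimately show ?thesis by (simp add: reach_count_def card_image)
qed

definition merge_go :: "bool \<Rightarrow> 'a \<Rightarrow> 'a list \<Rightarrow> 'a list" where "merge_go b x ys = (if b then ys else x # ys)"

lemma merge_go_code [code]: "merge_go True x ys = ys" "merge_go False x ys = x # ys"
  by (simp_all add: merge_go_def)

fun merge :: "'a list \<Rightarrow> 'a list \<Rightarrow> 'a list" where
  "merge [] ys = ys"
| "merge (x # xs) ys = merge xs (merge_go (mem x ys) x ys)"

lemma merge: "set (merge xs ys) = set xs \<union> set ys" "distinct ys \<Longrightarrow> distinct (merge xs ys)"
  by (induction xs ys rule: merge.induct) (auto simp: merge_go_def mem_def)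

fun spread :: "('v \<Rightarrow> 'v list) \<Rightarrow> 'v list \<Rightarrow> 'v list \<Rightarrow> 'v list" where
  "spread N [] ys = ys"
| "spread N (x # xs) ys = spread N xs (merge (N x) ys)"

lemma spread: "set (spread N xs ys) = (\<Union>x\<in>set xs. set (N x)) \<union> set ys" "distinct ys \<Longrightarrow> distinct (spread N xs ys)"
  by (induction xs arbitrary: ys) (auto simp: merge)

fun walks :: "('v \<Rightarrow> 'v list) \<Rightarrow> nat \<Rightarrow> 'v list \<Rightarrow> 'v list" where
  "walks N 0 xs = xs"
| "walks N (Suc n) xs = walks N n (spread N xs [])"

lemma walks:
  assumes "graph G" "nbfun G N" "set xs \<subseteq> verts G" "distinct xs"
  shows "set (walks N n xs) = {u. \<exists>x\<in>set xs. (adj G ^^ n) x u} \<and> distinct (walks N n xs)"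
  using assms(3,4)
proof (induction n arbitrary: xs)
  case (Suc n)
  have s: "set (spread N xs []) = {u. \<exists>x\<in>set xs. adj G x u}"
    using Suc.prems(1) assms(2) by (auto simp: spread nbfunD subset_iff)
  have "set (spread N xs []) \<subseteq> verts G" unfolding s using graph_adjD[OF assms(1)] by blast
  from Suc.IH[OF this spread(2)] have IH: "set (walks N n (spread N xs [])) = {u. \<exists>x. (\<exists>y\<in>set xs. adj G y x) \<and> (adj G ^^ n) x u}"
    "distinct (walks N n (spread N xs []))" unfolding s by auto
  have "(\<exists>x. (\<exists>y\<in>set xs. adj G y x) \<and> (adj G ^^ n) x u) \<longleftrightarrow> (\<exists>y\<in>set xs. (adj G ^^ Suc n) y u)" for u
    by (blast dest: relpowp_Suc_D2 intro: relpowp_Suc_I2)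
  then show ?case using IH by simp
qed auto

definition sizes :: "('v \<Rightarrow> 'v list) \<Rightarrow> nat \<Rightarrow> 'v list \<Rightarrow> nat list" where
  "sizes N n vs = map (\<lambda>v. length (walks N n [v])) vs"

lemma sizes:
  assumes G: "graph G" and N: "nbfun G N" and vs: "set vs = verts G" "distinct vs"
  shows "reach_count n G m = length (filter (\<lambda>l. l = m) (sizes N n vs))"
proof -
  have w: "length (walks N n [v]) = card {u. (adj G ^^ n) v u}" if "v \<in> verts G" for v
  proof -
    have *: "set (walks N n [v]) = {u. (adj G ^^ n) v u}" "distinct (walks N n [v])"
      using walks[OF G N, of "[v]" n] that by auto
    show ?thesis using distinct_card[OF *(2)] unfolding *(1) by simp
  qed
  have e: "{v \<in> verts G. card {u. (adj G ^^ n) v u} = m} = set (filter (\<lambda>v. length (walks N n [v]) = m) vs)"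
    using w vs(1) by auto
  have "reach_count n G m = length (filter (\<lambda>v. length (walks N n [v]) = m) vs)"
    by (simp only: reach_count_def e distinct_card[OF distinct_filter[OF vs(2)]])
  then show ?thesis by (simp add: sizes_def filter_map o_def)
qed

section \<open>Neighbours in the graph of a configuration\<close>

definition arcl1 :: "('a \<times> z3) list \<Rightarrow> ('a \<times> z3 \<times> 'a) list" where
  "arcl1 c = map (\<lambda>p. (fst (fst p), snd (fst p), fst (snd p))) (zip c (rotate1 c))"

definition arcl :: "('a \<times> z3) list list \<Rightarrow> ('a \<times> z3 \<times> 'a) list" where
  "arcl cs = concat (map arcl1 cs)"

lemma set_arcl: "set (arcl cs) = arcs cs"
proof -
  have "set (arcl1 c) = {(fst (c ! s), snd (c ! s), fst (c ! (Suc s mod length c))) | s. s < length c}" for c :: "('a \<times> z3) list"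
    unfolding arcl1_def set_map set_zip_rotate1 setcompr_eq_image image_image by simp
  then show ?thesis unfolding arcl_def arcs_def set_concat set_map by blast
qed

fun look_go :: "bool \<Rightarrow> 'v \<Rightarrow> 'v list \<Rightarrow> 'v list" where
  "look_go True v L = v # L" | "look_go False v L = L"

fun look :: "(bool list \<times> z3 \<times> bool list) list \<Rightarrow> z3 \<Rightarrow> bool list \<Rightarrow> vertex list" where
  "look [] k a = []"
| "look ((x, v, y) # L) k a = look_go (x = a) (Some (k + v, y)) (look_go (y = a) (Some (k - v, x)) (look L k a))"

lemma set_look: "set (look L k a) = {u. \<exists>x v y. (x, v, y) \<in> set L \<and> (x = a \<and> u = Some (k + v, y) \<or> y = a \<and> u = Some (k - v, x))}"
proof (induction L k a rule: look.induct)
  case (2 x v y L k a)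
  have g: "set (look_go b v L) = (if b then {v} else {}) \<union> set L" for b v and L :: "vertex list" by (cases b) auto
  show ?case unfolding look.simps g 2 by auto
qed simp

fun nb_go :: "bool \<Rightarrow> z3 \<Rightarrow> bool list \<Rightarrow> (bool list \<times> z3 \<times> bool list) list \<Rightarrow> vertex list" where
  "nb_go True k bs L = [Some (k, bs @ [False]), Some (k, bs @ [True])]"
| "nb_go False k bs L = look L k bs"

fun nb :: "nat \<Rightarrow> (bool list \<times> z3 \<times> bool list) list \<Rightarrow> vertex \<Rightarrow> vertex list" where
  "nb d L None = [Some (Z0, []), Some (Z1, []), Some (Z2, [])]"
| "nb d L (Some (k, bs)) = par (Some (k, bs)) # nb_go (length bs < d) k bs L"

lemma nbfun_CG:
  assumes v: "valid d cs"
  shows "nbfun (CG d cs) (nb d (arcl cs))"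
  unfolding nbfun_def
proof
  fix w assume w: "w \<in> verts (CG d cs)"
  have adj: "adj (CG d cs) w u \<longleftrightarrow> adj (PT d) w u \<or> {w, u} \<in> outer cs" for u
    by (simp add: adj_def edges_CG)
  have ends: "length a = d \<and> length b = d" if "(a, x, b) \<in> arcs cs" for a x b
  proof -
    have "set (map fst (concat cs)) = {bs. length bs = d}" using v by (simp add: valid_def)
    then show ?thesis using arcs_ends[OF that] by auto
  qed
  show "set (nb d (arcl cs) w) = {u. adj (CG d cs) w u}"
  proof (cases w)
    case None
    have "{None, u} \<notin> outer cs" for u by (auto simp: outer_def doubleton_eq_iff)
    then have "{u. adj (CG d cs) w u} = {u. adj (PT d) None u}" unfolding adj unfolding None by simp
    then show ?thesis unfolding nbrs_None None by simp
  next
    case (Some p)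
    obtain k bs where p: "p = (k, bs)" by (cases p)
    have out: "{Some (k, bs), u} \<in> outer cs \<longleftrightarrow> u \<in> set (look (arcl cs) k bs)" for u
    proof
      assume "{Some (k, bs), u} \<in> outer cs"
      then obtain j a x b where "{Some (k, bs), u} = {Some (j, a), Some (j + x, b)}" "(a, x, b) \<in> arcs cs"
        by (auto simp: outer_def)
      moreover from this(1) consider "bs = a" "u = Some (k + x, b)" | "bs = b" "u = Some (k - x, a)"
        unfolding doubleton_eq_iff by auto
      ultimately show "u \<in> set (look (arcl cs) k bs)" unfolding set_look set_arcl by cases blast+
    next
      assume "u \<in> set (look (arcl cs) k bs)"
      then obtain x y z where xyz: "(x, y, z) \<in> arcs cs" "x = bs \<and> u = Some (k + y, z) \<or> z = bs \<and> u = Some (k - y, x)"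
        by (auto simp: set_look set_arcl)
      from xyz(2) show "{Some (k, bs), u} \<in> outer cs"
      proof
        assume "x = bs \<and> u = Some (k + y, z)"
        then show ?thesis using xyz(1) unfolding outer_def by blast
      next
        assume *: "z = bs \<and> u = Some (k - y, x)"
        then have "{Some (k, bs), u} = {Some (k - y, x), Some (k - y + y, z)}" by auto
        then show ?thesis using xyz(1) unfolding outer_def by blast
      qed
    qed
    have wk: "w = Some (k, bs)" using Some p by simp
    have nbrs: "{u. adj (CG d cs) w u} = {u. adj (PT d) (Some (k, bs)) u} \<union> set (look (arcl cs) k bs)"
      unfolding adj unfolding wk out by blast
    show ?thesis
    proof (cases "length bs < d")
      case True
      have "set (look (arcl cs) k bs) = {}"
      proof (rule equals0I)
        fix u assume "u \<in> set (look (arcl cs) k bs)"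
        then obtain x y z where "(x, y, z) \<in> arcs cs" "x = bs \<or> z = bs" unfolding set_look set_arcl by blast
        then show False using ends[of x y z] True by auto
      qed
      then show ?thesis unfolding nbrs nbrs_inner[OF True] unfolding wk using True by (simp del: par.simps)
    next
      case False
      have l: "length bs = d" using w False by (simp add: Some p)
      show ?thesis unfolding nbrs nbrs_leaf[OF l] unfolding wk using False by (simp del: par.simps)
    qed
  qed
qed

fun blists :: "nat \<Rightarrow> bool list list" where
  "blists 0 = [[]]"
| "blists (Suc d) = map (Cons False) (blists d) @ map (Cons True) (blists d)"

lemma set_blists: "set (blists d) = {bs. length bs = d}"
proof (induction d)
  case (Suc d)
  have "bs \<in> set (blists (Suc d)) \<longleftrightarrow> length bs = Suc d" for bs
    by (cases bs; cases "hd bs") (auto simp: Suc)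
  then show ?case by blast
qed auto

fun blists_le :: "nat \<Rightarrow> bool list list" where
  "blists_le 0 = [[]]"
| "blists_le (Suc d) = blists_le d @ blists (Suc d)"

lemma set_blists_le: "set (blists_le d) = {bs. length bs \<le> d}"
proof (induction d)
  case (Suc d)
  show ?case unfolding blists_le.simps set_append Suc set_blists by auto
qed auto

definition vlist :: "nat \<Rightarrow> vertex list" where
  "vlist d = None # concat (map (\<lambda>k. map (\<lambda>bs. Some (k, bs)) (blists_le d)) [Z0, Z1, Z2])"

lemma set_vlist: "set (vlist d) = PT_verts d"
proof -
  have "set (vlist d) = insert None (\<Union>k\<in>UNIV. (\<lambda>bs. Some (k, bs)) ` {bs. length bs \<le> d})"
    by (simp add: vlist_def set_blists_le UNIV_z3)
  then show ?thesis unfolding PT_verts_def by blast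
qed

definition valid_check :: "nat \<Rightarrow> config \<Rightarrow> bool" where
  "valid_check d cs \<longleftrightarrow> dist (map fst (concat cs)) \<and> alll (\<lambda>p. length (fst p) = d) (concat cs) \<and>
     alll (\<lambda>b. mem b (map fst (concat cs))) (blists d) \<and>
     alll (\<lambda>c. 2 \<le> length c \<and> (if length c = 2 then snd (c ! 0) + snd (c ! 1) \<noteq> Z0 else True)) cs"

lemma valid_check: assumes "valid_check d cs" shows "valid d cs"
proof -
  have *: "distinct (map fst (concat cs))" "\<And>p. p \<in> set (concat cs) \<Longrightarrow> length (fst p) = d"
    "\<And>b. length b = d \<Longrightarrow> b \<in> set (map fst (concat cs))"
    "\<And>c. c \<in> set cs \<Longrightarrow> 2 \<le> length c \<and> (if length c = 2 then snd (c ! 0) + snd (c ! 1) \<noteq> Z0 else True)"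
    using assms unfolding valid_check_def dist_iff alll_iff mem_def set_blists by blast+
  have "set (map fst (concat cs)) = {bs. length bs = d}"
  proof
    show "set (map fst (concat cs)) \<subseteq> {bs. length bs = d}" using *(2) by fastforce
  qed (use *(3) in blast)
  moreover have "2 \<le> length c \<and> (length c = 2 \<longrightarrow> snd (c ! 0) + snd (c ! 1) \<noteq> Z0)" if "c \<in> set cs" for c
    using *(4)[OF that] by presburger
  ultimately show ?thesis unfolding valid_def using *(1) by blast
qed

section \<open>Classification from representatives\<close>

lemma rotation_snark_CG:
  assumes "valid d cs" "snark (CG d cs)" "0 < d" shows "rotation_snark (Suc d) (CG d cs)"
  unfolding rotation_snark_iff using rotation_hist_PT[OF assms(1)] assms(2,3) by (intro conjI exI[of _ "PT d"]) simp_all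

text \<open>\<open>R\<close> lists the configurations that are snarks and \<open>Q\<close> those
  with a small cut. \<open>S\<close> supplies switch trees both as invariant colourings and as
  automorphisms, \<open>S'\<close> the automorphisms for rejecting shapes, \<open>us\<close> the
  roots of subtrees tested for a closed part; \<open>shs\<close> are the shapes that remain.\<close>

locale classification =
  fixes d :: nat and R Q :: "config list" and us :: "bool list list" and S S' :: "sw list"
    and shs :: "bool list list list list" and f :: "unit list" and L :: "bool list list"
  assumes d: "0 < d"
    and shapes: "check_shapes us S' shs (gen f L [] [])" "set L = {bs. length bs = d}" "[] \<notin> set us"
      "2 * card {bs :: bool list. length bs = d} < length f"
    and tests: "\<And>sh. sh \<in> set shs \<Longrightarrow> \<exists>hs. test_shape (R @ Q) S hs sh"
    and cuts: "\<And>cs. cs \<in> set Q \<Longrightarrow> \<not> snark (CG d cs)"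
    and reps: "\<And>cs. cs \<in> set R \<Longrightarrow> valid d cs" "\<And>cs. cs \<in> set R \<Longrightarrow> snark (CG d cs)"
begin

lemma reaches_rep:
  assumes "snark G" "rotation_hist (Suc d) T G" shows "\<exists>cs\<in>set R. reaches d cs G T"
proof -
  obtain cs where "reaches d cs G T"
    using rotation_snark_config[OF assms] by (auto simp: reaches_def)
  then obtain cs where m: "minimal d cs G T" using minimal_exists by blast
  then have r: "reaches d cs G T" by (simp add: minimal_def)
  then obtain h where h: "graph_iso h (CG d cs) G" by (auto simp: reaches_def)
  have s: "snark (CG d cs)" using graph_iso_snark[OF graph_iso_inv[OF h]] assms(1) by blast
  have "map (map fst) cs \<in> set shs" by (rule check_shapes[OF shapes m s])
  then obtain hs where "test_shape (R @ Q) S hs (map (map fst) cs)" using tests by blast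
  then have "cs \<in> set (R @ Q)" using test_shape m s d by blast
  then show ?thesis using cuts s r by auto
qed

lemma rotation_snark_rep: "rotation_snark (Suc d) G \<longleftrightarrow> (\<exists>cs\<in>set R. isomorphic (CG d cs) G)"
proof
  assume "rotation_snark (Suc d) G"
  then obtain T where T: "snark G" "rotation_hist (Suc d) T G" unfolding rotation_snark_iff by blast
  then show "\<exists>cs\<in>set R. isomorphic (CG d cs) G"
    using reaches_rep[OF T] unfolding reaches_def isomorphic_def by blast
next
  assume "\<exists>cs\<in>set R. isomorphic (CG d cs) G"
  then obtain cs h where cs: "cs \<in> set R" "graph_iso h (CG d cs) G" unfolding isomorphic_def by blast
  show "rotation_snark (Suc d) G"
    using graph_iso_rotation_snark[OF cs(2)] rotation_snark_CG[OF reps[OF cs(1)] d] by blast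
qed

text \<open>The isomorphism found for a rotation Hist carries \<open>PT d\<close> to precisely this
  Hist, so the outer cycle lengths can be read off the lifts of the representative, for every
  admissible choice of the Hist.\<close>

lemma rotation_snarks_with_oc_rep:
  "rotation_snarks_with_oc (Suc d) M = {G. \<exists>cs\<in>set (filter (\<lambda>cs. mset (map length (all_lifts cs)) = M) R). isomorphic (CG d cs) G}"
proof (intro set_eqI iffI)
  fix G :: "'v ugraph" assume "G \<in> rotation_snarks_with_oc (Suc d) M"
  then obtain T where T: "rotation_snark (Suc d) G" "rotation_hist (Suc d) T G" "oc G T = M"
    unfolding rotation_snarks_with_oc_def rotation_snarks_def by blast
  have s: "snark G" using T(1) unfolding rotation_snark_iff by blast
  obtain cs h where cs: "cs \<in> set R" "graph_iso h (CG d cs) G" "img h (PT d) = T"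
    using reaches_rep[OF s T(2)] unfolding reaches_def by blast
  have "oc G T = oc (CG d cs) (PT d)"
    using graph_iso_oc[OF cs(2) subgraph_PT_CG] cs(3) by simp
  then have "mset (map length (all_lifts cs)) = M" using T(3) oc_CG[OF reps(1)[OF cs(1)]] by simp
  then show "G \<in> {G. \<exists>cs\<in>set (filter (\<lambda>cs. mset (map length (all_lifts cs)) = M) R). isomorphic (CG d cs) G}"
    using cs unfolding isomorphic_def by auto
next
  fix G :: "'v ugraph"
  assume "G \<in> {G. \<exists>cs\<in>set (filter (\<lambda>cs. mset (map length (all_lifts cs)) = M) R). isomorphic (CG d cs) G}"
  then obtain cs h where cs: "cs \<in> set R" "mset (map length (all_lifts cs)) = M" "graph_iso h (CG d cs) G"
    unfolding isomorphic_def by auto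
  have "rotation_snark (Suc d) G" using rotation_snark_rep[of G] cs unfolding isomorphic_def by blast
  moreover have "rotation_hist (Suc d) (img h (PT d)) G"
    using graph_iso_rotation_hist[OF cs(3) rotation_hist_PT[OF reps(1)[OF cs(1)]]] by simp
  moreover have "oc G (img h (PT d)) = M"
    using graph_iso_oc[OF cs(3) subgraph_PT_CG] oc_CG[OF reps(1)[OF cs(1)]] cs(2) by simp
  ultimately show "G \<in> rotation_snarks_with_oc (Suc d) M"
    unfolding rotation_snarks_with_oc_def rotation_snarks_def by blast
qed

end

text \<open>The representatives live on another vertex type, but being finite each has a copy on
  natural numbers. So every representative contributes a class, and different ones contribute
  different classes.\<close>

lemma card_iso_classes:
  fixes H :: "'c \<Rightarrow> 'v ugraph"
  assumes H: "\<And>r. r \<in> set rs \<Longrightarrow> graph (H r)" and rs: "distinct rs"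
    and inj: "\<And>r s. r \<in> set rs \<Longrightarrow> s \<in> set rs \<Longrightarrow> isomorphic (H r) (H s) \<Longrightarrow> r = s"
  shows "card (iso_classes {G :: nat ugraph. \<exists>r\<in>set rs. isomorphic (H r) G}) = length rs"
proof -
  let ?A = "{G :: nat ugraph. \<exists>r\<in>set rs. isomorphic (H r) G}"
  let ?R = "{(G, K). G \<in> ?A \<and> K \<in> ?A \<and> isomorphic G K}"
  define K where "K r = {G :: nat ugraph. isomorphic (H r) G}" for r
  have ne: "K r \<noteq> {}" if r: "r \<in> set rs" for r
  proof -
    have "finite (verts (H r))" using H[OF r] by (simp add: graph_def)
    then obtain g :: "'v \<Rightarrow> nat" where "inj_on g (verts (H r))" using finite_imp_inj_to_nat_seg by blast
    then have "isomorphic (H r) (img g (H r))" using graph_iso_img[OF H[OF r]] unfolding isomorphic_def by blast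
    then show ?thesis unfolding K_def by blast
  qed
  have cl: "?R `` {G} = K r" if r: "r \<in> set rs" "G \<in> K r" for r G
  proof (intro set_eqI iffI)
    fix G' assume "G' \<in> ?R `` {G}"
    then have "isomorphic G G'" by blast
    then show "G' \<in> K r" using r(2) isomorphic_trans unfolding K_def by blast
  next
    fix G' assume G': "G' \<in> K r"
    have "isomorphic G G'" using r(2) G' isomorphic_trans isomorphic_sym unfolding K_def by blast
    moreover have "G \<in> ?A" "G' \<in> ?A" using r G' unfolding K_def by blast+
    ultimately show "G' \<in> ?R `` {G}" by blast
  qed
  have "iso_classes ?A = K ` set rs"
  proof (intro set_eqI iffI)
    fix X assume "X \<in> iso_classes ?A"
    then obtain G where G: "G \<in> ?A" "X = ?R `` {G}" unfolding iso_classes_def by (rule quotientE)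
    then obtain r where "r \<in> set rs" "G \<in> K r" unfolding K_def by blast
    then show "X \<in> K ` set rs" using cl G(2) by blast
  next
    fix X assume "X \<in> K ` set rs"
    then obtain r where r: "r \<in> set rs" "X = K r" by blast
    then obtain G where G: "G \<in> K r" using ne by blast
    then have "G \<in> ?A" using r(1) unfolding K_def by blast
    then have "?R `` {G} \<in> ?A // ?R" by (rule quotientI)
    then show "X \<in> iso_classes ?A" unfolding iso_classes_def using cl[OF r(1) G] r(2) by simp
  qed
  moreover have "inj_on K (set rs)"
  proof (rule inj_onI)
    fix r s assume rs': "r \<in> set rs" "s \<in> set rs" "K r = K s"
    obtain G where "G \<in> K r" using ne[OF rs'(1)] by blast
    then have "isomorphic (H r) G" "isomorphic (H s) G" using rs'(3) unfolding K_def by blast+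
    then have "isomorphic (H r) (H s)" using isomorphic_trans isomorphic_sym by blast
    then show "r = s" by (rule inj[OF rs'(1,2)])
  qed
  ultimately show ?thesis using rs by (simp add: card_image distinct_card)
qed

text \<open>In a cubic graph a walk of length 4 ends after 0, 2 or 4 steps without reversal, so at
  most 1 + 6 + 24 = 31 vertices are reached, which is the upper end of the range.\<close>

definition signature :: "nat \<Rightarrow> config \<Rightarrow> nat list" where
  "signature d cs = map (\<lambda>m. length (filter (\<lambda>l. l = m) (sizes (nb d (arcl cs)) 4 (vlist d)))) [16..<32]"

lemma isomorphic_signature:
  assumes "valid d cs" "valid d cs'" "isomorphic (CG d cs) (CG d cs')" "dist (vlist d)"
  shows "signature d cs = signature d cs'"
proof -
  have s: "reach_count 4 (CG d cs) m = length (filter (\<lambda>l. l = m) (sizes (nb d (arcl cs)) 4 (vlist d)))" if "valid d cs" for m cs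
    by (rule sizes[OF graph_CG[OF that] nbfun_CG[OF that]]) (use assms(4) in \<open>simp_all add: set_vlist dist_iff\<close>)
  show ?thesis unfolding signature_def s[OF assms(1), symmetric] s[OF assms(2), symmetric]
    isomorphic_reach_count[OF assms(3)] ..
qed

section \<open>Isomorphisms given by lists of vertices\<close>

definition dset :: "('v \<times> 'v) list \<Rightarrow> 'v set set" where
  "dset es = (\<lambda>e. {fst e, snd e}) ` set es"

lemma dset_append: "dset (es @ es') = dset es \<union> dset es'"
  by (simp add: dset_def image_Un)

lemma dset_concat: "dset (concat ess) = (\<Union>es\<in>set ess. dset es)"
  by (auto simp: dset_def)

definition dsub :: "('v \<times> 'v) list \<Rightarrow> ('v \<times> 'v) list \<Rightarrow> bool" where
  "dsub es es' \<longleftrightarrow> alll (\<lambda>e. mem e es' \<or> mem (snd e, fst e) es') es"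

lemma dsub: "dsub es es' \<Longrightarrow> dset es \<subseteq> dset es'"
proof
  fix x assume d: "dsub es es'" and "x \<in> dset es"
  then obtain e where e: "e \<in> set es" "x = {fst e, snd e}" by (auto simp: dset_def)
  then have "e \<in> set es' \<or> (snd e, fst e) \<in> set es'" using d by (auto simp: dsub_def alll_iff mem_def)
  then show "x \<in> dset es'"
  proof
    assume "e \<in> set es'" then show ?thesis unfolding dset_def e(2) by (rule imageI)
  next
    assume "(snd e, fst e) \<in> set es'"
    from imageI[OF this, of "\<lambda>e. {fst e, snd e}"] show ?thesis unfolding dset_def e(2) by (simp add: insert_commute)
  qed
qed

lemma edges_elist:
  assumes G: "graph G" and N: "nbfun G N" and vs: "set vs = verts G"
  shows "edges G = dset (elist N vs [])"
proof (intro set_eqI iffI)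
  fix e assume e: "e \<in> edges G"
  have "card e = 2" using graph_edgeD[OF G e] by blast
  then obtain a b where ab: "e = {a, b}" by (meson card_2_iff)
  have a: "adj G a b" "adj G b a" using e ab adj_sym[of G a b] by (auto simp: adj_def)
  have v: "a \<in> verts G" "b \<in> verts G" using graph_adjD[OF G a(1)] by blast+
  have "(a, b) \<in> set (elist N vs []) \<or> (b, a) \<in> set (elist N vs [])"
    using elist_complete[of a vs b N "[]"] a v vs nbfunD[OF N] by simp
  then show "e \<in> dset (elist N vs [])" unfolding dset_def ab
    by (elim disjE) (erule image_eqI[rotated], simp add: insert_commute)+
next
  fix e assume "e \<in> dset (elist N vs [])"
  then obtain a b where ab: "(a, b) \<in> set (elist N vs [])" "e = {a, b}" by (auto simp: dset_def)
  have "a \<in> verts G" "b \<in> set (N a)" using elist[OF ab(1)] vs by blast+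
  then show "e \<in> edges G" using nbfunD[OF N] by (simp add: ab(2) adj_def)
qed

fun assoc :: "('a \<times> 'b) list \<Rightarrow> 'a \<Rightarrow> 'b" where
  "assoc (p # ps) x = (if fst p = x then snd p else assoc ps x)"
| "assoc [] x = undefined"

text \<open>The map sends each vertex of \<open>vs\<close> to the vertex at the same position of
  \<open>ws\<close>. Edges are pairs in some direction, so the two edge lists are compared up to
  reversal.\<close>

definition iso_check :: "('v \<Rightarrow> 'v list) \<Rightarrow> 'v list \<Rightarrow> 'w list \<Rightarrow> ('w \<times> 'w) list \<Rightarrow> bool" where
  "iso_check N vs ws es \<longleftrightarrow> dist vs \<and> dist ws \<and> length vs = length ws \<and>
     (let es' = map (\<lambda>e. (assoc (zip vs ws) (fst e), assoc (zip vs ws) (snd e))) (elist N vs []) in dsub es es' \<and> dsub es' es)"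

lemma assoc_zip:
  "distinct vs \<Longrightarrow> length vs = length ws \<Longrightarrow> map (assoc (zip vs ws)) vs = ws"
proof (induction vs ws rule: list_induct2')
  case (4 v vs w ws)
  have "map (assoc (zip (v # vs) (w # ws))) vs = map (assoc (zip vs ws)) vs"
    using 4(2) by (intro map_cong refl) auto
  moreover have "map (assoc (zip vs ws)) vs = ws" using 4 by simp
  ultimately have "map (assoc (zip (v # vs) (w # ws))) vs = ws" by (rule trans)
  then show ?case unfolding list.map by simp
qed simp_all

lemma iso_check:
  assumes G: "graph G" and N: "nbfun G N" and vs: "set vs = verts G" and c: "iso_check N vs ws es"
  shows "isomorphic G (set ws, dset es)"
proof -
  let ?f = "assoc (zip vs ws)"
  let ?es = "map (\<lambda>e. (?f (fst e), ?f (snd e))) (elist N vs [])"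
  have d: "distinct vs" "distinct ws" "length vs = length ws" "dset ?es = dset es"
    using c dsub by (auto simp: iso_check_def dist_iff Let_def)
  have m: "map ?f vs = ws" by (rule assoc_zip[OF d(1,3)])
  have "(`) ?f ` edges G = dset ?es" unfolding edges_elist[OF G N vs] by (simp add: dset_def image_image)
  moreover have "?f ` verts G = set ws" unfolding vs[symmetric] using m by (metis set_map)
  ultimately have "(set ws, dset es) = img ?f G" using d(4) by (simp add: img_def)
  moreover have "inj_on ?f (verts G)" using d(2) m vs by (metis distinct_map)
  ultimately show ?thesis using graph_iso_img[OF G] unfolding isomorphic_def by metis
qed

lemma cycle_edges_dset: "cycle_edges vs = dset (zip vs (rotate1 vs))"
  unfolding cycle_edges_def dset_def set_zip_rotate1 setcompr_eq_image image_image by simp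

definition std_list :: "nat \<Rightarrow> (nat \<times> nat) list" where
  "std_list i = concat (map (\<lambda>k. map (Pair k) [0..<3 * 2 ^ (k - 1)]) [1..<Suc i])"

lemma std_T_list: "std_T i = (set ((0, 0) # std_list i), dset (map (\<lambda>v. (v, parent v)) (std_list i)))"
proof -
  have "{(k, j). 1 \<le> k \<and> k \<le> i \<and> j < 3 * 2 ^ (k - 1)} = set (std_list i)"
    by (auto simp: std_list_def)
  then show ?thesis unfolding std_T_def dset_def Let_def by (simp add: image_image del: parent.simps)
qed

lemma add_outer_cycles_list:
  "add_outer_cycles i cs = (set ((0, 0) # std_list i), dset (map (\<lambda>v. (v, parent v)) (std_list i) @
     concat (map (\<lambda>c. zip (map (Pair i) c) (rotate1 (map (Pair i) c))) cs)))"
  by (simp add: add_outer_cycles_def std_T_list cycle_edges_dset dset_append dset_concat)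

lemma petersen_list:
  "petersen = (set [0..<10], dset (concat (map (\<lambda>i. [(i, (i + 1) mod 5), (i, i + 5), (i + 5, (i + 2) mod 5 + 5)]) [0..<5])))"
  unfolding petersen_def dset_concat by (simp add: dset_def lessThan_atLeast0)

lemma filter_mset_sort:
  "filter (\<lambda>x. mset (g x) = mset ys) xs = filter (\<lambda>x. sort (g x) = sort ys) xs"
proof (rule filter_cong[OF refl])
  fix x
  show "mset (g x) = mset ys \<longleftrightarrow> sort (g x) = sort ys"
    by (metis mset_sort sorted_list_of_multiset_mset)
qed

section \<open>Computations\<close>

text \<open>With 8 triples for \<open>d = 1\<close> and 512 for \<open>d = 2\<close> all of them can
  be tried; \<open>d = 3\<close> would have \<open>2 ^ 21\<close>, so there selected triples are
  stored.\<close>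

definition all_hints :: "nat \<Rightarrow> (sw \<times> sw \<times> sw) list" where
  "all_hints d = concat (map (\<lambda>a. concat (map (\<lambda>b. map (\<lambda>c. (a, b, c)) (allsw d)) (allsw d))) (allsw d))"

text \<open>Vertices are encoded as characters: the lowest two bits give the branch, the next four the path
  with a leading 1.\<close>

fun path_bits :: "bool \<Rightarrow> bool \<Rightarrow> bool \<Rightarrow> bool \<Rightarrow> bool list" where
  "path_bits True x y z = [x, y, z]"
| "path_bits False True y z = [y, z]"
| "path_bits False False True z = [z]"
| "path_bits False False False z = []"

fun branch_bits :: "bool \<Rightarrow> bool \<Rightarrow> bool list \<Rightarrow> vertex" where
  "branch_bits False False p = None"
| "branch_bits True False p = Some (Z0, p)"
| "branch_bits False True p = Some (Z1, p)"
| "branch_bits True True p = Some (Z2, p)"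

fun vx :: "char \<Rightarrow> vertex" where
  "vx (Char b0 b1 b2 b3 b4 b5 b6 b7) = branch_bits b0 b1 (path_bits b5 b4 b3 b2)"

text \<open>The strings are orders of the vertices, \<open>s\<close> for the cut search and
  \<open>t\<close> for the colouring search; the order determines how early the branches of these
  searches end.\<close>

definition snark_at :: "nat \<Rightarrow> config \<Rightarrow> string \<Rightarrow> string \<Rightarrow> bool" where
  "snark_at d cs s t \<longleftrightarrow> valid_check d cs \<and> snark_check (nb d (arcl cs)) (vlist d) (map vx s) (map vx t)"

lemma snark_at: assumes "snark_at d cs s t" shows "valid d cs" "snark (CG d cs)"
proof -
  show v: "valid d cs" using assms valid_check by (simp add: snark_at_def)
  have ne: "vlist d \<noteq> []" by (simp add: vlist_def)
  have c: "snark_check (nb d (arcl cs)) (vlist d) (map vx s) (map vx t)" using assms by (simp add: snark_at_def)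
  show "snark (CG d cs)"
    by (rule snark_check[OF graph_CG[OF v] nbfun_CG[OF v] _ ne c]) (simp add: set_vlist)
qed

definition cut_at :: "nat \<Rightarrow> config \<Rightarrow> string \<Rightarrow> string \<Rightarrow> string \<Rightarrow> bool" where
  "cut_at d cs x p q \<longleftrightarrow> valid_check d cs \<and> cut_check (nb d (arcl cs)) (vlist d) (map vx x) (map vx p) (map vx q)"

lemma cut_at: assumes "cut_at d cs x p q" shows "\<not> snark (CG d cs)"
proof -
  have v: "valid d cs" using assms valid_check by (simp add: cut_at_def)
  have c: "cut_check (nb d (arcl cs)) (vlist d) (map vx x) (map vx p) (map vx q)" using assms by (simp add: cut_at_def)
  show ?thesis by (rule cut_check[OF graph_CG[OF v] nbfun_CG[OF v] _ c]) (simp add: set_vlist)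
qed

lemma iso_at:
  assumes "valid d cs" "iso_check (nb d (arcl cs)) (vlist d) ws es" "set ws = V" shows "isomorphic (CG d cs) (V, dset es)"
  using iso_check[OF graph_CG[OF assms(1)] nbfun_CG[OF assms(1)] _ assms(2)] assms(3) by (simp add: set_vlist)

abbreviation (input) l0 where "l0 \<equiv> [False,False,False]"
abbreviation (input) l1 where "l1 \<equiv> [False,False,True]"
abbreviation (input) l2 where "l2 \<equiv> [False,True,False]"
abbreviation (input) l3 where "l3 \<equiv> [False,True,True]"
abbreviation (input) l4 where "l4 \<equiv> [True,False,False]"
abbreviation (input) l5 where "l5 \<equiv> [True,False,True]"
abbreviation (input) l6 where "l6 \<equiv> [True,True,False]"
abbreviation (input) l7 where "l7 \<equiv> [True,True,True]"

fun nibble :: "char \<Rightarrow> bool \<times> bool \<times> bool \<times> bool" where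
  "nibble (Char b0 b1 b2 b3 b4 b5 b6 b7) = (b0, b1, b2, b3)"

text \<open>A switch tree of depth 3 has 1 + 2 + 4 = 7 switches, four from the first character and
  three from the second. A triple therefore takes six characters.\<close>

definition decode_sw :: "char \<Rightarrow> char \<Rightarrow> sw" where
  "decode_sw x y = (case nibble x of (b0, b1, b2, b3) \<Rightarrow> case nibble y of (b4, b5, b6, b7) \<Rightarrow>
     Nd b0 (Nd b1 (Nd b2 Lf Lf) (Nd b3 Lf Lf)) (Nd b4 (Nd b5 Lf Lf) (Nd b6 Lf Lf)))"

fun decode :: "string \<Rightarrow> (sw \<times> sw \<times> sw) list" where
  "decode (a # b # c # d # e # f # s) = (decode_sw a b, decode_sw c d, decode_sw e f) # decode s"
| "decode _ = []"

section \<open>Representatives of the rotation snarks\<close>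

definition snark2 :: config where "snark2 = [[([False], Z1), ([True], Z1)]]"
definition snark3_1 :: config where "snark3_1 = [[([False,False], Z0), ([True,False], Z1)], [([False,True], Z0), ([True,True], Z2)]]"
definition snark3_2 :: config where "snark3_2 = [[([False,False], Z1), ([False,True], Z0), ([True,False], Z1), ([True,True], Z0)]]"
text \<open>The same graph as for \<open>snark3_1\<close>, with the second 2-cycle traversed
  backwards: this keeps its leaf sequence and turns the voltages 0, 2 into 1, 0. Both lead to the
  first Loupekine snark, even by the same vertex list.\<close>

definition snark3_3 :: config where "snark3_3 = [[([False,False], Z0), ([True,False], Z1)], [([False,True], Z1), ([True,True], Z0)]]"
definition snark4_1 :: config where "snark4_1 = [[(l0, Z1), (l1, Z1), (l2, Z0), (l4, Z0), (l6, Z0), (l3, Z0), (l5, Z0), (l7, Z1)]]"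
definition snark4_2 :: config where "snark4_2 = [[(l0, Z1), (l1, Z1), (l2, Z1), (l4, Z0), (l6, Z0), (l3, Z0), (l5, Z0), (l7, Z0)]]"
definition snark4_3 :: config where "snark4_3 = [[(l0, Z1), (l1, Z1), (l2, Z2), (l4, Z0), (l6, Z0), (l3, Z0), (l5, Z0), (l7, Z2)]]"
definition snark4_4 :: config where "snark4_4 = [[(l0, Z1), (l1, Z1), (l4, Z0), (l2, Z0), (l6, Z0), (l5, Z0), (l3, Z0), (l7, Z1)]]"
definition snark4_5 :: config where "snark4_5 = [[(l0, Z1), (l2, Z1)], [(l1, Z0), (l3, Z0), (l4, Z0), (l6, Z1), (l5, Z0), (l7, Z0)]]"
definition snark4_6 :: config where "snark4_6 = [[(l0, Z1), (l2, Z1)], [(l1, Z0), (l4, Z1), (l6, Z2), (l3, Z0), (l5, Z1), (l7, Z2)]]"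
definition snark4_7 :: config where "snark4_7 = [[(l0, Z1), (l2, Z1)], [(l1, Z1), (l4, Z1), (l6, Z1), (l3, Z1), (l5, Z1), (l7, Z1)]]"
definition snark4_8 :: config where "snark4_8 = [[(l0, Z1), (l2, Z1), (l1, Z0), (l4, Z0), (l6, Z0), (l3, Z0), (l5, Z0), (l7, Z0)]]"
definition snark4_9 :: config where "snark4_9 = [[(l0, Z1), (l2, Z1), (l1, Z0), (l4, Z0), (l6, Z0), (l3, Z0), (l5, Z0), (l7, Z1)]]"
definition snark4_10 :: config where "snark4_10 = [[(l0, Z1), (l2, Z1), (l1, Z1), (l4, Z0), (l6, Z0), (l3, Z0), (l5, Z0), (l7, Z2)]]"
definition snark4_11 :: config where "snark4_11 = [[(l0, Z1), (l2, Z1), (l1, Z2), (l4, Z0), (l6, Z0), (l3, Z0), (l5, Z0), (l7, Z2)]]"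
definition snark4_12 :: config where "snark4_12 = [[(l0, Z0), (l2, Z0), (l4, Z0), (l1, Z1), (l6, Z2), (l3, Z2), (l7, Z1), (l5, Z0)]]"
definition snark4_13 :: config where "snark4_13 = [[(l0, Z1), (l2, Z2), (l4, Z0), (l1, Z1), (l6, Z2), (l5, Z0)], [(l3, Z1), (l7, Z1)]]"
definition snark4_14 :: config where "snark4_14 = [[(l0, Z0), (l2, Z0), (l4, Z0), (l6, Z1)], [(l1, Z0), (l3, Z1), (l5, Z0), (l7, Z0)]]"
definition snark4_15 :: config where "snark4_15 = [[(l0, Z0), (l2, Z0), (l4, Z0), (l6, Z1), (l3, Z0), (l1, Z0), (l7, Z0), (l5, Z2)]]"

definition snarks4 :: "config list" where
  "snarks4 = [snark4_1, snark4_2, snark4_3, snark4_4, snark4_5, snark4_6, snark4_7, snark4_8, snark4_9, snark4_10, snark4_11, snark4_12, snark4_13, snark4_14, snark4_15]"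

lemma snark_snark2: "snark_at 1 snark2
    ''EIMJOFNKGD''
    ''DEIMFJNGKO''"
  by code_simp

lemma snark_snark3_1: "snark_at 2 snark3_1
    ''EIMQYU]RJFDN^VZGKS[WO_''
    ''DEIMQUY]FJNRVZ^GKOSW[_''"
  by code_simp

lemma snark_snark3_2: "snark_at 2 snark3_2
    ''EIMQ]UYVJFDN^RZGKS_WO[''
    ''DEIMQUY]FJNRVZ^GKOSW[_''"
  by code_simp

lemma snark_snark3_3: "snark_at 2 snark3_3
    ''EIMQYU]RJFDN^VZGKS[WO_''
    ''DEIMQUY]FJNRVZ^GKOSW[_''"
  by code_simp

lemma snark_snark4_5: "snark_at 3 snark4_5
    ''[O_{sow?gWKGSDEIUQem}uqYM]yvkajcibVJRFf~n^zNZr''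
    ''QakjVcbiUImeE}JR]MyqYuv~fnDFW^NZrzoSKgGO_{?sw''"
  by code_simp

lemma snark_snark4_14: "snark_at 3 snark4_14
    ''^z~vfRJVnjbrZNFDEIUmeQ}ai{_OG[ws?Kqy]MYuoWgkSc''
    ''kWKosGcSg?DuE_O[{w}eQIamUiM]YqyvFNZ^~zrjbVJnf''"
  by code_simp

lemma snark_snark4_15: "snark_at 3 snark4_15
    ''s{_O[kw?mUegoW}IQKGScuDEaivqYM]yFJVnjbRf~^zNZr''
    ''GDKO_{[s?wbSgkWoczFjrRJVNZ^v~fnEIuaQiUme}qYy]''"
  by code_simp

lemma snark_snark4_12: "snark_at 3 snark4_12
    ''vbZjrVJRf}n{_O[]wcksFNDGKWSgyo~^zeQIEMUm?Yqiua''
    ''?muaUiIQqeYzEMD^FNZvbRJjVrfn{}_]OGyo~KW[wkscS''"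
  by code_simp

lemma snark_snark4_7: "snark_at 3 snark4_7
    ''sfy}]RJVnw[O_j{aQer?IUmvZkbicEMDGFNKSWgoYquz^~''
    '']M}yfs[wnRJVYu~qg^zoFNDEGOKWSkbcijaUIQmZvre{_''"
  by code_simp

lemma snark_snark4_13: "snark_at 3 snark4_13
    ''uzYeqjaQVJIUREMDFf{_OG[siKcSwgy]}n?mo~^NWvZbkr''
    ''gsyw[icSOKGW_krf{vZbRDFNJ?o}n]Vm~^UEIMYuzajqe''"
  by code_simp

lemma snark_snark4_4: "snark_at 3 snark4_4
    ''VjzJRvnf^~aQerZcNFIUDEm}b]MYuyiqgSKGO_?oW{ksw[''
    ''EM]YuyqiUmI}bgDFJRNZvz^jVnr~ceQSafKG?Woksw{_[''"
  by code_simp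

lemma snark_snark4_1: "snark_at 3 snark4_1
    ''[O_{sow?kWKGDfaRJFVjeQIEUM]}bYumyqigSc~vn^NzrZ''
    ''ZrjznVv~^NFJceDSGKOWow[_{s?kQafRIEgbUimu}YM]y''"
  by code_simp

lemma snark_snark4_2: "snark_at 3 snark4_2
    ''SKgWo{_OG[ws?cjeVJRbDFQIEUikfa}qYumMy]~vn^NzrZ''
    ''w[O_?{soGWKcSjekqy]MYmu}afQEIUDigbRJFV~^NZvnz''"
  by code_simp

lemma snark_snark4_11: "snark_at 3 snark4_11
    ''^z~vnVjaJRgrZNFDQeIEUkbfiqMY]ymu}cSKGWO_?ow{s[''
    ''O_{[sow?ebkWKGSgjQar~vZ^znNVJFDREIMUfic}]umyq''"
  by code_simp

lemma snark_snark4_6: "snark_at 3 snark4_6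
    ''?_O[{vnVjJRfrZaQeIUGbkicDEFNKWSow}gsy]MqY^~zmu''
    ''[w}gsy]oSWKGO_?f{rZvnkbRJVjaciFDNEMQIUmuYz^~q''"
  by code_simp

lemma snark_snark4_3: "snark_at 3 snark4_3
    ''nVzjJeRvqQIZrNF^~afkUDEMY]ymu}cWo{_OGKSgbi?sw[''
    ''isU{[ow?_ObgWKGSc}um]yqYMjeEIDQFVJRafknv~zr^N''"
  by code_simp

lemma snark_snark4_8: "snark_at 3 snark4_8
    ''Yque}QajVJIUmy]MERgDFkbfirZNv~n^zs{_OG[owWKSc?''
    ''u}Y]MmyqeQaIEUjgs[wo{_O?GDKWScikbfRJVFN^~zrnv''"
  by code_simp

lemma snark_snark4_10: "snark_at 3 snark4_10
    ''vZ~^NajVnzrJFeQIURgDEqkbfiMY]ymu}cSKWGO_?ow{s[''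
    ''M]}YuyqmgScUiEIDGKfO[s{_ow?WbRkJFeQjVanzr~^NZ''"
  by code_simp

lemma snark_snark4_9: "snark_at 3 snark4_9
    ''^z~vnVjJRgfrZNFDEIUicSKGO_{s[oWw?aQekbq}YuMmy]''
    ''nzVvZrN^~JFfRcib}umUy]YqMEIDQekjagSKWGsO[?wo_''"
  by code_simp

lemma signature3: "signature 2 snark3_1 \<noteq> signature 2 snark3_2"
  by code_simp

text \<open>The entries belong to 16 up to 31 reached vertices. Every row for
  \<open>T\<^sub>4\<close> adds up to 46, the number of vertices, so no vertex falls outside the
  range.\<close>

lemma signature4_1: "signature 3 snark4_1 = [0, 0, 3, 12, 3, 6, 6, 0, 0, 3, 6, 3, 0, 3, 0, 1]"
  by code_simp

lemma signature4_2: "signature 3 snark4_2 = [0, 0, 0, 0, 0, 15, 6, 3, 0, 3, 6, 12, 0, 0, 0, 1]"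
  by code_simp

lemma signature4_3: "signature 3 snark4_3 = [0, 0, 0, 0, 3, 15, 6, 0, 9, 6, 6, 0, 0, 0, 0, 1]"
  by code_simp

lemma signature4_4: "signature 3 snark4_4 = [0, 0, 6, 0, 12, 0, 12, 0, 0, 0, 0, 12, 0, 0, 0, 4]"
  by code_simp

lemma signature4_5: "signature 3 snark4_5 = [0, 0, 0, 0, 0, 6, 6, 6, 6, 9, 6, 6, 0, 0, 0, 1]"
  by code_simp

lemma signature4_6: "signature 3 snark4_6 = [0, 0, 0, 0, 0, 0, 15, 6, 3, 0, 6, 6, 6, 3, 0, 1]"
  by code_simp

lemma signature4_7: "signature 3 snark4_7 = [0, 0, 0, 0, 0, 0, 0, 12, 12, 0, 0, 6, 6, 6, 0, 4]"
  by code_simp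

lemma signature4_8: "signature 3 snark4_8 = [0, 0, 0, 0, 12, 12, 0, 0, 0, 6, 12, 0, 0, 0, 0, 4]"
  by code_simp

lemma signature4_9: "signature 3 snark4_9 = [0, 0, 0, 0, 3, 15, 6, 0, 0, 3, 3, 9, 6, 0, 0, 1]"
  by code_simp

lemma signature4_10: "signature 3 snark4_10 = [0, 0, 0, 3, 6, 9, 6, 0, 6, 0, 6, 3, 6, 0, 0, 1]"
  by code_simp

lemma signature4_11: "signature 3 snark4_11 = [0, 0, 3, 6, 12, 0, 6, 3, 6, 0, 3, 3, 0, 3, 0, 1]"
  by code_simp

lemma signature4_12: "signature 3 snark4_12 = [0, 0, 3, 3, 9, 9, 3, 6, 3, 0, 3, 3, 3, 0, 0, 1]"
  by code_simp

lemma signature4_13: "signature 3 snark4_13 = [0, 0, 0, 0, 0, 0, 6, 18, 0, 0, 6, 12, 0, 3, 0, 1]"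
  by code_simp

lemma signature4_14: "signature 3 snark4_14 = [0, 0, 0, 0, 0, 0, 0, 0, 24, 18, 0, 3, 0, 0, 0, 1]"
  by code_simp

lemma signature4_15: "signature 3 snark4_15 = [0, 0, 0, 0, 0, 0, 0, 24, 0, 18, 0, 3, 0, 0, 0, 1]"
  by code_simp

text \<open>Each entry gives a configuration, one side of a cut with at most three edges, a cycle on
  this side and a cycle on the other side.\<close>

definition cut_data4 :: "(config \<times> string \<times> string \<times> string) list" where
  "cut_data4 = [([[(l0, Z0), (l2, Z1)], [(l1, Z0), (l4, Z0), (l6, Z0), (l3, Z0), (l5, Z0), (l7, Z0)]],
    ''DEGIMKOQUY]SW[_aeimquy}cgkosw{?'', ''IUiaQ'', ''VJRbj''),
  ([[(l0, Z0), (l2, Z1)], [(l1, Z0), (l4, Z0), (l6, Z1), (l3, Z2), (l5, Z0), (l7, Z0)]],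
    ''DEFGIJNKOQURVZ^SW[_aimbfjrvz~cgkosw{?'', ''IUiaQ'', ''YM]yq''),
  ([[(l0, Z0), (l2, Z1)], [(l1, Z0), (l4, Z0), (l6, Z2), (l3, Z1), (l5, Z0), (l7, Z0)]],
    ''DEFGIJNKOQURVZ^SW[_aimbfjnrvz~cgksw{?'', ''IUiaQ'', ''Yuoyq''),
  ([[(l0, Z0), (l2, Z1)], [(l1, Z1), (l4, Z0), (l6, Z1), (l3, Z2), (l5, Z0), (l7, Z2)]],
    ''DEFGIJNKOQURVZ^SW[_aeimbfjrvz~ckosw{?'', ''IUiaQ'', ''Yu}gq''),
  ([[(l0, Z0), (l2, Z1)], [(l1, Z1), (l4, Z0), (l6, Z2), (l3, Z1), (l5, Z0), (l7, Z2)]],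
    ''DEFGIJNKOQURVZ^SW[_aeimbfjnrvz~cksw{?'', ''IUiaQ'', ''Yu}gq''),
  ([[(l0, Z0), (l2, Z1)], [(l1, Z2), (l4, Z0), (l6, Z2), (l3, Z1), (l5, Z0), (l7, Z1)]],
    ''DEFGIJNKOQURVZ^SW[_aeimbjnrvz~cgksw{?'', ''IUiaQ'', ''Yuoyq''),
  ([[(l0, Z1), (l2, Z1)], [(l1, Z0), (l4, Z0), (l6, Z0), (l3, Z0), (l5, Z0), (l7, Z0)]],
    ''DEGIMKOQUY]SW[_aeimquy}bjcgkosw{?'', ''[w?_O'', ''v~^NZ''),
  ([[(l0, Z1), (l2, Z1)], [(l1, Z0), (l4, Z0), (l6, Z1), (l3, Z2), (l5, Z0), (l7, Z0)]],
    ''DEFGIJNKOQURVZ^SW[_aimbfjrvz~cgkosw{?'', ''[w?_O'', ''YM]yq''),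
  ([[(l0, Z1), (l2, Z1)], [(l1, Z1), (l4, Z0), (l6, Z1), (l3, Z2), (l5, Z0), (l7, Z2)]],
    ''DEFGIJNKOQURVZ^SW[_aeimbfjrvz~ckosw{?'', ''[w?_O'', ''Yu}gq''),
  ([[(l0, Z1), (l2, Z1)], [(l1, Z1), (l4, Z0), (l6, Z2), (l3, Z1), (l5, Z0), (l7, Z2)]],
    ''DEFGIJNKOQURVZ^SW[_aeimbfjnrvz~cksw{?'', ''[w?_O'', ''Yu}gq''),
  ([[(l0, Z0), (l2, Z0), (l4, Z0), (l1, Z0), (l6, Z0), (l3, Z0), (l5, Z0), (l7, Z0)]],
    ''DEGIMKOQUY]SW[_aeimquy}cgkosw{?'', ''IUiaQ'', ''VJRbj''),
  ([[(l0, Z0), (l2, Z1), (l4, Z2), (l1, Z2), (l6, Z1), (l3, Z1), (l5, Z1), (l7, Z1)]],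
    ''DEFGMJNKOY]RV^SW[quy}bfjnz~cgkosw'', ''KWkcS'', ''_{mv?''),
  ([[(l0, Z0), (l2, Z0), (l4, Z0), (l1, Z0), (l6, Z0), (l5, Z0)], [(l3, Z1), (l7, Z1)]],
    ''DEGIMKOQUY]SW[_aeimquy}n~cgkosw{?'', ''IUiaQ'', ''VJRbj''),
  ([[(l0, Z0), (l2, Z0), (l4, Z0), (l1, Z0), (l6, Z0), (l5, Z0), (l3, Z0), (l7, Z0)]],
    ''DEGIMKOQUY]SW[_aeimquy}cgkosw{?'', ''IUiaQ'', ''Vn~bj''),
  ([[(l0, Z0), (l2, Z1), (l4, Z2), (l1, Z2), (l6, Z2), (l5, Z2), (l3, Z2), (l7, Z1)]],
    ''DEFGMJNKOY]RV^SW[quy}bfjnz~cgkosw'', ''[wyfs'', ''_{vm?''),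
  ([[(l0, Z0), (l2, Z0), (l4, Z0), (l6, Z0), (l1, Z0), (l3, Z0), (l5, Z0), (l7, Z0)]],
    ''DEGIMKOQUY]SW[_aeimquy}cgkosw{?'', ''IUiaQ'', ''VJRbj''),
  ([[(l0, Z0), (l2, Z1), (l4, Z1), (l6, Z1), (l1, Z0), (l3, Z1), (l5, Z1), (l7, Z1)]],
    ''DEFGMJNKOY]RV^SW[quy}bfjnz~cgkosw'', ''KWogS'', ''UIQai''),
  ([[(l0, Z0), (l2, Z0), (l4, Z0), (l6, Z0), (l1, Z0), (l3, Z0), (l7, Z0), (l5, Z0)]],
    ''DEGIMKOQUY]SW[_aeimquy}cgkosw{?'', ''IUiaQ'', ''VJRbj''),
  ([[(l0, Z0), (l2, Z1), (l4, Z1), (l6, Z1), (l1, Z0), (l3, Z2), (l7, Z2), (l5, Z2)]],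
    ''DEFGMJNKOY]RV^SW[quy}bfjnz~cgkosw'', ''[wbjs'', ''_{em?''),
  ([[(l0, Z1), (l2, Z1), (l4, Z0), (l6, Z1), (l1, Z1), (l3, Z1), (l7, Z0), (l5, Z1)]],
    ''DEFGIJNKOQUVZ^S[_aeimjnrvz~cgsw{?'', ''[w?_O'', ''Yubkq''),
  ([[(l0, Z0), (l2, Z0), (l4, Z0), (l6, Z0), (l3, Z0), (l1, Z0), (l7, Z0), (l5, Z0)]],
    ''DEGIMKOQUY]SW[_aeimquy}cgkosw{?'', ''IUiaQ'', ''VJRbj''),
  ([[(l0, Z0), (l2, Z1), (l4, Z1), (l6, Z1), (l3, Z0), (l1, Z2), (l7, Z2), (l5, Z2)]],
    ''DEFGMJNKOY]RV^SW[quy}bfjnz~cgkosw'', ''[wbjs'', ''_{me?''),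
  ([[(l0, Z0), (l4, Z0), (l2, Z0), (l6, Z0), (l1, Z0), (l5, Z0), (l3, Z0), (l7, Z0)]],
    ''DEGIMKOQUY]SW[_aeimquy}cgkosw{?'', ''IUiqaQ'', ''Vn~^zj''),
  ([[(l0, Z1), (l4, Z1), (l2, Z2), (l6, Z2), (l1, Z1), (l5, Z1), (l3, Z2), (l7, Z2)]],
    ''DEFGIJNKOQURZ^W[_aeimbfrvz~kosw{?'', ''[sb?_O'', ''Vnugyj''),
  ([[(l0, Z0), (l2, Z1)], [(l1, Z1), (l4, Z0), (l6, Z0), (l3, Z0), (l5, Z0), (l7, Z2)]],
    ''I[DKaZnbzcUoJ{WiVjvQEkwFGS_OeRf^r~s?N'', ''IUiaQ'', ''Yu}gq''),
  ([[(l0, Z0), (l2, Z1)], [(l1, Z2), (l4, Z0), (l6, Z0), (l3, Z0), (l5, Z0), (l7, Z1)]],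
    ''I[DKaZnbzcUoJ{WiVjvQEkwFGS_OeR^r~sg?N'', ''IUiaQ'', ''YM]yq''),
  ([[(l0, Z0), (l2, Z1)], [(l1, Z2), (l4, Z0), (l6, Z1), (l3, Z2), (l5, Z0), (l7, Z1)]],
    ''I[DKamZbzcUoJ{WiVjvQEkwFGS_OeR^r~sg?N'', ''IUiaQ'', ''YM]yq''),
  ([[(l0, Z1), (l2, Z1)], [(l1, Z0), (l4, Z0), (l6, Z2), (l3, Z1), (l5, Z0), (l7, Z0)]],
    ''I[DKamZnbzcUJ{WiVjvQEkwFGS_ORf^r~sg?N'', ''[w?_O'', ''Yuoyq''),
  ([[(l0, Z1), (l2, Z1)], [(l1, Z2), (l4, Z0), (l6, Z1), (l3, Z2), (l5, Z0), (l7, Z1)]],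
    ''I[DKamZbzcUoJ{WiVjvQEkwFGS_OeR^r~sg?N'', ''[w?_O'', ''YM]yq'')]"

lemma cut_data4: "alll (\<lambda>(cs, x, p, q). cut_at 3 cs x p q) cut_data4"
  by code_simp

definition cuts4 :: "config list" where "cuts4 = map fst cut_data4"

section \<open>Repeated representatives\<close>

definition snark4_16 :: config where "snark4_16 = [[(l0, Z1), (l2, Z2), (l4, Z0), (l1, Z1), (l6, Z2), (l5, Z0)], [(l3, Z2), (l7, Z2)]]"

lemma valid_snark4_16: "valid_check 3 snark4_16"
  by code_simp

lemma lifts_snark4_16: "sort (map length (all_lifts snark4_16)) = sort (map length (all_lifts snark4_13))"
  by code_simp

lemma iso_snark4_16:
  "iso_check (nb 3 (arcl snark4_16)) (vlist 3) (map vx ''DEIMQUY]aeimquy}FJNRVZ^bfjnrvz~GKOSW[_cgkosw{?'') (elist (nb 3 (arcl snark4_13)) (vlist 3) [])"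
  "alll (\<lambda>x. mem x (map vx ''DEIMQUY]aeimquy}FJNRVZ^bfjnrvz~GKOSW[_cgkosw{?'')) (vlist 3) \<and> alll (\<lambda>x. mem x (vlist 3)) (map vx ''DEIMQUY]aeimquy}FJNRVZ^bfjnrvz~GKOSW[_cgkosw{?'')"
  by code_simp+

definition snark4_17 :: config where "snark4_17 = [[(l0, Z1), (l2, Z1)], [(l1, Z0), (l4, Z2), (l6, Z1), (l3, Z0), (l5, Z2), (l7, Z1)]]"

lemma valid_snark4_17: "valid_check 3 snark4_17"
  by code_simp

lemma lifts_snark4_17: "sort (map length (all_lifts snark4_17)) = sort (map length (all_lifts snark4_6))"
  by code_simp

lemma iso_snark4_17:
  "iso_check (nb 3 (arcl snark4_17)) (vlist 3) (map vx ''DGKOSW[_cgkosw{?FJNRVZ^bfjnrvz~EIMQUY]aeimquy}'') (elist (nb 3 (arcl snark4_6)) (vlist 3) [])"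
  "alll (\<lambda>x. mem x (map vx ''DGKOSW[_cgkosw{?FJNRVZ^bfjnrvz~EIMQUY]aeimquy}'')) (vlist 3) \<and> alll (\<lambda>x. mem x (vlist 3)) (map vx ''DGKOSW[_cgkosw{?FJNRVZ^bfjnrvz~EIMQUY]aeimquy}'')"
  by code_simp+

definition snark4_18 :: config where "snark4_18 = [[(l0, Z0), (l2, Z1), (l1, Z0), (l3, Z0), (l4, Z0), (l6, Z0)], [(l5, Z1), (l7, Z1)]]"

lemma valid_snark4_18: "valid_check 3 snark4_18"
  by code_simp

lemma lifts_snark4_18: "sort (map length (all_lifts snark4_18)) = sort (map length (all_lifts snark4_5))"
  by code_simp

lemma iso_snark4_18:
  "iso_check (nb 3 (arcl snark4_18)) (vlist 3) (map vx ''DEMIY]QUquy}eamiFNJZ^RVrvz~fbnjGOK[_SWsw{?gcok'') (elist (nb 3 (arcl snark4_5)) (vlist 3) [])"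
  "alll (\<lambda>x. mem x (map vx ''DEMIY]QUquy}eamiFNJZ^RVrvz~fbnjGOK[_SWsw{?gcok'')) (vlist 3) \<and> alll (\<lambda>x. mem x (vlist 3)) (map vx ''DEMIY]QUquy}eamiFNJZ^RVrvz~fbnjGOK[_SWsw{?gcok'')"
  by code_simp+

text \<open>\<open>snark4_16\<close> is \<open>snark4_13\<close> with its 2-cycle reversed,
  \<open>snark4_17\<close> is the reflection of \<open>snark4_6\<close> with its 2-cycle reversed,
  and the normalisation does not compare these directions. \<open>snark4_18\<close> is the image of
  \<open>snark4_5\<close> under a tree automorphism; both have the same sequence of leaves, divided
  differently into cycles.\<close>

definition dups4 :: "config list" where "dups4 = [snark4_16, snark4_17, snark4_18]"

definition test4 :: "string \<times> bool list list list \<Rightarrow> bool" where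
  "test4 h = test_shape ((snarks4 @ dups4) @ cuts4) (allsw 3) (decode (fst h)) (snd h)"

text \<open>Shapes that are not rejected as a whole, each with encoded triples of switch trees whose
  colourings exclude survivors. Where the string is empty, all survivors are listed configurations
  or not minimal. The division into short lists keeps the single evaluations moderate.\<close>

definition hints_1 :: "(string \<times> bool list list list) list" where
  "hints_1 = [(''pcdfbepghbjakdgemaipodeeldjpfagemdaglgnafdgdegabbphcnajapclbjepbhaiemakdoeepgagbeccfgfigechbnaldhbneppmgoagecpagmbibmakfkbifigagcfoacaafeelddbnaegkcgdaecbofedkbiceekdieigkpcfeembofibgpkcjdfbdciaopepgekcefgemgeamgafgdffjdpglcbfhbldbbnegamfceeaagcbafgdegpfbajgfcfchddejchbjafghbjfjghckbkeaemccggbafiemdlepfjdipkccecbadggfbnfpemdecgejbpcfbdajchboccbcpnejahfcdiaopldlgnaafcpopfcjdlehefalegagdmgadggkghbpebpiegdegbdlpnchdnejdbgjfpcmpofgekfegcpiacggbnbnbpenfnedpmpodeemfaacghpfdlelenalpeccfgeabgpmphdbajgcaoacpofgaiejbnpdpeecfkaiaodkccdiegecamakfhfnfddpalfhbbfhbnpeeebgfdglgjgoacpcflenglehcjgjphbjglchgdffgfpbcfgkfggkbceaaggfehbfemfkekbkcgegapcfafdpafflejfjchgoameefmpcdgemdcbichalfhecambcbbphblegdiaabhchbdgfpbehejepbnaoeopkgfcdcjgifipepibkpaahppflfmbafaeogcpgaafmgcddpfpnamdgaeekbeaababiakbfenfdpfgbcddnphdfcfalbpdcageegmempkeebgembcaoccekboaodggaggbhappnf'',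 [[l0,l4,l2,l6,l1,l5,l3,l7]]),
  (''cdpehcpgcdaeleegpandppeecdpbfcdgpppdeeccdgdcndoekphdnbdddgmfofkgdglpodnbbgjgnb'', [[l0,l2,l1,l4,l3,l6,l5,l7]]),
  ('''', [[l0,l1,l2,l4,l5],[l3,l6,l7]]),
  (''ggeacdhplcjfnpdfickgldpbndcfobdehaeclgmpgdcgddkaabadmbodldecdplaffaenejfggecfppgdahcoaccggkghppbcgoappmgdglgapfebapaheegogecodjcadbceejcnddpggkaaehcmchcnbogngjeedebnbdcfggdlcpaafobdgepfdacfcgphcacegjfbdnpibmbjgedoble'', [[l0,l2,l1,l4],[l3,l6,l5,l7]])]"

definition hints_2 :: "(string \<times> bool list list list) list" where
  "hints_2 = [(''hccdpeppnpjenfjbfpockpmbiemcbdfcofhbhphdlflbfcpakplggplekbcdlcibocdcodcfpgdpge'', [[l0,l2,l4,l6,l1,l3,l5,l7]]),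
  (''hbndgbbbgfag'', [[l0,l1,l4,l2,l6,l7,l3,l5]]),
  ('''', [[l0,l1,l2,l4,l5,l3,l6,l7]]),
  ('''', [[l0,l1,l2],[l3,l4,l6],[l5,l7]])]"

definition hints_3 :: "(string \<times> bool list list list) list" where
  "hints_3 = [(''gdedpfkpcdbbcbpgefmfickfjbobapkcmglamcnaocipngmbfgjecbncgffdhaodidjbcbip'', [[l0,l2,l4,l6,l1,l3,l7,l5]]),
  (''afjcgadapfpdcemapdpbgejcjcpagp'', [[l0,l1,l2,l3,l4,l6],[l5,l7]]),
  (''dcbefpnbpcjgdeefjfeahglcjfacbeofaajekpmanghaaadejpfdnbdcnfpdhgbendacedodjgjbeckaegkdeggfoedgidfbiccdoaaglalggbobjpjbdbecjddbdc'', [[l0,l2],[l1,l4,l6,l3,l7,l5]]),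
  ('''', [[l0,l1,l4],[l2,l5,l6],[l3,l7]])]"

definition hints_4 :: "(string \<times> bool list list list) list" where
  "hints_4 = [(''eecfechpeahdkpkadcfdofebcpjgbfibleogipdgpddgkakfkpnppcmcpghejpmgngkpkgef'', [[l0,l2,l4,l1,l6,l5,l3,l7]]),
  (''lejppfmbofaemgepcahbdaffpelanfmckdcejgfphfbanfpejefbhflfdgbppcfajpmcofgghgnfddofodcbccmdkaiakaofibaagpcaoemgpcdfbclppcfehejcfdddbbdgpcdcfgcbgeodfepalfebgcidopmdeecfkeebhfdbbdebgagdmacccpnfddbpodifoplglddaegifmcpghfbflpbabgmdmbmcpchbjekpccipngnbjcpgpgfe'', [[l0,l4],[l1,l6,l2,l5,l3,l7]]),
  ('''', [[l0,l1,l2,l3,l4],[l5,l6,l7]]),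
  (''eaidobbplfpgpfhgjbmbkdageamfkpeacpggjekpapjfgfbaacpaggpedbkgkgickbdfpgjdepcdmgepmdepkdocmaageamaogichagblgdggbidjgmalckejdlbodjenbhgbabeje'', [[l0,l1,l4,l5],[l2,l6,l3,l7]])]"

definition hints_5 :: "(string \<times> bool list list list) list" where
  "hints_5 = [(''caigablbnpadhboeochfeggendbfcbaceaieicfcacdpkbdblchdbbmflalalcjddp'', [[l0,l2,l4,l6,l3,l1,l7,l5]]),
  ('''', [[l0,l1,l2,l4,l6,l7,l3,l5]]),
  (''aegbbgkcoegpocpbbdfebppgpcfcmgmcfcfdlghgjdkdnpadlegpdegblenpnpiblecplpddapecifcdnpiplaopjdebfecbgfnfpdigcgmg'', [[l0,l1,l2,l4],[l3,l6,l5,l7]]),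
  ('''', [[l0,l1,l2],[l3,l4,l6,l7,l5]])]"

definition hints_6 :: "(string \<times> bool list list list) list" where
  "hints_6 = [(''gelcacbfjaepcgedaaagmgddgbapmbmcppbedgmdccepjppbfacfpb'', [[l0,l2,l4,l1,l6,l3,l5,l7]]),
  ('''', [[l0,l1,l2,l4,l6,l7,l5,l3]]),
  (''cegbefefadipncdfbbkfobobicncdfcgocfeadebdfabpdefmbkchadpapepipicgghpdfmbkgmfegjpfdeefccflfoacfapjepdicmfbapajeidmgkgabfddcofpg'', [[l0,l2,l4,l3,l5,l6,l1,l7]]),
  (''gdoeeafgnpecageghchdlgjbndgpjdigdclgedodacacaglcbcjplcjbhplcogackdddcgpdlcdeheddlebfheegpa'', [[l0,l2],[l1,l4],[l3,l6,l5,l7]])]"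

definition hints_7 :: "(string \<times> bool list list list) list" where
  "hints_7 = [(''makdggbdlpdckdhpmebbjbbficefkdpcjaffofgbgbdfjbcpgbdpdgmaeeig'', [[l0,l2,l4,l1,l6,l5],[l3,l7]]),
  (''aclaipafocjglcjdlcndfcpd'', [[l0,l1,l4,l2,l3,l6],[l5,l7]]),
  (''mdfaeagagegcodmbkakehcecgaadffcdlpdddpoegcgpagpemplfhcegndmpednfngkgaglefafbockcfempcpheip'', [[l0,l1,l2,l4,l6,l5,l7,l3]]),
  (''eeogigegmpfe'', [[l0,l1,l4,l6],[l2,l5],[l3,l7]])]"

definition hints_8 :: "(string \<times> bool list list list) list" where
  "hints_8 = [(''mckfgepdfglaaggamddpbcheiaodcgpcfejpkcaegpcbipkcmakpebhglabclapchfjadclpdcpdnbnejdhgopmakgagcpabifgpiebafgfpodcgcfiacbofkfogmcdabgnbodipiahgfchpbfjgddefgbaghbjengobmgefedeggpiemfmgaeibmdieickdngnabfmeogcbiaoamfngdclfjdfcbpmpogcfngpddajajglghffbbgacodgdfbfghabapffgdbdfbgnfledgffnfncfadancigcdegegmaegncfajagaaboggpegog'', [[l0,l4,l2,l6],[l1,l5,l3,l7]]),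
  (''kdcfpdnbjdffhgdepcpbhpddnajafalbjeobfecfkbmenedbkplcbfabibkgcdjemakglbbfafddoggpepnc'', [[l0,l2],[l1,l4,l6,l3,l5,l7]]),
  ('''', [[l0,l1,l2,l3,l4,l6,l7,l5]]),
  (''hcgbap'', [[l0,l1,l2,l4],[l3,l6],[l5,l7]])]"

definition hints_9 :: "(string \<times> bool list list list) list" where
  "hints_9 = [(''dehpnfjepchfhancbbggkeappafpjfpbfanfaaggkbpalgjfmdkbgefglajpcfmekcbdhbdekcafmehcngjbjdpclfipodcbkfgamclbpcbdobceidmpkpgfofgekcfanpdafdlencigkpgfcfoeegegcaippcffhbnddabeobedicpelpjbjahffppcbfjplbpefcaggbkebchbneaampkpncdbhckecdgcpddbfanalgpbhgffbdedogogopipidnbffnfgdofecibkdagecicoekgcfoenehdhbkeadgdjbbdnfddjbnaceccmboekdcffcndddnfdddcmgafappchblbibmckepdngjcpdlfhbagibmdfbhepfjddbhceaeeifapmckapdlgjbbehffpmfefeaebegmplgjgnagbeeaepbfepfapgfkabdfgjegacpkcjddbhgbdlcpgfchajeecgdmcdbjdfelbjcfajchcjpkcmdofafcdefebkckbogcaodobagiecegegcmgodia'', [[l0,l4,l1,l6,l2,l5,l3,l7]]),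
  (''dcpbjfjpnaag'', [[l0,l1,l2,l4,l6,l7],[l3,l5]]),
  (''afbghcfffcogbcogkbaemfhejaoeppndadlbgflgcbaclchp'', [[l0,l1,l4,l2,l5,l6,l3,l7]]),
  ('''', [[l0,l1,l2,l4,l3,l5,l6,l7]])]"

definition hints_10 :: "(string \<times> bool list list list) list" where
  "hints_10 = [(''gdmpcbfbbphcfdbphgbeacndlehpfdhgmcaeffdajp'', [[l0,l1,l2,l4,l6,l3,l5,l7]]),
  (''kplfgepppbnf'', [[l0,l1,l4,l2,l6,l7],[l3,l5]]),
  (''dabdhbkaaecpldjpnapfjaffccibiedajdhfmagbiefaddjdhcpfjalbbgbdnaldpcigidaenejdjpdajflfiecaoa'', [[l0,l4],[l1,l5,l2,l6],[l3,l7]]),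
  ('''', [[l0,l1,l4,l2,l5,l3,l6,l7]])]"

definition hints_11 :: "(string \<times> bool list list list) list" where
  "hints_11 = [(''jddbhcmdgeibiembgddbpgcebbndkcmaidgfdfobkfceacgf'', [[l0,l2,l4,l1,l6,l3,l7,l5]]),
  (''kfgaedbdfblecaadoflbhefcbchblelejdhfjbpfhegbmgmceecbeebefepcidgfmabahgjflgnbpdidmbcempapobcccbmedpddlpbahphggaedaggcefoaebkpgpkdiceffafplgipggcabffpfgpdndfdogceaghanpjcfepdpfpanafaedebibiaidmdddpcjpefaemc'', [[l0,l4,l1,l5,l2,l6],[l3,l7]]),
  (''kpdacbjedapp'', [[l0,l2,l4,l3,l5,l6],[l1,l7]]),
  (''iaopafopcciambofegibebgadfbgldpghfjejblpheggodgalfjppambccmpgfcgkfdphebeccccafbbbgld'', [[l0,l4],[l1,l6],[l2,l5,l3,l7]])]"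

definition hints_12 :: "(string \<times> bool list list list) list" where
  "hints_12 = [(''jghenglfichfkpggepocmecd'', [[l0,l1,l4,l2,l6,l5,l3,l7]]),
  (''fepafeipipnb'', [[l0,l1,l2,l4,l5,l6],[l3,l7]]),
  (''fgnejcddkblbcfmpge'', [[l0,l2,l4,l6],[l1,l5],[l3,l7]]),
  (''pebbhacdipoakdapgadebbhabahgngcpoceabahdnpkpcdiaafgpkfmbkdapbehppeccgcefnbddhpofefgpfeffnagdifagggmfoafplapgggmfaeofaggpjppgbglfnfbpbanplcpdppfefpbanplfpchplgjffpjfhcpflfbbhg'', [[l0,l4,l1,l6],[l2,l5,l3,l7]])]"

definition hints_13 :: "(string \<times> bool list list list) list" where
  "hints_13 = [(''maggff'', [[l0,l1,l4,l2,l6],[l3,l5,l7]]),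
  (''dcmfkbfdkcegkbdembpgfbkgbffpcbaemeialaobkghaeepggfdddehamfjfndbdgddeafobbgofmapancbbngjbichcmeaeobhpmgngjcjenpggegnejcef'', [[l0,l2,l1,l4,l6,l3,l7,l5]]),
  (''hgdpjchffchadpoakf'', [[l0,l2,l4,l6],[l1,l7],[l3,l5]]),
  ('''', [[l0,l1,l2],[l3,l4,l5,l6,l7]])]"

definition hints_14 :: "(string \<times> bool list list list) list" where
  "hints_14 = [(''lbhefcaakfgdjblffp'', [[l0,l1,l4,l2,l6,l5],[l3,l7]]),
  (''bcocfendnbnfebcakddfbpncfdbdjdnfcaidlppfmfkcgafgkadgmbeanbbfjalgmdfgkejcafjclaoehfaapaepgcccofpbmcicecifndjgfabggelchgcfffgaadkedffpdekdkbhppbapcahgepadndbeianclfldpbpfdekbhelpjgdadfeajcdgdbcgaffbkckgifjpfpkciffdgglfkbpfcglpjgcdhgcdgbggdamdcfgpkdkehgmdegmgickpdfcgnejcbghgepnafdjbjbffbbaefdigaenbicfdhbdbldfglbigdgobhghdmbadidepmpbgncjgleipgcepcala'', [[l0,l2,l1,l3,l4,l6,l5,l7]]),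
  (''kbacifkdmacflfbdebpeoceafandkfbajfldcpkgmdfpkcbbddlpbgickelgjemccakdjgjedgjaeg'', [[l0,l2],[l1,l4,l3,l6],[l5,l7]]),
  ('''', [[l0,l1,l4],[l2,l3,l6,l5,l7]])]"

definition hints_15 :: "(string \<times> bool list list list) list" where
  "hints_15 = [('''', [[l0,l1,l2,l4,l6],[l3,l5,l7]]),
  ('''', [[l0,l1,l2,l4,l6,l3,l7,l5]]),
  (''ddpfhpdaiamdkdkekampcgka'', [[l0,l2],[l1,l4,l6],[l3,l5,l7]]),
  (''fcapfpocfpheibcfbfkpogbbkbjblp'', [[l0,l1,l4,l5],[l2,l3,l6,l7]])]"

definition hints_16 :: "(string \<times> bool list list list) list" where
  "hints_16 = [(''mgpgdflpbehplphbfcjffcdplpfajccpibgpcpgpmbmecdibmciegdccogfdgecpieidfdkpbdhpfecgjahbbdhdlccfkcefgacakaacfbbdhplcbbmecdgpdplpcenabggacbpafahcfcbe'', [[l0,l2,l1,l4,l6,l3,l5,l7]]),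
  (''paldjgcekceffclfjeedigobmcceappbhcnfhgjapdnapdbbcpicafcpiaafkaeecpedgemcjbfenpjdhglbpffgjahcjbbeeecgifmpkggacakdaejafclbmaocagpfbalcfgdafaccgfkbhphcpgcpifafbefpdglepdncddhbpbibecefodaecbcagpecpcnepbmdkfiafafddfocicobhpdfdbmbkfegkbeaogaacdmddddbhdcgmfkfmfebmfdphcpbnfnepbnbpbffbcffjempidggjafbpanfpfbeacobcekekbeajanglengdabaoacagd'', [[l0,l4,l1,l5,l2,l6,l3,l7]]),
  (''dgefkcgdhedabembecgchbjphdjcgdnahfbdfccekagpkpcpkbepjc'', [[l0,l2],[l1,l3,l4,l6],[l5,l7]]),
  ('''', [[l0,l1,l4],[l2,l5,l3,l6,l7]])]"

definition hints_17 :: "(string \<times> bool list list list) list" where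
  "hints_17 = [('''', [[l0,l1,l2,l4,l6,l3],[l5,l7]]),
  (''fgpgkejdmaobofeagbapjdgfeedpmefdfpecbgadcacanpgdeppdadmekaigefcpldobjbop'', [[l0,l2,l4,l3,l6,l1,l7,l5]]),
  ('''', [[l0,l1,l2,l4,l3,l6,l5,l7]]),
  (''jddblcaeibodhcnajdedcfaanbddhgbdpflefcjdlckfmcmdgcaegf'', [[l0,l4],[l1,l5],[l2,l6,l3,l7]])]"

definition hints_18 :: "(string \<times> bool list list list) list" where
  "hints_18 = [(''jpdchgdabcfboehpidaghdbegaaekanehfcafcddmcoabekbdccfpfhfmpjcipkeeefdmgeegfbgee'', [[l0,l2,l4,l6],[l1,l3,l7,l5]]),
  (''deobpckeadnbncdbbpkcgfmbeppbadldaenglghgdgnepaldgfobkdneabbdidfgkfnepemfncjebaecigaeabnfncgcpfmgkgceockbdfccnbnpacbbjcdfnepfaeoepcdbafffoe'', [[l0,l2,l1,l3,l4,l6],[l5,l7]]),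
  ('''', [[l0,l1,l4,l2,l5],[l3,l6,l7]]),
  (''pajflfkbmbjangndhepejflb'', [[l0,l1,l4,l5],[l2,l6],[l3,l7]])]"

definition hints_19 :: "(string \<times> bool list list list) list" where
  "hints_19 = [(''fejabcgfdpbcbcobdpapjghedcmffambapldmdgccd'', [[l0,l2,l4,l6],[l1,l3,l5,l7]]),
  (''pblajdmdkbaakbgaieladgbpkgabmckgepcaafiekcfbnaddhgnaddiamdebnbpaledcldjefgnejchabaffgaeccemboegdmakfcbcaogapcegaaaebcfmelalcfbmdmbaaaggpocibodegnbpfbadefehfmdefibcdkecgadkgicbdbdnbhcpppbpflbpcccmcifpfjbnflddbdceccpmaffpfjahgldbdipmdiaefcgcpnfpeje'', [[l0,l4],[l1,l5,l2,l6,l3,l7]]),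
  (''nemekpgpbeeedafenpbejegagabfhdkanbibppcdnghdngjcoegfdgmembebgajeabaegaaegdbfha'', [[l0,l1,l4,l6],[l2,l5,l3,l7]]),
  (''bbfdkpjfdcebbbmajafcmffa'', [[l0,l2],[l1,l4],[l3,l6],[l5,l7]])]"

definition hints_20 :: "(string \<times> bool list list list) list" where
  "hints_20 = [(''pfecnffpnbbaogigpdmgdgddbaegjcpejgmpagibkfkdjboc'', [[l0,l2,l4,l1,l5,l6],[l3,l7]]),
  (''ggkpeefbmemb'', [[l0,l1,l2,l4,l6,l5,l3,l7]]),
  ('''', [[l0,l1,l2,l4,l3,l6,l7,l5]]),
  (''mcodcgeckfgacboaaecbodcp'', [[l0,l4],[l1,l5],[l2,l6],[l3,l7]])]"

definition hints_21 :: "(string \<times> bool list list list) list" where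
  "hints_21 = [(''nchacbccnbigpdfgladeagde'', [[l0,l2,l4,l6],[l1,l5,l3,l7]]),
  (''ogkbidopicpc'', [[l0,l1,l4,l2,l6,l3,l5,l7]]),
  (''afecpd'', [[l0,l1,l2,l4],[l3,l5,l6,l7]]),
  (''ccadmpfeffbppcdfbgpfjffa'', [[l0,l4],[l1,l6],[l2,l5],[l3,l7]])]"

definition hints_22 :: "(string \<times> bool list list list) list" where
  "hints_22 = [(''jeoeopcddaiafepeepapfdmfmgfapgndhpigoafgpeapnfefkbjeacdgcghdbckfhckfkbnghffgmbbpjeigicnapciciapboepgjendedbpjcpdpb'', [[l0,l1,l4,l6,l2,l3,l5,l7]]),
  (''cppejefdbbkc'', [[l0,l1,l2,l4,l6,l5],[l3,l7]]),
  ('''', [[l0,l1,l4,l2,l6,l3,l7,l5]]),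
  ('''', [[l0,l1,l2],[l3,l4],[l5,l6,l7]])]"

definition hints_23 :: "(string \<times> bool list list list) list" where
  "hints_23 = [(''ncdbbplcnfdbddkbnfdcebpfogldapldngneogkdopnakbebkapaog'', [[l0,l2,l1,l4,l3,l6],[l5,l7]]),
  (''agdfhgnpgpkadppdoabgjcldjdbpmedfmccdbbfckpcpgceenckgfpngpgddgcdgnpnpeemfcdjffgjbececjcldiglafggb'', [[l0,l2],[l1,l4,l3,l6,l5,l7]]),
  (''cpncdfmbogbfcfbbpp'', [[l0,l1,l4,l5,l2,l3,l6,l7]]),
  ('''', [[l0,l1,l4],[l2,l3,l6],[l5,l7]])]"

definition hints_24 :: "(string \<times> bool list list list) list" where
  "hints_24 = [('''', [[l0,l2,l4],[l1,l5,l6,l3,l7]]),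
  (''pchfjeodobofabddhbegigfpdpigfeigfadpngdpfpgdebcahpldedkggbhpapipddepicfgephbabbpjglpmpmcfejpkcefjakajcieecaghchahegahgepdbfccpnapedbecbemdnpegfpigeaachdjpggedhplplpibdpoghghboplbjaecoaadkphelakfabbgjpagbfpbeccaegagbpopidna'', [[l0,l2],[l1,l3,l4,l6,l5,l7]]),
  (''namakdadjapdocoancleapcgmghpoe'', [[l0,l1,l2,l3,l4,l6,l5,l7]]),
  ('''', [[l0,l1,l4],[l2,l5],[l3,l6,l7]])]"

definition hints_25 :: "(string \<times> bool list list list) list" where
  "hints_25 = [(''obogjbnejdbgfpegkb'', [[l0,l2,l4],[l1,l5,l6],[l3,l7]]),
  (''mfhcjflcdagfcgdaddppjfkcppfepb'', [[l0,l1,l4,l2,l3,l6,l5,l7]]),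
  (''ldjeepodfakc'', [[l0,l1,l2,l3,l4,l5,l6,l7]]),
  (''fpcdjbkpbbfdeancjpednfagmecfdfkpogecgcecbdkcpblp'', [[l0,l2,l1,l4],[l3,l6],[l5,l7]])]"

definition hints_26 :: "(string \<times> bool list list list) list" where
  "hints_26 = [('''', [[l0,l2,l1,l4,l6],[l3,l5,l7]]),
  (''kcdeaacpgblejbbgagmfeaeghchgjc'', [[l0,l1,l4,l2,l5,l6],[l3,l7]]),
  (''gabbabjgfdpcbfcdienenaep'', [[l0,l1,l4,l6],[l2,l3,l5,l7]]),
  (''mpccadbpfeffecmpgdggmbkeepaeafodmggdifgcccjbfppp'', [[l0,l4,l1,l6],[l2,l5],[l3,l7]])]"

definition hints_27 :: "(string \<times> bool list list list) list" where
  "hints_27 = [(''agfddccfdggcgboacpndnbnfdggbkpbgigmpmappkgfdoglfjehdmbeehelgoccpebjggbhgkflgjf'', [[l0,l2,l4,l1,l5,l6,l3,l7]]),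
  (''ggmakdaaodccgemccbhpaebfkaeegbpaoboecpjfkbjfhddcibofdcgppbmalcfendjgcbicbfnpnd'', [[l0,l2,l1,l4,l6,l5],[l3,l7]]),
  (''gfgdgboeoboaadjaoaefnckccciahgceiphpdfddkdmbcaiefffefbmgfgmdnbpdedcpjeephpcciadfkapbjddeeblfjpee'', [[l0,l1,l2],[l3,l4,l6,l5,l7]]),
  (''lpdaffeaidkpidopaanddgbalbpcbfbppgfeieedkfkegcccogmcopdddafficecieffpcbcnddang'', [[l0,l4,l1,l5],[l2,l6,l3,l7]])]"

definition hints_28 :: "(string \<times> bool list list list) list" where
  "hints_28 = [(''ccnejaicoajbngabke'', [[l0,l1,l4,l6,l2,l3,l7,l5]]),
  ('''', [[l0,l1,l2,l4,l3,l6],[l5,l7]]),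
  ('''', [[l0,l1,l4],[l2,l5,l6,l3,l7]]),
  (''bppblelplgfdlefbpbgaacodjgnafgobmeefhgnfldgamccf'', [[l0,l4,l1,l5],[l2,l6],[l3,l7]])]"

definition hints4 :: "(string \<times> bool list list list) list" where
  "hints4 = hints_1 @ hints_2 @ hints_3 @ hints_4 @ hints_5 @ hints_6 @ hints_7 @ hints_8 @ hints_9 @ hints_10 @ hints_11 @ hints_12 @ hints_13 @ hints_14 @ hints_15 @ hints_16 @ hints_17 @ hints_18 @ hints_19 @ hints_20 @ hints_21 @ hints_22 @ hints_23 @ hints_24 @ hints_25 @ hints_26 @ hints_27 @ hints_28"

text \<open>A small selection from the 128 automorphisms in \<open>allsw 3\<close>, enough to reject
  all shapes that are neither closed on a subtree nor among the listed ones.\<close>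

definition swaps4 :: "sw list" where
  "swaps4 = [Nd True (Nd False (Nd True Lf Lf) (Nd True Lf Lf)) (Nd True (Nd True Lf Lf) (Nd False Lf Lf)), Nd True (Nd False (Nd True Lf Lf) (Nd False Lf Lf)) (Nd False (Nd True Lf Lf) (Nd True Lf Lf)), Nd False (Nd False (Nd True Lf Lf) (Nd False Lf Lf)) (Nd True (Nd False Lf Lf) (Nd True Lf Lf)), Nd False (Nd True (Nd False Lf Lf) (Nd False Lf Lf)) (Nd True (Nd True Lf Lf) (Nd True Lf Lf)), Nd True (Nd True (Nd False Lf Lf) (Nd True Lf Lf)) (Nd True (Nd True Lf Lf) (Nd True Lf Lf)), Nd False (Nd False (Nd False Lf Lf) (Nd True Lf Lf)) (Nd False (Nd False Lf Lf) (Nd False Lf Lf)), Nd True (Nd True (Nd True Lf Lf) (Nd True Lf Lf)) (Nd False (Nd False Lf Lf) (Nd False Lf Lf)), Nd True (Nd True (Nd False Lf Lf) (Nd True Lf Lf)) (Nd False (Nd True Lf Lf) (Nd True Lf Lf)), Nd False (Nd True (Nd False Lf Lf) (Nd False Lf Lf)) (Nd False (Nd False Lf Lf) (Nd False Lf Lf)), Nd False (Nd True (Nd False Lf Lf) (Nd False Lf Lf)) (Nd False (Nd True Lf Lf) (Nd False Lf Lf)), Nd False (Nd False (Nd True Lf Lf) (Nd False Lf Lf)) (Nd False (Nd True Lf Lf) (Nd False Lf Lf)), Nd True (Nd False (Nd False Lf Lf) (Nd False Lf Lf)) (Nd False (Nd True Lf Lf) (Nd False Lf Lf)), Nd True (Nd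 True (Nd False Lf Lf) (Nd False Lf Lf)) (Nd False (Nd False Lf Lf) (Nd False Lf Lf)), Nd True (Nd True (Nd False Lf Lf) (Nd True Lf Lf)) (Nd False (Nd True Lf Lf) (Nd False Lf Lf)), Nd True (Nd False (Nd True Lf Lf) (Nd False Lf Lf)) (Nd True (Nd True Lf Lf) (Nd True Lf Lf))]"

text \<open>The subtree roots are all inner vertices of a branch except its root. The bound 17
  exceeds twice the number 8 of leaf paths by one; 5 and 9 arise in the same way for the smaller
  trees.\<close>

lemma shapes4: "check_shapes [[False], [True], [False, False], [False, True], [True, False], [True, True]] swaps4 (map snd hints4)
    (gen (replicate 17 ()) (blists 3) [] [])"
  by code_simp

lemma hints_1: "alll test4 hints_1"
  by code_simp

lemma hints_2: "alll test4 hints_2"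
  by code_simp

lemma hints_3: "alll test4 hints_3"
  by code_simp

lemma hints_4: "alll test4 hints_4"
  by code_simp

lemma hints_5: "alll test4 hints_5"
  by code_simp

lemma hints_6: "alll test4 hints_6"
  by code_simp

lemma hints_7: "alll test4 hints_7"
  by code_simp

lemma hints_8: "alll test4 hints_8"
  by code_simp

lemma hints_9: "alll test4 hints_9"
  by code_simp

lemma hints_10: "alll test4 hints_10"
  by code_simp

lemma hints_11: "alll test4 hints_11"
  by code_simp

lemma hints_12: "alll test4 hints_12"
  by code_simp

lemma hints_13: "alll test4 hints_13"
  by code_simp

lemma hints_14: "alll test4 hints_14"
  by code_simp

lemma hints_15: "alll test4 hints_15"
  by code_simp

lemma hints_16: "alll test4 hints_16"
  by code_simp

lemma hints_17: "alll test4 hints_17"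
  by code_simp

lemma hints_18: "alll test4 hints_18"
  by code_simp

lemma hints_19: "alll test4 hints_19"
  by code_simp

lemma hints_20: "alll test4 hints_20"
  by code_simp

lemma hints_21: "alll test4 hints_21"
  by code_simp

lemma hints_22: "alll test4 hints_22"
  by code_simp

lemma hints_23: "alll test4 hints_23"
  by code_simp

lemma hints_24: "alll test4 hints_24"
  by code_simp

lemma hints_25: "alll test4 hints_25"
  by code_simp

lemma hints_26: "alll test4 hints_26"
  by code_simp

lemma hints_27: "alll test4 hints_27"
  by code_simp

lemma hints_28: "alll test4 hints_28"
  by code_simp

lemma shapes2: "check_shapes [] (allsw 1) [[[[False], [True]]]] (gen (replicate 5 ()) (blists 1) [] [])"
  by code_simp

lemma hints2: "test_shape [snark2] (allsw 1) (all_hints 1) [[[False], [True]]]"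
  by code_simp

definition shapes3 :: "bool list list list list" where
  "shapes3 = [[[[False, False], [False, True], [True, False], [True, True]]],
    [[[False, False], [True, False]], [[False, True], [True, True]]],
    [[[False, False], [True, False], [False, True], [True, True]]]]"

lemma shapes3: "check_shapes [[False], [True]] (allsw 2) shapes3 (gen (replicate 9 ()) (blists 2) [] [])"
  by code_simp

lemma hints3: "alll (test_shape [snark3_1, snark3_2, snark3_3] (allsw 2) (all_hints 2)) shapes3"
  by code_simp

lemma iso_petersen: "iso_check (nb 1 (arcl snark2)) (vlist 1)
    [0, 4, 9, 3, 1, 2, 6, 5, 8, 7]
    (concat (map (\<lambda>i. [(i, (i + 1) mod 5), (i, i + 5), (i + 5, (i + 2) mod 5 + 5)]) [0..<5]) :: (nat \<times> nat) list)"
  by code_simp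

lemma iso_loupekine1: "iso_check (nb 2 (arcl snark3_1)) (vlist 2)
    [(0, 0), (1, 1), (2, 2), (2, 3), (3, 5), (3, 4), (3, 6), (3, 7), (1, 0), (2, 0), (2, 1), (3, 1), (3, 0), (3, 2), (3, 3), (1, 2), (2, 4), (2, 5), (3, 9), (3, 8), (3, 10), (3, 11)]
    (map (\<lambda>v. (v, parent v)) (std_list 3) @
      concat (map (\<lambda>c. zip (map (Pair 3) c) (rotate1 (map (Pair 3) c))) [[0, 3, 4, 7, 8, 11], [1, 2, 9, 10, 5, 6]]))"
  by code_simp

lemma iso_loupekine1b: "iso_check (nb 2 (arcl snark3_3)) (vlist 2)
    [(0, 0), (1, 1), (2, 2), (2, 3), (3, 5), (3, 4), (3, 6), (3, 7), (1, 0), (2, 0), (2, 1), (3, 1), (3, 0), (3, 2), (3, 3), (1, 2), (2, 4), (2, 5), (3, 9), (3, 8), (3, 10), (3, 11)]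
    (map (\<lambda>v. (v, parent v)) (std_list 3) @
      concat (map (\<lambda>c. zip (map (Pair 3) c) (rotate1 (map (Pair 3) c))) [[0, 3, 4, 7, 8, 11], [1, 2, 9, 10, 5, 6]]))"
  by code_simp

lemma iso_loupekine2: "iso_check (nb 2 (arcl snark3_2)) (vlist 2)
    [(0, 0), (1, 1), (2, 2), (2, 3), (3, 4), (3, 5), (3, 6), (3, 7), (1, 0), (2, 0), (2, 1), (3, 0), (3, 1), (3, 2), (3, 3), (1, 2), (2, 4), (2, 5), (3, 8), (3, 9), (3, 10), (3, 11)]
    (map (\<lambda>v. (v, parent v)) (std_list 3) @
      concat (map (\<lambda>c. zip (map (Pair 3) c) (rotate1 (map (Pair 3) c))) [[0, 9, 10, 7, 4, 1, 2, 11, 8, 5, 6, 3]]))"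
  by code_simp

section \<open>Assembling the three classifications\<close>

lemma card_blists: "card {bs :: bool list. length bs = d} \<le> length (blists d)"
  unfolding set_blists[symmetric] by (rule card_length)

lemma classification2: "classification 1 [snark2] [] [] (allsw 1) (allsw 1) [[[[False], [True]]]] (replicate 5 ()) (blists 1)"
proof
  show "2 * card {bs :: bool list. length bs = 1} < length (replicate 5 ())" using card_blists[of 1] by simp
  fix sh :: "bool list list list" assume "sh \<in> set [[[[False], [True]]]]"
  then show "\<exists>hs. test_shape ([snark2] @ []) (allsw 1) hs sh" using hints2 by auto
next
  fix cs assume "cs \<in> set [snark2]"
  then have "cs = snark2" by simp
  then show "valid 1 cs" "snark (CG 1 cs)" using snark_at[OF snark_snark2] by simp_all
qed (rule shapes2 set_blists | simp)+

lemma classification3: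
  "classification 2 [snark3_1, snark3_2, snark3_3] [] [[False], [True]] (allsw 2) (allsw 2) shapes3 (replicate 9 ()) (blists 2)"
proof
  show "2 * card {bs :: bool list. length bs = 2} < length (replicate 9 ())"
    using card_blists[of 2] by (simp add: numeral_2_eq_2)
  fix sh :: "bool list list list" assume "sh \<in> set shapes3"
  then show "\<exists>hs. test_shape ([snark3_1, snark3_2, snark3_3] @ []) (allsw 2) hs sh" using hints3 by (auto simp: alll_iff)
next
  fix cs assume "cs \<in> set [snark3_1, snark3_2, snark3_3]"
  then consider "cs = snark3_1" | "cs = snark3_2" | "cs = snark3_3" by auto
  then have "valid 2 cs \<and> snark (CG 2 cs)"
    using snark_at[OF snark_snark3_1] snark_at[OF snark_snark3_2] snark_at[OF snark_snark3_3] by cases simp_all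
  then show "valid 2 cs" "snark (CG 2 cs)" by simp_all
qed (rule shapes3 set_blists | simp)+

lemma snarks4: assumes "cs \<in> set snarks4" shows "valid 3 cs" "snark (CG 3 cs)"
proof -
  have "list_all (\<lambda>cs. valid 3 cs \<and> snark (CG 3 cs)) snarks4"
    unfolding snarks4_def by (simp add: snark_at[OF snark_snark4_1] snark_at[OF snark_snark4_2] snark_at[OF snark_snark4_3] snark_at[OF snark_snark4_4] snark_at[OF snark_snark4_5] snark_at[OF snark_snark4_6] snark_at[OF snark_snark4_7] snark_at[OF snark_snark4_8] snark_at[OF snark_snark4_9] snark_at[OF snark_snark4_10] snark_at[OF snark_snark4_11] snark_at[OF snark_snark4_12] snark_at[OF snark_snark4_13] snark_at[OF snark_snark4_14] snark_at[OF snark_snark4_15])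
  then show "valid 3 cs" "snark (CG 3 cs)" using assms by (simp_all add: list_all_iff)
qed

lemma set_eq_check: "alll (\<lambda>x. mem x ys) xs \<and> alll (\<lambda>y. mem y xs) ys \<Longrightarrow> set xs = set ys"
  by (auto simp: alll_iff mem_def)

lemma isomorphic_check:
  assumes "valid d a" "valid d b" "iso_check (nb d (arcl a)) (vlist d) ws (elist (nb d (arcl b)) (vlist d) [])"
    "alll (\<lambda>x. mem x ws) (vlist d) \<and> alll (\<lambda>x. mem x (vlist d)) ws"
  shows "isomorphic (CG d a) (CG d b)"
proof -
  have ws: "set ws = PT_verts d" using set_eq_check[OF assms(4)] set_vlist by blast
  have "edges (CG d b) = dset (elist (nb d (arcl b)) (vlist d) [])"
    by (rule edges_elist[OF graph_CG[OF assms(2)] nbfun_CG[OF assms(2)]]) (simp add: set_vlist)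
  then have "CG d b = (PT_verts d, dset (elist (nb d (arcl b)) (vlist d) []))" by (simp add: prod_eq_iff)
  then show ?thesis using iso_at[OF assms(1,3) ws] by simp
qed

lemma dups4_mate:
  assumes "cs \<in> set dups4"
  shows "valid 3 cs \<and> (\<exists>cs'\<in>set snarks4. isomorphic (CG 3 cs) (CG 3 cs') \<and>
    mset (map length (all_lifts cs)) = mset (map length (all_lifts cs')))"
proof -
  have m1: "valid 3 snark4_16 \<and> (\<exists>cs'\<in>set snarks4. isomorphic (CG 3 snark4_16) (CG 3 cs') \<and>
      mset (map length (all_lifts snark4_16)) = mset (map length (all_lifts cs')))"
  proof (intro conjI bexI[of _ snark4_13])
    show v: "valid 3 snark4_16" by (rule valid_check[OF valid_snark4_16])
    show "snark4_13 \<in> set snarks4" by (simp add: snarks4_def)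
    then show "isomorphic (CG 3 snark4_16) (CG 3 snark4_13)"
      using isomorphic_check[OF v snarks4(1) iso_snark4_16] by blast
    show "mset (map length (all_lifts snark4_16)) = mset (map length (all_lifts snark4_13))"
      using lifts_snark4_16 by (metis mset_sort)
  qed
  have m2: "valid 3 snark4_17 \<and> (\<exists>cs'\<in>set snarks4. isomorphic (CG 3 snark4_17) (CG 3 cs') \<and>
      mset (map length (all_lifts snark4_17)) = mset (map length (all_lifts cs')))"
  proof (intro conjI bexI[of _ snark4_6])
    show v: "valid 3 snark4_17" by (rule valid_check[OF valid_snark4_17])
    show "snark4_6 \<in> set snarks4" by (simp add: snarks4_def)
    then show "isomorphic (CG 3 snark4_17) (CG 3 snark4_6)"
      using isomorphic_check[OF v snarks4(1) iso_snark4_17] by blast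
    show "mset (map length (all_lifts snark4_17)) = mset (map length (all_lifts snark4_6))"
      using lifts_snark4_17 by (metis mset_sort)
  qed
  have m3: "valid 3 snark4_18 \<and> (\<exists>cs'\<in>set snarks4. isomorphic (CG 3 snark4_18) (CG 3 cs') \<and>
      mset (map length (all_lifts snark4_18)) = mset (map length (all_lifts cs')))"
  proof (intro conjI bexI[of _ snark4_5])
    show v: "valid 3 snark4_18" by (rule valid_check[OF valid_snark4_18])
    show "snark4_5 \<in> set snarks4" by (simp add: snarks4_def)
    then show "isomorphic (CG 3 snark4_18) (CG 3 snark4_5)"
      using isomorphic_check[OF v snarks4(1) iso_snark4_18] by blast
    show "mset (map length (all_lifts snark4_18)) = mset (map length (all_lifts snark4_5))"
      using lifts_snark4_18 by (metis mset_sort)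
  qed
  consider "cs = snark4_16" | "cs = snark4_17" | "cs = snark4_18" using assms by (auto simp: dups4_def)
  then show ?thesis
  proof cases
    case 1
    show ?thesis unfolding \<open>cs = snark4_16\<close> by (rule m1)
  next
    case 2
    show ?thesis unfolding \<open>cs = snark4_17\<close> by (rule m2)
  next
    case 3
    show ?thesis unfolding \<open>cs = snark4_18\<close> by (rule m3)
  qed
qed

lemma dups4: assumes "cs \<in> set dups4" shows "valid 3 cs" "snark (CG 3 cs)"
proof -
  obtain cs' where cs': "cs' \<in> set snarks4" "isomorphic (CG 3 cs) (CG 3 cs')" and v: "valid 3 cs"
    using dups4_mate[OF assms] by blast
  show "valid 3 cs" by (rule v)
  obtain h where "graph_iso h (CG 3 cs') (CG 3 cs)" using isomorphic_sym[OF cs'(2)] unfolding isomorphic_def by blast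
  then show "snark (CG 3 cs)" using snarks4(2)[OF cs'(1)] by (rule graph_iso_snark)
qed

text \<open>The mate of a repeated representative has an isomorphic graph and the same outer cycle
  lengths, so dropping the repetitions changes neither the full count nor the count for a given
  multiset.\<close>

lemma drop_dups4:
  "(\<exists>cs\<in>set (filter (\<lambda>cs. mset (map length (all_lifts cs)) = M) (snarks4 @ dups4)). isomorphic (CG 3 cs) G) \<longleftrightarrow>
    (\<exists>cs\<in>set (filter (\<lambda>cs. mset (map length (all_lifts cs)) = M) snarks4). isomorphic (CG 3 cs) G)"
  "(\<exists>cs\<in>set (snarks4 @ dups4). isomorphic (CG 3 cs) G) \<longleftrightarrow> (\<exists>cs\<in>set snarks4. isomorphic (CG 3 cs) G)"
proof -
  have m: "\<exists>cs'\<in>set snarks4. isomorphic (CG 3 cs') G \<and> mset (map length (all_lifts cs)) = mset (map length (all_lifts cs'))"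
    if cs: "cs \<in> set dups4" "isomorphic (CG 3 cs) G" for cs
  proof -
    obtain cs' where cs': "cs' \<in> set snarks4" "isomorphic (CG 3 cs) (CG 3 cs')"
      "mset (map length (all_lifts cs)) = mset (map length (all_lifts cs'))"
      using dups4_mate[OF cs(1)] by blast
    have "isomorphic (CG 3 cs') G" by (rule isomorphic_trans[OF isomorphic_sym[OF cs'(2)] cs(2)])
    then show ?thesis using cs'(1,3) by blast
  qed
  show "(\<exists>cs\<in>set (snarks4 @ dups4). isomorphic (CG 3 cs) G) \<longleftrightarrow> (\<exists>cs\<in>set snarks4. isomorphic (CG 3 cs) G)"
    unfolding set_append using m by blast
  show "(\<exists>cs\<in>set (filter (\<lambda>cs. mset (map length (all_lifts cs)) = M) (snarks4 @ dups4)). isomorphic (CG 3 cs) G) \<longleftrightarrow>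
    (\<exists>cs\<in>set (filter (\<lambda>cs. mset (map length (all_lifts cs)) = M) snarks4). isomorphic (CG 3 cs) G)" (is "?L \<longleftrightarrow> ?R")
  proof
    assume ?L
    then obtain cs where cs: "cs \<in> set snarks4 \<or> cs \<in> set dups4" "mset (map length (all_lifts cs)) = M" "isomorphic (CG 3 cs) G"
      unfolding set_filter set_append by blast
    from cs(1) show ?R
    proof
      assume "cs \<in> set snarks4" then show ?thesis unfolding set_filter using cs(2,3) by blast
    next
      assume "cs \<in> set dups4"
      then obtain cs' where "cs' \<in> set snarks4" "isomorphic (CG 3 cs') G" "mset (map length (all_lifts cs')) = M"
        using m[OF _ cs(3)] cs(2) by metis
      then show ?thesis unfolding set_filter by blast
    qed
  qed (unfold set_filter set_append, blast)
qed

lemma hints4: assumes "h \<in> set hints4" shows "test4 h"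
proof -
  have app: "alll test4 (xs @ ys) \<longleftrightarrow> alll test4 xs \<and> alll test4 ys" for xs ys by (auto simp: alll_iff)
  have "alll test4 hints4" unfolding hints4_def by (simp add: app hints_1 hints_2 hints_3 hints_4 hints_5 hints_6 hints_7 hints_8 hints_9 hints_10 hints_11 hints_12 hints_13 hints_14 hints_15 hints_16 hints_17 hints_18 hints_19 hints_20 hints_21 hints_22 hints_23 hints_24 hints_25 hints_26 hints_27 hints_28 )
  then show ?thesis using assms by (simp add: alll_iff)
qed

lemma classification4:
  "classification 3 (snarks4 @ dups4) cuts4 [[False], [True], [False, False], [False, True], [True, False], [True, True]] (allsw 3) swaps4
    (map snd hints4) (replicate 17 ()) (blists 3)"
proof
  show "2 * card {bs :: bool list. length bs = 3} < length (replicate 17 ())"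
    using card_blists[of 3] by (simp add: numeral_3_eq_3)
  fix sh assume "sh \<in> set (map snd hints4)"
  then obtain h where h: "h \<in> set hints4" "sh = snd h" by auto
  show "\<exists>hs. test_shape ((snarks4 @ dups4) @ cuts4) (allsw 3) hs sh" using hints4[OF h(1)] unfolding test4_def h(2) by blast
next
  fix cs assume "cs \<in> set (snarks4 @ dups4)"
  then have "cs \<in> set snarks4 \<or> cs \<in> set dups4" by simp
  then show "valid 3 cs" "snark (CG 3 cs)" using snarks4 dups4 by blast+
next
  fix cs assume "cs \<in> set cuts4"
  then obtain x p q where "(cs, x, p, q) \<in> set cut_data4" unfolding cuts4_def by auto
  then have "cut_at 3 cs x p q" using cut_data4 unfolding alll_iff by fast
  then show "\<not> snark (CG 3 cs)" by (rule cut_at)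
qed (rule shapes4 set_blists | simp)+

lemma distinct_signature4: "distinct (map (signature 3) snarks4)"
  unfolding snarks4_def list.map signature4_1 signature4_2 signature4_3 signature4_4 signature4_5 signature4_6 signature4_7 signature4_8 signature4_9 signature4_10 signature4_11 signature4_12 signature4_13 signature4_14 signature4_15 by code_simp

lemma dist_vlist: "dist (vlist 2)" "dist (vlist 3)"
  by code_simp+

lemma isomorphic_snarks4:
  assumes "r \<in> set snarks4" "s \<in> set snarks4" "isomorphic (CG 3 r) (CG 3 s)" shows "r = s"
proof -
  have "signature 3 r = signature 3 s"
    by (rule isomorphic_signature[OF snarks4(1)[OF assms(1)] snarks4(1)[OF assms(2)] assms(3) dist_vlist(2)])
  moreover have "inj_on (signature 3) (set snarks4)" using distinct_signature4 by (simp add: distinct_map)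
  ultimately show ?thesis using assms(1,2) by (simp add: inj_onD)
qed

lemma card_rotation_snarks4: "card (iso_classes (rotation_snarks 4 :: nat ugraph set)) = 15"
proof -
  have r: "rotation_snark 4 G \<longleftrightarrow> (\<exists>cs\<in>set snarks4. isomorphic (CG 3 cs) G)" for G :: "nat ugraph"
    using classification.rotation_snark_rep[OF classification4, of G] unfolding drop_dups4 by simp
  then have e: "rotation_snarks 4 = {G :: nat ugraph. \<exists>cs\<in>set snarks4. isomorphic (CG 3 cs) G}"
    unfolding rotation_snarks_def by (rule Collect_cong)
  have "distinct snarks4" using distinct_signature4 by (simp add: distinct_map)
  then have "card (iso_classes (rotation_snarks 4 :: nat ugraph set)) = length snarks4"
    unfolding e using isomorphic_snarks4 snarks4(1) graph_CG by (intro card_iso_classes) blast+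
  then show ?thesis by (simp add: snarks4_def)
qed

lemma card_rotation_snarks4_with_oc:
  "card (iso_classes (rotation_snarks_with_oc 4 (mset ys) :: nat ugraph set)) =
    length (filter (\<lambda>cs. sort (map length (all_lifts cs)) = sort ys) snarks4)"
proof -
  let ?F = "filter (\<lambda>cs. sort (map length (all_lifts cs)) = sort ys) snarks4"
  have "rotation_snarks_with_oc (Suc 3) (mset ys) = {G :: nat ugraph. \<exists>cs\<in>set ?F. isomorphic (CG 3 cs) G}"
    unfolding classification.rotation_snarks_with_oc_rep[OF classification4] drop_dups4(1)
    unfolding filter_mset_sort by (rule refl)
  moreover have "Suc 3 = 4" by simp
  ultimately have e: "rotation_snarks_with_oc 4 (mset ys) = {G :: nat ugraph. \<exists>cs\<in>set ?F. isomorphic (CG 3 cs) G}"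
    by (simp only:)
  have sub: "r \<in> set snarks4" if "r \<in> set ?F" for r using that by simp
  have "distinct snarks4" using distinct_signature4 by (simp add: distinct_map)
  then have "distinct ?F" by simp
  then show ?thesis unfolding e
    using isomorphic_snarks4[OF sub sub] graph_CG[OF snarks4(1)[OF sub]] by (intro card_iso_classes) blast+
qed

lemma oc_counts:
  "length (filter (\<lambda>cs. sort (map length (all_lifts cs)) = sort [24]) snarks4) = 2"
  "length (filter (\<lambda>cs. sort (map length (all_lifts cs)) = sort [12, 12]) snarks4) = 1"
  "length (filter (\<lambda>cs. sort (map length (all_lifts cs)) = sort [18, 6]) snarks4) = 1"
  "length (filter (\<lambda>cs. sort (map length (all_lifts cs)) = sort [8, 8, 8]) snarks4) = 8"
  "length (filter (\<lambda>cs. sort (map length (all_lifts cs)) = sort [6, 6, 6, 6]) snarks4) = 3"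
  by code_simp+

lemma petersen_iso: "isomorphic (CG 1 snark2) petersen"
  unfolding petersen_list
  by (rule iso_at[OF snark_at(1)[OF snark_snark2] iso_petersen]) (rule set_eq_check, code_simp)


lemma loupekine_iso:
  "isomorphic (CG 2 snark3_1) loupekine1" "isomorphic (CG 2 snark3_3) loupekine1" "isomorphic (CG 2 snark3_2) loupekine2"
proof -
  show "isomorphic (CG 2 snark3_1) loupekine1"
    unfolding loupekine1_def add_outer_cycles_list
    by (rule iso_at[OF snark_at(1)[OF snark_snark3_1] iso_loupekine1]) (rule set_eq_check, code_simp)
  show "isomorphic (CG 2 snark3_3) loupekine1"
    unfolding loupekine1_def add_outer_cycles_list
    by (rule iso_at[OF snark_at(1)[OF snark_snark3_3] iso_loupekine1b]) (rule set_eq_check, code_simp)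
  show "isomorphic (CG 2 snark3_2) loupekine2"
    unfolding loupekine2_def add_outer_cycles_list
    by (rule iso_at[OF snark_at(1)[OF snark_snark3_2] iso_loupekine2]) (rule set_eq_check, code_simp)
qed

lemma isomorphic_cong: assumes "isomorphic H K" shows "isomorphic H G \<longleftrightarrow> isomorphic G K"
proof
  assume "isomorphic H G"
  from isomorphic_trans[OF isomorphic_sym[OF this] assms] show "isomorphic G K" .
next
  assume "isomorphic G K"
  from isomorphic_trans[OF assms isomorphic_sym[OF this]] show "isomorphic H G" .
qed

theorem theorem6:
  shows "(\<forall>G :: nat ugraph. (\<exists>i\<le>3. rotation_snark i G) \<longleftrightarrow>
            isomorphic G petersen \<or> isomorphic G loupekine1 \<or> isomorphic G loupekine2) \<and>
         \<not> isomorphic loupekine1 loupekine2 \<and>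
         card (iso_classes (rotation_snarks 4 :: nat ugraph set)) = 15 \<and>
         card (iso_classes (rotation_snarks_with_oc 4 {#24#} :: nat ugraph set)) = 2 \<and>
         card (iso_classes (rotation_snarks_with_oc 4 {#12, 12#} :: nat ugraph set)) = 1 \<and>
         card (iso_classes (rotation_snarks_with_oc 4 {#18, 6#} :: nat ugraph set)) = 1 \<and>
         card (iso_classes (rotation_snarks_with_oc 4 {#8, 8, 8#} :: nat ugraph set)) = 8 \<and>
         card (iso_classes (rotation_snarks_with_oc 4 {#6, 6, 6, 6#} :: nat ugraph set)) = 3"
proof (intro conjI allI)
  fix G :: "nat ugraph"
  have 2: "rotation_snark 2 G \<longleftrightarrow> isomorphic G petersen"
    using classification.rotation_snark_rep[OF classification2, of G] isomorphic_cong[OF petersen_iso, of G]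
    by (simp add: numeral_2_eq_2)
  have "rotation_snark 3 G \<longleftrightarrow> (\<exists>cs\<in>set [snark3_1, snark3_2, snark3_3]. isomorphic (CG 2 cs) G)"
    using classification.rotation_snark_rep[OF classification3, of G] by (simp add: numeral_3_eq_3 numeral_2_eq_2)
  \<comment> \<open>Two of the three representatives yield the first Loupekine snark.\<close>
  then have 3: "rotation_snark 3 G \<longleftrightarrow> isomorphic G loupekine1 \<or> isomorphic G loupekine2"
    using isomorphic_cong[OF loupekine_iso(1), of G] isomorphic_cong[OF loupekine_iso(2), of G]
      isomorphic_cong[OF loupekine_iso(3), of G] by auto
  have "(\<exists>i\<le>3. rotation_snark i G) \<longleftrightarrow> rotation_snark 2 G \<or> rotation_snark 3 G"
  proof
    assume "\<exists>i\<le>3. rotation_snark i G"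
    then obtain i where i: "i \<le> 3" "rotation_snark i G" by blast
    then have "2 \<le> i" by (simp add: rotation_snark_def)
    then have "i = 2 \<or> i = 3" using i(1) by linarith
    then show "rotation_snark 2 G \<or> rotation_snark 3 G" using i(2) by blast
  next
    assume "rotation_snark 2 G \<or> rotation_snark 3 G"
    then show "\<exists>i\<le>3. rotation_snark i G" by (elim disjE) (intro exI conjI, assumption?, simp_all)+
  qed
  then show "(\<exists>i\<le>3. rotation_snark i G) \<longleftrightarrow> isomorphic G petersen \<or> isomorphic G loupekine1 \<or> isomorphic G loupekine2"
    using 2 3 by blast
next
  show "\<not> isomorphic loupekine1 loupekine2"
  proof
    assume "isomorphic loupekine1 loupekine2"
    then have "isomorphic (CG 2 snark3_1) (CG 2 snark3_2)"
      using isomorphic_trans[OF isomorphic_trans[OF loupekine_iso(1)] isomorphic_sym[OF loupekine_iso(3)]] by blast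
    then show False
      using isomorphic_signature[OF snark_at(1)[OF snark_snark3_1] snark_at(1)[OF snark_snark3_2] _ dist_vlist(1)] signature3
      by blast
  qed
next
  show "card (iso_classes (rotation_snarks 4 :: nat ugraph set)) = 15" by (rule card_rotation_snarks4)
  show "card (iso_classes (rotation_snarks_with_oc 4 {#24#} :: nat ugraph set)) = 2"
    using card_rotation_snarks4_with_oc[of "[24]"] oc_counts(1) by simp
  show "card (iso_classes (rotation_snarks_with_oc 4 {#12, 12#} :: nat ugraph set)) = 1"
    using card_rotation_snarks4_with_oc[of "[12, 12]"] oc_counts(2) by simp
  show "card (iso_classes (rotation_snarks_with_oc 4 {#18, 6#} :: nat ugraph set)) = 1"
    using card_rotation_snarks4_with_oc[of "[18, 6]"] oc_counts(3) by simp
  show "card (iso_classes (rotation_snarks_with_oc 4 {#8, 8, 8#} :: nat ugraph set)) = 8"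
    using card_rotation_snarks4_with_oc[of "[8, 8, 8]"] oc_counts(4) by simp
  show "card (iso_classes (rotation_snarks_with_oc 4 {#6, 6, 6, 6#} :: nat ugraph set)) = 3"
    using card_rotation_snarks4_with_oc[of "[6, 6, 6, 6]"] oc_counts(5) by simp
qed

end
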